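(* Let $\mathcal{M}\subseteq\mathcal{B}(H_1,H_2)$ be an approximately $\mathfrak{I}$-injective masa-bimodule, and let $\kappa\subseteq X\times Y$ be the $\omega$-closed set with $\mathcal{M}=\mathfrak{M}_{\max}(\kappa)$. There exist an $\mathfrak{I}$-injective masa-bimodule $\mathcal{M}_{\rm inj}$ and an approximately $\mathfrak{I}$-injective masa-bimodule $\mathcal{M}_{\rm pai}$ such that (a) there is a direct sum decomposition $\mathfrak{M}_{\max}(\kappa)=\mathcal{M}_{\rm inj}+\mathcal{M}_{\rm pai}$; (b) $\mathcal{M}_{\rm inj}=\overline{\mathcal{M}\cap\mathcal{K}}^{w^*}$; and (c) $\mathcal{M}_{\rm pai}$ contains no non-zero compact operators. Moreover, $\mathcal{M}_{\rm inj}$ is the maximal $\mathfrak{I}$-injective masa-bimodule contained in $\mathcal{M}$ and $$\mathfrak{M}_{\min}(\kappa)\cap\mathcal{K}=\mathfrak{M}_{\max}(\kappa)\cap\mathcal{K}=\overline{\mathfrak{M}_{\max}(\kappa)\cap\mathcal{C}_2}^{\|\cdot\|}.$$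
   Context: $(X,m)$ and $(Y,n)$ are standard measure spaces ($\sigma$-finite regular Borel measures for Borel structures arising from complete separable metrizable topologies), $H_1=L^2(X,m)$, $H_2=L^2(Y,n)$; $\mathcal{D}_1,\mathcal{D}_2$ are the algebras of multiplication operators by functions in $L^\infty(X,m)$, $L^\infty(Y,n)$; $M_g$ is multiplication by $g$. $\mathcal{K}$ and $\mathcal{C}_2$ are the sets of compact, respectively Hilbert–Schmidt, operators from $H_1$ to $H_2$; $\|\cdot\|$ is the operator norm. $\mathcal{B}(H_1,H_2)$ has the weak* topology as the dual of the trace class operators from $H_2$ to $H_1$. A masa-bimodule is a subspace $\mathcal{U}\subseteq\mathcal{B}(H_1,H_2)$ with $\mathcal{D}_2\mathcal{U}\mathcal{D}_1\subseteq\mathcal{U}$. $\mathrm{Ref}\,\mathcal{U}=\{T\in\mathcal{B}(H_1,H_2):Tx\in\overline{\mathcal{U}x}\ \forall x\in H_1\}$. Schur maps: let $\Gamma(X,Y)=L^2(X,m)\hat\otimes L^2(Y,n)$ (projective tensor product), identified with the predual of $\mathcal{B}(H_1,H_2)$ via $\langle T,f\otimes g\rangle=(Tf,\overline{g})$, and its elements with functions $h(x,y)=\sum_i f_i(x)g_i(y)$, $\sum\|f_i\|_2^2<\infty$, $\sum\|g_i\|_2^2<\infty$. A Schur multiplier is $\varphi\in L^\infty(X\times Y,m\times n)$ such that $\varphi h$ is equivalent with respect to $m\times n$ to a function in $\Gamma(X,Y)$ for every $h\in\Gamma(X,Y)$; the dual of the map $h\mapsto\varphi h$ is the Schur map $S_\varphi$.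 (The Schur maps are exactly the bounded weak* continuous masa-bimodule maps on $\mathcal{B}(H_1,H_2)$.) $\mathfrak{I}$ is the set of all idempotent Schur maps. A subspace is $\mathfrak{I}$-injective if it is the range of some element of $\mathfrak{I}$. A subspace $\mathcal{M}$ is approximately $\mathfrak{I}$-injective if there are $(\phi_n)_{n\in\mathbb{N}}\subseteq\mathfrak{I}$ and $C>0$ with $\|\phi_n\|\le C$, $\mathrm{Ran}\,\phi_{n+1}\subseteq\mathrm{Ran}\,\phi_n$ for all $n$, and $\mathcal{M}=\bigcap_n\mathrm{Ran}\,\phi_n$ (such $\mathcal{M}$ is a reflexive masa-bimodule). $E\subseteq X\times Y$ is marginally null if $E\subseteq(X_0\times Y)\cup(X\times Y_0)$ with $m(X_0)=n(Y_0)=0$; two sets are marginally equivalent if their symmetric difference is marginally null. A set is $\omega$-open if it is marginally equivalent to a countable union $\bigcup_i\alpha_i\times\beta_i$ of measurable rectangles, and $\omega$-closed if its complement is $\omega$-open. For $\kappa$ $\omega$-closed, $\mathfrak{M}_{\max}(\kappa)$ is the set of $T\in\mathcal{B}(H_1,H_2)$ with $M_{\chi_\beta}TM_{\chi_\alpha}=0$ for all measurable $\alpha\subseteq X$, $\beta\subseteq Y$ with $(\alpha\times\beta)\cap\kappa$ marginally null. Every reflexive masa-bimodule is of this form with $\kappa$ unique up to marginal equivalence. The support of a weak* closed masa-bimodule $\mathcal{U}$ is the $\omega$-closed set $\kappa$ with $\mathrm{Ref}\,\mathcal{U}=\mathfrak{M}_{\max}(\kappa)$. $\mathfrak{M}_{\min}(\kappa)$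 is the smallest weak* closed masa-bimodule with support $\kappa$ (it exists). *)

theory Defs
  imports "HOL-Analysis.Analysis"
begin

section \<open>Standard measure spaces\<close>

text \<open>
  Regularity is imposed as inner regularity by compact sets. Outer regularity is not demanded, so
  that the class contains the measures admitted under either common convention.
\<close>

definition standard_measure :: "'a measure \<Rightarrow> bool" where
  "standard_measure m \<longleftrightarrow>
     sigma_finite_measure m \<and>
     (\<exists>T. topspace T = space m \<and> completely_metrizable_space T \<and> separable_space T \<and>
          sets m = sigma_sets (topspace T) {U. openin T U} \<and>
          (\<forall>A\<in>sets m. emeasure m A = (SUP K\<in>{K. compactin T K \<and> K \<subseteq> A}. emeasure m K)))"

section \<open>The Hilbert space of square integrable functions\<close>

text \<open>
  Vectors are classes of measurable functions modulo equality almost everywhere. All operations are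
  computed on the representative \<open>rep u\<close>, on whose choice they do not depend.
\<close>

definition sq_int :: "'a measure \<Rightarrow> ('a \<Rightarrow> complex) set" where
  "sq_int m = {f \<in> borel_measurable m. integrable m (\<lambda>x. (cmod (f x))\<^sup>2)}"

definition cls :: "'a measure \<Rightarrow> ('a \<Rightarrow> complex) \<Rightarrow> ('a \<Rightarrow> complex) set" where
  "cls m f = {g \<in> borel_measurable m. AE x in m. g x = f x}"

definition rep :: "('a \<Rightarrow> complex) set \<Rightarrow> 'a \<Rightarrow> complex" where
  "rep u = (SOME f. f \<in> u)"

definition L2 :: "'a measure \<Rightarrow> ('a \<Rightarrow> complex) set set" where
  "L2 m = cls m ` sq_int m"

definition l2_lincomb ::
  "'a measure \<Rightarrow> complex \<Rightarrow> ('a \<Rightarrow> complex) set \<Rightarrow> complex \<Rightarrow> ('a \<Rightarrow> complex) set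
     \<Rightarrow> ('a \<Rightarrow> complex) set" where
  "l2_lincomb m a u b v = cls m (\<lambda>x. a * rep u x + b * rep v x)"

definition l2_zero :: "'a measure \<Rightarrow> ('a \<Rightarrow> complex) set" where
  "l2_zero m = cls m (\<lambda>_. 0)"

definition l2_inner :: "'a measure \<Rightarrow> ('a \<Rightarrow> complex) set \<Rightarrow> ('a \<Rightarrow> complex) set \<Rightarrow> complex" where
  "l2_inner m u v = (\<integral>x. rep u x * cnj (rep v x) \<partial>m)"

definition l2_norm :: "'a measure \<Rightarrow> ('a \<Rightarrow> complex) set \<Rightarrow> real" where
  "l2_norm m u = sqrt (\<integral>x. (cmod (rep u x))\<^sup>2 \<partial>m)"

definition l2_dist :: "'a measure \<Rightarrow> ('a \<Rightarrow> complex) set \<Rightarrow> ('a \<Rightarrow> complex) set \<Rightarrow> real" where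
  "l2_dist m u v = sqrt (\<integral>x. (cmod (rep u x - rep v x))\<^sup>2 \<partial>m)"

definition l2_topology :: "'a measure \<Rightarrow> ('a \<Rightarrow> complex) set topology" where
  "l2_topology m = Metric_space.mtopology (L2 m) (l2_dist m)"

definition l2_orthonormal_basis :: "'a measure \<Rightarrow> ('a \<Rightarrow> complex) set set \<Rightarrow> bool" where
  "l2_orthonormal_basis m E \<longleftrightarrow>
     E \<subseteq> L2 m \<and>
     (\<forall>u\<in>E. \<forall>v\<in>E. l2_inner m u v = (if u = v then 1 else 0)) \<and>
     (\<forall>u\<in>L2 m. (\<forall>e\<in>E. l2_inner m u e = 0) \<longrightarrow> u = l2_zero m)"

section \<open>Bounded operators\<close>

type_synonym ('a, 'b) l2_op = "('a \<Rightarrow> complex) set \<Rightarrow> ('b \<Rightarrow> complex) set"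

text \<open>
  Operators are extensional functions (undefined off \<open>L2 m\<close>), so that equality of operators is
  equality in HOL.
\<close>

definition bounded_ops :: "'a measure \<Rightarrow> 'b measure \<Rightarrow> ('a, 'b) l2_op set" where
  "bounded_ops m n =
     {T \<in> L2 m \<rightarrow>\<^sub>E L2 n.
        (\<forall>a b. \<forall>u\<in>L2 m. \<forall>v\<in>L2 m. T (l2_lincomb m a u b v) = l2_lincomb n a (T u) b (T v)) \<and>
        (\<exists>C. \<forall>u\<in>L2 m. l2_norm n (T u) \<le> C * l2_norm m u)}"

definition op_norm :: "'a measure \<Rightarrow> 'b measure \<Rightarrow> ('a, 'b) l2_op \<Rightarrow> real" where
  "op_norm m n T = (SUP u\<in>{u \<in> L2 m. l2_norm m u \<le> 1}. l2_norm n (T u))"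

definition op_lincomb ::
  "'a measure \<Rightarrow> 'b measure \<Rightarrow> complex \<Rightarrow> ('a, 'b) l2_op \<Rightarrow> complex \<Rightarrow> ('a, 'b) l2_op
     \<Rightarrow> ('a, 'b) l2_op" where
  "op_lincomb m n a T b S = (\<lambda>u\<in>L2 m. l2_lincomb n a (T u) b (S u))"

definition op_zero :: "'a measure \<Rightarrow> 'b measure \<Rightarrow> ('a, 'b) l2_op" where
  "op_zero m n = (\<lambda>u\<in>L2 m. l2_zero n)"

definition op_subspace :: "'a measure \<Rightarrow> 'b measure \<Rightarrow> ('a, 'b) l2_op set \<Rightarrow> bool" where
  "op_subspace m n U \<longleftrightarrow>
     U \<subseteq> bounded_ops m n \<and> op_zero m n \<in> U \<and>
     (\<forall>a b. \<forall>T\<in>U. \<forall>S\<in>U. op_lincomb m n a T b S \<in> U)"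

definition op_norm_closure ::
  "'a measure \<Rightarrow> 'b measure \<Rightarrow> ('a, 'b) l2_op set \<Rightarrow> ('a, 'b) l2_op set" where
  "op_norm_closure m n U =
     {T \<in> bounded_ops m n. \<forall>\<epsilon>>0. \<exists>S\<in>U. op_norm m n (op_lincomb m n 1 T (-1) S) < \<epsilon>}"

definition compact_ops :: "'a measure \<Rightarrow> 'b measure \<Rightarrow> ('a, 'b) l2_op set" where
  "compact_ops m n =
     {T \<in> bounded_ops m n.
        compactin (l2_topology n) (l2_topology n closure_of (T ` {u \<in> L2 m. l2_norm m u \<le> 1}))}"

definition hilbert_schmidt_ops :: "'a measure \<Rightarrow> 'b measure \<Rightarrow> ('a, 'b) l2_op set" where
  "hilbert_schmidt_ops m n =
     {T \<in> bounded_ops m n.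
        \<exists>E. l2_orthonormal_basis m E \<and> (\<lambda>e. (l2_norm n (T e))\<^sup>2) summable_on E}"

section \<open>Masa-bimodules\<close>

definition ess_bounded :: "'a measure \<Rightarrow> ('a \<Rightarrow> complex) set" where
  "ess_bounded m = {g \<in> borel_measurable m. \<exists>C. AE x in m. cmod (g x) \<le> C}"

definition mult_op :: "'a measure \<Rightarrow> ('a \<Rightarrow> complex) \<Rightarrow> ('a, 'a) l2_op" where
  "mult_op m g = (\<lambda>u\<in>L2 m. cls m (\<lambda>x. g x * rep u x))"

definition sandwich ::
  "'a measure \<Rightarrow> 'b measure \<Rightarrow> ('b \<Rightarrow> complex) \<Rightarrow> ('a, 'b) l2_op \<Rightarrow> ('a \<Rightarrow> complex)
     \<Rightarrow> ('a, 'b) l2_op" where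
  "sandwich m n b T a = compose (L2 m) (mult_op n b) (compose (L2 m) T (mult_op m a))"

definition masa_bimodule :: "'a measure \<Rightarrow> 'b measure \<Rightarrow> ('a, 'b) l2_op set \<Rightarrow> bool" where
  "masa_bimodule m n U \<longleftrightarrow>
     op_subspace m n U \<and>
     (\<forall>T\<in>U. \<forall>a\<in>ess_bounded m. \<forall>b\<in>ess_bounded n. sandwich m n b T a \<in> U)"

definition Ref :: "'a measure \<Rightarrow> 'b measure \<Rightarrow> ('a, 'b) l2_op set \<Rightarrow> ('a, 'b) l2_op set" where
  "Ref m n U =
     {T \<in> bounded_ops m n. \<forall>u\<in>L2 m. T u \<in> l2_topology n closure_of ((\<lambda>S. S u) ` U)}"

section \<open>Marginally null sets and omega-closed sets\<close>

definition marginally_null :: "'a measure \<Rightarrow> 'b measure \<Rightarrow> ('a \<times> 'b) set \<Rightarrow> bool" where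
  "marginally_null m n E \<longleftrightarrow>
     (\<exists>X0\<in>null_sets m. \<exists>Y0\<in>null_sets n. E \<subseteq> (X0 \<times> space n) \<union> (space m \<times> Y0))"

definition marginally_equiv ::
  "'a measure \<Rightarrow> 'b measure \<Rightarrow> ('a \<times> 'b) set \<Rightarrow> ('a \<times> 'b) set \<Rightarrow> bool" where
  "marginally_equiv m n E F \<longleftrightarrow> marginally_null m n ((E - F) \<union> (F - E))"

definition omega_open :: "'a measure \<Rightarrow> 'b measure \<Rightarrow> ('a \<times> 'b) set \<Rightarrow> bool" where
  "omega_open m n E \<longleftrightarrow>
     E \<subseteq> space m \<times> space n \<and>
     (\<exists>\<alpha> \<beta>. (\<forall>i::nat. \<alpha> i \<in> sets m \<and> \<beta> i \<in> sets n) \<and>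
            marginally_equiv m n E (\<Union>i. \<alpha> i \<times> \<beta> i))"

definition omega_closed :: "'a measure \<Rightarrow> 'b measure \<Rightarrow> ('a \<times> 'b) set \<Rightarrow> bool" where
  "omega_closed m n E \<longleftrightarrow>
     E \<subseteq> space m \<times> space n \<and> omega_open m n (space m \<times> space n - E)"

section \<open>The predual and the weak* topology\<close>

text \<open>
  \<open>gamma_expansion m n h F G\<close>: up to a marginally null set, \<open>h (x, y)\<close> is the sum of the
  \<open>F i x * G i y\<close>, with square summable norms. The functions \<open>h\<close> which have such an expansion form
  the projective tensor product of the two spaces.
\<close>

definition gamma_expansion ::
  "'a measure \<Rightarrow> 'b measure \<Rightarrow> ('a \<times> 'b \<Rightarrow> complex) \<Rightarrow> (nat \<Rightarrow> 'a \<Rightarrow> complex)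
     \<Rightarrow> (nat \<Rightarrow> 'b \<Rightarrow> complex) \<Rightarrow> bool" where
  "gamma_expansion m n h F G \<longleftrightarrow>
     (\<forall>i. F i \<in> sq_int m) \<and> (\<forall>i. G i \<in> sq_int n) \<and>
     summable (\<lambda>i. \<integral>x. (cmod (F i x))\<^sup>2 \<partial>m) \<and> summable (\<lambda>i. \<integral>y. (cmod (G i y))\<^sup>2 \<partial>n) \<and>
     (\<exists>X0\<in>null_sets m. \<exists>Y0\<in>null_sets n. \<forall>x\<in>space m - X0. \<forall>y\<in>space n - Y0.
        (\<lambda>i. F i x * G i y) sums h (x, y))"

definition Gamma :: "'a measure \<Rightarrow> 'b measure \<Rightarrow> ('a \<times> 'b \<Rightarrow> complex) set" where
  "Gamma m n = {h. \<exists>F G. gamma_expansion m n h F G}"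

text \<open>
  The value on an elementary tensor is the inner product of \<open>T f\<close> with the complex conjugate of
  \<open>g\<close>, that is, the integral of \<open>T f * g\<close>. The value on \<open>h\<close> is the same for all expansions of \<open>h\<close>.
\<close>

definition pairing ::
  "'a measure \<Rightarrow> 'b measure \<Rightarrow> ('a, 'b) l2_op \<Rightarrow> ('a \<times> 'b \<Rightarrow> complex) \<Rightarrow> complex" where
  "pairing m n T h =
     (THE c. \<exists>F G. gamma_expansion m n h F G \<and>
        c = (\<Sum>i. l2_inner n (T (cls m (F i))) (cls n (\<lambda>y. cnj (G i y)))))"

definition weak_star :: "'a measure \<Rightarrow> 'b measure \<Rightarrow> ('a, 'b) l2_op topology" where
  "weak_star m n =
     topology_generated_by
       {{T \<in> bounded_ops m n. pairing m n T h \<in> V} | h V. h \<in> Gamma m n \<and> open V}"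

section \<open>Schur maps\<close>

definition schur_multiplier :: "'a measure \<Rightarrow> 'b measure \<Rightarrow> ('a \<times> 'b \<Rightarrow> complex) \<Rightarrow> bool" where
  "schur_multiplier m n \<phi> \<longleftrightarrow>
     \<phi> \<in> ess_bounded (m \<Otimes>\<^sub>M n) \<and>
     (\<forall>h\<in>Gamma m n. \<exists>h'\<in>Gamma m n. AE z in m \<Otimes>\<^sub>M n. h' z = \<phi> z * h z)"

text \<open>\<open>\<Phi>\<close> is the dual of the map \<open>h \<mapsto> \<phi> h\<close> on the predual.\<close>

definition is_schur_map ::
  "'a measure \<Rightarrow> 'b measure \<Rightarrow> ('a \<times> 'b \<Rightarrow> complex) \<Rightarrow> (('a, 'b) l2_op \<Rightarrow> ('a, 'b) l2_op)
     \<Rightarrow> bool" where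
  "is_schur_map m n \<phi> \<Phi> \<longleftrightarrow>
     \<Phi> \<in> bounded_ops m n \<rightarrow>\<^sub>E bounded_ops m n \<and>
     (\<forall>T\<in>bounded_ops m n. \<forall>h\<in>Gamma m n. \<forall>h'\<in>Gamma m n.
        (AE z in m \<Otimes>\<^sub>M n. h' z = \<phi> z * h z) \<longrightarrow> pairing m n (\<Phi> T) h = pairing m n T h')"

definition idempotent_schur_maps ::
  "'a measure \<Rightarrow> 'b measure \<Rightarrow> (('a, 'b) l2_op \<Rightarrow> ('a, 'b) l2_op) set" where
  "idempotent_schur_maps m n =
     {\<Phi>. (\<exists>\<phi>. schur_multiplier m n \<phi> \<and> is_schur_map m n \<phi> \<Phi>) \<and>
         (\<forall>T\<in>bounded_ops m n. \<Phi> (\<Phi> T) = \<Phi> T)}"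

definition schur_injective :: "'a measure \<Rightarrow> 'b measure \<Rightarrow> ('a, 'b) l2_op set \<Rightarrow> bool" where
  "schur_injective m n U \<longleftrightarrow> (\<exists>\<Phi>\<in>idempotent_schur_maps m n. U = \<Phi> ` bounded_ops m n)"

definition approx_schur_injective :: "'a measure \<Rightarrow> 'b measure \<Rightarrow> ('a, 'b) l2_op set \<Rightarrow> bool" where
  "approx_schur_injective m n U \<longleftrightarrow>
     (\<exists>(\<Phi> :: nat \<Rightarrow> ('a, 'b) l2_op \<Rightarrow> ('a, 'b) l2_op) (C :: real).
        C > 0 \<and>
        (\<forall>k. \<Phi> k \<in> idempotent_schur_maps m n) \<and>
        (\<forall>k. \<forall>T\<in>bounded_ops m n. op_norm m n (\<Phi> k T) \<le> C * op_norm m n T) \<and>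
        (\<forall>k. \<Phi> (Suc k) ` bounded_ops m n \<subseteq> \<Phi> k ` bounded_ops m n) \<and>
        U = (\<Inter>k. \<Phi> k ` bounded_ops m n))"

section \<open>Maximal and minimal masa-bimodules with a given support\<close>

definition M_max :: "'a measure \<Rightarrow> 'b measure \<Rightarrow> ('a \<times> 'b) set \<Rightarrow> ('a, 'b) l2_op set" where
  "M_max m n \<kappa> =
     {T \<in> bounded_ops m n. \<forall>\<alpha>\<in>sets m. \<forall>\<beta>\<in>sets n.
        marginally_null m n ((\<alpha> \<times> \<beta>) \<inter> \<kappa>) \<longrightarrow>
        sandwich m n (indicator \<beta>) T (indicator \<alpha>) = op_zero m n}"

definition has_support ::
  "'a measure \<Rightarrow> 'b measure \<Rightarrow> ('a, 'b) l2_op set \<Rightarrow> ('a \<times> 'b) set \<Rightarrow> bool" where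
  "has_support m n U \<kappa> \<longleftrightarrow> omega_closed m n \<kappa> \<and> Ref m n U = M_max m n \<kappa>"

text \<open>
  There is a smallest weak* closed masa-bimodule with support \<open>\<kappa>\<close>; being smallest, it is the
  intersection of all of them.
\<close>

definition M_min :: "'a measure \<Rightarrow> 'b measure \<Rightarrow> ('a \<times> 'b) set \<Rightarrow> ('a, 'b) l2_op set" where
  "M_min m n \<kappa> =
     \<Inter>{U. masa_bimodule m n U \<and> closedin (weak_star m n) U \<and> has_support m n U \<kappa>}"

end

theory Submission
  imports Defs
begin

text \<open>
  The multipliers \<open>\<phi> k\<close> of a decreasing sequence of idempotent Schur maps \<open>\<Phi> k\<close> are, almost everywhere, a
  decreasing sequence of indicator functions; let \<open>\<phi>\<close> be their limit. For \<open>h\<close> in the predual the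
  functions \<open>\<phi> k * h\<close> define uniformly bounded functionals, and they converge to \<open>\<phi> * h\<close> in square mean.
  So \<open>\<phi> * h\<close> is bounded as a functional on the kernel operators and, by singular value decomposition,
  lies in the predual again: \<open>\<phi>\<close> is a Schur multiplier. The range of its Schur map \<open>\<Phi>\<close> is \<open>M_inj\<close>, and
  \<open>M_pai\<close> is the intersection of the ranges of the idempotents \<open>\<Phi> k - \<Phi>\<close>.

  A compact \<open>T\<close> in \<open>M\<close> is fixed by all \<open>\<Phi> k\<close>. If the kernel operator of \<open>A\<close> is close to \<open>T\<close>, then so are, with
  the factor \<open>C\<close>, the kernel operators of \<open>\<phi> k * A\<close> and of their limit \<open>\<phi> * A\<close>. Hence \<open>\<Phi> T = T\<close>, and \<open>T\<close> is
  a norm limit of Hilbert--Schmidt operators in \<open>M\<close>.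

  For the statement on \<open>M_min\<close>, let \<open>h = \<Sum>i. F i * G i\<close> in the predual annihilate a masa-bimodule \<open>U\<close>. On
  a rectangle where \<open>F\<close> and \<open>G\<close> are nearly constant and \<open>h\<close> does not vanish, \<open>U\<close> is zero, and hence so is
  \<open>Ref U\<close>. Countably many such rectangles cover the set where \<open>h\<close> does not vanish, so \<open>h\<close> annihilates
  all kernel operators in \<open>Ref U\<close>.
\<close>

section \<open>Square integrable functions\<close>

text \<open>The obstacle is that \<open>\<phi> k * h\<close> converges only in square mean, while
  membership in the predual is a trace class condition that square mean limits do not preserve. The
  uniform constant \<open>C\<close> enters here: it bounds the limit functional on kernel operators,
  and testing with finite rank partial isometries built from singular vectors turns this bound into
  summability of the singular values. That the multipliers are indicators comes from the action on
  kernels: a Schur map multiplies the kernel, so idempotency, read off from one kernel without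
  zeros, says that the multiplier equals its square almost everywhere.

  In the annihilator argument one cannot divide by \<open>h\<close> inside the predual. On a small
  rectangle, however, \<open>h\<close> acts as a Schur multiplier that is a nonzero constant plus a
  perturbation of smaller norm. The resulting vanishing passes from \<open>U\<close> to
  \<open>Ref U\<close> because \<open>Ref\<close> respects the vanishing of a single matrix
  coefficient. For a kernel operator, vanishing on countably many rectangles is enough, because its
  pairing with \<open>h\<close> is an integral.\<close>

definition ip :: "'a measure \<Rightarrow> ('a \<Rightarrow> complex) \<Rightarrow> ('a \<Rightarrow> complex) \<Rightarrow> complex" where
  "ip m f g = (\<integral>x. f x * cnj (g x) \<partial>m)"

text \<open>Norm and inner product are taken on functions rather than on classes, so
  \<open>nm\<close> is only a seminorm. Classes enter again when operators are translated into
  bilinear forms.\<close>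

definition nm :: "'a measure \<Rightarrow> ('a \<Rightarrow> complex) \<Rightarrow> real" where
  "nm m f = sqrt (\<integral>x. (cmod (f x))\<^sup>2 \<partial>m)"

lemma sq_int_measurable [measurable_dest]: "f \<in> sq_int m \<Longrightarrow> f \<in> borel_measurable m"
  by (simp add: sq_int_def)

lemma sq_int_integrable: "f \<in> sq_int m \<Longrightarrow> integrable m (\<lambda>x. (cmod (f x))\<^sup>2)"
  by (simp add: sq_int_def)

lemma sq_intI:
  assumes "f \<in> borel_measurable m" "integrable m g" "\<And>x. x \<in> space m \<Longrightarrow> (cmod (f x))\<^sup>2 \<le> g x"
  shows "f \<in> sq_int m"
proof -
  have "integrable m (\<lambda>x. (cmod (f x))\<^sup>2)"
    using assms by (intro Bochner_Integration.integrable_bound[OF assms(2)])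
      (auto intro!: AE_I2 order_trans[OF _ abs_ge_self])
  then show ?thesis using assms by (simp add: sq_int_def)
qed

lemma cmod_add_sq_le: "(cmod (a + b))\<^sup>2 \<le> 2 * (cmod a)\<^sup>2 + 2 * (cmod b)\<^sup>2"
proof -
  have "(cmod (a + b))\<^sup>2 \<le> (cmod a + cmod b)\<^sup>2"
    by (intro power_mono norm_triangle_ineq) auto
  also have "\<dots> \<le> 2 * (cmod a)\<^sup>2 + 2 * (cmod b)\<^sup>2"
    using sum_squares_bound[of "cmod a" "cmod b"] by (simp add: power2_sum)
  finally show ?thesis .
qed

lemma sq_int_zero [simp, intro]: "(\<lambda>_. 0) \<in> sq_int m"
  by (simp add: sq_int_def)

lemma sq_int_add [simp, intro]:
  assumes "f \<in> sq_int m" "g \<in> sq_int m" shows "(\<lambda>x. f x + g x) \<in> sq_int m"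
  using assms
  by (intro sq_intI[where g="\<lambda>x. 2 * (cmod (f x))\<^sup>2 + 2 * (cmod (g x))\<^sup>2"])
     (auto intro!: cmod_add_sq_le sq_int_measurable sq_int_integrable borel_measurable_add)

lemma sq_int_cmult [simp, intro]:
  assumes "f \<in> sq_int m" shows "(\<lambda>x. c * f x) \<in> sq_int m"
  using assms by (auto simp: sq_int_def norm_mult power_mult_distrib intro!: borel_measurable_times)

lemma sq_int_uminus [simp, intro]:
  assumes "f \<in> sq_int m" shows "(\<lambda>x. - f x) \<in> sq_int m"
  using sq_int_cmult[OF assms, of "-1"] by simp

lemma sq_int_diff [simp, intro]:
  assumes "f \<in> sq_int m" "g \<in> sq_int m" shows "(\<lambda>x. f x - g x) \<in> sq_int m"
  using sq_int_add[OF assms(1) sq_int_uminus[OF assms(2)]] by simp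

lemma sq_int_cnj [simp, intro]:
  assumes "f \<in> sq_int m" shows "(\<lambda>x. cnj (f x)) \<in> sq_int m"
proof -
  have "(\<lambda>x. cnj (f x)) \<in> borel_measurable m"
    by (rule borel_measurable_continuous_on[OF _ sq_int_measurable[OF assms]])
       (intro continuous_intros)
  then show ?thesis using assms by (simp add: sq_int_def)
qed

lemma sq_int_sum [simp, intro]:
  assumes "\<And>i. i \<in> I \<Longrightarrow> f i \<in> sq_int m" shows "(\<lambda>x. \<Sum>i\<in>I. f i x) \<in> sq_int m"
  using assms by (induction I rule: infinite_finite_induct) auto

lemma sq_int_cong_AE:
  assumes "f \<in> sq_int m" "g \<in> borel_measurable m" "AE x in m. g x = f x"
  shows "g \<in> sq_int m"
proof -
  have "integrable m (\<lambda>x. (cmod (g x))\<^sup>2) \<longleftrightarrow> integrable m (\<lambda>x. (cmod (f x))\<^sup>2)"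
    using assms by (intro integrable_cong_AE) (auto intro: sq_int_measurable)
  then show ?thesis using assms by (simp add: sq_int_def)
qed

lemma sq_int_bounded_mult:
  assumes f: "f \<in> sq_int m" and b: "b \<in> borel_measurable m" "AE x in m. cmod (b x) \<le> C"
  shows "(\<lambda>x. b x * f x) \<in> sq_int m"
proof -
  have "integrable m (\<lambda>x. (cmod (b x * f x))\<^sup>2)"
  proof (rule Bochner_Integration.integrable_bound)
    show "integrable m (\<lambda>x. C\<^sup>2 * (cmod (f x))\<^sup>2)"
      using sq_int_integrable[OF f] by simp
    show "(\<lambda>x. (cmod (b x * f x))\<^sup>2) \<in> borel_measurable m"
      using b(1) sq_int_measurable[OF f] by measurable
    show "AE x in m. norm ((cmod (b x * f x))\<^sup>2) \<le> norm (C\<^sup>2 * (cmod (f x))\<^sup>2)"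
      using b(2) by eventually_elim
        (auto simp: norm_mult power_mult_distrib intro!: mult_right_mono power_mono)
  qed
  moreover have "(\<lambda>x. b x * f x) \<in> borel_measurable m"
    using b(1) sq_int_measurable[OF f] by measurable
  ultimately show ?thesis by (simp add: sq_int_def)
qed

lemma ess_boundedE:
  assumes "b \<in> ess_bounded m"
  obtains C where "C > 0" "AE x in m. cmod (b x) \<le> C" "b \<in> borel_measurable m"
proof -
  from assms obtain C where C: "AE x in m. cmod (b x) \<le> C" "b \<in> borel_measurable m"
    by (auto simp: ess_bounded_def)
  have "AE x in m. cmod (b x) \<le> max C 1" using C(1) by eventually_elim auto
  with C(2) that[of "max C 1"] show ?thesis by auto
qed

lemma sq_int_ess_mult [simp, intro]:
  "f \<in> sq_int m \<Longrightarrow> b \<in> ess_bounded m \<Longrightarrow> (\<lambda>x. b x * f x) \<in> sq_int m"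
  by (erule ess_boundedE, rule sq_int_bounded_mult) auto

lemma ess_bounded_indicator [simp, intro]: "A \<in> sets m \<Longrightarrow> indicator A \<in> ess_bounded m"
  by (auto simp: ess_bounded_def intro!: exI[of _ 1] AE_I2 split: split_indicator)

lemma integrable_sq_norm_mult:
  assumes "f \<in> sq_int m" "g \<in> sq_int m"
  shows "integrable m (\<lambda>x. cmod (f x) * cmod (g x))"
proof (rule Bochner_Integration.integrable_bound)
  show "integrable m (\<lambda>x. (cmod (f x))\<^sup>2 + (cmod (g x))\<^sup>2)"
    using assms by (auto intro: sq_int_integrable)
  show "(\<lambda>x. cmod (f x) * cmod (g x)) \<in> borel_measurable m"
    using sq_int_measurable[OF assms(1)] sq_int_measurable[OF assms(2)] by measurable
  show "AE x in m. norm (cmod (f x) * cmod (g x)) \<le> norm ((cmod (f x))\<^sup>2 + (cmod (g x))\<^sup>2)"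
  proof (rule AE_I2)
    fix x
    have "0 \<le> cmod (f x) * cmod (g x)" by simp
    then have "cmod (f x) * cmod (g x) \<le> (cmod (f x))\<^sup>2 + (cmod (g x))\<^sup>2"
      using sum_squares_bound[of "cmod (f x)" "cmod (g x)"] by linarith
    then show "norm (cmod (f x) * cmod (g x)) \<le> norm ((cmod (f x))\<^sup>2 + (cmod (g x))\<^sup>2)"
      by (simp add: abs_mult)
  qed
qed

lemma integrable_sq_mult [simp, intro]:
  assumes "f \<in> sq_int m" "g \<in> sq_int m"
  shows "integrable m (\<lambda>x. f x * g x)"
  by (rule Bochner_Integration.integrable_bound[OF integrable_sq_norm_mult[OF assms]])
     (use sq_int_measurable[OF assms(1)] sq_int_measurable[OF assms(2)] in
       \<open>auto simp: norm_mult intro!: borel_measurable_times\<close>)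

lemma nm_nonneg [simp]: "0 \<le> nm m f"
  by (simp add: nm_def)

lemma nm_sq: "(nm m f)\<^sup>2 = (\<integral>x. (cmod (f x))\<^sup>2 \<partial>m)"
  by (simp add: nm_def)

lemma ip_self: "ip m f f = complex_of_real ((nm m f)\<^sup>2)"
  unfolding ip_def nm_sq integral_complex_of_real[symmetric]
  by (simp add: complex_norm_square del: integral_complex_of_real of_real_power)

lemma nm_zero [simp]: "nm m (\<lambda>_. 0) = 0"
  by (simp add: nm_def)

lemma nm_cmult [simp]: "nm m (\<lambda>x. c * f x) = cmod c * nm m f"
  by (simp add: nm_def norm_mult power_mult_distrib real_sqrt_mult)

lemma nm_uminus [simp]: "nm m (\<lambda>x. - f x) = nm m f"
  by (simp add: nm_def)

lemma nm_cnj [simp]: "nm m (\<lambda>x. cnj (f x)) = nm m f"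
  by (simp add: nm_def)

lemma nm_diff_commute: "nm m (\<lambda>x. f x - g x) = nm m (\<lambda>x. g x - f x)"
  by (simp add: nm_def norm_minus_commute)

lemma nm_cong_AE:
  assumes "f \<in> borel_measurable m" "g \<in> borel_measurable m" "AE x in m. f x = g x"
  shows "nm m f = nm m g"
proof -
  have "(\<integral>x. (cmod (f x))\<^sup>2 \<partial>m) = (\<integral>x. (cmod (g x))\<^sup>2 \<partial>m)"
    using assms by (intro integral_cong_AE) auto
  then show ?thesis by (simp add: nm_def)
qed

lemma ip_cong_AE:
  assumes "f \<in> sq_int m" "f' \<in> sq_int m" "g \<in> sq_int m" "g' \<in> sq_int m"
    "AE x in m. f x = f' x" "AE x in m. g x = g' x"
  shows "ip m f g = ip m f' g'"
  unfolding ip_def using assms by (intro integral_cong_AE borel_measurable_integrable) auto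

lemma nm_eq_0_iff:
  assumes "f \<in> sq_int m"
  shows "nm m f = 0 \<longleftrightarrow> (AE x in m. f x = 0)"
proof -
  have "nm m f = 0 \<longleftrightarrow> (\<integral>x. (cmod (f x))\<^sup>2 \<partial>m) = 0" by (simp add: nm_def)
  also have "\<dots> \<longleftrightarrow> (AE x in m. (cmod (f x))\<^sup>2 = 0)"
    using assms by (intro integral_nonneg_eq_0_iff_AE) (auto intro: sq_int_integrable)
  finally show ?thesis by simp
qed

lemma integral_norm_mult_le:
  assumes f: "f \<in> sq_int m" and g: "g \<in> sq_int m"
  shows "(\<integral>x. cmod (f x) * cmod (g x) \<partial>m) \<le> nm m f * nm m g"
proof -
  have [measurable]: "f \<in> borel_measurable m" "g \<in> borel_measurable m"
    using f g by (auto intro: sq_int_measurable)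
  let ?I = "\<integral>x. cmod (f x) * cmod (g x) \<partial>m"
  have "(\<integral>\<^sup>+x. ennreal (cmod (f x)) * ennreal (cmod (g x)) \<partial>m)\<^sup>2
      \<le> (\<integral>\<^sup>+x. (ennreal (cmod (f x)))^2 \<partial>m) * (\<integral>\<^sup>+x. (ennreal (cmod (g x)))^2 \<partial>m)"
    by (rule Cauchy_Schwarz_nn_integral) auto
  then have "(\<integral>\<^sup>+x. ennreal (cmod (f x) * cmod (g x)) \<partial>m)\<^sup>2
      \<le> (\<integral>\<^sup>+x. ennreal ((cmod (f x))^2) \<partial>m) * (\<integral>\<^sup>+x. ennreal ((cmod (g x))^2) \<partial>m)"
    by (simp add: ennreal_mult ennreal_power)
  also have "(\<integral>\<^sup>+x. ennreal (cmod (f x) * cmod (g x)) \<partial>m) = ennreal ?I"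
    using integrable_sq_norm_mult[OF f g] by (intro nn_integral_eq_integral) auto
  also have "(\<integral>\<^sup>+x. ennreal ((cmod (f x))^2) \<partial>m) = ennreal ((nm m f)\<^sup>2)"
    using sq_int_integrable[OF f] unfolding nm_sq by (intro nn_integral_eq_integral) auto
  also have "(\<integral>\<^sup>+x. ennreal ((cmod (g x))^2) \<partial>m) = ennreal ((nm m g)\<^sup>2)"
    using sq_int_integrable[OF g] unfolding nm_sq by (intro nn_integral_eq_integral) auto
  finally have "ennreal (?I\<^sup>2) \<le> ennreal ((nm m f)\<^sup>2 * (nm m g)\<^sup>2)"
    by (simp add: ennreal_power ennreal_mult)
  then have "?I\<^sup>2 \<le> (nm m f * nm m g)\<^sup>2"
    by (simp add: power_mult_distrib ennreal_le_iff)
  then show ?thesis by (rule power2_le_imp_le) simp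
qed

lemma norm_integral_mult_le:
  assumes f: "f \<in> sq_int m" and g: "g \<in> sq_int m"
  shows "cmod (\<integral>x. f x * g x \<partial>m) \<le> nm m f * nm m g"
proof -
  have "cmod (\<integral>x. f x * g x \<partial>m) \<le> (\<integral>x. cmod (f x * g x) \<partial>m)"
    by (rule integral_norm_bound)
  also have "\<dots> \<le> nm m f * nm m g"
    using integral_norm_mult_le[OF f g] by (simp add: norm_mult)
  finally show ?thesis .
qed

lemma norm_ip_le:
  "f \<in> sq_int m \<Longrightarrow> g \<in> sq_int m \<Longrightarrow> cmod (ip m f g) \<le> nm m f * nm m g"
  unfolding ip_def using norm_integral_mult_le[of f m "\<lambda>x. cnj (g x)"] by simp

lemma ip_add_left:
  "f \<in> sq_int m \<Longrightarrow> g \<in> sq_int m \<Longrightarrow> h \<in> sq_int m \<Longrightarrow>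
    ip m (\<lambda>x. f x + g x) h = ip m f h + ip m g h"
  by (simp add: ip_def distrib_right)

lemma ip_add_right:
  "f \<in> sq_int m \<Longrightarrow> g \<in> sq_int m \<Longrightarrow> h \<in> sq_int m \<Longrightarrow>
    ip m h (\<lambda>x. f x + g x) = ip m h f + ip m h g"
  by (simp add: ip_def distrib_left)

lemma ip_diff_left:
  "f \<in> sq_int m \<Longrightarrow> g \<in> sq_int m \<Longrightarrow> h \<in> sq_int m \<Longrightarrow>
    ip m (\<lambda>x. f x - g x) h = ip m f h - ip m g h"
  by (simp add: ip_def left_diff_distrib)

lemma ip_cmult_left [simp]: "ip m (\<lambda>x. c * f x) h = c * ip m f h"
  by (simp add: ip_def mult.assoc)

lemma ip_cmult_right [simp]: "ip m h (\<lambda>x. c * f x) = cnj c * ip m h f"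
  by (simp add: ip_def mult.left_commute)

lemma ip_zero [simp]: "ip m (\<lambda>_. 0) h = 0" "ip m h (\<lambda>_. 0) = 0"
  by (simp_all add: ip_def)

lemma cnj_ip: "cnj (ip m f g) = ip m g f"
proof -
  have "cnj (ip m f g) = (\<integral>x. cnj (f x * cnj (g x)) \<partial>m)"
    unfolding ip_def by (rule Bochner_Integration.integral_cnj[symmetric])
  also have "(\<lambda>x. cnj (f x * cnj (g x))) = (\<lambda>x. g x * cnj (f x))"
    by (simp add: mult.commute)
  finally show ?thesis by (simp only: ip_def)
qed

lemma ip_sum_left:
  assumes "\<And>i. i \<in> I \<Longrightarrow> f i \<in> sq_int m" "h \<in> sq_int m"
  shows "ip m (\<lambda>x. \<Sum>i\<in>I. f i x) h = (\<Sum>i\<in>I. ip m (f i) h)"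
  using assms by (induction I rule: infinite_finite_induct) (auto simp: ip_add_left)

lemma ip_sum_right:
  assumes "\<And>i. i \<in> I \<Longrightarrow> f i \<in> sq_int m" "h \<in> sq_int m"
  shows "ip m h (\<lambda>x. \<Sum>i\<in>I. f i x) = (\<Sum>i\<in>I. ip m h (f i))"
  using assms by (induction I rule: infinite_finite_induct) (auto simp: ip_add_right)

lemma nm_add_sq:
  assumes "f \<in> sq_int m" "g \<in> sq_int m"
  shows "(nm m (\<lambda>x. f x + g x))\<^sup>2 = (nm m f)\<^sup>2 + (nm m g)\<^sup>2 + 2 * Re (ip m f g)"
proof -
  have "complex_of_real ((nm m (\<lambda>x. f x + g x))\<^sup>2)
      = ip m f f + ip m g g + (ip m f g + cnj (ip m f g))"
    using assms
    by (simp add: ip_self[symmetric] ip_add_left ip_add_right cnj_ip del: of_real_power)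
  also have "\<dots> = complex_of_real ((nm m f)\<^sup>2 + (nm m g)\<^sup>2 + 2 * Re (ip m f g))"
    by (simp add: ip_self complex_add_cnj)
  finally show ?thesis by (simp only: of_real_eq_iff)
qed

lemma nm_diff_sq:
  assumes "f \<in> sq_int m" "g \<in> sq_int m"
  shows "(nm m (\<lambda>x. f x - g x))\<^sup>2 = (nm m f)\<^sup>2 + (nm m g)\<^sup>2 - 2 * Re (ip m f g)"
  using nm_add_sq[OF assms(1) sq_int_cmult[OF assms(2), of "-1"]]
    ip_cmult_right[of m f "-1" g] by simp

lemma nm_triangle:
  assumes "f \<in> sq_int m" "g \<in> sq_int m"
  shows "nm m (\<lambda>x. f x + g x) \<le> nm m f + nm m g"
proof (rule power2_le_imp_le)
  have "Re (ip m f g) \<le> nm m f * nm m g"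
    using norm_ip_le[OF assms] complex_Re_le_cmod[of "ip m f g"] by linarith
  then show "(nm m (\<lambda>x. f x + g x))\<^sup>2 \<le> (nm m f + nm m g)\<^sup>2"
    by (simp add: nm_add_sq[OF assms] power2_sum)
qed simp

lemma nm_dist_triangle:
  assumes "f \<in> sq_int m" "g \<in> sq_int m" "h \<in> sq_int m"
  shows "nm m (\<lambda>x. f x - h x) \<le> nm m (\<lambda>x. f x - g x) + nm m (\<lambda>x. g x - h x)"
  using nm_triangle[of "\<lambda>x. f x - g x" m "\<lambda>x. g x - h x"] assms by simp

lemma nm_diff_ge:
  assumes "f \<in> sq_int m" "g \<in> sq_int m"
  shows "\<bar>nm m f - nm m g\<bar> \<le> nm m (\<lambda>x. f x - g x)"
  using nm_triangle[of "\<lambda>x. f x - g x" m g] nm_triangle[of "\<lambda>x. g x - f x" m f] assms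
  by (auto simp: nm_diff_commute[of m f g])

lemma tendsto_ip:
  assumes F: "\<And>k. f k \<in> sq_int m" "g \<in> sq_int m" "h \<in> sq_int m"
    and lim: "(\<lambda>k. nm m (\<lambda>x. f k x - g x)) \<longlonglongrightarrow> 0"
  shows "(\<lambda>k. ip m h (f k)) \<longlonglongrightarrow> ip m h g" "(\<lambda>k. ip m (f k) h) \<longlonglongrightarrow> ip m g h"
proof -
  have *: "(\<lambda>k. ip m (f k) h - ip m g h) \<longlonglongrightarrow> 0"
  proof (rule Lim_null_comparison)
    show "\<forall>\<^sub>F k in sequentially. norm (ip m (f k) h - ip m g h) \<le> nm m (\<lambda>x. f k x - g x) * nm m h"
      using norm_ip_le[of "\<lambda>x. f _ x - g x" m h] F by (simp add: ip_diff_left)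
    show "(\<lambda>k. nm m (\<lambda>x. f k x - g x) * nm m h) \<longlonglongrightarrow> 0"
      using tendsto_mult_left_zero[OF lim] by simp
  qed
  then show 1: "(\<lambda>k. ip m (f k) h) \<longlonglongrightarrow> ip m g h"
    by (simp add: LIM_zero_iff)
  then have "(\<lambda>k. cnj (ip m (f k) h)) \<longlonglongrightarrow> cnj (ip m g h)"
    by (rule tendsto_cnj)
  then show "(\<lambda>k. ip m h (f k)) \<longlonglongrightarrow> ip m h g"
    by (simp add: cnj_ip)
qed

lemma tendsto_nm:
  assumes F: "\<And>k. f k \<in> sq_int m" "g \<in> sq_int m"
    and lim: "(\<lambda>k. nm m (\<lambda>x. f k x - g x)) \<longlonglongrightarrow> 0"
  shows "(\<lambda>k. nm m (f k)) \<longlonglongrightarrow> nm m g"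
proof -
  have "(\<lambda>k. nm m (f k) - nm m g) \<longlonglongrightarrow> 0"
    by (rule Lim_null_comparison[OF _ lim]) (use nm_diff_ge[of "f _" m g] F in auto)
  then show ?thesis by (simp add: LIM_zero_iff)
qed

section \<open>Completeness and the Riesz representation theorem\<close>

lemma summable_power4_imp_summable_norm:
  fixes d :: "nat \<Rightarrow> complex"
  assumes "summable (\<lambda>k. 4 ^ k * (cmod (d k))\<^sup>2)"
  shows "summable d"
proof -
  let ?c = "\<Sum>k. 4 ^ k * (cmod (d k))\<^sup>2"
  \<comment> \<open>A single term is at most the whole sum \<open>?c\<close>, so \<open>d k\<close>
    decays like \<open>(1/2) ^ k\<close>.\<close>
  have *: "norm (d k) \<le> sqrt ?c * (1/2) ^ k" for k
  proof -
    have "4 ^ k * (cmod (d k))\<^sup>2 = sum (\<lambda>k. 4 ^ k * (cmod (d k))\<^sup>2) {k}" by simp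
    also have "\<dots> \<le> ?c"
      by (intro sum_le_suminf[OF assms]) auto
    finally have "sqrt (4 ^ k * (cmod (d k))\<^sup>2) \<le> sqrt ?c" by simp
    moreover have "sqrt (4 ^ k) = (2::real) ^ k"
      by (metis real_sqrt_four real_sqrt_power)
    ultimately have "2 ^ k * cmod (d k) \<le> sqrt ?c" by (simp add: real_sqrt_mult)
    then show ?thesis by (simp add: field_simps)
  qed
  have "summable (\<lambda>k. sqrt ?c * (1/2) ^ k)"
    by (intro summable_mult summable_geometric) simp
  then show ?thesis
    by (rule summable_comparison_test[rotated]) (use * in blast)
qed

text \<open>
  A sufficiently sparse subsequence has increments \<open>d\<close> with \<open>\<Sum>k. 4 ^ k * \<parallel>d k\<parallel>\<^sup>2 < \<infinity>\<close>, and hence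
  converges almost everywhere; Fatou's lemma identifies its pointwise limit as the limit in norm.
\<close>

lemma sq_int_complete:
  assumes f: "\<And>k. f k \<in> sq_int m"
    and cauchy: "\<And>e. e > 0 \<Longrightarrow> \<exists>N. \<forall>i\<ge>N. \<forall>j\<ge>N. nm m (\<lambda>x. f i x - f j x) < e"
  obtains g where "g \<in> sq_int m" "(\<lambda>k. nm m (\<lambda>x. f k x - g x)) \<longlonglongrightarrow> 0"
proof -
  have [measurable]: "f k \<in> borel_measurable m" for k
    using f by (rule sq_int_measurable)
  have "\<exists>N. \<forall>i\<ge>N. \<forall>j\<ge>N. nm m (\<lambda>x. f i x - f j x) < (1/4) ^ k" for k :: nat
    by (rule cauchy) simp
  then obtain N where N: "\<And>k i j. i \<ge> N k \<Longrightarrow> j \<ge> N k \<Longrightarrow> nm m (\<lambda>x. f i x - f j x) < (1/4) ^ k"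
    by metis
  \<comment> \<open>The summand \<open>k\<close> gives \<open>r j \<ge> j\<close>, which the Fatou
    estimate needs; the sum of the \<open>N j\<close> makes both \<open>r k\<close> and
    \<open>r (Suc k)\<close> at least \<open>N k\<close>, so that the increments are small.\<close>
  define r where "r k = k + (\<Sum>j\<le>k. N j)" for k
  have rN: "r k \<ge> N k" for k
    unfolding r_def using member_le_sum[of k "{..k}" N] by simp
  have rS: "r (Suc k) \<ge> N k" for k
    unfolding r_def using member_le_sum[of k "{..Suc k}" N] by simp
  define d where "d k x = f (r (Suc k)) x - f (r k) x" for k x
  have d: "d k \<in> sq_int m" for k
    using f unfolding d_def by auto
  have dm [measurable]: "d k \<in> borel_measurable m" for k
    using d by (rule sq_int_measurable)
  have dn: "nm m (d k) \<le> (1/4) ^ k" for k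
    unfolding d_def using N[OF rS rN] by (simp add: less_imp_le)
  have "(\<integral>\<^sup>+x. (\<Sum>k. ennreal (4 ^ k * (cmod (d k x))\<^sup>2)) \<partial>m)
      = (\<Sum>k. \<integral>\<^sup>+x. ennreal (4 ^ k * (cmod (d k x))\<^sup>2) \<partial>m)"
    by (intro nn_integral_suminf) measurable
  also have "\<dots> = (\<Sum>k. ennreal (4 ^ k * (nm m (d k))\<^sup>2))"
    using sq_int_integrable[OF d]
    by (subst nn_integral_eq_integral) (auto simp: nm_sq)
  \<comment> \<open>The weight \<open>4 ^ k\<close> consumes one of the two factors
    \<open>(1/4) ^ k\<close> of the squared norm.\<close>
  also have "\<dots> \<le> (\<Sum>k. ennreal ((1/4) ^ k))"
  proof (intro suminf_le ennreal_leI)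
    fix k
    have "(nm m (d k))\<^sup>2 \<le> ((1/4) ^ k)\<^sup>2"
      using dn by (intro power_mono) auto
    then have "4 ^ k * (nm m (d k))\<^sup>2 \<le> 4 ^ k * ((1/4) ^ k)\<^sup>2" by simp
    also have "\<dots> = (1/4::real) ^ k"
      by (simp add: power2_eq_square power_one_over field_simps)
    finally show "4 ^ k * (nm m (d k))\<^sup>2 \<le> (1/4::real) ^ k" .
  qed auto
  also have "\<dots> = ennreal (\<Sum>k. (1/4) ^ k)"
    by (rule suminf_ennreal2) (simp_all add: summable_geometric)
  finally have "(\<integral>\<^sup>+x. (\<Sum>k. ennreal (4 ^ k * (cmod (d k x))\<^sup>2)) \<partial>m) \<noteq> \<infinity>"
    unfolding infinity_ennreal_def by (rule neq_top_trans[OF ennreal_neq_top])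
  then have "AE x in m. (\<Sum>k. ennreal (4 ^ k * (cmod (d k x))\<^sup>2)) \<noteq> \<infinity>"
    by (rule nn_integral_PInf_AE[rotated]) measurable
  then have conv: "AE x in m. (\<lambda>k. f (r k) x) \<longlonglongrightarrow> lim (\<lambda>k. f (r k) x)"
  proof eventually_elim
    case (elim x)
    have "summable (\<lambda>k. 4 ^ k * (cmod (d k x))\<^sup>2)"
    proof (rule summable_suminf_not_top)
      show "(\<Sum>k. ennreal (4 ^ k * (cmod (d k x))\<^sup>2)) \<noteq> top"
        using elim unfolding infinity_ennreal_def .
    qed simp
    then have "summable (\<lambda>k. d k x)"
      by (rule summable_power4_imp_summable_norm)
    then have "(\<lambda>n. (\<Sum>k<n. d k x) + f (r 0) x) \<longlonglongrightarrow> (\<Sum>k. d k x) + f (r 0) x"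
      by (intro tendsto_add summable_LIMSEQ tendsto_const)
    moreover have "(\<Sum>k<n. d k x) + f (r 0) x = f (r n) x" for n
    proof (induction n)
      case (Suc n)
      have "(\<Sum>k<Suc n. d k x) + f (r 0) x = ((\<Sum>k<n. d k x) + f (r 0) x) + d n x" by simp
      also have "\<dots> = f (r n) x + d n x" by (simp only: Suc.IH)
      finally show ?case by (simp add: d_def)
    qed simp
    ultimately have "(\<lambda>n. f (r n) x) \<longlonglongrightarrow> (\<Sum>k. d k x) + f (r 0) x"
      by (simp only:)
    moreover from limI[OF this] have "lim (\<lambda>k. f (r k) x) = (\<Sum>k. d k x) + f (r 0) x" .
    ultimately show ?case by (simp only:)
  qed
  define g where "g x = lim (\<lambda>k. f (r k) x)" for x
  have gm [measurable]: "g \<in> borel_measurable m"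
    unfolding g_def by measurable
  have bound: "(\<integral>\<^sup>+x. ennreal ((cmod (f i x - g x))\<^sup>2) \<partial>m) \<le> ennreal (((1/4) ^ k)\<^sup>2)"
    if i: "i \<ge> N k" for i k
  proof -
    have "(\<integral>\<^sup>+x. ennreal ((cmod (f i x - g x))\<^sup>2) \<partial>m)
        = (\<integral>\<^sup>+x. liminf (\<lambda>j. ennreal ((cmod (f i x - f (r j) x))\<^sup>2)) \<partial>m)"
    proof (rule nn_integral_cong_AE)
      show "AE x in m. ennreal ((cmod (f i x - g x))\<^sup>2)
          = liminf (\<lambda>j. ennreal ((cmod (f i x - f (r j) x))\<^sup>2))"
        using conv
      proof eventually_elim
        case (elim x)
        have "(\<lambda>j. ennreal ((cmod (f i x - f (r j) x))\<^sup>2)) \<longlonglongrightarrow> ennreal ((cmod (f i x - g x))\<^sup>2)"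
          using elim unfolding g_def by (intro tendsto_intros)
        then show ?case by (intro lim_imp_Liminf[symmetric]) auto
      qed
    qed
    also have "\<dots> \<le> liminf (\<lambda>j. \<integral>\<^sup>+x. ennreal ((cmod (f i x - f (r j) x))\<^sup>2) \<partial>m)"
      by (intro nn_integral_liminf) measurable
    also have "\<dots> \<le> ennreal (((1/4) ^ k)\<^sup>2)"
    proof (rule Liminf_le)
      show "\<forall>\<^sub>F j in sequentially.
          (\<integral>\<^sup>+x. ennreal ((cmod (f i x - f (r j) x))\<^sup>2) \<partial>m) \<le> ennreal (((1/4) ^ k)\<^sup>2)"
        using eventually_ge_at_top[of "N k"]
      proof eventually_elim
        case (elim j)
        have "r j \<ge> N k" using elim unfolding r_def by simp
        then have "nm m (\<lambda>x. f i x - f (r j) x) \<le> (1/4) ^ k"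
          using N[OF i, of "r j"] by simp
        then have "(nm m (\<lambda>x. f i x - f (r j) x))\<^sup>2 \<le> ((1/4) ^ k)\<^sup>2"
          by (intro power_mono) auto
        moreover have "(\<integral>\<^sup>+x. ennreal ((cmod (f i x - f (r j) x))\<^sup>2) \<partial>m)
            = ennreal ((nm m (\<lambda>x. f i x - f (r j) x))\<^sup>2)"
          unfolding nm_sq by (rule nn_integral_eq_integral) (auto intro!: sq_int_integrable f)
        ultimately show ?case by (simp add: ennreal_leI)
      qed
    qed simp
    finally show ?thesis .
  qed
  have fg: "(\<lambda>x. f i x - g x) \<in> sq_int m" if "i \<ge> N k" for i k
  proof -
    have "integrable m (\<lambda>x. (cmod (f i x - g x))\<^sup>2)"
      using bound[OF that] by (intro integrableI_bounded) (auto intro: order.strict_trans1)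
    then show ?thesis by (simp add: sq_int_def)
  qed
  have "g \<in> sq_int m"
    using sq_int_diff[OF f fg[OF order_refl], of "N 0" 0] by simp
  moreover have "(\<lambda>k. nm m (\<lambda>x. f k x - g x)) \<longlonglongrightarrow> 0"
  proof (rule LIMSEQ_I)
    fix e :: real assume "e > 0"
    then obtain k where k: "(1/4) ^ k < e"
      using real_arch_pow_inv[of e "1/4"] by auto
    have "norm (nm m (\<lambda>x. f i x - g x) - 0) < e" if i: "i \<ge> N k" for i
    proof -
      have "ennreal ((nm m (\<lambda>x. f i x - g x))\<^sup>2) = (\<integral>\<^sup>+x. ennreal ((cmod (f i x - g x))\<^sup>2) \<partial>m)"
        unfolding nm_sq using sq_int_integrable[OF fg[OF i]]
        by (intro nn_integral_eq_integral[symmetric]) auto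
      also have "\<dots> \<le> ennreal (((1/4) ^ k)\<^sup>2)" by (rule bound[OF i])
      finally have "(nm m (\<lambda>x. f i x - g x))\<^sup>2 \<le> ((1/4) ^ k)\<^sup>2"
        by (simp add: ennreal_le_iff)
      then have "nm m (\<lambda>x. f i x - g x) \<le> (1/4) ^ k"
        by (rule power2_le_imp_le) simp
      with k show ?thesis by simp
    qed
    then show "\<exists>no. \<forall>n\<ge>no. norm (nm m (\<lambda>x. f n x - g x) - 0) < e" by blast
  qed
  ultimately show ?thesis by (rule that)
qed

text \<open>Evaluate at \<open>t = - c / (a + 1)\<close>: the value is negative unless
  \<open>c\<close> vanishes. The denominator \<open>a + 1\<close> in place of \<open>a\<close> also
  covers \<open>a = 0\<close>.\<close>

lemma quadratic_nonneg_imp_zero: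
  fixes a c :: real
  assumes "\<And>t. t\<^sup>2 * a + 2 * t * c \<ge> 0" "a \<ge> 0"
  shows "c = 0"
proof (rule ccontr)
  assume "c \<noteq> 0"
  define s where "s = 1 / (a + 1)"
  have s: "s * (a + 1) = 1" using assms(2) by (simp add: s_def)
  have "(- c * s)\<^sup>2 * a + 2 * (- c * s) * c \<ge> 0" by (rule assms)
  then have "((- c * s)\<^sup>2 * a + 2 * (- c * s) * c) * (a + 1)\<^sup>2 \<ge> 0"
    by (intro mult_nonneg_nonneg) auto
  moreover have "((- c * s)\<^sup>2 * a + 2 * (- c * s) * c) * (a + 1)\<^sup>2
      = c\<^sup>2 * (s * (a + 1))\<^sup>2 * a - 2 * c\<^sup>2 * (s * (a + 1)) * (a + 1)"
    by (simp add: power2_eq_square algebra_simps)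
  moreover have "\<dots> = - (c\<^sup>2 * (a + 2))"
    unfolding s by (simp add: algebra_simps)
  moreover have "c\<^sup>2 * (a + 2) > 0"
    using \<open>c \<noteq> 0\<close> assms(2) by (intro mult_pos_pos) auto
  ultimately show False by linarith
qed

text \<open>
  The representing vector minimizes \<open>J f = \<parallel>f\<parallel>\<^sup>2 - 2 * Re (\<phi> f)\<close>; a minimizing sequence is Cauchy by
  the parallelogram law.
\<close>

theorem riesz_representation:
  fixes \<phi> :: "('a \<Rightarrow> complex) \<Rightarrow> complex"
  assumes add: "\<And>f g. f \<in> sq_int m \<Longrightarrow> g \<in> sq_int m \<Longrightarrow> \<phi> (\<lambda>x. f x + g x) = \<phi> f + \<phi> g"
    and cmult: "\<And>f c. f \<in> sq_int m \<Longrightarrow> \<phi> (\<lambda>x. c * f x) = c * \<phi> f"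
    and bound: "\<And>f. f \<in> sq_int m \<Longrightarrow> cmod (\<phi> f) \<le> K * nm m f"
    and K: "K \<ge> 0"
  obtains u where "u \<in> sq_int m" "\<And>f. f \<in> sq_int m \<Longrightarrow> \<phi> f = ip m f u" "nm m u \<le> K"
proof -
  define J where "J f = (nm m f)\<^sup>2 - 2 * Re (\<phi> f)" for f
  \<comment> \<open>Completing the square in \<open>nm m f\<close>.\<close>
  have lower: "J f \<ge> - (K\<^sup>2)" if "f \<in> sq_int m" for f
  proof -
    have "Re (\<phi> f) \<le> K * nm m f"
      using bound[OF that] complex_Re_le_cmod[of "\<phi> f"] by linarith
    moreover have "0 \<le> (nm m f - K)\<^sup>2" by simp
    moreover have "(nm m f - K)\<^sup>2 = (nm m f)\<^sup>2 - 2 * (K * nm m f) + K\<^sup>2"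
      by (simp add: power2_diff)
    ultimately show ?thesis unfolding J_def by linarith
  qed
  define d where "d = Inf (J ` sq_int m)"
  have bdd: "bdd_below (J ` sq_int m)"
    using lower by (intro bdd_belowI2[of _ "- (K\<^sup>2)"]) auto
  have d_le: "d \<le> J f" if "f \<in> sq_int m" for f
    unfolding d_def using that bdd by (intro cInf_lower) auto
  have "\<exists>f\<in>sq_int m. J f < d + 1 / real (Suc n)" for n
  proof -
    have "J ` sq_int m \<noteq> {}" using sq_int_zero by blast
    then show ?thesis
      using cInf_lessD[of "J ` sq_int m" "d + 1 / real (Suc n)"] unfolding d_def by auto
  qed
  then obtain f where f: "\<And>n. f n \<in> sq_int m" "\<And>n. J (f n) < d + 1 / real (Suc n)"
    by metis
  have par: "(nm m (\<lambda>x. g x - h x))\<^sup>2 = 2 * J g + 2 * J h - 4 * J (\<lambda>x. (1/2) * (g x + h x))"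
    if gh: "g \<in> sq_int m" "h \<in> sq_int m" for g h
  proof -
    have 1: "(nm m (\<lambda>x. (1/2) * (g x + h x)))\<^sup>2 = (nm m (\<lambda>x. g x + h x))\<^sup>2 / 4"
      by (simp only: nm_cmult) (simp add: power_mult_distrib power2_eq_square)
    have 2: "\<phi> (\<lambda>x. (1/2) * (g x + h x)) = (1/2) * (\<phi> g + \<phi> h)"
      using cmult[OF sq_int_add[OF gh], of "1/2"] add[OF gh] by (simp only:)
    have 3: "Re (\<phi> (\<lambda>x. (1/2) * (g x + h x))) = (Re (\<phi> g) + Re (\<phi> h)) / 2"
      unfolding 2 by simp
    show ?thesis
      unfolding J_def 1 3 nm_add_sq[OF gh] nm_diff_sq[OF gh] by (simp add: field_simps)
  qed
  have fdiff: "(nm m (\<lambda>x. f i x - f j x))\<^sup>2 \<le> 2 * (1 / real (Suc i)) + 2 * (1 / real (Suc j))" for i j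
  proof -
    have "d \<le> J (\<lambda>x. (1/2) * (f i x + f j x))"
      by (intro d_le sq_int_cmult sq_int_add f)
    then show ?thesis
      using f(2)[of i] f(2)[of j] par[OF f(1)[of i] f(1)[of j]] by linarith
  qed
  have cau: "\<exists>N. \<forall>i\<ge>N. \<forall>j\<ge>N. nm m (\<lambda>x. f i x - f j x) < e" if "e > 0" for e
  proof -
    obtain N where N: "4 / e\<^sup>2 < real N" using reals_Archimedean2 by blast
    have "nm m (\<lambda>x. f i x - f j x) < e" if "i \<ge> N" "j \<ge> N" for i j
    proof -
      have *: "2 * (1 / real (Suc k)) < e\<^sup>2 / 2" if "k \<ge> N" for k
      proof -
        have "4 / e\<^sup>2 < real (Suc k)" using N that by linarith
        moreover have "e\<^sup>2 > 0" using \<open>e > 0\<close> by simp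
        ultimately have "4 < e\<^sup>2 * real (Suc k)" by (simp only: pos_divide_less_eq mult.commute)
        then show ?thesis by (simp add: divide_less_eq)
      qed
      have "(nm m (\<lambda>x. f i x - f j x))\<^sup>2 < e\<^sup>2"
        using fdiff[of i j] *[OF \<open>i \<ge> N\<close>] *[OF \<open>j \<ge> N\<close>] by linarith
      then show ?thesis by (rule power2_less_imp_less) (use \<open>e > 0\<close> in simp)
    qed
    then show ?thesis by blast
  qed
  obtain u where u: "u \<in> sq_int m" "(\<lambda>k. nm m (\<lambda>x. f k x - u x)) \<longlonglongrightarrow> 0"
    by (rule sq_int_complete[OF f(1) cau])
  have Re_eq: "Re (\<phi> g) = Re (ip m g u)" if g: "g \<in> sq_int m" for g
  proof -
    have "t\<^sup>2 * (nm m g)\<^sup>2 + 2 * t * (Re (ip m g u) - Re (\<phi> g)) \<ge> 0" for t :: real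
    proof (rule LIMSEQ_le)
      show "(\<lambda>n. t\<^sup>2 * (nm m g)\<^sup>2 + 2 * t * (Re (ip m g (f n)) - Re (\<phi> g)))
          \<longlonglongrightarrow> t\<^sup>2 * (nm m g)\<^sup>2 + 2 * t * (Re (ip m g u) - Re (\<phi> g))"
        by (intro tendsto_intros tendsto_ip(1) f u g)
      show "(\<lambda>n. - inverse (real (Suc n))) \<longlonglongrightarrow> 0"
        using tendsto_minus[OF LIMSEQ_inverse_real_of_nat] by simp
      have "- inverse (real (Suc n)) \<le> t\<^sup>2 * (nm m g)\<^sup>2 + 2 * t * (Re (ip m g (f n)) - Re (\<phi> g))" for n
      proof -
        let ?h = "\<lambda>x. complex_of_real t * g x + f n x"
        have tg: "(\<lambda>x. complex_of_real t * g x) \<in> sq_int m" using g by (rule sq_int_cmult)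
        \<comment> \<open>First variation: \<open>f n\<close> is minimal up to
          \<open>1 / Suc n\<close>, so expanding \<open>J ?h\<close> in \<open>t\<close> leaves a
          quadratic polynomial which is nonnegative in the limit. Its linear coefficient must
          vanish, and that is the representation of the real part.\<close>
        have "d \<le> J ?h" by (intro d_le sq_int_add tg f)
        also have "J ?h = t\<^sup>2 * (nm m g)\<^sup>2 + 2 * t * (Re (ip m g (f n)) - Re (\<phi> g)) + J (f n)"
          unfolding J_def nm_add_sq[OF tg f(1)] add[OF tg f(1)] cmult[OF g] nm_cmult ip_cmult_left
          by (simp add: power_mult_distrib algebra_simps)
        finally show ?thesis using f(2)[of n] unfolding inverse_eq_divide by linarith
      qed
      then show "\<exists>N. \<forall>n\<ge>N. - inverse (real (Suc n)) \<le> t\<^sup>2 * (nm m g)\<^sup>2 + 2 * t * (Re (ip m g (f n)) - Re (\<phi> g))"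
        by blast
    qed
    from quadratic_nonneg_imp_zero[OF this] show ?thesis by simp
  qed
  have eq: "\<phi> g = ip m g u" if g: "g \<in> sq_int m" for g
  proof (rule complex_eqI)
    show "Re (\<phi> g) = Re (ip m g u)" by (rule Re_eq[OF g])
    have "Re (\<phi> (\<lambda>x. \<i> * g x)) = Re (ip m (\<lambda>x. \<i> * g x) u)"
      using g by (intro Re_eq) auto
    then show "Im (\<phi> g) = Im (ip m g u)" using g by (simp add: cmult)
  qed
  have "nm m u \<le> K"
  proof -
    have "(nm m u)\<^sup>2 = cmod (\<phi> u)"
      unfolding eq[OF u(1)] ip_self by (simp add: norm_power)
    also have "\<dots> \<le> K * nm m u" by (rule bound[OF u(1)])
    finally have "nm m u * nm m u \<le> K * nm m u" by (simp add: power2_eq_square)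
    then show ?thesis
      using K nm_nonneg[of m u] by (cases "nm m u = 0") auto
  qed
  with u(1) eq show ?thesis by (rule that)
qed

section \<open>Orthogonal families\<close>

definition sub_orthonormal :: "'a measure \<Rightarrow> ('i \<Rightarrow> 'a \<Rightarrow> complex) \<Rightarrow> 'i set \<Rightarrow> bool" where
  "sub_orthonormal m e I \<longleftrightarrow>
     (\<forall>i\<in>I. e i \<in> sq_int m \<and> nm m (e i) \<le> 1) \<and> (\<forall>i\<in>I. \<forall>j\<in>I. i \<noteq> j \<longrightarrow> ip m (e i) (e j) = 0)"

definition orthonormal :: "'a measure \<Rightarrow> ('i \<Rightarrow> 'a \<Rightarrow> complex) \<Rightarrow> 'i set \<Rightarrow> bool" where
  "orthonormal m e I \<longleftrightarrow>
     (\<forall>i\<in>I. e i \<in> sq_int m) \<and> (\<forall>i\<in>I. \<forall>j\<in>I. ip m (e i) (e j) = (if i = j then 1 else 0))"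

definition proj :: "'a measure \<Rightarrow> ('i \<Rightarrow> 'a \<Rightarrow> complex) \<Rightarrow> 'i set \<Rightarrow> ('a \<Rightarrow> complex) \<Rightarrow> 'a \<Rightarrow> complex"
  where "proj m e I f = (\<lambda>x. \<Sum>i\<in>I. ip m f (e i) * e i x)"

lemma nm_eq_1_iff: "nm m f = 1 \<longleftrightarrow> ip m f f = 1"
proof -
  have "ip m f f = 1 \<longleftrightarrow> complex_of_real ((nm m f)\<^sup>2) = complex_of_real 1"
    by (simp only: ip_self of_real_1)
  also have "\<dots> \<longleftrightarrow> (nm m f)\<^sup>2 = 1\<^sup>2" by (simp only: of_real_eq_iff one_power2)
  also have "\<dots> \<longleftrightarrow> nm m f = 1" by (subst power2_eq_iff_nonneg) auto
  finally show ?thesis by simp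
qed

lemma orthonormal_imp_sub: "orthonormal m e I \<Longrightarrow> sub_orthonormal m e I"
  unfolding orthonormal_def sub_orthonormal_def by (auto simp: nm_eq_1_iff[THEN iffD2])

lemma nm_sum_orthogonal:
  assumes "finite I" "\<And>i. i \<in> I \<Longrightarrow> f i \<in> sq_int m"
    "\<And>i j. i \<in> I \<Longrightarrow> j \<in> I \<Longrightarrow> i \<noteq> j \<Longrightarrow> ip m (f i) (f j) = 0"
  shows "(nm m (\<lambda>x. \<Sum>i\<in>I. f i x))\<^sup>2 = (\<Sum>i\<in>I. (nm m (f i))\<^sup>2)"
  using assms
proof (induction I)
  case (insert i I)
  have "ip m (f i) (\<lambda>x. \<Sum>j\<in>I. f j x) = (\<Sum>j\<in>I. ip m (f i) (f j))"
    using insert by (intro ip_sum_right) auto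
  also have "\<dots> = 0"
    using insert.hyps by (intro sum.neutral ballI insert.prems(2)) auto
  finally have 0: "ip m (f i) (\<lambda>x. \<Sum>j\<in>I. f j x) = 0" .
  have "(nm m (\<lambda>x. \<Sum>j\<in>insert i I. f j x))\<^sup>2 = (nm m (\<lambda>x. f i x + (\<Sum>j\<in>I. f j x)))\<^sup>2"
    using insert.hyps by simp
  also have "\<dots> = (nm m (f i))\<^sup>2 + (nm m (\<lambda>x. \<Sum>j\<in>I. f j x))\<^sup>2"
    using insert.prems(1) 0 by (subst nm_add_sq) auto
  finally show ?case using insert by simp
qed simp

lemma sub_orthonormal_nm_sum_sq:
  assumes e: "sub_orthonormal m e I" and I: "finite I"
  shows "(nm m (\<lambda>x. \<Sum>i\<in>I. c i * e i x))\<^sup>2 = (\<Sum>i\<in>I. (cmod (c i) * nm m (e i))\<^sup>2)"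
    and "(nm m (\<lambda>x. \<Sum>i\<in>I. c i * e i x))\<^sup>2 \<le> (\<Sum>i\<in>I. (cmod (c i))\<^sup>2)"
proof -
  show *: "(nm m (\<lambda>x. \<Sum>i\<in>I. c i * e i x))\<^sup>2 = (\<Sum>i\<in>I. (cmod (c i) * nm m (e i))\<^sup>2)"
    using e I by (subst nm_sum_orthogonal) (auto simp: sub_orthonormal_def)
  have "(cmod (c i) * nm m (e i))\<^sup>2 \<le> (cmod (c i))\<^sup>2" if "i \<in> I" for i
    using e that by (intro power_mono) (auto simp: sub_orthonormal_def mult_left_le)
  then show "(nm m (\<lambda>x. \<Sum>i\<in>I. c i * e i x))\<^sup>2 \<le> (\<Sum>i\<in>I. (cmod (c i))\<^sup>2)"
    unfolding * by (rule sum_mono)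
qed

lemma ip_proj_right:
  assumes "\<And>i. i \<in> I \<Longrightarrow> e i \<in> sq_int m" "f \<in> sq_int m"
  shows "ip m f (proj m e I f) = (\<Sum>i\<in>I. complex_of_real ((cmod (ip m f (e i)))\<^sup>2))"
proof -
  have "ip m f (proj m e I f) = (\<Sum>i\<in>I. ip m f (\<lambda>x. ip m f (e i) * e i x))"
    unfolding proj_def using assms by (intro ip_sum_right) auto
  also have "\<dots> = (\<Sum>i\<in>I. complex_of_real ((cmod (ip m f (e i)))\<^sup>2))"
    unfolding ip_cmult_right complex_norm_square by (simp only: mult.commute)
  finally show ?thesis .
qed

text \<open>With \<open>?S\<close> the sum on the left, the inner product of \<open>f\<close> with
  its \<open>proj\<close> is \<open>?S\<close>, and the squared norm of \<open>proj\<close> is at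
  most \<open>?S\<close>, with inequality because the vectors may be shorter than one. So the
  squared norm of the difference is at most the squared norm of \<open>f\<close> minus
  \<open>?S\<close>.\<close>

lemma bessel:
  assumes e: "sub_orthonormal m e I" and I: "finite I" and f: "f \<in> sq_int m"
  shows "(\<Sum>i\<in>I. (cmod (ip m f (e i)))\<^sup>2) \<le> (nm m f)\<^sup>2"
proof -
  let ?S = "\<Sum>i\<in>I. (cmod (ip m f (e i)))\<^sup>2"
  have es: "\<And>i. i \<in> I \<Longrightarrow> e i \<in> sq_int m" using e by (auto simp: sub_orthonormal_def)
  have p: "proj m e I f \<in> sq_int m" unfolding proj_def using es by auto
  have "0 \<le> (nm m (\<lambda>x. f x - proj m e I f x))\<^sup>2" by simp
  also have "\<dots> = (nm m f)\<^sup>2 + (nm m (proj m e I f))\<^sup>2 - 2 * ?S"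
    using ip_proj_right[of I e m f, OF es f] by (simp add: nm_diff_sq[OF f p])
  also have "\<dots> \<le> (nm m f)\<^sup>2 - ?S"
    using sub_orthonormal_nm_sum_sq(2)[OF e I, of "\<lambda>i. ip m f (e i)"] unfolding proj_def by simp
  finally show ?thesis by simp
qed

lemma proj_sq_int [simp, intro]:
  "(\<And>i. i \<in> I \<Longrightarrow> e i \<in> sq_int m) \<Longrightarrow> proj m e I f \<in> sq_int m"
  unfolding proj_def by auto

lemma orthonormalD: "orthonormal m e I \<Longrightarrow> i \<in> I \<Longrightarrow> e i \<in> sq_int m"
  by (auto simp: orthonormal_def)

lemma nm_proj_sq:
  assumes "orthonormal m e I" "finite I"
  shows "(nm m (proj m e I f))\<^sup>2 = (\<Sum>i\<in>I. (cmod (ip m f (e i)))\<^sup>2)"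
  unfolding proj_def sub_orthonormal_nm_sum_sq(1)[OF orthonormal_imp_sub[OF assms(1)] assms(2)]
  using assms(1) by (intro sum.cong) (auto simp: orthonormal_def nm_eq_1_iff[THEN iffD2])

lemma nm_diff_proj_sq:
  assumes e: "orthonormal m e I" and I: "finite I" and f: "f \<in> sq_int m"
  shows "(nm m (\<lambda>x. f x - proj m e I f x))\<^sup>2 = (nm m f)\<^sup>2 - (\<Sum>i\<in>I. (cmod (ip m f (e i)))\<^sup>2)"
  using ip_proj_right[of I e m f, OF orthonormalD[OF e] f] nm_proj_sq[OF e I, of f]
  by (simp add: nm_diff_sq[OF f proj_sq_int[OF orthonormalD[OF e]]])

lemma nm_diff_proj_le:
  assumes "orthonormal m e I" "finite I" "f \<in> sq_int m"
  shows "nm m (\<lambda>x. f x - proj m e I f x) \<le> nm m f"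
  by (rule power2_le_imp_le) (auto simp: nm_diff_proj_sq[OF assms] sum_nonneg)

lemma ip_proj_left:
  assumes e: "orthonormal m e I" and I: "finite I" and j: "j \<in> I" and f: "f \<in> sq_int m"
  shows "ip m (proj m e I f) (e j) = ip m f (e j)"
proof -
  have "ip m (proj m e I f) (e j) = (\<Sum>i\<in>I. ip m f (e i) * ip m (e i) (e j))"
    unfolding proj_def using orthonormalD[OF e] j by (subst ip_sum_left) auto
  also have "\<dots> = (\<Sum>i\<in>I. if i = j then ip m f (e j) else 0)"
    using e j by (intro sum.cong) (auto simp: orthonormal_def)
  finally show ?thesis using I j by simp
qed

lemma ip_null_left: "f \<in> sq_int m \<Longrightarrow> g \<in> sq_int m \<Longrightarrow> nm m f = 0 \<Longrightarrow> ip m f g = 0"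
  using norm_ip_le[of f m g] by simp

text \<open>Gram--Schmidt; the vectors may be linearly dependent modulo null functions.\<close>

lemma gram_schmidt:
  fixes f :: "nat \<Rightarrow> 'a \<Rightarrow> complex"
  assumes "\<And>i. i < r \<Longrightarrow> f i \<in> sq_int m"
  shows "\<exists>N e. orthonormal m e {..<N::nat} \<and>
    (\<forall>i<r. nm m (\<lambda>x. f i x - proj m e {..<N} (f i) x) = 0)"
  using assms
proof (induction r)
  case 0
  show ?case by (intro exI[of _ 0]) (auto simp: orthonormal_def)
next
  case (Suc r)
  have "\<exists>N e. orthonormal m e {..<N::nat} \<and>
      (\<forall>i<r. nm m (\<lambda>x. f i x - proj m e {..<N} (f i) x) = 0)"
    by (rule Suc.IH) (rule Suc.prems[OF less_SucI])
  then obtain N :: nat and e where e: "orthonormal m e {..<N}"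
    and fe: "\<And>i. i < r \<Longrightarrow> nm m (\<lambda>x. f i x - proj m e {..<N} (f i) x) = 0"
    by blast
  define g where "g = (\<lambda>x. f r x - proj m e {..<N} (f r) x)"
  have es: "e j \<in> sq_int m" if "j < N" for j using orthonormalD[OF e] that by auto
  have fs: "f i \<in> sq_int m" if "i < Suc r" for i using Suc.prems that by auto
  have ps: "proj m e {..<N} h \<in> sq_int m" for h using es by auto
  have gs: "g \<in> sq_int m" unfolding g_def using fs ps by auto
  show ?case
  proof (cases "nm m g = 0")
    case True
    with e fe show ?thesis
      by (intro exI[of _ N] exI[of _ e]) (auto simp: less_Suc_eq g_def)
  next
    case False
    define u where "u = (\<lambda>x. complex_of_real (1 / nm m g) * g x)"
    have us: "u \<in> sq_int m" unfolding u_def using gs by (rule sq_int_cmult)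
    have nu: "ip m u u = 1"
      using False unfolding nm_eq_1_iff[symmetric] u_def nm_cmult by (simp add: norm_divide)
    have ge: "ip m g (e j) = 0" if "j < N" for j
      unfolding g_def using that fs ps es ip_proj_left[OF e _ _ fs, of j r]
      by (subst ip_diff_left) auto
    have ue: "ip m u (e j) = 0" if "j < N" for j
      unfolding u_def ip_cmult_left using ge[OF that] by simp
    have eu: "ip m (e j) u = 0" if "j < N" for j
      using ue[OF that] cnj_ip[of m u "e j"] by simp
    define e' where "e' j = (if j = N then u else e j)" for j
    have e': "orthonormal m e' {..<Suc N}"
      using e us nu ue eu unfolding orthonormal_def e'_def by (auto simp: less_Suc_eq)
    have pr: "proj m e' {..<Suc N} h = (\<lambda>x. proj m e {..<N} h x + ip m h u * u x)" for h
      unfolding proj_def e'_def by (auto simp: fun_eq_iff)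
    have pu: "ip m (proj m e {..<N} h) u = 0" for h
      unfolding proj_def using es us eu by (subst ip_sum_left) auto
    have "nm m (\<lambda>x. f i x - proj m e' {..<Suc N} (f i) x) = 0" if "i < Suc r" for i
    proof (cases "i = r")
      case True
      have "ip m (f r) u = ip m g u"
        using pu[of "f r"] fs ps us unfolding g_def by (subst ip_diff_left) auto
      also have "\<dots> = complex_of_real (nm m g)"
        using False unfolding u_def ip_cmult_right ip_self
        by (simp add: power2_eq_square)
      finally have "ip m (f r) u * u x = g x" for x
        using False unfolding u_def by simp
      then have "f r x - proj m e' {..<Suc N} (f r) x = 0" for x
        unfolding pr by (simp add: g_def)
      then show ?thesis using True by simp
    next
      case False
      then have i: "i < r" using that by simp
      \<comment> \<open>An earlier vector agrees with its old projection up to a null function, and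
        that projection is orthogonal to \<open>u\<close>. The new direction therefore adds nothing
        to it.\<close>
      have "ip m (\<lambda>x. f i x - proj m e {..<N} (f i) x) u = 0"
        using fe[OF i] fs[OF that] ps us by (intro ip_null_left) auto
      then have "ip m (f i) u = 0"
        using pu[of "f i"] fs[OF that] ps us by (subst (asm) ip_diff_left) auto
      then show ?thesis using fe[OF i] unfolding pr by simp
    qed
    with e' show ?thesis by blast
  qed
qed

section \<open>Bounded operators as bounded bilinear forms\<close>

lemma cls_self: "f \<in> borel_measurable m \<Longrightarrow> f \<in> cls m f"
  by (simp add: cls_def)

lemma cls_eqI:
  assumes "AE x in m. f x = g x" shows "cls m f = cls m g"
proof -
  have "AE x in m. h x = g x" if "AE x in m. h x = f x" for h
    using assms that by eventually_elim simp
  moreover have "AE x in m. h x = f x" if "AE x in m. h x = g x" for h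
    using assms that by eventually_elim simp
  ultimately show ?thesis unfolding cls_def by blast
qed

lemma cls_eqD:
  assumes "cls m f = cls m g" "f \<in> borel_measurable m" shows "AE x in m. f x = g x"
  using cls_self[OF assms(2)] unfolding assms(1) by (simp add: cls_def)

lemma rep_cls:
  assumes "f \<in> borel_measurable m"
  shows "rep (cls m f) \<in> borel_measurable m" "AE x in m. rep (cls m f) x = f x"
proof -
  have "rep (cls m f) \<in> cls m f"
    unfolding rep_def by (rule someI[of "\<lambda>g. g \<in> cls m f"]) (rule cls_self[OF assms])
  then show "rep (cls m f) \<in> borel_measurable m" "AE x in m. rep (cls m f) x = f x"
    by (auto simp: cls_def)
qed

lemma rep_cls_sq_int:
  assumes "f \<in> sq_int m" shows "rep (cls m f) \<in> sq_int m"
  by (rule sq_int_cong_AE[OF assms rep_cls[OF sq_int_measurable[OF assms]]])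

lemma cls_rep_cls: "f \<in> borel_measurable m \<Longrightarrow> cls m (rep (cls m f)) = cls m f"
  by (rule cls_eqI) (rule rep_cls)

lemma cls_in_L2 [simp, intro]: "f \<in> sq_int m \<Longrightarrow> cls m f \<in> L2 m"
  by (simp add: L2_def)

lemma L2_rep:
  assumes "u \<in> L2 m" shows "rep u \<in> sq_int m" "cls m (rep u) = u"
  using assms by (auto simp: L2_def rep_cls_sq_int cls_rep_cls sq_int_measurable)

lemma l2_norm_eq: "l2_norm m u = nm m (rep u)"
  by (simp add: l2_norm_def nm_def)

lemma l2_norm_cls [simp]: "f \<in> sq_int m \<Longrightarrow> l2_norm m (cls m f) = nm m f"
  unfolding l2_norm_eq by (intro nm_cong_AE rep_cls sq_int_measurable)

lemma l2_inner_cls: "f \<in> sq_int m \<Longrightarrow> g \<in> sq_int m \<Longrightarrow> l2_inner m (cls m f) (cls m g) = ip m f g"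
  unfolding l2_inner_def ip_def[symmetric]
  by (intro ip_cong_AE rep_cls_sq_int rep_cls sq_int_measurable)

lemma l2_dist_cls:
  assumes "f \<in> sq_int m" "g \<in> sq_int m"
  shows "l2_dist m (cls m f) (cls m g) = nm m (\<lambda>x. f x - g x)"
proof -
  have "AE x in m. rep (cls m f) x - rep (cls m g) x = f x - g x"
    using rep_cls(2)[OF sq_int_measurable[OF assms(1)]] rep_cls(2)[OF sq_int_measurable[OF assms(2)]]
    by eventually_elim simp
  then show ?thesis
    unfolding l2_dist_def nm_def[symmetric] using assms
    by (intro nm_cong_AE sq_int_measurable sq_int_diff rep_cls_sq_int)
qed

lemma l2_lincomb_cls:
  assumes "f \<in> sq_int m" "g \<in> sq_int m"
  shows "l2_lincomb m a (cls m f) b (cls m g) = cls m (\<lambda>x. a * f x + b * g x)"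
proof -
  have "AE x in m. a * rep (cls m f) x + b * rep (cls m g) x = a * f x + b * g x"
    using rep_cls(2)[OF sq_int_measurable[OF assms(1)]] rep_cls(2)[OF sq_int_measurable[OF assms(2)]]
    by eventually_elim simp
  then show ?thesis unfolding l2_lincomb_def by (rule cls_eqI)
qed

lemma mult_op_cls:
  assumes "f \<in> sq_int m" "b \<in> ess_bounded m"
  shows "mult_op m b (cls m f) = cls m (\<lambda>x. b x * f x)"
proof -
  have "AE x in m. b x * rep (cls m f) x = b x * f x"
    using rep_cls(2)[OF sq_int_measurable[OF assms(1)]] by eventually_elim simp
  then show ?thesis unfolding mult_op_def using assms by (simp add: cls_eqI)
qed

lemma sq_int_AE_eqI:
  assumes "f \<in> sq_int m" "g \<in> sq_int m" "\<And>h. h \<in> sq_int m \<Longrightarrow> ip m f h = ip m g h"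
  shows "AE x in m. f x = g x"
proof -
  have d: "(\<lambda>x. f x - g x) \<in> sq_int m" using assms by auto
  have "ip m (\<lambda>x. f x - g x) (\<lambda>x. f x - g x) = 0"
    using assms(3)[OF d] assms d by (subst ip_diff_left) auto
  then have "nm m (\<lambda>x. f x - g x) = 0" by (simp add: ip_self)
  then have "AE x in m. f x - g x = 0" by (simp only: nm_eq_0_iff[OF d])
  then show ?thesis by eventually_elim simp
qed

text \<open>Bilinear and not sesquilinear, in accordance with the duality between operators and
  elementary tensors. \<open>K\<close> is any bound, not the least one.\<close>

locale bounded_form =
  fixes m :: "'x measure" and n :: "'y measure"
    and B :: "('x \<Rightarrow> complex) \<Rightarrow> ('y \<Rightarrow> complex) \<Rightarrow> complex" and K :: real
  assumes K_nonneg: "K \<ge> 0"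
    and add_left: "f \<in> sq_int m \<Longrightarrow> f' \<in> sq_int m \<Longrightarrow> g \<in> sq_int n \<Longrightarrow>
      B (\<lambda>x. f x + f' x) g = B f g + B f' g"
    and add_right: "f \<in> sq_int m \<Longrightarrow> g \<in> sq_int n \<Longrightarrow> g' \<in> sq_int n \<Longrightarrow>
      B f (\<lambda>y. g y + g' y) = B f g + B f g'"
    and cmult_left: "f \<in> sq_int m \<Longrightarrow> g \<in> sq_int n \<Longrightarrow> B (\<lambda>x. c * f x) g = c * B f g"
    and cmult_right: "f \<in> sq_int m \<Longrightarrow> g \<in> sq_int n \<Longrightarrow> B f (\<lambda>y. c * g y) = c * B f g"
    and bound: "f \<in> sq_int m \<Longrightarrow> g \<in> sq_int n \<Longrightarrow> cmod (B f g) \<le> K * nm m f * nm n g"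
begin

lemma diff_left:
  assumes "f \<in> sq_int m" "f' \<in> sq_int m" "g \<in> sq_int n"
  shows "B (\<lambda>x. f x - f' x) g = B f g - B f' g"
  using add_left[OF assms(1) sq_int_cmult[OF assms(2)] assms(3), of "-1"]
    cmult_left[OF assms(2,3), of "-1"] by simp

lemma diff_right:
  assumes "f \<in> sq_int m" "g \<in> sq_int n" "g' \<in> sq_int n"
  shows "B f (\<lambda>y. g y - g' y) = B f g - B f g'"
  using add_right[OF assms(1,2) sq_int_cmult[OF assms(3)], of "-1"]
    cmult_right[OF assms(1,3), of "-1"] by simp

lemma zero_left [simp]: "g \<in> sq_int n \<Longrightarrow> B (\<lambda>_. 0) g = 0"
  using cmult_left[OF sq_int_zero, of g 0] by simp

lemma zero_right [simp]: "f \<in> sq_int m \<Longrightarrow> B f (\<lambda>_. 0) = 0"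
  using cmult_right[OF _ sq_int_zero, of f 0] by simp

lemma sum_left:
  assumes "\<And>i. i \<in> I \<Longrightarrow> f i \<in> sq_int m" "g \<in> sq_int n"
  shows "B (\<lambda>x. \<Sum>i\<in>I. f i x) g = (\<Sum>i\<in>I. B (f i) g)"
  using assms by (induction I rule: infinite_finite_induct) (auto simp: add_left)

lemma cong_AE_left:
  assumes "f \<in> sq_int m" "f' \<in> sq_int m" "g \<in> sq_int n" "AE x in m. f x = f' x"
  shows "B f g = B f' g"
proof -
  have "AE x in m. f x - f' x = 0" using assms(4) by eventually_elim simp
  then have "nm m (\<lambda>x. f x - f' x) = 0" using assms by (simp add: nm_eq_0_iff)
  then have "B (\<lambda>x. f x - f' x) g = 0"
    using bound[OF sq_int_diff[OF assms(1,2)] assms(3)] by simp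
  then show ?thesis using assms by (simp add: diff_left)
qed

end

definition ap :: "'x measure \<Rightarrow> ('x, 'y) l2_op \<Rightarrow> ('x \<Rightarrow> complex) \<Rightarrow> 'y \<Rightarrow> complex" where
  "ap m T f = rep (T (cls m f))"

text \<open>The two conjugations cancel: this is the integral of \<open>T f * g\<close>, the value
  of \<open>T\<close> on the elementary tensor of \<open>f\<close> and \<open>g\<close>.\<close>

definition bform ::
  "'x measure \<Rightarrow> 'y measure \<Rightarrow> ('x, 'y) l2_op \<Rightarrow> ('x \<Rightarrow> complex) \<Rightarrow> ('y \<Rightarrow> complex) \<Rightarrow> complex"
  where "bform m n T f g = l2_inner n (T (cls m f)) (cls n (\<lambda>y. cnj (g y)))"

lemma bounded_ops_L2: "T \<in> bounded_ops m n \<Longrightarrow> u \<in> L2 m \<Longrightarrow> T u \<in> L2 n"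
  by (auto simp: bounded_ops_def)

lemma bounded_ops_extensional: "T \<in> bounded_ops m n \<Longrightarrow> T \<in> extensional (L2 m)"
  by (auto simp: bounded_ops_def PiE_def)

lemma ap_sq_int [simp, intro]: "T \<in> bounded_ops m n \<Longrightarrow> f \<in> sq_int m \<Longrightarrow> ap m T f \<in> sq_int n"
  unfolding ap_def by (rule L2_rep(1), rule bounded_ops_L2) auto

lemma cls_ap: "T \<in> bounded_ops m n \<Longrightarrow> f \<in> sq_int m \<Longrightarrow> cls n (ap m T f) = T (cls m f)"
  unfolding ap_def by (rule L2_rep(2), rule bounded_ops_L2) auto

lemma bform_eq_ip:
  "T \<in> bounded_ops m n \<Longrightarrow> f \<in> sq_int m \<Longrightarrow> g \<in> sq_int n \<Longrightarrow>
    bform m n T f g = ip n (ap m T f) (\<lambda>y. cnj (g y))"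
  unfolding bform_def by (subst cls_ap[symmetric]) (auto intro: l2_inner_cls)

lemma ap_lincomb:
  assumes T: "T \<in> bounded_ops m n" and f: "f \<in> sq_int m" "g \<in> sq_int m"
  shows "AE y in n. ap m T (\<lambda>x. a * f x + b * g x) y = a * ap m T f y + b * ap m T g y"
proof (rule cls_eqD)
  have "cls n (ap m T (\<lambda>x. a * f x + b * g x)) = T (l2_lincomb m a (cls m f) b (cls m g))"
    using f by (subst cls_ap[OF T]) (auto simp: l2_lincomb_cls)
  also have "\<dots> = l2_lincomb n a (T (cls m f)) b (T (cls m g))"
    using T f by (simp add: bounded_ops_def)
  also have "\<dots> = cls n (\<lambda>y. a * ap m T f y + b * ap m T g y)"
    using T f by (simp add: cls_ap[OF T, symmetric] l2_lincomb_cls)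
  finally show "cls n (ap m T (\<lambda>x. a * f x + b * g x)) = cls n (\<lambda>y. a * ap m T f y + b * ap m T g y)" .
  show "ap m T (\<lambda>x. a * f x + b * g x) \<in> borel_measurable n"
    using T f by (intro sq_int_measurable ap_sq_int sq_int_add sq_int_cmult)
qed

lemma bounded_ops_bound:
  "T \<in> bounded_ops m n \<Longrightarrow> \<exists>C. \<forall>u\<in>L2 m. l2_norm n (T u) \<le> C * l2_norm m u"
  by (simp add: bounded_ops_def)

lemma op_norm_bdd_above:
  assumes T: "T \<in> bounded_ops m n"
  shows "bdd_above ((\<lambda>u. l2_norm n (T u)) ` {u \<in> L2 m. l2_norm m u \<le> 1})"
proof -
  obtain C where "\<forall>u\<in>L2 m. l2_norm n (T u) \<le> C * l2_norm m u"
    using bounded_ops_bound[OF T] by blast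
  note C = bspec[OF this]
  show ?thesis
  proof (rule bdd_aboveI2)
    fix u assume "u \<in> {u \<in> L2 m. l2_norm m u \<le> 1}"
    then have u: "u \<in> L2 m" "l2_norm m u \<le> 1" by auto
    have "l2_norm n (T u) \<le> C * l2_norm m u" by (rule C[OF u(1)])
    also have "\<dots> \<le> \<bar>C\<bar> * l2_norm m u"
      by (intro mult_right_mono) (auto simp: l2_norm_eq)
    also have "\<dots> \<le> \<bar>C\<bar> * 1"
      using u(2) by (intro mult_left_mono) auto
    finally show "l2_norm n (T u) \<le> \<bar>C\<bar>" by simp
  qed
qed

lemma l2_norm_T_le:
  assumes T: "T \<in> bounded_ops m n" and u: "u \<in> L2 m"
  shows "l2_norm n (T u) \<le> op_norm m n T * l2_norm m u"
proof -
  obtain C where "\<forall>u\<in>L2 m. l2_norm n (T u) \<le> C * l2_norm m u"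
    using bounded_ops_bound[OF T] by blast
  note C = bspec[OF this]
  note bdd = op_norm_bdd_above[OF T]
  let ?f = "rep u"
  have f: "?f \<in> sq_int m" and fu: "cls m ?f = u" using L2_rep[OF u] by auto
  show ?thesis
  proof (cases "nm m ?f = 0")
    case True
    then show ?thesis using C[OF u] by (simp add: l2_norm_eq)
  next
    case False
    then have pos: "nm m ?f > 0" using nm_nonneg[of m ?f] by linarith
    let ?c = "complex_of_real (1 / nm m ?f)"
    \<comment> \<open>The zero summand brings the rescaled vector into the shape of
      \<open>l2_lincomb\<close>, in which linearity of operators is stated.\<close>
    let ?v = "cls m (\<lambda>x. ?c * ?f x + 0 * ?f x)"
    have v: "?v \<in> L2 m" using f by (intro cls_in_L2 sq_int_add sq_int_cmult)
    have "l2_norm m ?v = nm m (\<lambda>x. ?c * ?f x + 0 * ?f x)"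
      using f by (intro l2_norm_cls sq_int_add sq_int_cmult)
    also have "\<dots> = nm m (\<lambda>x. ?c * ?f x)" by (simp only: mult_zero_left add_0_right)
    also have "\<dots> = 1" unfolding nm_cmult using pos by (simp add: norm_divide)
    finally have "l2_norm m ?v \<le> 1" by simp
    with v have le: "l2_norm n (T ?v) \<le> op_norm m n T"
      unfolding op_norm_def by (intro cSUP_upper bdd) auto
    have "T ?v = T (l2_lincomb m ?c u 0 u)"
      using l2_lincomb_cls[OF f f, of ?c 0] by (simp only: fu)
    also have "\<dots> = l2_lincomb n ?c (T u) 0 (T u)"
      using T u by (simp add: bounded_ops_def)
    also have "\<dots> = cls n (\<lambda>y. ?c * rep (T u) y)" by (simp add: l2_lincomb_def)
    finally have "l2_norm n (T ?v) = nm n (\<lambda>y. ?c * rep (T u) y)"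
      using L2_rep[OF bounded_ops_L2[OF T u]] by (simp only: l2_norm_cls sq_int_cmult)
    also have "\<dots> = nm n (rep (T u)) / nm m ?f"
      unfolding nm_cmult using pos by (simp add: norm_divide)
    finally show ?thesis using le pos by (simp add: l2_norm_eq pos_divide_le_eq)
  qed
qed

lemma nm_ap_le:
  assumes "T \<in> bounded_ops m n" "f \<in> sq_int m"
  shows "nm n (ap m T f) \<le> op_norm m n T * nm m f"
  using l2_norm_T_le[OF assms(1) cls_in_L2[OF assms(2)]] assms(2)
  by (simp add: ap_def l2_norm_eq[symmetric])

lemma op_norm_nonneg:
  assumes T: "T \<in> bounded_ops m n" shows "0 \<le> op_norm m n T"
proof -
  have "l2_zero m \<in> {u \<in> L2 m. l2_norm m u \<le> 1}"
    by (simp add: l2_zero_def)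
  then have "l2_norm n (T (l2_zero m)) \<le> op_norm m n T"
    unfolding op_norm_def by (intro cSUP_upper op_norm_bdd_above[OF T])
  then show ?thesis unfolding l2_norm_eq by (rule order_trans[OF nm_nonneg])
qed

lemma bounded_form_bform:
  assumes T: "T \<in> bounded_ops m n"
  shows "bounded_form m n (bform m n T) (op_norm m n T)"
proof
  show "0 \<le> op_norm m n T" by (rule op_norm_nonneg[OF T])
next
  fix f f' g assume fg: "f \<in> sq_int m" "f' \<in> sq_int m" "g \<in> sq_int n"
  have "ip n (ap m T (\<lambda>x. 1 * f x + 1 * f' x)) (\<lambda>y. cnj (g y))
      = ip n (\<lambda>y. 1 * ap m T f y + 1 * ap m T f' y) (\<lambda>y. cnj (g y))"
    using fg T by (intro ip_cong_AE ap_sq_int sq_int_add sq_int_cmult sq_int_cnj ap_lincomb) auto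
  then show "bform m n T (\<lambda>x. f x + f' x) g = bform m n T f g + bform m n T f' g"
    using fg T by (simp add: bform_eq_ip ip_add_left)
next
  fix f g g' assume "f \<in> sq_int m" "g \<in> sq_int n" "g' \<in> sq_int n"
  then show "bform m n T f (\<lambda>y. g y + g' y) = bform m n T f g + bform m n T f g'"
    using T by (simp add: bform_eq_ip ip_add_right)
next
  fix f g c assume fg: "f \<in> sq_int m" "g \<in> sq_int n"
  have "ip n (ap m T (\<lambda>x. c * f x + 0 * f x)) (\<lambda>y. cnj (g y))
      = ip n (\<lambda>y. c * ap m T f y + 0 * ap m T f y) (\<lambda>y. cnj (g y))"
    using fg T by (intro ip_cong_AE ap_sq_int sq_int_add sq_int_cmult sq_int_cnj ap_lincomb) auto
  then show "bform m n T (\<lambda>x. c * f x) g = c * bform m n T f g"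
    using fg T by (simp add: bform_eq_ip)
  have "bform m n T f (\<lambda>y. c * g y) = ip n (ap m T f) (\<lambda>y. cnj c * cnj (g y))"
    using fg T sq_int_cmult[OF fg(2), of c] by (simp add: bform_eq_ip)
  then show "bform m n T f (\<lambda>y. c * g y) = c * bform m n T f g"
    using fg T by (simp add: bform_eq_ip)
next
  fix f g assume fg: "f \<in> sq_int m" "g \<in> sq_int n"
  have "cmod (bform m n T f g) \<le> nm n (ap m T f) * nm n g"
    using norm_ip_le[OF ap_sq_int[OF T fg(1)] sq_int_cnj[OF fg(2)]] fg T by (simp add: bform_eq_ip)
  also have "\<dots> \<le> op_norm m n T * nm m f * nm n g"
    using nm_ap_le[OF T fg(1)] by (intro mult_right_mono) auto
  finally show "cmod (bform m n T f g) \<le> op_norm m n T * nm m f * nm n g" .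
qed

lemma bform_bound:
  "T \<in> bounded_ops m n \<Longrightarrow> f \<in> sq_int m \<Longrightarrow> g \<in> sq_int n \<Longrightarrow>
    cmod (bform m n T f g) \<le> op_norm m n T * nm m f * nm n g"
  by (rule bounded_form.bound[OF bounded_form_bform])

lemma nm_ap_sq_eq_bform:
  assumes T: "T \<in> bounded_ops m n" and f: "f \<in> sq_int m"
  shows "bform m n T f (\<lambda>y. cnj (ap m T f y)) = complex_of_real ((nm n (ap m T f))\<^sup>2)"
proof -
  have "bform m n T f (\<lambda>y. cnj (ap m T f y)) = ip n (ap m T f) (ap m T f)"
    using f T by (subst bform_eq_ip) auto
  then show ?thesis by (simp only: ip_self)
qed

text \<open>Test with the conjugate of \<open>ap m T f\<close> itself and divide by its
  norm.\<close>

lemma nm_ap_leI: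
  assumes T: "T \<in> bounded_ops m n" and f: "f \<in> sq_int m" and C: "0 \<le> C"
    and le: "\<And>g. g \<in> sq_int n \<Longrightarrow> cmod (bform m n T f g) \<le> C * nm n g"
  shows "nm n (ap m T f) \<le> C"
proof -
  have "(nm n (ap m T f))\<^sup>2 = cmod (bform m n T f (\<lambda>y. cnj (ap m T f y)))"
    unfolding nm_ap_sq_eq_bform[OF T f] norm_of_real by simp
  also have "\<dots> \<le> C * nm n (ap m T f)"
    using le[of "\<lambda>y. cnj (ap m T f y)"] T f by simp
  finally have "nm n (ap m T f) * nm n (ap m T f) \<le> C * nm n (ap m T f)"
    by (simp add: power2_eq_square)
  then show ?thesis
    using C nm_nonneg[of n "ap m T f"] by (cases "nm n (ap m T f) = 0") auto
qed

lemma op_norm_leI: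
  assumes T: "T \<in> bounded_ops m n" and C: "0 \<le> C"
    and le: "\<And>f g. f \<in> sq_int m \<Longrightarrow> g \<in> sq_int n \<Longrightarrow> cmod (bform m n T f g) \<le> C * nm m f * nm n g"
  shows "op_norm m n T \<le> C"
  unfolding op_norm_def
proof (rule cSUP_least)
  have "l2_zero m \<in> {u \<in> L2 m. l2_norm m u \<le> 1}"
    by (simp add: l2_zero_def)
  then show "{u \<in> L2 m. l2_norm m u \<le> 1} \<noteq> {}" by blast
next
  fix u assume u: "u \<in> {u \<in> L2 m. l2_norm m u \<le> 1}"
  then have f: "rep u \<in> sq_int m" "cls m (rep u) = u" by (auto simp: L2_rep)
  have "nm n (ap m T (rep u)) \<le> C * nm m (rep u)"
    using C by (intro nm_ap_leI[OF T f(1)] le[OF f(1)] mult_nonneg_nonneg) auto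
  also have "\<dots> \<le> C * 1"
    using C u by (intro mult_left_mono) (auto simp: l2_norm_eq)
  finally show "l2_norm n (T u) \<le> C" by (simp add: ap_def f l2_norm_eq)
qed

lemma bform_eqI:
  assumes T: "T \<in> bounded_ops m n" and S: "S \<in> bounded_ops m n"
    and eq: "\<And>f g. f \<in> sq_int m \<Longrightarrow> g \<in> sq_int n \<Longrightarrow> bform m n T f g = bform m n S f g"
  shows "T = S"
proof (rule extensionalityI[of _ "L2 m"])
  show "T \<in> extensional (L2 m)" "S \<in> extensional (L2 m)"
    using T S by (auto intro: bounded_ops_extensional)
  fix u assume "u \<in> L2 m"
  then have f: "rep u \<in> sq_int m" "cls m (rep u) = u" by (auto simp: L2_rep)
  have "AE y in n. ap m T (rep u) y = ap m S (rep u) y"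
  proof (rule sq_int_AE_eqI)
    fix h assume h: "h \<in> sq_int n"
    show "ip n (ap m T (rep u)) h = ip n (ap m S (rep u)) h"
      using eq[OF f(1) sq_int_cnj[OF h]] T S f h by (simp add: bform_eq_ip)
  qed (use T S f in auto)
  then have "cls n (ap m T (rep u)) = cls n (ap m S (rep u))" by (rule cls_eqI)
  then show "T u = S u" by (simp add: cls_ap T S f)
qed

text \<open>For each \<open>f\<close> the functional \<open>B f\<close> is represented by a vector,
  whose conjugate \<open>w f\<close> is the image of \<open>f\<close>. The choice of
  \<open>w\<close> need not be linear or respect null sets, but \<open>w f\<close> is unique up to a
  null set, and this is enough for an operator on classes.\<close>

theorem op_of_form:
  assumes B: "bounded_form m n B K"
  shows "\<exists>T\<in>bounded_ops m n. \<forall>f\<in>sq_int m. \<forall>g\<in>sq_int n. bform m n T f g = B f g"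
proof -
  interpret bounded_form m n B K by (rule B)
  have "\<exists>w. w \<in> sq_int n \<and> (\<forall>g\<in>sq_int n. B f g = ip n w (\<lambda>y. cnj (g y))) \<and> nm n w \<le> K * nm m f"
    if f: "f \<in> sq_int m" for f
  proof (rule riesz_representation[of n "B f" "K * nm m f"])
    show "0 \<le> K * nm m f" using K_nonneg by simp
    fix u assume u: "u \<in> sq_int n" "\<And>g. g \<in> sq_int n \<Longrightarrow> B f g = ip n g u" "nm n u \<le> K * nm m f"
    have "B f g = ip n (\<lambda>y. cnj (u y)) (\<lambda>y. cnj (g y))" if "g \<in> sq_int n" for g
      unfolding u(2)[OF that] ip_def by (simp add: mult.commute)
    then show ?thesis
      using u(1,3) by (intro exI[of _ "\<lambda>y. cnj (u y)"]) auto
  qed (use f in \<open>auto intro: add_right cmult_right bound\<close>)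
  then have "\<forall>f\<in>sq_int m. \<exists>w. w \<in> sq_int n \<and> (\<forall>g\<in>sq_int n. B f g = ip n w (\<lambda>y. cnj (g y))) \<and>
      nm n w \<le> K * nm m f"
    by blast
  from bchoice[OF this] obtain w where
    "\<forall>f\<in>sq_int m. w f \<in> sq_int n \<and> (\<forall>g\<in>sq_int n. B f g = ip n (w f) (\<lambda>y. cnj (g y))) \<and>
      nm n (w f) \<le> K * nm m f"
    by blast
  then have w: "\<And>f. f \<in> sq_int m \<Longrightarrow> w f \<in> sq_int n"
    "\<And>f g. f \<in> sq_int m \<Longrightarrow> g \<in> sq_int n \<Longrightarrow> B f g = ip n (w f) (\<lambda>y. cnj (g y))"
    "\<And>f. f \<in> sq_int m \<Longrightarrow> nm n (w f) \<le> K * nm m f"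
    by blast+
  define T where "T = (\<lambda>u\<in>L2 m. cls n (w (rep u)))"
  \<comment> \<open>Any representing function \<open>v\<close> may be used to compute
    \<open>T\<close>, which frees the rest of the proof from the choice made in \<open>w\<close> and
    in \<open>rep\<close>.\<close>
  have Tcls: "T (cls m f) = cls n v"
    if f: "f \<in> sq_int m" and v: "v \<in> sq_int n" and eq: "\<And>g. g \<in> sq_int n \<Longrightarrow> B f g = ip n v (\<lambda>y. cnj (g y))" for f v
  proof -
    have r: "rep (cls m f) \<in> sq_int m" by (rule rep_cls_sq_int[OF f])
    have "AE y in n. w (rep (cls m f)) y = v y"
    proof (rule sq_int_AE_eqI[OF w(1)[OF r] v])
      fix h assume h: "h \<in> sq_int n"
      have "B (rep (cls m f)) (\<lambda>y. cnj (h y)) = B f (\<lambda>y. cnj (h y))"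
        using h f r rep_cls(2)[OF sq_int_measurable[OF f]] by (intro cong_AE_left) auto
      then show "ip n (w (rep (cls m f))) h = ip n v h"
        using eq[OF sq_int_cnj[OF h]] w(2)[OF r sq_int_cnj[OF h]] by simp
    qed
    then show ?thesis unfolding T_def using f by (simp add: cls_eqI)
  qed
  have T1: "T (cls m f) = cls n (w f)" if "f \<in> sq_int m" for f
    using that by (intro Tcls w)
  have "T \<in> bounded_ops m n"
    unfolding bounded_ops_def
  proof (intro CollectI conjI allI ballI)
    show "T \<in> L2 m \<rightarrow>\<^sub>E L2 n"
      using w(1) L2_rep(1) unfolding T_def by auto
    fix a b u v assume u: "u \<in> L2 m" and v: "v \<in> L2 m"
    let ?f = "rep u" and ?g = "rep v"
    have f: "?f \<in> sq_int m" "cls m ?f = u" using L2_rep[OF u] by auto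
    have g: "?g \<in> sq_int m" "cls m ?g = v" using L2_rep[OF v] by auto
    have "T (l2_lincomb m a u b v) = T (cls m (\<lambda>x. a * ?f x + b * ?g x))"
      using l2_lincomb_cls[OF f(1) g(1), of a b] by (simp only: f(2) g(2))
    also have "\<dots> = cls n (\<lambda>y. a * w ?f y + b * w ?g y)"
      using f(1) g(1)
      by (intro Tcls) (auto simp: add_left cmult_left ip_add_left w)
    also have "\<dots> = l2_lincomb n a (T (cls m ?f)) b (T (cls m ?g))"
      using f(1) g(1) by (simp add: T1 w l2_lincomb_cls)
    finally show "T (l2_lincomb m a u b v) = l2_lincomb n a (T u) b (T v)"
      by (simp only: f(2) g(2))
  next
    have "l2_norm n (T u) \<le> K * l2_norm m u" if u: "u \<in> L2 m" for u
    proof -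
      have f: "rep u \<in> sq_int m" "cls m (rep u) = u" using L2_rep[OF u] by auto
      have "l2_norm n (T (cls m (rep u))) \<le> K * l2_norm m (cls m (rep u))"
        using w(1,3)[OF f(1)] f(1) by (simp only: T1 l2_norm_cls)
      then show ?thesis by (simp only: f(2))
    qed
    then show "\<exists>C. \<forall>u\<in>L2 m. l2_norm n (T u) \<le> C * l2_norm m u" by blast
  qed
  moreover have "bform m n T f g = B f g" if "f \<in> sq_int m" "g \<in> sq_int n" for f g
    using that w by (simp add: bform_def T1 l2_inner_cls)
  ultimately show ?thesis by blast
qed

text \<open>Boundedness of a pointwise defined operator \<open>R\<close> is obtained by first
  producing an operator \<open>S\<close> from the intended form and then identifying the two. Hence
  \<open>R\<close> is only required to be extensional here.\<close>

lemma op_eqI: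
  assumes S: "S \<in> bounded_ops m n" and R: "R \<in> extensional (L2 m)"
    and r: "\<And>f. f \<in> sq_int m \<Longrightarrow> r f \<in> sq_int n" "\<And>f. f \<in> sq_int m \<Longrightarrow> R (cls m f) = cls n (r f)"
    and eq: "\<And>f g. f \<in> sq_int m \<Longrightarrow> g \<in> sq_int n \<Longrightarrow> ip n (r f) (\<lambda>y. cnj (g y)) = bform m n S f g"
  shows "R = S"
proof (rule extensionalityI[OF R bounded_ops_extensional[OF S]])
  fix u assume "u \<in> L2 m"
  then have f: "rep u \<in> sq_int m" "cls m (rep u) = u" by (auto simp: L2_rep)
  have "AE y in n. r (rep u) y = ap m S (rep u) y"
  proof (rule sq_int_AE_eqI)
    fix h assume h: "h \<in> sq_int n"
    show "ip n (r (rep u)) h = ip n (ap m S (rep u)) h"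
      using eq[OF f(1) sq_int_cnj[OF h]] S f h by (simp add: bform_eq_ip)
  qed (use S f r in auto)
  then have "cls n (r (rep u)) = cls n (ap m S (rep u))" by (rule cls_eqI)
  then have "R (cls m (rep u)) = S (cls m (rep u))" using r(2)[OF f(1)] cls_ap[OF S f(1)] by simp
  then show "R u = S u" by (simp only: f(2))
qed

section \<open>Linear combinations and sandwiches in terms of forms\<close>

lemma op_lincomb:
  assumes T: "T \<in> bounded_ops m n" and S: "S \<in> bounded_ops m n"
  shows op_lincomb_bounded: "op_lincomb m n a T b S \<in> bounded_ops m n"
    and bform_op_lincomb: "\<And>f g. f \<in> sq_int m \<Longrightarrow> g \<in> sq_int n \<Longrightarrow>
      bform m n (op_lincomb m n a T b S) f g = a * bform m n T f g + b * bform m n S f g"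
proof -
  interpret T: bounded_form m n "bform m n T" "op_norm m n T" by (rule bounded_form_bform[OF T])
  interpret S: bounded_form m n "bform m n S" "op_norm m n S" by (rule bounded_form_bform[OF S])
  have "bounded_form m n (\<lambda>f g. a * bform m n T f g + b * bform m n S f g)
      (cmod a * op_norm m n T + cmod b * op_norm m n S)"
  proof
    fix f g assume fg: "f \<in> sq_int m" "g \<in> sq_int n"
    have "cmod (a * bform m n T f g + b * bform m n S f g)
        \<le> cmod a * cmod (bform m n T f g) + cmod b * cmod (bform m n S f g)"
      using norm_triangle_ineq[of "a * bform m n T f g" "b * bform m n S f g"]
      by (simp add: norm_mult)
    also have "\<dots> \<le> cmod a * (op_norm m n T * nm m f * nm n g) + cmod b * (op_norm m n S * nm m f * nm n g)"
      using T.bound[OF fg] S.bound[OF fg] by (intro add_mono mult_left_mono) auto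
    finally show "cmod (a * bform m n T f g + b * bform m n S f g)
        \<le> (cmod a * op_norm m n T + cmod b * op_norm m n S) * nm m f * nm n g"
      by (simp add: algebra_simps)
  qed (simp_all add: T.add_left T.add_right T.cmult_left T.cmult_right S.add_left S.add_right
        S.cmult_left S.cmult_right T.K_nonneg S.K_nonneg algebra_simps)
  then obtain R where R: "R \<in> bounded_ops m n"
    and eq: "\<And>f g. f \<in> sq_int m \<Longrightarrow> g \<in> sq_int n \<Longrightarrow>
      bform m n R f g = a * bform m n T f g + b * bform m n S f g"
    using op_of_form by blast
  have "op_lincomb m n a T b S = R"
  proof (rule op_eqI[OF R, where r = "\<lambda>f y. a * ap m T f y + b * ap m S f y"])
    fix f assume f: "f \<in> sq_int m"
    show "(\<lambda>y. a * ap m T f y + b * ap m S f y) \<in> sq_int n" using T S f by auto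
    have "op_lincomb m n a T b S (cls m f) = l2_lincomb n a (T (cls m f)) b (S (cls m f))"
      using f by (simp add: op_lincomb_def)
    also have "\<dots> = cls n (\<lambda>y. a * ap m T f y + b * ap m S f y)"
      using l2_lincomb_cls[OF ap_sq_int[OF T f] ap_sq_int[OF S f], of a b] T S f by (simp add: cls_ap)
    finally show "op_lincomb m n a T b S (cls m f) = cls n (\<lambda>y. a * ap m T f y + b * ap m S f y)" .
    fix g assume g: "g \<in> sq_int n"
    show "ip n (\<lambda>y. a * ap m T f y + b * ap m S f y) (\<lambda>y. cnj (g y)) = bform m n R f g"
      using T S f g by (simp add: eq ip_add_left bform_eq_ip)
  qed (simp add: op_lincomb_def)
  with R eq show "op_lincomb m n a T b S \<in> bounded_ops m n"
    "\<And>f g. f \<in> sq_int m \<Longrightarrow> g \<in> sq_int n \<Longrightarrow>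
      bform m n (op_lincomb m n a T b S) f g = a * bform m n T f g + b * bform m n S f g"
    by auto
qed

lemma op_zero:
  shows op_zero_bounded: "op_zero m n \<in> bounded_ops m n"
    and bform_op_zero: "\<And>f g. f \<in> sq_int m \<Longrightarrow> g \<in> sq_int n \<Longrightarrow> bform m n (op_zero m n) f g = 0"
proof -
  have "bounded_form m n (\<lambda>f g. 0) 0" by standard auto
  then obtain R where R: "R \<in> bounded_ops m n"
    and eq: "\<And>f g. f \<in> sq_int m \<Longrightarrow> g \<in> sq_int n \<Longrightarrow> bform m n R f g = 0"
    using op_of_form[of m n "\<lambda>f g. 0" 0] by auto
  have "op_zero m n = R"
    by (rule op_eqI[OF R, where r = "\<lambda>f y. 0"]) (auto simp: op_zero_def l2_zero_def eq)
  with R eq show "op_zero m n \<in> bounded_ops m n"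
    "\<And>f g. f \<in> sq_int m \<Longrightarrow> g \<in> sq_int n \<Longrightarrow> bform m n (op_zero m n) f g = 0" by auto
qed

lemma nm_ess_mult_le:
  assumes f: "f \<in> sq_int m" and b: "b \<in> borel_measurable m" "AE x in m. cmod (b x) \<le> C" and C: "C \<ge> 0"
  shows "nm m (\<lambda>x. b x * f x) \<le> C * nm m f"
proof (rule power2_le_imp_le)
  have "(nm m (\<lambda>x. b x * f x))\<^sup>2 \<le> (\<integral>x. C\<^sup>2 * (cmod (f x))\<^sup>2 \<partial>m)"
    unfolding nm_sq
  proof (rule integral_mono_AE)
    show "integrable m (\<lambda>x. (cmod (b x * f x))\<^sup>2)"
      using sq_int_bounded_mult[OF f b] by (rule sq_int_integrable)
    show "integrable m (\<lambda>x. C\<^sup>2 * (cmod (f x))\<^sup>2)" using sq_int_integrable[OF f] by simp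
    show "AE x in m. (cmod (b x * f x))\<^sup>2 \<le> C\<^sup>2 * (cmod (f x))\<^sup>2"
      using b(2) by eventually_elim
        (auto simp: norm_mult power_mult_distrib intro!: mult_right_mono power_mono)
  qed
  then show "(nm m (\<lambda>x. b x * f x))\<^sup>2 \<le> (C * nm m f)\<^sup>2"
    by (simp add: power_mult_distrib nm_sq)
qed (use C in auto)

lemma sandwich:
  assumes T: "T \<in> bounded_ops m n" and a: "a \<in> ess_bounded m" and b: "b \<in> ess_bounded n"
  shows sandwich_bounded: "sandwich m n b T a \<in> bounded_ops m n"
    and bform_sandwich: "\<And>f g. f \<in> sq_int m \<Longrightarrow> g \<in> sq_int n \<Longrightarrow>
      bform m n (sandwich m n b T a) f g = bform m n T (\<lambda>x. a x * f x) (\<lambda>y. b y * g y)"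
proof -
  interpret T: bounded_form m n "bform m n T" "op_norm m n T" by (rule bounded_form_bform[OF T])
  obtain A where A: "A > 0" "AE x in m. cmod (a x) \<le> A" "a \<in> borel_measurable m"
    using a by (rule ess_boundedE)
  obtain C where C: "C > 0" "AE x in n. cmod (b x) \<le> C" "b \<in> borel_measurable n"
    using b by (rule ess_boundedE)
  have "bounded_form m n (\<lambda>f g. bform m n T (\<lambda>x. a x * f x) (\<lambda>y. b y * g y)) (op_norm m n T * A * C)"
  proof
    fix f g assume fg: "f \<in> sq_int m" "g \<in> sq_int n"
    have "cmod (bform m n T (\<lambda>x. a x * f x) (\<lambda>y. b y * g y))
        \<le> op_norm m n T * nm m (\<lambda>x. a x * f x) * nm n (\<lambda>y. b y * g y)"
      using fg a b by (intro T.bound sq_int_ess_mult)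
    also have "\<dots> \<le> op_norm m n T * (A * nm m f) * (C * nm n g)"
      using A C fg T.K_nonneg
      by (intro mult_mono mult_left_mono nm_ess_mult_le mult_nonneg_nonneg) auto
    finally show "cmod (bform m n T (\<lambda>x. a x * f x) (\<lambda>y. b y * g y)) \<le> op_norm m n T * A * C * nm m f * nm n g"
      by (simp add: mult_ac)
  next
    show "0 \<le> op_norm m n T * A * C" using A C T.K_nonneg by simp
  next
    fix f g c assume fg: "f \<in> sq_int m" "g \<in> sq_int n"
    show "bform m n T (\<lambda>x. a x * (c * f x)) (\<lambda>y. b y * g y) = c * bform m n T (\<lambda>x. a x * f x) (\<lambda>y. b y * g y)"
      using T.cmult_left[OF sq_int_ess_mult[OF fg(1) a] sq_int_ess_mult[OF fg(2) b], of c]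
      by (simp only: mult.left_commute)
    show "bform m n T (\<lambda>x. a x * f x) (\<lambda>y. b y * (c * g y)) = c * bform m n T (\<lambda>x. a x * f x) (\<lambda>y. b y * g y)"
      using T.cmult_right[OF sq_int_ess_mult[OF fg(1) a] sq_int_ess_mult[OF fg(2) b], of c]
      by (simp only: mult.left_commute)
  qed (use a b in \<open>simp_all add: distrib_left T.add_left T.add_right\<close>)
  then obtain R where R: "R \<in> bounded_ops m n"
    and eq: "\<And>f g. f \<in> sq_int m \<Longrightarrow> g \<in> sq_int n \<Longrightarrow>
      bform m n R f g = bform m n T (\<lambda>x. a x * f x) (\<lambda>y. b y * g y)"
    using op_of_form by blast
  have "sandwich m n b T a = R"
  proof (rule op_eqI[OF R, where r = "\<lambda>f y. b y * ap m T (\<lambda>x. a x * f x) y"])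
    show "sandwich m n b T a \<in> extensional (L2 m)" by (simp add: sandwich_def compose_def)
    fix f assume f: "f \<in> sq_int m"
    have af: "(\<lambda>x. a x * f x) \<in> sq_int m" using f a by auto
    show "(\<lambda>y. b y * ap m T (\<lambda>x. a x * f x) y) \<in> sq_int n" using T af b by auto
    show "sandwich m n b T a (cls m f) = cls n (\<lambda>y. b y * ap m T (\<lambda>x. a x * f x) y)"
      using f af T a b
      by (simp add: sandwich_def compose_eq mult_op_cls cls_ap[OF T af, symmetric])
    fix g assume g: "g \<in> sq_int n"
    have bg: "(\<lambda>y. b y * g y) \<in> sq_int n" using g b by auto
    show "ip n (\<lambda>y. b y * ap m T (\<lambda>x. a x * f x) y) (\<lambda>y. cnj (g y)) = bform m n R f g"
      unfolding eq[OF f g] bform_eq_ip[OF T af bg] ip_def by (simp add: mult_ac)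
  qed
  with R eq show "sandwich m n b T a \<in> bounded_ops m n"
    "\<And>f g. f \<in> sq_int m \<Longrightarrow> g \<in> sq_int n \<Longrightarrow>
      bform m n (sandwich m n b T a) f g = bform m n T (\<lambda>x. a x * f x) (\<lambda>y. b y * g y)"
    by auto
qed

section \<open>Tensors and kernel operators\<close>

definition tensor :: "('x \<Rightarrow> complex) \<Rightarrow> ('y \<Rightarrow> complex) \<Rightarrow> 'x \<times> 'y \<Rightarrow> complex" where
  "tensor f g = (\<lambda>z. f (fst z) * g (snd z))"

definition kform ::
  "'x measure \<Rightarrow> 'y measure \<Rightarrow> ('x \<times> 'y \<Rightarrow> complex) \<Rightarrow> ('x \<Rightarrow> complex) \<Rightarrow> ('y \<Rightarrow> complex) \<Rightarrow> complex"
  where "kform m n k f g = (\<integral>z. k z * tensor f g z \<partial>(m \<Otimes>\<^sub>M n))"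

text \<open>The integral operator sending \<open>f\<close> to the function of \<open>y\<close> given
  by the integral of \<open>k (x, y) * f x\<close> over \<open>x\<close>. It is fixed by its form,
  so the choice is unique by \<open>bform_eqI\<close>, and no pointwise integral has to be
  handled.\<close>

definition kop :: "'x measure \<Rightarrow> 'y measure \<Rightarrow> ('x \<times> 'y \<Rightarrow> complex) \<Rightarrow> ('x, 'y) l2_op" where
  "kop m n k =
     (SOME T. T \<in> bounded_ops m n \<and> (\<forall>f\<in>sq_int m. \<forall>g\<in>sq_int n. bform m n T f g = kform m n k f g))"

lemma tensor_measurable [measurable (raw)]:
  assumes [measurable]: "f \<in> borel_measurable m" "g \<in> borel_measurable n"
  shows "tensor f g \<in> borel_measurable (m \<Otimes>\<^sub>M n)"
  unfolding tensor_def by measurable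

locale two_sigma_finite = m: sigma_finite_measure m + n: sigma_finite_measure n
  for m :: "'x measure" and n :: "'y measure"

sublocale two_sigma_finite \<subseteq> pair_sigma_finite m n ..

context two_sigma_finite
begin

text \<open>The sets over which \<open>D\<close> has integral zero are closed under complements and
  countable disjoint unions, and they contain the rectangles, which are stable under intersection
  and generate the product sets.\<close>

lemma density_zero_on_rectangle:
  fixes D :: "'x \<times> 'y \<Rightarrow> complex"
  assumes int: "integrable (m \<Otimes>\<^sub>M n) D"
    and zero: "\<And>a b. a \<in> sets m \<Longrightarrow> b \<in> sets n \<Longrightarrow> (\<integral>z\<in>a \<times> b. D z \<partial>(m \<Otimes>\<^sub>M n)) = 0"
  shows "AE z in m \<Otimes>\<^sub>M n. D z = 0"
proof (rule P.density_zero[OF int])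
  fix E assume "E \<in> sets (m \<Otimes>\<^sub>M n)"
  then have E: "E \<in> sigma_sets (space m \<times> space n) {a \<times> b | a b. a \<in> sets m \<and> b \<in> sets n}"
    by (simp add: sets_pair_measure)
  have si: "set_integrable (m \<Otimes>\<^sub>M n) A D" if "A \<in> sets (m \<Otimes>\<^sub>M n)" for A
    unfolding set_integrable_def using int that by (intro integrable_mult_indicator) auto
  from Int_stable_pair_measure_generator pair_measure_closed E
  show "(\<integral>z\<in>E. D z \<partial>(m \<Otimes>\<^sub>M n)) = 0"
  proof (induction rule: sigma_sets_induct_disjoint)
    case (basic A)
    then obtain a b where "A = a \<times> b" "a \<in> sets m" "b \<in> sets n" by blast
    then show ?case using zero by simp
  next
    case empty
    show ?case by (simp add: set_lebesgue_integral_def)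
  next
    case (compl A)
    have A: "A \<in> sets (m \<Otimes>\<^sub>M n)" using compl(1) by (simp add: sets_pair_measure)
    have "(\<integral>z\<in>space m \<times> space n. D z \<partial>(m \<Otimes>\<^sub>M n))
        = (\<integral>z\<in>(space m \<times> space n - A) \<union> A. D z \<partial>(m \<Otimes>\<^sub>M n))"
      using sets.sets_into_space[OF A] by (simp add: space_pair_measure Un_absorb2)
    also have "\<dots> = (\<integral>z\<in>space m \<times> space n - A. D z \<partial>(m \<Otimes>\<^sub>M n)) + (\<integral>z\<in>A. D z \<partial>(m \<Otimes>\<^sub>M n))"
      using A by (intro set_integral_Un si) auto
    finally show ?case using compl(2) zero[of "space m" "space n"] by simp
  next
    case (union A)
    have A: "A i \<in> sets (m \<Otimes>\<^sub>M n)" for i using union(2) by (auto simp: sets_pair_measure)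
    have "(\<integral>z\<in>(\<Union>i. A i). D z \<partial>(m \<Otimes>\<^sub>M n)) = (\<Sum>i. \<integral>z\<in>A i. D z \<partial>(m \<Otimes>\<^sub>M n))"
      using A union(1) by (intro lebesgue_integral_countable_add si)
        (auto simp: disjoint_family_on_def)
    then show ?case using union(3) by simp
  qed
qed

lemma integrable_tensor:
  fixes F :: "'x \<Rightarrow> 'c::{real_normed_field, banach, second_countable_topology}"
  assumes F: "integrable m F" and G: "integrable n G"
  shows "integrable (m \<Otimes>\<^sub>M n) (\<lambda>z. F (fst z) * G (snd z))"
    and "(\<integral>z. F (fst z) * G (snd z) \<partial>(m \<Otimes>\<^sub>M n)) = (\<integral>x. F x \<partial>m) * (\<integral>y. G y \<partial>n)"
proof -
  have [measurable]: "F \<in> borel_measurable m" "G \<in> borel_measurable n"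
    using F G by auto
  show int: "integrable (m \<Otimes>\<^sub>M n) (\<lambda>z. F (fst z) * G (snd z))"
    using F G by (intro Fubini_integrable) (auto simp: norm_mult)
  show "(\<integral>z. F (fst z) * G (snd z) \<partial>(m \<Otimes>\<^sub>M n)) = (\<integral>x. F x \<partial>m) * (\<integral>y. G y \<partial>n)"
    by (subst integral_fst'[OF int, symmetric]) simp
qed

lemma tensor_sq_int [simp, intro]:
  assumes "f \<in> sq_int m" "g \<in> sq_int n" shows "tensor f g \<in> sq_int (m \<Otimes>\<^sub>M n)"
proof -
  have "integrable (m \<Otimes>\<^sub>M n) (\<lambda>z. (cmod (tensor f g z))\<^sup>2)"
    using integrable_tensor(1)[OF sq_int_integrable[OF assms(1)] sq_int_integrable[OF assms(2)]]
    by (simp add: tensor_def norm_mult power_mult_distrib)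
  moreover have "tensor f g \<in> borel_measurable (m \<Otimes>\<^sub>M n)"
    using assms by (intro tensor_measurable sq_int_measurable)
  ultimately show ?thesis by (simp add: sq_int_def)
qed

lemma ip_tensor:
  assumes "f \<in> sq_int m" "g \<in> sq_int n" "f' \<in> sq_int m" "g' \<in> sq_int n"
  shows "ip (m \<Otimes>\<^sub>M n) (tensor f g) (tensor f' g') = ip m f f' * ip n g g'"
proof -
  have "ip (m \<Otimes>\<^sub>M n) (tensor f g) (tensor f' g')
      = (\<integral>z. (f (fst z) * cnj (f' (fst z))) * (g (snd z) * cnj (g' (snd z))) \<partial>(m \<Otimes>\<^sub>M n))"
    by (simp add: ip_def tensor_def mult_ac)
  also have "\<dots> = ip m f f' * ip n g g'"
    unfolding ip_def using assms by (intro integrable_tensor(2)) auto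
  finally show ?thesis .
qed

lemma nm_tensor:
  assumes "f \<in> sq_int m" "g \<in> sq_int n"
  shows "nm (m \<Otimes>\<^sub>M n) (tensor f g) = nm m f * nm n g"
proof -
  have "(nm (m \<Otimes>\<^sub>M n) (tensor f g))\<^sup>2 = (nm m f)\<^sup>2 * (nm n g)\<^sup>2"
    unfolding nm_sq
    using integrable_tensor(2)[OF sq_int_integrable[OF assms(1)] sq_int_integrable[OF assms(2)]]
    by (simp add: tensor_def norm_mult power_mult_distrib)
  then have "(nm (m \<Otimes>\<^sub>M n) (tensor f g))\<^sup>2 = (nm m f * nm n g)\<^sup>2"
    by (simp add: power_mult_distrib)
  then show ?thesis by (subst (asm) power2_eq_iff_nonneg) auto
qed

lemma indicator_sq_int:
  assumes "A \<in> sets M" "emeasure M A \<noteq> \<infinity>"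
  shows "(indicator A :: 'a \<Rightarrow> complex) \<in> sq_int M"
proof -
  have "integrable M (indicator A :: 'a \<Rightarrow> real)"
    using assms by (simp add: less_top)
  also have "(indicator A :: 'a \<Rightarrow> real) = (\<lambda>x. (cmod (indicator A x))\<^sup>2)"
    by (auto simp: fun_eq_iff split: split_indicator)
  finally show ?thesis using assms by (simp add: sq_int_def)
qed

text \<open>On a rectangle of finite measure \<open>D\<close> is integrable, and the indicators of
  its measurable subrectangles are tensors of square integrable functions. Countably many such
  rectangles cover the product.\<close>

theorem tensors_separate:
  assumes D: "D \<in> sq_int (m \<Otimes>\<^sub>M n)"
    and zero: "\<And>f g. f \<in> sq_int m \<Longrightarrow> g \<in> sq_int n \<Longrightarrow> kform m n D f g = 0"
  shows "AE z in m \<Otimes>\<^sub>M n. D z = 0"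
proof -
  obtain A :: "nat \<Rightarrow> 'x set" where A: "range A \<subseteq> sets m" "(\<Union>i. A i) = space m"
    "\<And>i. emeasure m (A i) \<noteq> \<infinity>"
    using m.sigma_finite by metis
  obtain B :: "nat \<Rightarrow> 'y set" where B: "range B \<subseteq> sets n" "(\<Union>i. B i) = space n"
    "\<And>i. emeasure n (B i) \<noteq> \<infinity>"
    using n.sigma_finite by metis
  have ij: "AE z in m \<Otimes>\<^sub>M n. indicator (A i \<times> B j) z * D z = 0" for i j
  proof (rule density_zero_on_rectangle)
    have AB [measurable]: "A i \<in> sets m" "B j \<in> sets n" using A B by auto
    have f: "(indicator (A i \<inter> a) :: 'x \<Rightarrow> complex) \<in> sq_int m" if "a \<in> sets m" for a
    proof (rule indicator_sq_int)
      show "emeasure m (A i \<inter> a) \<noteq> \<infinity>"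
        using emeasure_mono[of "A i \<inter> a" "A i" m] A(3)[of i] AB
        by (auto simp: top_unique)
    qed (use that in auto)
    have g: "(indicator (B j \<inter> b) :: 'y \<Rightarrow> complex) \<in> sq_int n" if "b \<in> sets n" for b
    proof (rule indicator_sq_int)
      show "emeasure n (B j \<inter> b) \<noteq> \<infinity>"
        using emeasure_mono[of "B j \<inter> b" "B j" n] B(3)[of j] AB
        by (auto simp: top_unique)
    qed (use that in auto)
    have eq: "indicator (A i \<times> B j) z * D z * indicator (a \<times> b) z
        = D z * tensor (indicator (A i \<inter> a)) (indicator (B j \<inter> b)) z" for a b z
      by (cases z) (auto simp: tensor_def split: split_indicator)
    have "integrable (m \<Otimes>\<^sub>M n) (\<lambda>z. D z * tensor (indicator (A i \<inter> space m)) (indicator (B j \<inter> space n)) z)"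
      using D f[of "space m"] g[of "space n"] by (intro integrable_sq_mult tensor_sq_int) auto
    then have "integrable (m \<Otimes>\<^sub>M n) (\<lambda>z. indicator (A i \<times> B j) z * D z * indicator (space m \<times> space n) z)"
      by (simp only: eq)
    then show "integrable (m \<Otimes>\<^sub>M n) (\<lambda>z. indicator (A i \<times> B j) z * D z)"
      by (rule Bochner_Integration.integrable_cong[THEN iffD1, rotated -1])
         (auto simp: space_pair_measure split: split_indicator)
    fix a b assume ab: "a \<in> sets m" "b \<in> sets n"
    have "(\<integral>z\<in>a \<times> b. indicator (A i \<times> B j) z * D z \<partial>(m \<Otimes>\<^sub>M n))
        = (\<integral>z. indicator (A i \<times> B j) z * D z * indicator (a \<times> b) z \<partial>(m \<Otimes>\<^sub>M n))"
      unfolding set_lebesgue_integral_def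
      by (intro Bochner_Integration.integral_cong refl) (auto split: split_indicator)
    also have "\<dots> = kform m n D (indicator (A i \<inter> a)) (indicator (B j \<inter> b))"
      by (simp only: eq kform_def)
    also have "\<dots> = 0" using f g ab by (intro zero)
    finally show "(\<integral>z\<in>a \<times> b. indicator (A i \<times> B j) z * D z \<partial>(m \<Otimes>\<^sub>M n)) = 0" .
  qed
  have "AE z in m \<Otimes>\<^sub>M n. \<forall>i j. indicator (A i \<times> B j) z * D z = 0"
    unfolding AE_all_countable using ij by blast
  then show ?thesis
  proof (rule AE_mp, intro AE_I2 impI)
    fix z assume z: "z \<in> space (m \<Otimes>\<^sub>M n)" and 0: "\<forall>i j. indicator (A i \<times> B j) z * D z = 0"
    have "fst z \<in> (\<Union>i. A i)" "snd z \<in> (\<Union>i. B i)"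
      using z unfolding A(2) B(2) by (auto simp: space_pair_measure)
    then obtain i j where "fst z \<in> A i" "snd z \<in> B j" by blast
    then have "z \<in> A i \<times> B j" by (cases z) auto
    then show "D z = 0" using 0[rule_format, of i j] by simp
  qed
qed

section \<open>Kernel operators\<close>

lemma kform_bound:
  assumes "k \<in> sq_int (m \<Otimes>\<^sub>M n)" "f \<in> sq_int m" "g \<in> sq_int n"
  shows "cmod (kform m n k f g) \<le> nm (m \<Otimes>\<^sub>M n) k * nm m f * nm n g"
  using norm_integral_mult_le[OF assms(1) tensor_sq_int[OF assms(2,3)]] assms
  by (simp add: kform_def nm_tensor mult.assoc)

lemma kform_diff:
  assumes "k \<in> sq_int (m \<Otimes>\<^sub>M n)" "k' \<in> sq_int (m \<Otimes>\<^sub>M n)" "f \<in> sq_int m" "g \<in> sq_int n"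
  shows "kform m n (\<lambda>z. k z - k' z) f g = kform m n k f g - kform m n k' f g"
  using assms unfolding kform_def left_diff_distrib
  by (intro Bochner_Integration.integral_diff) auto

lemma bounded_form_kform:
  assumes k: "k \<in> sq_int (m \<Otimes>\<^sub>M n)"
  shows "bounded_form m n (kform m n k) (nm (m \<Otimes>\<^sub>M n) k)"
proof
  fix f f' g assume fg: "f \<in> sq_int m" "f' \<in> sq_int m" "g \<in> sq_int n"
  have "tensor (\<lambda>x. f x + f' x) g = (\<lambda>z. tensor f g z + tensor f' g z)"
    by (auto simp: tensor_def algebra_simps)
  moreover have "integrable (m \<Otimes>\<^sub>M n) (\<lambda>z. k z * tensor f g z)" "integrable (m \<Otimes>\<^sub>M n) (\<lambda>z. k z * tensor f' g z)"
    using fg k by auto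
  ultimately show "kform m n k (\<lambda>x. f x + f' x) g = kform m n k f g + kform m n k f' g"
    by (simp add: kform_def distrib_left)
next
  fix f g g' assume fg: "f \<in> sq_int m" "g \<in> sq_int n" "g' \<in> sq_int n"
  have "tensor f (\<lambda>y. g y + g' y) = (\<lambda>z. tensor f g z + tensor f g' z)"
    by (auto simp: tensor_def algebra_simps)
  moreover have "integrable (m \<Otimes>\<^sub>M n) (\<lambda>z. k z * tensor f g z)" "integrable (m \<Otimes>\<^sub>M n) (\<lambda>z. k z * tensor f g' z)"
    using fg k by auto
  ultimately show "kform m n k f (\<lambda>y. g y + g' y) = kform m n k f g + kform m n k f g'"
    by (simp add: kform_def distrib_left)
next
  fix f g c
  have "(\<lambda>z. k z * tensor (\<lambda>x. c * f x) g z) = (\<lambda>z. c * (k z * tensor f g z))"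
    "(\<lambda>z. k z * tensor f (\<lambda>y. c * g y) z) = (\<lambda>z. c * (k z * tensor f g z))"
    by (auto simp: tensor_def algebra_simps)
  then show "kform m n k (\<lambda>x. c * f x) g = c * kform m n k f g"
    "kform m n k f (\<lambda>y. c * g y) = c * kform m n k f g"
    by (simp_all add: kform_def)
qed (use kform_bound[OF k] in auto)

lemma kop:
  assumes k: "k \<in> sq_int (m \<Otimes>\<^sub>M n)"
  shows kop_bounded: "kop m n k \<in> bounded_ops m n"
    and bform_kop: "\<And>f g. f \<in> sq_int m \<Longrightarrow> g \<in> sq_int n \<Longrightarrow> bform m n (kop m n k) f g = kform m n k f g"
proof -
  have "\<exists>T. T \<in> bounded_ops m n \<and> (\<forall>f\<in>sq_int m. \<forall>g\<in>sq_int n. bform m n T f g = kform m n k f g)"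
    using op_of_form[OF bounded_form_kform[OF k]] by blast
  from someI_ex[OF this] show "kop m n k \<in> bounded_ops m n"
    "\<And>f g. f \<in> sq_int m \<Longrightarrow> g \<in> sq_int n \<Longrightarrow> bform m n (kop m n k) f g = kform m n k f g"
    unfolding kop_def by blast+
qed

text \<open>Injectivity of the passage from kernels to operators; it is the bridge from identities
  between Schur maps to identities between their multipliers.\<close>

lemma kop_eqD:
  assumes k: "k \<in> sq_int (m \<Otimes>\<^sub>M n)" "k' \<in> sq_int (m \<Otimes>\<^sub>M n)" and eq: "kop m n k = kop m n k'"
  shows "AE z in m \<Otimes>\<^sub>M n. k z = k' z"
proof -
  have "AE z in m \<Otimes>\<^sub>M n. k z - k' z = 0"
  proof (rule tensors_separate)
    fix f g assume fg: "f \<in> sq_int m" "g \<in> sq_int n"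
    show "kform m n (\<lambda>z. k z - k' z) f g = 0"
      using bform_kop[OF k(1) fg] bform_kop[OF k(2) fg] eq by (simp add: kform_diff k fg)
  qed (use k in auto)
  then show ?thesis by eventually_elim simp
qed

lemma AE_fst:
  assumes "AE x in m. P x" shows "AE z in m \<Otimes>\<^sub>M n. P (fst z)"
proof -
  obtain N where N: "N \<in> null_sets m" "{x \<in> space m. \<not> P x} \<subseteq> N"
    using assms by (auto simp: eventually_ae_filter)
  have "N \<times> space n \<in> null_sets (m \<Otimes>\<^sub>M n)"
    using N(1) by (auto simp: null_sets_def n.emeasure_pair_measure_Times)
  moreover have "{z \<in> space (m \<Otimes>\<^sub>M n). \<not> P (fst z)} \<subseteq> N \<times> space n"
    using N(2) by (auto simp: space_pair_measure)
  ultimately show ?thesis by (auto simp: eventually_ae_filter)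
qed

lemma AE_snd:
  assumes "AE y in n. P y" shows "AE z in m \<Otimes>\<^sub>M n. P (snd z)"
proof -
  obtain N where N: "N \<in> null_sets n" "{y \<in> space n. \<not> P y} \<subseteq> N"
    using assms by (auto simp: eventually_ae_filter)
  have "space m \<times> N \<in> null_sets (m \<Otimes>\<^sub>M n)"
    using N(1) by (auto simp: null_sets_def n.emeasure_pair_measure_Times)
  moreover have "{z \<in> space (m \<Otimes>\<^sub>M n). \<not> P (snd z)} \<subseteq> space m \<times> N"
    using N(2) by (auto simp: space_pair_measure)
  ultimately show ?thesis by (auto simp: eventually_ae_filter)
qed

end

section \<open>The predual\<close>

text \<open>The norm conditions of \<open>gamma_expansion\<close> without the function
  \<open>h\<close>: they alone force convergence of the series off a marginally null set.\<close>

definition gexp ::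
  "'x measure \<Rightarrow> 'y measure \<Rightarrow> (nat \<Rightarrow> 'x \<Rightarrow> complex) \<Rightarrow> (nat \<Rightarrow> 'y \<Rightarrow> complex) \<Rightarrow> bool" where
  "gexp m n F G \<longleftrightarrow> (\<forall>i. F i \<in> sq_int m) \<and> (\<forall>i. G i \<in> sq_int n) \<and>
     summable (\<lambda>i. (nm m (F i))\<^sup>2) \<and> summable (\<lambda>i. (nm n (G i))\<^sup>2)"

text \<open>The value is arbitrary where the series diverges, which under \<open>gexp\<close>
  happens only on a marginally null set.\<close>

definition gsum :: "(nat \<Rightarrow> 'x \<Rightarrow> complex) \<Rightarrow> (nat \<Rightarrow> 'y \<Rightarrow> complex) \<Rightarrow> 'x \<times> 'y \<Rightarrow> complex" where
  "gsum F G = (\<lambda>z. \<Sum>i. tensor (F i) (G i) z)"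

lemma gexpD:
  assumes "gexp m n F G"
  shows "F i \<in> sq_int m" "G i \<in> sq_int n" "summable (\<lambda>i. (nm m (F i))\<^sup>2)" "summable (\<lambda>i. (nm n (G i))\<^sup>2)"
  using assms by (auto simp: gexp_def)

lemma gamma_expansion_iff:
  "gamma_expansion m n h F G \<longleftrightarrow> gexp m n F G \<and>
     (\<exists>X0\<in>null_sets m. \<exists>Y0\<in>null_sets n. \<forall>x\<in>space m - X0. \<forall>y\<in>space n - Y0.
        (\<lambda>i. tensor (F i) (G i) (x, y)) sums h (x, y))"
  unfolding gamma_expansion_def gexp_def nm_sq by (simp add: tensor_def)

lemma gamma_expansionD: "gamma_expansion m n h F G \<Longrightarrow> gexp m n F G"
  by (simp add: gamma_expansion_iff)

lemma Gamma_I: "gamma_expansion m n h F G \<Longrightarrow> h \<in> Gamma m n"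
  by (auto simp: Gamma_def)

lemma summable_sq_imp_prod:
  fixes a b :: "nat \<Rightarrow> real"
  assumes "summable (\<lambda>i. (a i)\<^sup>2)" "summable (\<lambda>i. (b i)\<^sup>2)" "\<And>i. a i \<ge> 0" "\<And>i. b i \<ge> 0"
  shows "summable (\<lambda>i. a i * b i)"
    and "(\<Sum>i. a i * b i) \<le> ((\<Sum>i. (a i)\<^sup>2) + (\<Sum>i. (b i)\<^sup>2)) / 2"
    and "(\<Sum>i. a i * b i)\<^sup>2 \<le> (\<Sum>i. (a i)\<^sup>2) * (\<Sum>i. (b i)\<^sup>2)"
proof -
  have le: "a i * b i \<le> ((a i)\<^sup>2 + (b i)\<^sup>2) / 2" for i
    using sum_squares_bound[of "a i" "b i"] by simp
  have s: "summable (\<lambda>i. ((a i)\<^sup>2 + (b i)\<^sup>2) / 2)"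
    using assms(1,2) by (intro summable_divide summable_add)
  show sab: "summable (\<lambda>i. a i * b i)"
    by (rule summable_comparison_test[OF _ s]) (use assms(3,4) le in auto)
  have "(\<Sum>i. a i * b i) \<le> (\<Sum>i. ((a i)\<^sup>2 + (b i)\<^sup>2) / 2)"
    by (rule suminf_le[OF le sab s])
  also have "\<dots> = ((\<Sum>i. (a i)\<^sup>2) + (\<Sum>i. (b i)\<^sup>2)) / 2"
    using assms(1,2) by (simp add: suminf_divide suminf_add summable_add)
  finally show "(\<Sum>i. a i * b i) \<le> ((\<Sum>i. (a i)\<^sup>2) + (\<Sum>i. (b i)\<^sup>2)) / 2" .
  show "(\<Sum>i. a i * b i)\<^sup>2 \<le> (\<Sum>i. (a i)\<^sup>2) * (\<Sum>i. (b i)\<^sup>2)"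
  proof (rule LIMSEQ_le_const2)
    show "(\<lambda>N. (\<Sum>i<N. a i * b i)\<^sup>2) \<longlonglongrightarrow> (\<Sum>i. a i * b i)\<^sup>2"
      by (intro tendsto_power summable_LIMSEQ sab)
    have "(\<Sum>i<N. a i * b i)\<^sup>2 \<le> (\<Sum>i. (a i)\<^sup>2) * (\<Sum>i. (b i)\<^sup>2)" for N
    proof -
      have "(\<Sum>i<N. a i * b i)\<^sup>2 \<le> (\<Sum>i<N. (a i)\<^sup>2) * (\<Sum>i<N. (b i)\<^sup>2)"
        by (rule Cauchy_Schwarz_ineq_sum)
      also have "\<dots> \<le> (\<Sum>i. (a i)\<^sup>2) * (\<Sum>i. (b i)\<^sup>2)"
        by (intro mult_mono sum_le_suminf assms(1,2) sum_nonneg suminf_nonneg) auto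
      finally show ?thesis .
    qed
    then show "\<exists>N. \<forall>n\<ge>N. (\<Sum>i<n. a i * b i)\<^sup>2 \<le> (\<Sum>i. (a i)\<^sup>2) * (\<Sum>i. (b i)\<^sup>2)" by blast
  qed
qed

text \<open>By monotone convergence the sum of the squares has the sum of the squared norms as its
  integral, so it is finite almost everywhere.\<close>

lemma square_function:
  assumes F: "\<And>i. F i \<in> sq_int m" and sF: "summable (\<lambda>i. (nm m (F i))\<^sup>2)"
  shows AE_summable_sq: "AE x in m. summable (\<lambda>i. (cmod (F i x))\<^sup>2)"
    and integrable_square_function: "integrable m (\<lambda>x. \<Sum>i. (cmod (F i x))\<^sup>2)"
proof -
  have [measurable]: "F i \<in> borel_measurable m" for i using F by (rule sq_int_measurable)
  have "(\<integral>\<^sup>+x. (\<Sum>i. ennreal ((cmod (F i x))\<^sup>2)) \<partial>m) = (\<Sum>i. \<integral>\<^sup>+x. ennreal ((cmod (F i x))\<^sup>2) \<partial>m)"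
    by (intro nn_integral_suminf) measurable
  also have "\<dots> = (\<Sum>i. ennreal ((nm m (F i))\<^sup>2))"
    using sq_int_integrable[OF F] by (subst nn_integral_eq_integral) (auto simp: nm_sq)
  also have "\<dots> = ennreal (\<Sum>i. (nm m (F i))\<^sup>2)"
    by (rule suminf_ennreal2) (simp_all add: sF)
  finally have "(\<integral>\<^sup>+x. (\<Sum>i. ennreal ((cmod (F i x))\<^sup>2)) \<partial>m) \<noteq> \<infinity>"
    by simp
  then have "AE x in m. (\<Sum>i. ennreal ((cmod (F i x))\<^sup>2)) \<noteq> \<infinity>"
    by (rule nn_integral_PInf_AE[rotated]) measurable
  then show AE: "AE x in m. summable (\<lambda>i. (cmod (F i x))\<^sup>2)"
  proof eventually_elim
    case (elim x)
    show ?case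
    proof (rule summable_suminf_not_top)
      show "(\<Sum>i. ennreal ((cmod (F i x))\<^sup>2)) \<noteq> top"
        using elim unfolding infinity_ennreal_def .
    qed simp
  qed
  show "integrable m (\<lambda>x. \<Sum>i. (cmod (F i x))\<^sup>2)"
  proof (rule integrable_suminf)
    show "AE x in m. summable (\<lambda>i. norm ((cmod (F i x))\<^sup>2))" using AE by simp
    show "summable (\<lambda>i. \<integral>x. norm ((cmod (F i x))\<^sup>2) \<partial>m)" using sF by (simp add: nm_sq)
  qed (rule sq_int_integrable[OF F])
qed

lemma kform_sum:
  assumes "\<And>j. j \<in> J \<Longrightarrow> integrable (m \<Otimes>\<^sub>M n) (\<lambda>z. k j z * tensor f g z)"
  shows "kform m n (\<lambda>z. \<Sum>j\<in>J. k j z) f g = (\<Sum>j\<in>J. kform m n (k j) f g)"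
  unfolding kform_def sum_distrib_right using assms by (rule Bochner_Integration.integral_sum)

context two_sigma_finite
begin

text \<open>Cauchy--Schwarz in the index \<open>i\<close>. The bound does not depend on
  \<open>N\<close> and is a product of a function of \<open>x\<close> and a function of
  \<open>y\<close>, each of them integrable; so it serves as dominating function for the squares of
  all partial sums.\<close>

lemma gexp_AE_bound:
  assumes "gexp m n F G"
  shows "AE z in m \<Otimes>\<^sub>M n. summable (\<lambda>i. tensor (F i) (G i) z) \<and>
    (\<forall>N. (cmod (\<Sum>i<N. tensor (F i) (G i) z))\<^sup>2
        \<le> (\<Sum>i. (cmod (F i (fst z)))\<^sup>2) * (\<Sum>i. (cmod (G i (snd z)))\<^sup>2)) \<and>
    (cmod (gsum F G z))\<^sup>2 \<le> (\<Sum>i. (cmod (F i (fst z)))\<^sup>2) * (\<Sum>i. (cmod (G i (snd z)))\<^sup>2)"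
  using AE_fst[OF AE_summable_sq[OF gexpD(1,3)[OF assms]]]
    AE_snd[OF AE_summable_sq[OF gexpD(2,4)[OF assms]]]
proof eventually_elim
  case (elim z)
  let ?a = "\<lambda>i. cmod (F i (fst z))" and ?b = "\<lambda>i. cmod (G i (snd z))"
  note cs = summable_sq_imp_prod[of ?a ?b, OF elim norm_ge_zero norm_ge_zero]
  have nt: "norm (tensor (F i) (G i) z) = ?a i * ?b i" for i by (simp add: tensor_def norm_mult)
  have sn: "summable (\<lambda>i. norm (tensor (F i) (G i) z))" using cs(1) unfolding nt .
  have N: "(cmod (\<Sum>i<N. tensor (F i) (G i) z))\<^sup>2 \<le> (\<Sum>i. (?a i)\<^sup>2) * (\<Sum>i. (?b i)\<^sup>2)" for N
  proof -
    have "cmod (\<Sum>i<N. tensor (F i) (G i) z) \<le> (\<Sum>i<N. ?a i * ?b i)"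
      using norm_sum[of "\<lambda>i. tensor (F i) (G i) z" "{..<N}"] unfolding nt .
    also have "\<dots> \<le> (\<Sum>i. ?a i * ?b i)"
      by (intro sum_le_suminf cs(1)) auto
    finally have "(cmod (\<Sum>i<N. tensor (F i) (G i) z))\<^sup>2 \<le> (\<Sum>i. ?a i * ?b i)\<^sup>2"
      by (intro power_mono) auto
    then show ?thesis using cs(3) by linarith
  qed
  have "(cmod (gsum F G z))\<^sup>2 \<le> (\<Sum>i. (?a i)\<^sup>2) * (\<Sum>i. (?b i)\<^sup>2)"
  proof (rule LIMSEQ_le_const2)
    show "(\<lambda>N. (cmod (\<Sum>i<N. tensor (F i) (G i) z))\<^sup>2) \<longlonglongrightarrow> (cmod (gsum F G z))\<^sup>2"
      unfolding gsum_def
      by (intro tendsto_power tendsto_norm summable_LIMSEQ summable_norm_cancel[OF sn])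
  qed (use N in blast)
  with N summable_norm_cancel[OF sn] show ?case by blast
qed

lemma integrable_dominating:
  assumes "gexp m n F G"
  shows "integrable (m \<Otimes>\<^sub>M n) (\<lambda>z. (\<Sum>i. (cmod (F i (fst z)))\<^sup>2) * (\<Sum>i. (cmod (G i (snd z)))\<^sup>2))"
  by (rule integrable_tensor(1)[OF integrable_square_function[OF gexpD(1,3)[OF assms]]
        integrable_square_function[OF gexpD(2,4)[OF assms]]])

lemma tensor_gexp_measurable:
  assumes "gexp m n F G" shows "tensor (F i) (G i) \<in> borel_measurable (m \<Otimes>\<^sub>M n)"
  using gexpD(1,2)[OF assms] by (intro tensor_measurable sq_int_measurable)

lemma gsum_sq_int:
  assumes "gexp m n F G" shows "gsum F G \<in> sq_int (m \<Otimes>\<^sub>M n)"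
proof -
  have [measurable]: "tensor (F i) (G i) \<in> borel_measurable (m \<Otimes>\<^sub>M n)" for i
    by (rule tensor_gexp_measurable[OF assms])
  have gm [measurable]: "gsum F G \<in> borel_measurable (m \<Otimes>\<^sub>M n)"
    unfolding gsum_def by measurable
  have "integrable (m \<Otimes>\<^sub>M n) (\<lambda>z. (cmod (gsum F G z))\<^sup>2)"
  proof (rule Bochner_Integration.integrable_bound[OF integrable_dominating[OF assms]])
    show "AE z in m \<Otimes>\<^sub>M n. norm ((cmod (gsum F G z))\<^sup>2)
        \<le> norm ((\<Sum>i. (cmod (F i (fst z)))\<^sup>2) * (\<Sum>i. (cmod (G i (snd z)))\<^sup>2))"
      using gexp_AE_bound[OF assms]
    proof eventually_elim
      case (elim z)
      then have "(cmod (gsum F G z))\<^sup>2 \<le> (\<Sum>i. (cmod (F i (fst z)))\<^sup>2) * (\<Sum>i. (cmod (G i (snd z)))\<^sup>2)"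
        by blast
      then show ?case by (simp add: order_trans[OF _ abs_ge_self])
    qed
  qed measurable
  then show ?thesis using gm by (simp add: sq_int_def)
qed

text \<open>Dominated convergence. A kernel operator pairs with an expansion by integrating its
  kernel against the sum, so here the result visibly depends on the sum alone. Independence of the
  expansion for general operators is deduced from this case.\<close>

lemma kform_sums:
  assumes FG: "gexp m n F G" and k: "k \<in> sq_int (m \<Otimes>\<^sub>M n)"
  shows "(\<lambda>i. kform m n k (F i) (G i)) sums (\<integral>z. k z * gsum F G z \<partial>(m \<Otimes>\<^sub>M n))"
proof -
  have [measurable]: "tensor (F i) (G i) \<in> borel_measurable (m \<Otimes>\<^sub>M n)" for i
    by (rule tensor_gexp_measurable[OF FG])
  have [measurable]: "gsum F G \<in> borel_measurable (m \<Otimes>\<^sub>M n)" "k \<in> borel_measurable (m \<Otimes>\<^sub>M n)"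
    using gsum_sq_int[OF FG] k by (auto intro: sq_int_measurable)
  let ?D = "\<lambda>z. (\<Sum>i. (cmod (F i (fst z)))\<^sup>2) * (\<Sum>i. (cmod (G i (snd z)))\<^sup>2)"
  have "(\<lambda>N. \<integral>z. k z * (\<Sum>i<N. tensor (F i) (G i) z) \<partial>(m \<Otimes>\<^sub>M n))
      \<longlonglongrightarrow> (\<integral>z. k z * gsum F G z \<partial>(m \<Otimes>\<^sub>M n))"
  proof (rule integral_dominated_convergence)
    show "integrable (m \<Otimes>\<^sub>M n) (\<lambda>z. (cmod (k z))\<^sup>2 + ?D z)"
      using sq_int_integrable[OF k] integrable_dominating[OF FG] by (rule Bochner_Integration.integrable_add)
    show "AE z in m \<Otimes>\<^sub>M n. (\<lambda>N. k z * (\<Sum>i<N. tensor (F i) (G i) z)) \<longlonglongrightarrow> k z * gsum F G z"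
      using gexp_AE_bound[OF FG]
    proof eventually_elim
      case (elim z)
      then have "summable (\<lambda>i. tensor (F i) (G i) z)" by blast
      then show ?case unfolding gsum_def by (intro tendsto_mult tendsto_const summable_LIMSEQ)
    qed
    fix N
    show "AE z in m \<Otimes>\<^sub>M n. norm (k z * (\<Sum>i<N. tensor (F i) (G i) z)) \<le> (cmod (k z))\<^sup>2 + ?D z"
      using gexp_AE_bound[OF FG]
    proof eventually_elim
      case (elim z)
      let ?s = "cmod (\<Sum>i<N. tensor (F i) (G i) z)"
      have s: "?s\<^sup>2 \<le> ?D z" using elim by blast
      have "0 \<le> cmod (k z) * ?s" by simp
      then have "cmod (k z) * ?s \<le> (cmod (k z))\<^sup>2 + ?s\<^sup>2"
        using sum_squares_bound[of "cmod (k z)" ?s] by linarith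
      then show ?case using s unfolding norm_mult by linarith
    qed
  qed measurable
  moreover have "(\<integral>z. k z * (\<Sum>i<N. tensor (F i) (G i) z) \<partial>(m \<Otimes>\<^sub>M n)) = (\<Sum>i<N. kform m n k (F i) (G i))" for N
    unfolding kform_def sum_distrib_left
    using k gexpD(1,2)[OF FG] by (intro Bochner_Integration.integral_sum) auto
  ultimately show ?thesis by (simp add: sums_def)
qed

text \<open>Marginally null sets are null for the product measure.\<close>

lemma gamma_expansion_AE:
  assumes "gamma_expansion m n h F G"
  shows "AE z in m \<Otimes>\<^sub>M n. h z = gsum F G z"
proof -
  obtain X0 Y0 where X0: "X0 \<in> null_sets m" and Y0: "Y0 \<in> null_sets n"
    and sums: "\<And>x y. x \<in> space m - X0 \<Longrightarrow> y \<in> space n - Y0 \<Longrightarrow> (\<lambda>i. tensor (F i) (G i) (x, y)) sums h (x, y)"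
    using assms unfolding gamma_expansion_iff by blast
  show ?thesis
    using AE_fst[OF AE_not_in[OF X0]] AE_snd[OF AE_not_in[OF Y0]] AE_space
  proof eventually_elim
    case (elim z)
    obtain x y where z: "z = (x, y)" by (cases z)
    have "(\<lambda>i. tensor (F i) (G i) (x, y)) sums h (x, y)"
      using elim by (intro sums) (auto simp: z space_pair_measure)
    then show ?case by (simp add: gsum_def z sums_unique)
  qed
qed

lemma gamma_expansion_gsum:
  assumes "gexp m n F G" shows "gamma_expansion m n (gsum F G) F G"
proof -
  obtain X0 where X0: "X0 \<in> null_sets m" "{x \<in> space m. \<not> summable (\<lambda>i. (cmod (F i x))\<^sup>2)} \<subseteq> X0"
    using AE_summable_sq[OF gexpD(1,3)[OF assms]] unfolding eventually_ae_filter by blast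
  obtain Y0 where Y0: "Y0 \<in> null_sets n" "{y \<in> space n. \<not> summable (\<lambda>i. (cmod (G i y))\<^sup>2)} \<subseteq> Y0"
    using AE_summable_sq[OF gexpD(2,4)[OF assms]] unfolding eventually_ae_filter by blast
  have "(\<lambda>i. tensor (F i) (G i) (x, y)) sums gsum F G (x, y)"
    if "x \<in> space m - X0" "y \<in> space n - Y0" for x y
  proof -
    have "summable (\<lambda>i. (cmod (F i x))\<^sup>2)" "summable (\<lambda>i. (cmod (G i y))\<^sup>2)"
      using that X0 Y0 by blast+
    from summable_sq_imp_prod(1)[OF this] have "summable (\<lambda>i. norm (tensor (F i) (G i) (x, y)))"
      by (simp add: tensor_def norm_mult)
    then show ?thesis unfolding gsum_def by (rule summable_sums[OF summable_norm_cancel])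
  qed
  with assms X0(1) Y0(1) show ?thesis unfolding gamma_expansion_iff by blast
qed

section \<open>The pairing does not depend on the expansion\<close>

lemma summable_bform:
  assumes T: "T \<in> bounded_ops m n" and FG: "gexp m n F G"
  shows "summable (\<lambda>i. bform m n T (F i) (G i))"
    and "cmod (\<Sum>i. bform m n T (F i) (G i))
      \<le> op_norm m n T * (((\<Sum>i. (nm m (F i))\<^sup>2) + (\<Sum>i. (nm n (G i))\<^sup>2)) / 2)"
proof -
  let ?K = "op_norm m n T"
  note cs = summable_sq_imp_prod[OF gexpD(3,4)[OF FG] nm_nonneg nm_nonneg]
  have le: "cmod (bform m n T (F i) (G i)) \<le> ?K * (nm m (F i) * nm n (G i))" for i
    using bform_bound[OF T gexpD(1,2)[OF FG]] by (simp add: mult.assoc)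
  have s: "summable (\<lambda>i. ?K * (nm m (F i) * nm n (G i)))"
    by (intro summable_mult cs)
  have n: "summable (\<lambda>i. cmod (bform m n T (F i) (G i)))"
    by (rule summable_comparison_test[OF _ s]) (use le in auto)
  then show "summable (\<lambda>i. bform m n T (F i) (G i))" by (rule summable_norm_cancel)
  have "cmod (\<Sum>i. bform m n T (F i) (G i)) \<le> (\<Sum>i. cmod (bform m n T (F i) (G i)))"
    by (rule summable_norm[OF n])
  also have "\<dots> \<le> (\<Sum>i. ?K * (nm m (F i) * nm n (G i)))"
    by (rule suminf_le[OF le n s])
  also have "\<dots> = ?K * (\<Sum>i. nm m (F i) * nm n (G i))"
    by (rule suminf_mult[OF cs(1)])
  also have "\<dots> \<le> ?K * (((\<Sum>i. (nm m (F i))\<^sup>2) + (\<Sum>i. (nm n (G i))\<^sup>2)) / 2)"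
    by (intro mult_left_mono cs(2) op_norm_nonneg[OF T])
  finally show "cmod (\<Sum>i. bform m n T (F i) (G i))
      \<le> ?K * (((\<Sum>i. (nm m (F i))\<^sup>2) + (\<Sum>i. (nm n (G i))\<^sup>2)) / 2)" .
qed

lemma kform_tensor:
  assumes "u \<in> sq_int m" "w \<in> sq_int n" "f \<in> sq_int m" "g \<in> sq_int n"
  shows "kform m n (tensor u w) f g = (\<integral>x. u x * f x \<partial>m) * (\<integral>y. w y * g y \<partial>n)"
proof -
  have "kform m n (tensor u w) f g
      = (\<integral>z. (u (fst z) * f (fst z)) * (w (snd z) * g (snd z)) \<partial>(m \<Otimes>\<^sub>M n))"
    by (simp add: kform_def tensor_def mult_ac)
  also have "\<dots> = (\<integral>x. u x * f x \<partial>m) * (\<integral>y. w y * g y \<partial>n)"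
    using assms by (intro integrable_tensor(2)) auto
  finally show ?thesis .
qed

text \<open>
  The compression of an operator to a finite dimensional subspace is a kernel operator, so it only
  sees the sum of an expansion.
\<close>

lemma bform_proj_sums:
  assumes T: "T \<in> bounded_ops m n" and FG: "gexp m n F G" and e: "orthonormal m e {..<N::nat}"
  shows "(\<lambda>i. bform m n T (proj m e {..<N} (F i)) (G i)) sums
    (\<integral>z. (\<Sum>j<N. tensor (\<lambda>x. cnj (e j x)) (ap m T (e j)) z) * gsum F G z \<partial>(m \<Otimes>\<^sub>M n))"
proof -
  interpret T: bounded_form m n "bform m n T" "op_norm m n T" by (rule bounded_form_bform[OF T])
  have es: "e j \<in> sq_int m" if "j < N" for j using orthonormalD[OF e] that by auto
  have kj: "tensor (\<lambda>x. cnj (e j x)) (ap m T (e j)) \<in> sq_int (m \<Otimes>\<^sub>M n)" if "j < N" for j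
    using es[OF that] T by (intro tensor_sq_int sq_int_cnj ap_sq_int)
  have "bform m n T (proj m e {..<N} f) g
      = kform m n (\<lambda>z. \<Sum>j<N. tensor (\<lambda>x. cnj (e j x)) (ap m T (e j)) z) f g"
    if f: "f \<in> sq_int m" and g: "g \<in> sq_int n" for f g
  proof -
    have "bform m n T (proj m e {..<N} f) g = (\<Sum>j<N. ip m f (e j) * bform m n T (e j) g)"
      unfolding proj_def using es g by (subst T.sum_left) (auto simp: T.cmult_left)
    also have "\<dots> = (\<Sum>j<N. kform m n (tensor (\<lambda>x. cnj (e j x)) (ap m T (e j))) f g)"
    proof (rule sum.cong[OF refl])
      fix j assume "j \<in> {..<N}"
      then have ej: "e j \<in> sq_int m" using es by simp
      have "kform m n (tensor (\<lambda>x. cnj (e j x)) (ap m T (e j))) f g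
          = (\<integral>x. cnj (e j x) * f x \<partial>m) * (\<integral>y. ap m T (e j) y * g y \<partial>n)"
        using ej f g T by (intro kform_tensor sq_int_cnj ap_sq_int)
      also have "\<dots> = ip m f (e j) * bform m n T (e j) g"
        unfolding bform_eq_ip[OF T ej g] by (simp add: ip_def mult.commute)
      finally show "ip m f (e j) * bform m n T (e j) g
          = kform m n (tensor (\<lambda>x. cnj (e j x)) (ap m T (e j))) f g" ..
    qed
    also have "\<dots> = kform m n (\<lambda>z. \<Sum>j<N. tensor (\<lambda>x. cnj (e j x)) (ap m T (e j)) z) f g"
      by (intro kform_sum[symmetric] integrable_sq_mult[OF kj tensor_sq_int[OF f g]]) auto
    finally show ?thesis .
  qed
  note eq = this[OF gexpD(1,2)[OF FG]]
  show ?thesis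
    unfolding eq by (rule kform_sums[OF FG]) (use kj in auto)
qed

text \<open>The first \<open>r\<close> functions are reproduced by the projection, and on the others
  subtracting the projection does not increase the norm. The error is thus bounded by the tail of
  the series.\<close>

lemma suminf_bform_proj_close:
  assumes T: "T \<in> bounded_ops m n" and FG: "gexp m n F G" and e: "orthonormal m e {..<N::nat}"
    and null: "\<And>i. i < r \<Longrightarrow> nm m (\<lambda>x. F i x - proj m e {..<N} (F i) x) = 0"
  shows "cmod ((\<Sum>i. bform m n T (F i) (G i)) - (\<Sum>i. bform m n T (proj m e {..<N} (F i)) (G i)))
    \<le> op_norm m n T * (\<Sum>i. nm m (F (i + r)) * nm n (G (i + r)))"
proof -
  interpret T: bounded_form m n "bform m n T" "op_norm m n T" by (rule bounded_form_bform[OF T])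
  let ?d = "\<lambda>i x. F i x - proj m e {..<N} (F i) x"
  define c where "c i = bform m n T (?d i) (G i)" for i
  note FGs = gexpD(1,2)[OF FG]
  have p: "proj m e {..<N} (F i) \<in> sq_int m" for i by (rule proj_sq_int) (rule orthonormalD[OF e])
  have d: "?d i \<in> sq_int m" for i by (rule sq_int_diff[OF FGs(1) p])
  have c_eq: "c i = bform m n T (F i) (G i) - bform m n T (proj m e {..<N} (F i)) (G i)" for i
    unfolding c_def by (rule T.diff_left[OF FGs(1) p FGs(2)])
  have s1: "summable (\<lambda>i. bform m n T (F i) (G i))" by (rule summable_bform[OF T FG])
  have s2: "summable (\<lambda>i. bform m n T (proj m e {..<N} (F i)) (G i))"
    using bform_proj_sums[OF T FG e] by (rule sums_summable)
  have sc: "summable c" unfolding c_eq using s1 s2 by (rule summable_diff)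
  have c_le: "cmod (c i) \<le> op_norm m n T * (nm m (F i) * nm n (G i))" for i
  proof -
    have "cmod (c i) \<le> op_norm m n T * nm m (?d i) * nm n (G i)"
      unfolding c_def by (intro T.bound d FGs)
    also have "\<dots> \<le> op_norm m n T * nm m (F i) * nm n (G i)"
      using nm_diff_proj_le[OF e _ FGs(1)[of i]] T.K_nonneg
      by (intro mult_right_mono mult_left_mono) auto
    finally show ?thesis by (simp add: mult.assoc)
  qed
  have c0: "c i = 0" if "i < r" for i
    using T.bound[OF d FGs(2), of i i] null[OF that] by (simp add: c_def)
  have sp: "summable (\<lambda>i. nm m (F (i + r)) * nm n (G (i + r)))"
    using summable_ignore_initial_segment[OF summable_sq_imp_prod(1)[OF gexpD(3,4)[OF FG] nm_nonneg nm_nonneg]] .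
  have sn: "summable (\<lambda>i. cmod (c (i + r)))"
    by (rule summable_comparison_test[OF _ summable_mult[OF sp]]) (use c_le in auto)
  have "(\<Sum>i. bform m n T (F i) (G i)) - (\<Sum>i. bform m n T (proj m e {..<N} (F i)) (G i)) = suminf c"
    unfolding c_eq using s1 s2 by (rule suminf_diff)
  also have "\<dots> = (\<Sum>i. c (i + r))"
    using suminf_split_initial_segment[OF sc, of r] c0 by simp
  also have "cmod \<dots> \<le> (\<Sum>i. cmod (c (i + r)))" by (rule summable_norm[OF sn])
  also have "\<dots> \<le> (\<Sum>i. op_norm m n T * (nm m (F (i + r)) * nm n (G (i + r))))"
    by (rule suminf_le[OF c_le sn summable_mult[OF sp]])
  also have "\<dots> = op_norm m n T * (\<Sum>i. nm m (F (i + r)) * nm n (G (i + r)))"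
    by (rule suminf_mult[OF sp])
  finally show ?thesis .
qed

text \<open>Compress to a finite dimensional space containing the first \<open>r\<close> functions
  of both expansions. For the compression the two sums agree by \<open>bform_proj_sums\<close>, and
  both errors are tails that vanish as \<open>r\<close> grows.\<close>

lemma suminf_bform_cong:
  assumes T: "T \<in> bounded_ops m n" and FG: "gexp m n F G" and FG': "gexp m n F' G'"
    and eq: "AE z in m \<Otimes>\<^sub>M n. gsum F G z = gsum F' G' z"
  shows "(\<Sum>i. bform m n T (F i) (G i)) = (\<Sum>i. bform m n T (F' i) (G' i))"
proof -
  define t where "t r = op_norm m n T * (\<Sum>i. nm m (F (i + r)) * nm n (G (i + r)))
      + op_norm m n T * (\<Sum>i. nm m (F' (i + r)) * nm n (G' (i + r)))" for r
  let ?d = "(\<Sum>i. bform m n T (F i) (G i)) - (\<Sum>i. bform m n T (F' i) (G' i))"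
  have "cmod ?d \<le> t r" for r
  proof -
    \<comment> \<open>One list of length \<open>r + r\<close>: the first half comes from
      \<open>F\<close>, the second from \<open>F'\<close>.\<close>
    have "\<exists>N e. orthonormal m e {..<N::nat} \<and> (\<forall>i<r + r.
        nm m (\<lambda>x. (if i < r then F i else F' (i - r)) x
          - proj m e {..<N} (if i < r then F i else F' (i - r)) x) = 0)"
      by (rule gram_schmidt) (auto simp: gexpD(1)[OF FG] gexpD(1)[OF FG'])
    then obtain N :: nat and e where e: "orthonormal m e {..<N}"
      and null: "\<And>i. i < r + r \<Longrightarrow> nm m (\<lambda>x. (if i < r then F i else F' (i - r)) x
          - proj m e {..<N} (if i < r then F i else F' (i - r)) x) = 0"
      by blast
    have n1: "nm m (\<lambda>x. F i x - proj m e {..<N} (F i) x) = 0" if "i < r" for i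
      using null[of i] that by simp
    have n2: "nm m (\<lambda>x. F' i x - proj m e {..<N} (F' i) x) = 0" if "i < r" for i
      using null[of "i + r"] that by simp
    let ?k = "\<lambda>z. \<Sum>j<N. tensor (\<lambda>x. cnj (e j x)) (ap m T (e j)) z"
    have ks: "?k \<in> sq_int (m \<Otimes>\<^sub>M n)"
      using T orthonormalD[OF e] by (intro sq_int_sum tensor_sq_int sq_int_cnj ap_sq_int) auto
    have "AE z in m \<Otimes>\<^sub>M n. ?k z * gsum F G z = ?k z * gsum F' G' z"
      using eq by eventually_elim simp
    then have "(\<integral>z. ?k z * gsum F G z \<partial>(m \<Otimes>\<^sub>M n)) = (\<integral>z. ?k z * gsum F' G' z \<partial>(m \<Otimes>\<^sub>M n))"
      by (intro integral_cong_AE borel_measurable_integrable integrable_sq_mult ks gsum_sq_int FG FG')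
    then have eqp: "(\<Sum>i. bform m n T (proj m e {..<N} (F i)) (G i))
        = (\<Sum>i. bform m n T (proj m e {..<N} (F' i)) (G' i))"
      using sums_unique[OF bform_proj_sums[OF T FG e]] sums_unique[OF bform_proj_sums[OF T FG' e]]
      by (simp only:)
    have "cmod ?d \<le> cmod ((\<Sum>i. bform m n T (F i) (G i)) - (\<Sum>i. bform m n T (proj m e {..<N} (F i)) (G i)))
        + cmod ((\<Sum>i. bform m n T (F' i) (G' i)) - (\<Sum>i. bform m n T (proj m e {..<N} (F' i)) (G' i)))"
      unfolding eqp by norm
    also have "\<dots> \<le> t r"
      unfolding t_def
      by (intro add_mono suminf_bform_proj_close T FG FG' e n1 n2)
    finally show ?thesis .
  qed
  moreover have "t \<longlonglongrightarrow> op_norm m n T * 0 + op_norm m n T * 0"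
    unfolding t_def
    by (intro tendsto_add tendsto_mult_left suminf_exist_split2 summable_sq_imp_prod(1)
        gexpD(3,4)[OF FG] gexpD(3,4)[OF FG'] nm_nonneg)
  ultimately have "cmod ?d \<le> op_norm m n T * 0 + op_norm m n T * 0"
    by (intro LIMSEQ_le_const) auto
  then show ?thesis by simp
qed

lemma pairing_eq:
  assumes T: "T \<in> bounded_ops m n" and h: "gamma_expansion m n h F G"
  shows "pairing m n T h = (\<Sum>i. bform m n T (F i) (G i))"
  unfolding pairing_def bform_def[symmetric]
proof (rule the_equality)
  show "\<exists>F' G'. gamma_expansion m n h F' G' \<and>
      (\<Sum>i. bform m n T (F i) (G i)) = (\<Sum>i. bform m n T (F' i) (G' i))"
    using h by blast
  fix c assume "\<exists>F G. gamma_expansion m n h F G \<and> c = (\<Sum>i. bform m n T (F i) (G i))"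
  then obtain F' G' where h': "gamma_expansion m n h F' G'" and c: "c = (\<Sum>i. bform m n T (F' i) (G' i))"
    by blast
  have "AE z in m \<Otimes>\<^sub>M n. gsum F' G' z = gsum F G z"
    using gamma_expansion_AE[OF h] gamma_expansion_AE[OF h'] by eventually_elim simp
  then show "c = (\<Sum>i. bform m n T (F i) (G i))"
    unfolding c by (intro suminf_bform_cong T gamma_expansionD[OF h] gamma_expansionD[OF h'])
qed

lemma pairing_sums:
  assumes T: "T \<in> bounded_ops m n" and h: "gamma_expansion m n h F G"
  shows "(\<lambda>i. bform m n T (F i) (G i)) sums pairing m n T h"
  unfolding pairing_eq[OF assms] by (intro summable_sums summable_bform T gamma_expansionD[OF h])

lemma Gamma_E:
  assumes "h \<in> Gamma m n"
  obtains F G where "gamma_expansion m n h F G" "gexp m n F G"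
  using assms gamma_expansionD unfolding Gamma_def by blast

lemma pairing_cong_AE:
  assumes T: "T \<in> bounded_ops m n" and h: "h \<in> Gamma m n" "h' \<in> Gamma m n"
    and eq: "AE z in m \<Otimes>\<^sub>M n. h z = h' z"
  shows "pairing m n T h = pairing m n T h'"
proof -
  obtain F G where FG: "gamma_expansion m n h F G" "gexp m n F G" using h(1) by (rule Gamma_E)
  obtain F' G' where FG': "gamma_expansion m n h' F' G'" "gexp m n F' G'" using h(2) by (rule Gamma_E)
  have "AE z in m \<Otimes>\<^sub>M n. gsum F G z = gsum F' G' z"
    using gamma_expansion_AE[OF FG(1)] gamma_expansion_AE[OF FG'(1)] eq by eventually_elim simp
  then show ?thesis
    unfolding pairing_eq[OF T FG(1)] pairing_eq[OF T FG'(1)]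
    by (intro suminf_bform_cong T FG(2) FG'(2))
qed

text \<open>The predual is not given a norm; the constant stands in for an upper bound of the
  projective norm of \<open>h\<close>.\<close>

lemma pairing_bound:
  assumes "h \<in> Gamma m n"
  shows "\<exists>c\<ge>0. \<forall>T\<in>bounded_ops m n. cmod (pairing m n T h) \<le> op_norm m n T * c"
proof -
  obtain F G where FG: "gamma_expansion m n h F G" "gexp m n F G" using assms by (rule Gamma_E)
  have "0 \<le> ((\<Sum>i. (nm m (F i))\<^sup>2) + (\<Sum>i. (nm n (G i))\<^sup>2)) / 2"
    using gexpD(3,4)[OF FG(2)] by (simp add: suminf_nonneg)
  moreover have "cmod (pairing m n T h) \<le> op_norm m n T * (((\<Sum>i. (nm m (F i))\<^sup>2) + (\<Sum>i. (nm n (G i))\<^sup>2)) / 2)"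
    if "T \<in> bounded_ops m n" for T
    unfolding pairing_eq[OF that FG(1)] by (rule summable_bform(2)[OF that FG(2)])
  ultimately show ?thesis by blast
qed

lemma pairing_op_lincomb:
  assumes T: "T \<in> bounded_ops m n" and S: "S \<in> bounded_ops m n" and h: "h \<in> Gamma m n"
  shows "pairing m n (op_lincomb m n a T b S) h = a * pairing m n T h + b * pairing m n S h"
proof -
  obtain F G where FG: "gamma_expansion m n h F G" "gexp m n F G" using h by (rule Gamma_E)
  have "(\<lambda>i. a * bform m n T (F i) (G i) + b * bform m n S (F i) (G i))
      sums (a * pairing m n T h + b * pairing m n S h)"
    by (intro sums_add sums_mult pairing_sums T S FG(1))
  then show ?thesis
    unfolding pairing_eq[OF op_lincomb_bounded[OF T S] FG(1)] bform_op_lincomb[OF T S gexpD(1,2)[OF FG(2)]]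
    by (rule sums_unique[symmetric])
qed

lemma pairing_op_zero: "h \<in> Gamma m n \<Longrightarrow> pairing m n (op_zero m n) h = 0"
proof -
  assume "h \<in> Gamma m n"
  then obtain F G where FG: "gamma_expansion m n h F G" "gexp m n F G" by (rule Gamma_E)
  then show ?thesis using pairing_eq[OF op_zero_bounded FG(1)] gexpD(1,2)[OF FG(2)]
    by (simp add: bform_op_zero)
qed

lemma pairing_kop:
  assumes k: "k \<in> sq_int (m \<Otimes>\<^sub>M n)" and h: "gamma_expansion m n h F G"
  shows "pairing m n (kop m n k) h = (\<integral>z. k z * gsum F G z \<partial>(m \<Otimes>\<^sub>M n))"
proof -
  have FG: "gexp m n F G" by (rule gamma_expansionD[OF h])
  have "pairing m n (kop m n k) h = (\<Sum>i. kform m n k (F i) (G i))"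
    unfolding pairing_eq[OF kop_bounded[OF k] h] using gexpD(1,2)[OF FG] by (simp add: bform_kop[OF k])
  then show ?thesis using sums_unique[OF kform_sums[OF FG k]] by simp
qed

text \<open>A function in \<open>Gamma\<close> is prescribed only off a marginally null set and may
  fail to be measurable. Integrals are taken of the measurable representative \<open>h'\<close>, the
  sum of an expansion.\<close>

lemma Gamma_AE_sq_int:
  assumes "h \<in> Gamma m n"
  obtains h' where "h' \<in> sq_int (m \<Otimes>\<^sub>M n)" "AE z in m \<Otimes>\<^sub>M n. h z = h' z"
    "\<And>k. k \<in> sq_int (m \<Otimes>\<^sub>M n) \<Longrightarrow> pairing m n (kop m n k) h = (\<integral>z. k z * h' z \<partial>(m \<Otimes>\<^sub>M n))"
proof -
  obtain F G where FG: "gamma_expansion m n h F G" "gexp m n F G" using assms by (rule Gamma_E)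
  show ?thesis
    by (rule that[OF gsum_sq_int[OF FG(2)] gamma_expansion_AE[OF FG(1)] pairing_kop[OF _ FG(1)]])
qed

section \<open>Elementary tensors, multiples and sums in the predual\<close>

lemma gamma_expansion_tensor:
  assumes f: "f \<in> sq_int m" and g: "g \<in> sq_int n"
  shows "gamma_expansion m n (tensor f g) (\<lambda>i. if i = 0 then f else (\<lambda>_. 0)) (\<lambda>i. if i = 0 then g else (\<lambda>_. 0))"
proof -
  have s: "summable (\<lambda>i::nat. (nm m (if i = 0 then f else (\<lambda>_. 0)))\<^sup>2)"
    by (rule summable_finite[of "{0}"]) auto
  have s': "summable (\<lambda>i::nat. (nm n (if i = 0 then g else (\<lambda>_. 0)))\<^sup>2)"
    by (rule summable_finite[of "{0}"]) auto
  have "(\<lambda>i::nat. tensor (if i = 0 then f else (\<lambda>_. 0)) (if i = 0 then g else (\<lambda>_. 0)) z) sums tensor f g z" for z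
    using sums_finite[of "{0::nat}" "\<lambda>i. tensor (if i = 0 then f else (\<lambda>_. 0)) (if i = 0 then g else (\<lambda>_. 0)) z"]
    by (simp add: tensor_def)
  then show ?thesis
    unfolding gamma_expansion_iff gexp_def using f g s s' by auto
qed

lemma tensor_in_Gamma [simp, intro]: "f \<in> sq_int m \<Longrightarrow> g \<in> sq_int n \<Longrightarrow> tensor f g \<in> Gamma m n"
  by (rule Gamma_I[OF gamma_expansion_tensor])

lemma pairing_tensor:
  assumes T: "T \<in> bounded_ops m n" and f: "f \<in> sq_int m" and g: "g \<in> sq_int n"
  shows "pairing m n T (tensor f g) = bform m n T f g"
proof -
  interpret T: bounded_form m n "bform m n T" "op_norm m n T" by (rule bounded_form_bform[OF T])
  have "(\<Sum>i::nat. bform m n T (if i = 0 then f else (\<lambda>_. 0)) (if i = 0 then g else (\<lambda>_. 0)))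
      = (\<Sum>i\<in>{0::nat}. bform m n T (if i = 0 then f else (\<lambda>_. 0)) (if i = 0 then g else (\<lambda>_. 0)))"
    by (rule suminf_finite) auto
  then show ?thesis
    unfolding pairing_eq[OF T gamma_expansion_tensor[OF f g]] by simp
qed

lemma pairing_eqI:
  assumes T: "T \<in> bounded_ops m n" and S: "S \<in> bounded_ops m n"
    and eq: "\<And>h. h \<in> Gamma m n \<Longrightarrow> pairing m n T h = pairing m n S h"
  shows "T = S"
  by (rule bform_eqI[OF T S]) (simp add: pairing_tensor[OF T, symmetric] pairing_tensor[OF S, symmetric] eq)

lemma zero_in_Gamma [simp, intro]: "(\<lambda>_. 0) \<in> Gamma m n"
  using tensor_in_Gamma[OF sq_int_zero sq_int_zero] by (simp add: tensor_def)

lemma pairing_zero [simp]: "T \<in> bounded_ops m n \<Longrightarrow> pairing m n T (\<lambda>_. 0) = 0"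
proof -
  assume T: "T \<in> bounded_ops m n"
  interpret T: bounded_form m n "bform m n T" "op_norm m n T" by (rule bounded_form_bform[OF T])
  show ?thesis using pairing_tensor[OF T sq_int_zero sq_int_zero] by (simp add: tensor_def)
qed

lemma Gamma_cmult:
  assumes h: "h \<in> Gamma m n"
  shows "(\<lambda>z. c * h z) \<in> Gamma m n"
    and "T \<in> bounded_ops m n \<Longrightarrow> pairing m n T (\<lambda>z. c * h z) = c * pairing m n T h"
proof -
  obtain F G where FG: "gamma_expansion m n h F G" "gexp m n F G" using h by (rule Gamma_E)
  obtain X0 Y0 where XY: "X0 \<in> null_sets m" "Y0 \<in> null_sets n"
    and sums: "\<And>x y. x \<in> space m - X0 \<Longrightarrow> y \<in> space n - Y0 \<Longrightarrow> (\<lambda>i. tensor (F i) (G i) (x, y)) sums h (x, y)"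
    using FG(1) unfolding gamma_expansion_iff by blast
  have g: "gexp m n (\<lambda>i x. c * F i x) G"
    using FG(2) unfolding gexp_def by (auto simp: power_mult_distrib summable_mult)
  have tc: "tensor (\<lambda>x. c * F i x) (G i) z = c * tensor (F i) (G i) z" for i z
    by (simp add: tensor_def)
  have "(\<lambda>i. tensor (\<lambda>x. c * F i x) (G i) (x, y)) sums (c * h (x, y))"
    if "x \<in> space m - X0" "y \<in> space n - Y0" for x y
    unfolding tc by (rule sums_mult[OF sums[OF that]])
  then have h': "gamma_expansion m n (\<lambda>z. c * h z) (\<lambda>i x. c * F i x) G"
    unfolding gamma_expansion_iff using g XY by blast
  then show "(\<lambda>z. c * h z) \<in> Gamma m n" by (rule Gamma_I)
  assume T: "T \<in> bounded_ops m n"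
  interpret T: bounded_form m n "bform m n T" "op_norm m n T" by (rule bounded_form_bform[OF T])
  show "pairing m n T (\<lambda>z. c * h z) = c * pairing m n T h"
    unfolding pairing_eq[OF T h'] T.cmult_left[OF gexpD(1,2)[OF FG(2)]]
    by (rule sums_unique[symmetric]) (rule sums_mult[OF pairing_sums[OF T FG(1)]])
qed

end

text \<open>An expansion is a single sequence, so the expansion of a sum merges two sequences, one
  on the even and one on the odd indices.\<close>

definition interleave :: "(nat \<Rightarrow> 'a) \<Rightarrow> (nat \<Rightarrow> 'a) \<Rightarrow> nat \<Rightarrow> 'a" where
  "interleave f g i = (if even i then f (i div 2) else g ((i - 1) div 2))"

lemma interleave_apply2: "P (interleave f g i) (interleave f' g' i) = interleave (\<lambda>i. P (f i) (f' i)) (\<lambda>i. P (g i) (g' i)) i"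
  by (simp add: interleave_def)

lemma interleave_apply: "P (interleave f g i) = interleave (\<lambda>i. P (f i)) (\<lambda>i. P (g i)) i"
  by (simp add: interleave_def)

lemma sums_interleave_real:
  fixes f g :: "nat \<Rightarrow> real"
  shows "f sums a \<Longrightarrow> g sums b \<Longrightarrow> interleave f g sums (a + b)"
  using sums_if[of g b f a] by (simp add: interleave_def[abs_def] add.commute)

lemma sums_interleave_complex:
  fixes f g :: "nat \<Rightarrow> complex"
  assumes "f sums a" "g sums b" shows "interleave f g sums (a + b)"
proof -
  have "(\<lambda>i. Re (interleave f g i)) sums (Re a + Re b)" "(\<lambda>i. Im (interleave f g i)) sums (Im a + Im b)"
    using assms unfolding interleave_apply[of Re] interleave_apply[of Im]
    by (intro sums_interleave_real; simp add: sums_complex_iff)+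
  then show ?thesis by (simp add: sums_complex_iff)
qed

context two_sigma_finite
begin

lemma Gamma_add:
  assumes h: "h \<in> Gamma m n" "h' \<in> Gamma m n"
  shows "(\<lambda>z. h z + h' z) \<in> Gamma m n"
    and "T \<in> bounded_ops m n \<Longrightarrow> pairing m n T (\<lambda>z. h z + h' z) = pairing m n T h + pairing m n T h'"
proof -
  obtain F G where FG: "gamma_expansion m n h F G" "gexp m n F G" using h(1) by (rule Gamma_E)
  obtain F' G' where FG': "gamma_expansion m n h' F' G'" "gexp m n F' G'" using h(2) by (rule Gamma_E)
  obtain X0 Y0 where XY: "X0 \<in> null_sets m" "Y0 \<in> null_sets n"
    and sums: "\<And>x y. x \<in> space m - X0 \<Longrightarrow> y \<in> space n - Y0 \<Longrightarrow> (\<lambda>i. tensor (F i) (G i) (x, y)) sums h (x, y)"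
    using FG(1) unfolding gamma_expansion_iff by blast
  obtain X1 Y1 where XY': "X1 \<in> null_sets m" "Y1 \<in> null_sets n"
    and sums': "\<And>x y. x \<in> space m - X1 \<Longrightarrow> y \<in> space n - Y1 \<Longrightarrow> (\<lambda>i. tensor (F' i) (G' i) (x, y)) sums h' (x, y)"
    using FG'(1) unfolding gamma_expansion_iff by blast
  have "interleave F F' i \<in> sq_int m" "interleave G G' i \<in> sq_int n" for i
    using gexpD(1,2)[OF FG(2)] gexpD(1,2)[OF FG'(2)] by (auto simp: interleave_def)
  moreover have "summable (\<lambda>i. (nm m (interleave F F' i))\<^sup>2)"
    unfolding interleave_apply[of "\<lambda>u. (nm m u)\<^sup>2"]
    using sums_interleave_real[OF summable_sums summable_sums, OF gexpD(3)[OF FG(2)] gexpD(3)[OF FG'(2)]]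
    by (simp add: sums_summable)
  moreover have "summable (\<lambda>i. (nm n (interleave G G' i))\<^sup>2)"
    unfolding interleave_apply[of "\<lambda>u. (nm n u)\<^sup>2"]
    using sums_interleave_real[OF summable_sums summable_sums, OF gexpD(4)[OF FG(2)] gexpD(4)[OF FG'(2)]]
    by (simp add: sums_summable)
  ultimately have g: "gexp m n (interleave F F') (interleave G G')" by (simp add: gexp_def)
  have "(\<lambda>i. tensor (interleave F F' i) (interleave G G' i) (x, y)) sums (h (x, y) + h' (x, y))"
    if "x \<in> space m - (X0 \<union> X1)" "y \<in> space n - (Y0 \<union> Y1)" for x y
    unfolding interleave_apply2[of "\<lambda>u v. tensor u v (x, y)"]
    using that by (intro sums_interleave_complex sums sums') auto
  then have h': "gamma_expansion m n (\<lambda>z. h z + h' z) (interleave F F') (interleave G G')"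
    unfolding gamma_expansion_iff using g null_sets.Un[OF XY(1) XY'(1)] null_sets.Un[OF XY(2) XY'(2)]
    by blast
  then show "(\<lambda>z. h z + h' z) \<in> Gamma m n" by (rule Gamma_I)
  assume T: "T \<in> bounded_ops m n"
  have "interleave (\<lambda>i. bform m n T (F i) (G i)) (\<lambda>i. bform m n T (F' i) (G' i))
      sums (pairing m n T h + pairing m n T h')"
    by (intro sums_interleave_complex pairing_sums T FG(1) FG'(1))
  then show "pairing m n T (\<lambda>z. h z + h' z) = pairing m n T h + pairing m n T h'"
    unfolding pairing_eq[OF T h'] interleave_apply2[of "bform m n T"]
    by (simp add: sums_iff)
qed

lemma Gamma_diff:
  assumes h: "h \<in> Gamma m n" "h' \<in> Gamma m n"
  shows "(\<lambda>z. h z - h' z) \<in> Gamma m n"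
    and "T \<in> bounded_ops m n \<Longrightarrow> pairing m n T (\<lambda>z. h z - h' z) = pairing m n T h - pairing m n T h'"
  using Gamma_add[OF h(1) Gamma_cmult(1)[OF h(2), of "-1"]] Gamma_cmult(2)[OF h(2), of _ "-1"]
  by simp_all

text \<open>Multiplication by a bounded function of product form is the predual of a sandwich map.
  It carries the bimodule property over to annihilators.\<close>

lemma Gamma_mult_tensor:
  assumes h: "gamma_expansion m n h F G" and a: "a \<in> ess_bounded m" and b: "b \<in> ess_bounded n"
  shows "gamma_expansion m n (\<lambda>z. tensor a b z * h z) (\<lambda>i x. a x * F i x) (\<lambda>i y. b y * G i y)"
    and "T \<in> bounded_ops m n \<Longrightarrow>
      pairing m n (sandwich m n b T a) h = pairing m n T (\<lambda>z. tensor a b z * h z)"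
proof -
  have FG: "gexp m n F G" by (rule gamma_expansionD[OF h])
  obtain A where A: "A > 0" "AE x in m. cmod (a x) \<le> A" "a \<in> borel_measurable m"
    using a by (rule ess_boundedE)
  obtain C where C: "C > 0" "AE x in n. cmod (b x) \<le> C" "b \<in> borel_measurable n"
    using b by (rule ess_boundedE)
  obtain X0 Y0 where XY: "X0 \<in> null_sets m" "Y0 \<in> null_sets n"
    and sums: "\<And>x y. x \<in> space m - X0 \<Longrightarrow> y \<in> space n - Y0 \<Longrightarrow> (\<lambda>i. tensor (F i) (G i) (x, y)) sums h (x, y)"
    using h unfolding gamma_expansion_iff by blast
  have "(nm m (\<lambda>x. a x * F i x))\<^sup>2 \<le> A\<^sup>2 * (nm m (F i))\<^sup>2" for i
    unfolding power_mult_distrib[symmetric]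
    using A by (intro power_mono nm_ess_mult_le gexpD(1)[OF FG]) auto
  then have s1: "summable (\<lambda>i. (nm m (\<lambda>x. a x * F i x))\<^sup>2)"
    by (intro summable_comparison_test[OF _ summable_mult[OF gexpD(3)[OF FG]]]) auto
  have "(nm n (\<lambda>x. b x * G i x))\<^sup>2 \<le> C\<^sup>2 * (nm n (G i))\<^sup>2" for i
    unfolding power_mult_distrib[symmetric]
    using C by (intro power_mono nm_ess_mult_le gexpD(2)[OF FG]) auto
  then have s2: "summable (\<lambda>i. (nm n (\<lambda>x. b x * G i x))\<^sup>2)"
    by (intro summable_comparison_test[OF _ summable_mult[OF gexpD(4)[OF FG]]]) auto
  have g: "gexp m n (\<lambda>i x. a x * F i x) (\<lambda>i y. b y * G i y)"
    unfolding gexp_def using gexpD(1,2)[OF FG] a b s1 s2 by auto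
  have tc: "tensor (\<lambda>x. a x * F i x) (\<lambda>y. b y * G i y) z = tensor a b z * tensor (F i) (G i) z" for i z
    by (simp add: tensor_def)
  have "(\<lambda>i. tensor (\<lambda>x. a x * F i x) (\<lambda>y. b y * G i y) (x, y)) sums (tensor a b (x, y) * h (x, y))"
    if "x \<in> space m - X0" "y \<in> space n - Y0" for x y
    unfolding tc by (rule sums_mult[OF sums[OF that]])
  then show *: "gamma_expansion m n (\<lambda>z. tensor a b z * h z) (\<lambda>i x. a x * F i x) (\<lambda>i y. b y * G i y)"
    unfolding gamma_expansion_iff using g XY by blast
  assume T: "T \<in> bounded_ops m n"
  show "pairing m n (sandwich m n b T a) h = pairing m n T (\<lambda>z. tensor a b z * h z)"
    unfolding pairing_eq[OF T *] pairing_eq[OF sandwich_bounded[OF T a b] h]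
      bform_sandwich[OF T a b gexpD(1,2)[OF FG]] ..
qed

lemma gexp_shift: "gexp m n F G \<Longrightarrow> gexp m n (\<lambda>i. F (i + r)) (\<lambda>i. G (i + r))"
  unfolding gexp_def using summable_ignore_initial_segment by blast

end

section \<open>Weak* closed subspaces\<close>

context two_sigma_finite
begin

lemma topspace_weak_star [simp]: "topspace (weak_star m n) = bounded_ops m n"
proof -
  let ?S = "{{T \<in> bounded_ops m n. pairing m n T h \<in> V} | h V. h \<in> Gamma m n \<and> open V}"
  have "{T \<in> bounded_ops m n. pairing m n T (\<lambda>_. 0) \<in> (UNIV :: complex set)} \<in> ?S"
    using zero_in_Gamma open_UNIV by blast
  then have "\<Union>?S = bounded_ops m n" by auto
  then show ?thesis unfolding weak_star_def topology_generated_by_topspace .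
qed

lemma openin_weak_star_subbasis:
  assumes "h \<in> Gamma m n" "open V"
  shows "openin (weak_star m n) {T \<in> bounded_ops m n. pairing m n T h \<in> V}"
  unfolding weak_star_def by (rule topology_generated_by_Basis) (use assms in blast)

text \<open>Weaker than the description of a neighbourhood basis: only operators that agree with
  \<open>T\<close> exactly on finitely many functionals are found in \<open>W\<close>. For subspaces
  this suffices, since prescribed values can be attained exactly.\<close>

lemma openin_weak_star_imp:
  assumes "openin (weak_star m n) W" "T \<in> W"
  shows "\<exists>hs. set hs \<subseteq> Gamma m n \<and>
    (\<forall>S\<in>bounded_ops m n. (\<forall>h\<in>set hs. pairing m n S h = pairing m n T h) \<longrightarrow> S \<in> W)"
proof -
  let ?S = "{{T \<in> bounded_ops m n. pairing m n T h \<in> V} | h V. h \<in> Gamma m n \<and> open V}"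
  have "generate_topology_on ?S W"
    using assms(1) unfolding weak_star_def openin_topology_generated_by_iff .
  then show ?thesis using assms(2)
  proof (induction arbitrary: T rule: generate_topology_on.induct)
    case Empty
    then show ?case by simp
  next
    case (Int a b)
    obtain hs where hs: "set hs \<subseteq> Gamma m n"
      "\<forall>S\<in>bounded_ops m n. (\<forall>h\<in>set hs. pairing m n S h = pairing m n T h) \<longrightarrow> S \<in> a"
      using Int.IH(1)[of T] Int.prems by blast
    obtain hs' where hs': "set hs' \<subseteq> Gamma m n"
      "\<forall>S\<in>bounded_ops m n. (\<forall>h\<in>set hs'. pairing m n S h = pairing m n T h) \<longrightarrow> S \<in> b"
      using Int.IH(2)[of T] Int.prems by blast
    show ?case
      using hs hs' by (intro exI[of _ "hs @ hs'"]) auto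
  next
    case (UN K)
    then obtain k where k: "k \<in> K" "T \<in> k" by blast
    then obtain hs where "set hs \<subseteq> Gamma m n"
      "\<forall>S\<in>bounded_ops m n. (\<forall>h\<in>set hs. pairing m n S h = pairing m n T h) \<longrightarrow> S \<in> k"
      using UN.IH[of k T] by blast
    then show ?case using k by blast
  next
    case (Basis s)
    then obtain h V where s: "s = {T \<in> bounded_ops m n. pairing m n T h \<in> V}" "h \<in> Gamma m n" by blast
    show ?case
      using Basis.prems s by (intro exI[of _ "[h]"]) auto
  qed
qed

lemma op_subspaceD:
  assumes "op_subspace m n U"
  shows "U \<subseteq> bounded_ops m n" "op_zero m n \<in> U"
    "T \<in> U \<Longrightarrow> S \<in> U \<Longrightarrow> op_lincomb m n a T b S \<in> U"
  using assms by (auto simp: op_subspace_def)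

text \<open>Elimination: a functional that does not vanish on \<open>U\<close> is used to reduce the other ones.\<close>

lemma interpolate_functionals:
  assumes U: "op_subspace m n U" and T: "T \<in> bounded_ops m n"
    and ann: "\<And>h. h \<in> Gamma m n \<Longrightarrow> (\<forall>S\<in>U. pairing m n S h = 0) \<Longrightarrow> pairing m n T h = 0"
    and hs: "set hs \<subseteq> Gamma m n"
  shows "\<exists>S\<in>U. \<forall>h\<in>set hs. pairing m n S h = pairing m n T h"
  using hs
proof (induction "length hs" arbitrary: hs)
  case 0
  then show ?case using op_subspaceD(2)[OF U] by auto
next
  case (Suc l)
  then obtain g gs where gs: "hs = g # gs" "length gs = l" by (cases hs) auto
  have gG: "g \<in> Gamma m n" "set gs \<subseteq> Gamma m n" using Suc.prems gs by auto
  show ?case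
  proof (cases "\<forall>S\<in>U. pairing m n S g = 0")
    case True
    then have "pairing m n T g = 0" by (rule ann[OF gG(1)])
    moreover obtain S where "S \<in> U" "\<forall>h\<in>set gs. pairing m n S h = pairing m n T h"
      using Suc.hyps(1)[of gs] gs gG by auto
    ultimately show ?thesis using True gs by auto
  next
    case False
    then obtain R where R: "R \<in> U" "pairing m n R g \<noteq> 0" by blast
    have Rb: "R \<in> bounded_ops m n" using R op_subspaceD(1)[OF U] by blast
    \<comment> \<open>\<open>c\<close> is chosen so that \<open>R\<close> annihilates every
      \<open>q h\<close>. A multiple of \<open>R\<close> can then correct the value at
      \<open>g\<close> without disturbing the values already interpolated on the
      \<open>q h\<close>.\<close>
    define c where "c h = pairing m n R h / pairing m n R g" for h
    define q where "q h = (\<lambda>z. h z - c h * g z)" for h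
    have q: "q h \<in> Gamma m n" if "h \<in> Gamma m n" for h
      unfolding q_def using that gG(1) by (intro Gamma_diff Gamma_cmult)
    have pq: "pairing m n S (q h) = pairing m n S h - c h * pairing m n S g"
      if "h \<in> Gamma m n" "S \<in> bounded_ops m n" for h S
      unfolding q_def using Gamma_diff(2)[OF that(1) Gamma_cmult(1)[OF gG(1)] that(2)] Gamma_cmult(2)[OF gG(1) that(2)]
      by simp
    have "\<exists>S\<in>U. \<forall>h\<in>set (map q gs). pairing m n S h = pairing m n T h"
      using gs gG q by (intro Suc.hyps(1)) auto
    then obtain S where S: "S \<in> U" "\<And>h. h \<in> set gs \<Longrightarrow> pairing m n S (q h) = pairing m n T (q h)"
      by auto
    have Sb: "S \<in> bounded_ops m n" using S op_subspaceD(1)[OF U] by blast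
    define d where "d = (pairing m n T g - pairing m n S g) / pairing m n R g"
    let ?S = "op_lincomb m n 1 S d R"
    have pS: "pairing m n ?S h = pairing m n S h + d * pairing m n R h" if "h \<in> Gamma m n" for h
      using pairing_op_lincomb[OF Sb Rb that] by simp
    have 1: "pairing m n ?S g = pairing m n T g"
      unfolding pS[OF gG(1)] unfolding d_def using R(2) by simp
    have "pairing m n ?S h = pairing m n T h" if h: "h \<in> set gs" for h
    proof -
      have hG: "h \<in> Gamma m n" using h gG by auto
      have "pairing m n S h - c h * pairing m n S g = pairing m n T h - c h * pairing m n T g"
        using S(2)[OF h] pq[OF hG Sb] pq[OF hG T] by simp
      then have "pairing m n S h = pairing m n T h - c h * pairing m n T g + c h * pairing m n S g"
        by (simp only: diff_eq_eq)
      moreover have "d * pairing m n R h = c h * pairing m n T g - c h * pairing m n S g"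
        by (simp add: d_def c_def right_diff_distrib diff_divide_distrib mult.commute)
      ultimately show ?thesis unfolding pS[OF hG] by simp
    qed
    with 1 show ?thesis
      using gs op_subspaceD(3)[OF U S(1) R(1), of 1 d] by auto
  qed
qed

text \<open>The bipolar theorem for subspaces. The nontrivial direction is linear algebra: if every
  functional vanishing on \<open>U\<close> vanishes at \<open>T\<close>, then any finite list of
  values of \<open>T\<close> is attained on \<open>U\<close>.\<close>

theorem weak_star_closure_iff:
  assumes U: "op_subspace m n U"
  shows "T \<in> weak_star m n closure_of U \<longleftrightarrow> T \<in> bounded_ops m n \<and>
    (\<forall>h\<in>Gamma m n. (\<forall>S\<in>U. pairing m n S h = 0) \<longrightarrow> pairing m n T h = 0)"
proof (intro iffI conjI ballI impI)
  assume T: "T \<in> weak_star m n closure_of U"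
  then show Tb: "T \<in> bounded_ops m n" by (simp add: in_closure_of)
  fix h assume h: "h \<in> Gamma m n" and 0: "\<forall>S\<in>U. pairing m n S h = 0"
  show "pairing m n T h = 0"
  proof (rule ccontr)
    let ?W = "{T \<in> bounded_ops m n. pairing m n T h \<in> - {0}}"
    assume "pairing m n T h \<noteq> 0"
    then have "T \<in> ?W" using Tb by simp
    moreover have "openin (weak_star m n) ?W"
      by (rule openin_weak_star_subbasis[OF h]) auto
    ultimately have "\<exists>y. y \<in> U \<and> y \<in> ?W"
      using conjunct2[OF T[unfolded in_closure_of], rule_format, of ?W] by blast
    then show False using 0 by auto
  qed
next
  assume T: "T \<in> bounded_ops m n \<and> (\<forall>h\<in>Gamma m n. (\<forall>S\<in>U. pairing m n S h = 0) \<longrightarrow> pairing m n T h = 0)"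
  show "T \<in> weak_star m n closure_of U"
    unfolding in_closure_of
  proof (intro conjI allI impI)
    show "T \<in> topspace (weak_star m n)" using T by simp
    fix W assume "T \<in> W \<and> openin (weak_star m n) W"
    then obtain hs where hs: "set hs \<subseteq> Gamma m n"
      "\<And>S. S \<in> bounded_ops m n \<Longrightarrow> (\<forall>h\<in>set hs. pairing m n S h = pairing m n T h) \<Longrightarrow> S \<in> W"
      using openin_weak_star_imp[of W T] by blast
    obtain S where "S \<in> U" "\<forall>h\<in>set hs. pairing m n S h = pairing m n T h"
      using interpolate_functionals[OF U _ _ hs(1), of T] T by blast
    then show "\<exists>y. y \<in> U \<and> y \<in> W" using hs(2) op_subspaceD(1)[OF U] by blast
  qed
qed

lemma weak_star_closedD:
  assumes "closedin (weak_star m n) U" "op_subspace m n U" "T \<in> bounded_ops m n"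
    "\<And>h. h \<in> Gamma m n \<Longrightarrow> (\<forall>S\<in>U. pairing m n S h = 0) \<Longrightarrow> pairing m n T h = 0"
  shows "T \<in> U"
proof -
  have "T \<in> weak_star m n closure_of U"
    using assms(3,4) unfolding weak_star_closure_iff[OF assms(2)] by blast
  then show ?thesis using assms(1) by (simp add: closure_of_closedin)
qed

lemma weak_star_closedI:
  assumes "op_subspace m n U"
    "\<And>T. T \<in> bounded_ops m n \<Longrightarrow> (\<And>h. h \<in> Gamma m n \<Longrightarrow> (\<forall>S\<in>U. pairing m n S h = 0) \<Longrightarrow> pairing m n T h = 0)
      \<Longrightarrow> T \<in> U"
  shows "closedin (weak_star m n) U"
proof -
  have "weak_star m n closure_of U \<subseteq> U"
    using assms(2) unfolding subset_iff weak_star_closure_iff[OF assms(1)] by blast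
  then show ?thesis
    using op_subspaceD(1)[OF assms(1)] by (simp add: closure_of_subset_eq[symmetric])
qed

end

section \<open>The metric of the Hilbert space and compact operators\<close>

lemma l2_dist_eq: "l2_dist m u v = nm m (\<lambda>x. rep u x - rep v x)"
  by (simp add: l2_dist_def nm_def)

lemma Metric_space_L2: "Metric_space (L2 m) (l2_dist m)"
proof
  show "0 \<le> l2_dist m u v" for u v by (simp add: l2_dist_eq)
  show "l2_dist m u v = l2_dist m v u" for u v unfolding l2_dist_eq by (rule nm_diff_commute)
next
  fix u v assume uv: "u \<in> L2 m" "v \<in> L2 m"
  have "l2_dist m u v = 0 \<longleftrightarrow> (AE x in m. rep u x - rep v x = 0)"
    unfolding l2_dist_eq using uv L2_rep(1) by (intro nm_eq_0_iff sq_int_diff) auto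
  also have "\<dots> \<longleftrightarrow> u = v"
  proof
    assume "AE x in m. rep u x - rep v x = 0"
    then have "AE x in m. rep u x = rep v x" by eventually_elim simp
    then have "cls m (rep u) = cls m (rep v)" by (rule cls_eqI)
    then show "u = v" by (simp only: L2_rep[OF uv(1)] L2_rep[OF uv(2)])
  qed simp
  finally show "l2_dist m u v = 0 \<longleftrightarrow> u = v" .
next
  fix u v w assume "u \<in> L2 m" "v \<in> L2 m" "w \<in> L2 m"
  then show "l2_dist m u w \<le> l2_dist m u v + l2_dist m v w"
    unfolding l2_dist_eq by (intro nm_dist_triangle L2_rep)
qed

lemma l2_dist_cls_right:
  assumes "u \<in> L2 m" "f \<in> sq_int m"
  shows "l2_dist m u (cls m f) = nm m (\<lambda>x. rep u x - f x)"
  using l2_dist_cls[OF L2_rep(1)[OF assms(1)] assms(2)] L2_rep(2)[OF assms(1)] by simp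

lemma mcomplete_L2: "Metric_space.mcomplete (L2 m) (l2_dist m)"
proof -
  interpret Metric_space "L2 m" "l2_dist m" by (rule Metric_space_L2)
  show ?thesis
    unfolding mcomplete_def
  proof (intro allI impI)
    fix \<sigma> assume "MCauchy \<sigma>"
    then have r: "\<And>i. \<sigma> i \<in> L2 m"
      and c: "\<And>e. e > 0 \<Longrightarrow> \<exists>N. \<forall>i j. N \<le> i \<longrightarrow> N \<le> j \<longrightarrow> l2_dist m (\<sigma> i) (\<sigma> j) < e"
      unfolding MCauchy_def by blast+
    have "\<exists>N. \<forall>i\<ge>N. \<forall>j\<ge>N. nm m (\<lambda>x. rep (\<sigma> i) x - rep (\<sigma> j) x) < e" if "e > 0" for e
      using c[OF that] unfolding l2_dist_eq by blast
    then obtain g where g: "g \<in> sq_int m" "(\<lambda>k. nm m (\<lambda>x. rep (\<sigma> k) x - g x)) \<longlonglongrightarrow> 0"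
      by (rule sq_int_complete[OF L2_rep(1)[OF r]])
    have "limitin mtopology \<sigma> (cls m g) sequentially"
      unfolding limitin_metric
    proof (intro conjI allI impI)
      show "cls m g \<in> L2 m" using g(1) by (rule cls_in_L2)
      fix e :: real assume "e > 0"
      then have "\<forall>\<^sub>F k in sequentially. nm m (\<lambda>x. rep (\<sigma> k) x - g x) < e"
        using g(2) by (simp add: order_tendstoD)
      then show "\<forall>\<^sub>F k in sequentially. \<sigma> k \<in> L2 m \<and> l2_dist m (\<sigma> k) (cls m g) < e"
        by eventually_elim (simp add: r l2_dist_cls_right g(1))
    qed
    then show "\<exists>x. limitin mtopology \<sigma> x sequentially" by blast
  qed
qed

lemma in_l2_closure_iff:
  assumes "S \<subseteq> L2 m" "u \<in> L2 m"
  shows "u \<in> l2_topology m closure_of S \<longleftrightarrow> (\<forall>e>0. \<exists>v\<in>S. l2_dist m u v < e)"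
proof -
  interpret Metric_space "L2 m" "l2_dist m" by (rule Metric_space_L2)
  show ?thesis
    using assms unfolding l2_topology_def metric_closure_of mball_def by blast
qed

text \<open>In a complete space relative compactness is total boundedness. The centres
  \<open>W\<close> may lie anywhere in the space, which makes the criterion easier to verify than
  nets inside the image.\<close>

lemma compact_ops_iff:
  "T \<in> compact_ops m n \<longleftrightarrow> T \<in> bounded_ops m n \<and>
    (\<forall>e>0. \<exists>W. finite W \<and> W \<subseteq> sq_int n \<and>
      (\<forall>f\<in>sq_int m. nm m f \<le> 1 \<longrightarrow> (\<exists>w\<in>W. nm n (\<lambda>y. ap m T f y - w y) < e)))"
proof -
  interpret Metric_space "L2 n" "l2_dist n" by (rule Metric_space_L2)
  let ?D = "{u \<in> L2 m. l2_norm m u \<le> 1}"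
  have "compactin (l2_topology n) (l2_topology n closure_of (T ` ?D)) \<longleftrightarrow>
    (\<forall>e>0. \<exists>W. finite W \<and> W \<subseteq> sq_int n \<and>
      (\<forall>f\<in>sq_int m. nm m f \<le> 1 \<longrightarrow> (\<exists>w\<in>W. nm n (\<lambda>y. ap m T f y - w y) < e)))"
    if T: "T \<in> bounded_ops m n"
  proof -
    have TD: "T ` ?D \<subseteq> L2 n" using bounded_ops_L2[OF T] by blast
    then have "compactin (l2_topology n) (l2_topology n closure_of (T ` ?D)) \<longleftrightarrow> mtotally_bounded (T ` ?D)"
      unfolding l2_topology_def using mtotally_bounded_eq_compact_closure_of[OF mcomplete_L2] by blast
    also have "\<dots> \<longleftrightarrow> (\<forall>e>0. \<exists>W. finite W \<and> W \<subseteq> sq_int n \<and>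
      (\<forall>f\<in>sq_int m. nm m f \<le> 1 \<longrightarrow> (\<exists>w\<in>W. nm n (\<lambda>y. ap m T f y - w y) < e)))"
    proof (intro iffI allI impI)
      fix e :: real assume tb: "mtotally_bounded (T ` ?D)" and e: "e > 0"
      have "\<exists>K. finite K \<and> K \<subseteq> T ` ?D \<and> T ` ?D \<subseteq> (\<Union>x\<in>K. mball x e)"
        using tb[unfolded mtotally_bounded_def, rule_format, OF e] .
      then obtain K where K: "finite K" "K \<subseteq> T ` ?D" "T ` ?D \<subseteq> (\<Union>x\<in>K. mball x e)"
        by (elim exE conjE)
      have KL: "K \<subseteq> L2 n" using K(2) TD by blast
      have "\<exists>w\<in>rep ` K. nm n (\<lambda>y. ap m T f y - w y) < e" if f: "f \<in> sq_int m" "nm m f \<le> 1" for f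
      proof -
        have "T (cls m f) \<in> T ` ?D" using f by auto
        then obtain u where u: "u \<in> K" "T (cls m f) \<in> mball u e" using K(3) by blast
        have "l2_dist n u (T (cls m f)) < e" using u(2) by simp
        then have "nm n (\<lambda>y. ap m T f y - rep u y) < e"
          unfolding l2_dist_eq ap_def by (simp only: nm_diff_commute)
        then show ?thesis using u(1) by blast
      qed
      moreover have "rep ` K \<subseteq> sq_int n" using KL L2_rep(1) by blast
      ultimately show "\<exists>W. finite W \<and> W \<subseteq> sq_int n \<and>
        (\<forall>f\<in>sq_int m. nm m f \<le> 1 \<longrightarrow> (\<exists>w\<in>W. nm n (\<lambda>y. ap m T f y - w y) < e))"
        using K(1) by blast
    next
      assume net: "\<forall>e>0. \<exists>W. finite W \<and> W \<subseteq> sq_int n \<and>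
        (\<forall>f\<in>sq_int m. nm m f \<le> 1 \<longrightarrow> (\<exists>w\<in>W. nm n (\<lambda>y. ap m T f y - w y) < e))"
      show "mtotally_bounded (T ` ?D)"
        unfolding mtotally_bounded_def
      proof (intro allI impI)
        fix e :: real assume e: "e > 0"
        then have "e / 2 > 0" by simp
        from net[rule_format, OF this] obtain W where W: "finite W" "W \<subseteq> sq_int n"
          "\<forall>f\<in>sq_int m. nm m f \<le> 1 \<longrightarrow> (\<exists>w\<in>W. nm n (\<lambda>y. ap m T f y - w y) < e / 2)"
          by blast
        \<comment> \<open>Centres are moved into the image: each useful \<open>w\<close> is replaced
          by some image point within \<open>e / 2\<close>, and the radius doubles to
          \<open>e\<close>.\<close>
        define Q where "Q w u \<longleftrightarrow> u \<in> T ` ?D \<and> nm n (\<lambda>y. rep u y - w y) < e / 2" for w u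
        define p where "p w = (SOME u. Q w u)" for w
        let ?K = "p ` {w \<in> W. \<exists>u. Q w u}"
        have p: "Q w (p w)" if "\<exists>u. Q w u" for w
          unfolding p_def using that by (rule someI_ex)
        have "finite ?K" using W(1) by simp
        moreover have "?K \<subseteq> T ` ?D" using p unfolding Q_def by blast
        moreover have "T ` ?D \<subseteq> (\<Union>x\<in>?K. mball x e)"
        proof
          fix v assume v: "v \<in> T ` ?D"
          then obtain u where u: "u \<in> L2 m" "l2_norm m u \<le> 1" "v = T u" by blast
          have "rep u \<in> sq_int m" "nm m (rep u) \<le> 1" "T (cls m (rep u)) = v"
            using u L2_rep[OF u(1)] by (auto simp: l2_norm_eq)
          then obtain w where w: "w \<in> W" "nm n (\<lambda>y. rep v y - w y) < e / 2"
            using W(3) unfolding ap_def by metis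
          then have Q: "Q w v" unfolding Q_def using v by blast
          then have Qp: "Q w (p w)" by (intro p) blast
          have vL: "v \<in> L2 n" "p w \<in> L2 n" using v Qp TD unfolding Q_def by blast+
          have wsq: "w \<in> sq_int n" using w W(2) by blast
          have "l2_dist n (p w) v \<le> nm n (\<lambda>y. rep (p w) y - w y) + nm n (\<lambda>y. w y - rep v y)"
            unfolding l2_dist_eq by (intro nm_dist_triangle L2_rep(1) vL wsq)
          also have "\<dots> < e / 2 + e / 2"
            using Qp w(2) unfolding Q_def nm_diff_commute[of n w "rep v"] by (intro add_strict_mono) auto
          finally have "v \<in> mball (p w) e" using vL by simp
          then show "v \<in> (\<Union>x\<in>?K. mball x e)" using w(1) Q by blast
        qed
        ultimately show "\<exists>K. finite K \<and> K \<subseteq> T ` ?D \<and> T ` ?D \<subseteq> (\<Union>x\<in>K. mball x e)" by blast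
      qed
    qed
    finally show ?thesis .
  qed
  then show ?thesis unfolding compact_ops_def by blast
qed

section \<open>Norm limits of compact operators and finite rank operators\<close>

lemma nm_ap_diff:
  assumes T: "T \<in> bounded_ops m n" and S: "S \<in> bounded_ops m n" and f: "f \<in> sq_int m"
  shows "nm n (\<lambda>y. ap m T f y - ap m S f y) = nm n (ap m (op_lincomb m n 1 T (-1) S) f)"
proof -
  let ?R = "op_lincomb m n 1 T (-1) S"
  have R: "?R \<in> bounded_ops m n" by (rule op_lincomb_bounded[OF T S])
  have "AE y in n. ap m T f y - ap m S f y = ap m ?R f y"
  proof (rule sq_int_AE_eqI)
    fix h assume h: "h \<in> sq_int n"
    have "ip n (ap m ?R f) (\<lambda>y. cnj (cnj (h y))) = ip n (ap m T f) (\<lambda>y. cnj (cnj (h y))) - ip n (ap m S f) (\<lambda>y. cnj (cnj (h y)))"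
      unfolding bform_eq_ip[OF R f sq_int_cnj[OF h], symmetric] bform_eq_ip[OF T f sq_int_cnj[OF h], symmetric]
        bform_eq_ip[OF S f sq_int_cnj[OF h], symmetric] bform_op_lincomb[OF T S f sq_int_cnj[OF h]] by simp
    then show "ip n (\<lambda>y. ap m T f y - ap m S f y) h = ip n (ap m ?R f) h"
      using T S f h by (simp add: ip_diff_left)
  qed (use T S R f in auto)
  then show ?thesis
    using T S R f by (intro nm_cong_AE sq_int_measurable sq_int_diff ap_sq_int)
qed

lemma compact_ops_bounded: "T \<in> compact_ops m n \<Longrightarrow> T \<in> bounded_ops m n"
  by (simp add: compact_ops_def)

lemma compact_ops_limit:
  assumes T: "T \<in> bounded_ops m n"
    and approx: "\<And>e. e > 0 \<Longrightarrow> \<exists>S\<in>compact_ops m n. op_norm m n (op_lincomb m n 1 T (-1) S) < e"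
  shows "T \<in> compact_ops m n"
  unfolding compact_ops_iff
proof (intro conjI allI impI T)
  fix e :: real assume "e > 0"
  then have e2: "e / 2 > 0" by simp
  obtain S where S: "S \<in> compact_ops m n" "op_norm m n (op_lincomb m n 1 T (-1) S) < e / 2"
    using approx[OF e2] by blast
  have Sb: "S \<in> bounded_ops m n" by (rule compact_ops_bounded[OF S(1)])
  obtain W where W: "finite W" "W \<subseteq> sq_int n"
    "\<forall>f\<in>sq_int m. nm m f \<le> 1 \<longrightarrow> (\<exists>w\<in>W. nm n (\<lambda>y. ap m S f y - w y) < e / 2)"
    using S(1) e2 unfolding compact_ops_iff by blast
  have "\<exists>w\<in>W. nm n (\<lambda>y. ap m T f y - w y) < e" if f: "f \<in> sq_int m" "nm m f \<le> 1" for f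
  proof -
    obtain w where w: "w \<in> W" "nm n (\<lambda>y. ap m S f y - w y) < e / 2" using W(3) f by blast
    have "nm n (\<lambda>y. ap m T f y - ap m S f y) \<le> op_norm m n (op_lincomb m n 1 T (-1) S) * nm m f"
      unfolding nm_ap_diff[OF T Sb f(1)] by (rule nm_ap_le[OF op_lincomb_bounded[OF T Sb] f(1)])
    also have "\<dots> \<le> op_norm m n (op_lincomb m n 1 T (-1) S) * 1"
      by (intro mult_left_mono f op_norm_nonneg op_lincomb_bounded T Sb)
    finally have "nm n (\<lambda>y. ap m T f y - ap m S f y) < e / 2" using S(2) by simp
    moreover have "nm n (\<lambda>y. ap m T f y - w y) \<le> nm n (\<lambda>y. ap m T f y - ap m S f y) + nm n (\<lambda>y. ap m S f y - w y)"
      using w(1) W(2) by (intro nm_dist_triangle ap_sq_int[OF T f(1)] ap_sq_int[OF Sb f(1)]) auto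
    ultimately show ?thesis using w by (intro bexI[of _ w]) auto
  qed
  then show "\<exists>W. finite W \<and> W \<subseteq> sq_int n \<and>
      (\<forall>f\<in>sq_int m. nm m f \<le> 1 \<longrightarrow> (\<exists>w\<in>W. nm n (\<lambda>y. ap m T f y - w y) < e))"
    using W(1,2) by blast
qed

text \<open>The image of the unit ball consists of combinations of the \<open>w i\<close> with
  coefficients in the discs \<open>cball 0 (C i)\<close>. Finite nets of these discs combine, one
  index at a time, to a finite net of the image.\<close>

lemma compact_ops_finite_rank:
  assumes T: "T \<in> bounded_ops m n" and I: "finite I"
    and w: "\<And>i. i \<in> I \<Longrightarrow> w i \<in> sq_int n"
    and eq: "\<And>f g. f \<in> sq_int m \<Longrightarrow> g \<in> sq_int n \<Longrightarrow>
      bform m n T f g = (\<Sum>i\<in>I. \<phi> i f * (\<integral>y. w i y * g y \<partial>n))"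
    and bound: "\<And>i f. i \<in> I \<Longrightarrow> f \<in> sq_int m \<Longrightarrow> nm m f \<le> 1 \<Longrightarrow> cmod (\<phi> i f) \<le> C i"
  shows "T \<in> compact_ops m n"
proof -
  have ap_eq: "nm n (\<lambda>y. ap m T f y - v y) = nm n (\<lambda>y. (\<Sum>i\<in>I. \<phi> i f * w i y) - v y)"
    if f: "f \<in> sq_int m" and v: "v \<in> sq_int n" for f v
  proof -
    have s: "(\<lambda>y. \<Sum>i\<in>I. \<phi> i f * w i y) \<in> sq_int n" using w by auto
    have "AE y in n. ap m T f y = (\<Sum>i\<in>I. \<phi> i f * w i y)"
    proof (rule sq_int_AE_eqI)
      fix h assume h: "h \<in> sq_int n"
      have "ip n (ap m T f) h = bform m n T f (\<lambda>y. cnj (h y))"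
        using bform_eq_ip[OF T f sq_int_cnj[OF h]] by simp
      also have "\<dots> = ip n (\<lambda>y. \<Sum>i\<in>I. \<phi> i f * w i y) h"
        unfolding eq[OF f sq_int_cnj[OF h]] using w h by (subst ip_sum_left) (auto simp: ip_def)
      finally show "ip n (ap m T f) h = ip n (\<lambda>y. \<Sum>i\<in>I. \<phi> i f * w i y) h" .
    qed (use T f s in auto)
    then have "AE y in n. ap m T f y - v y = (\<Sum>i\<in>I. \<phi> i f * w i y) - v y"
      by eventually_elim simp
    then show ?thesis
      using T f v s by (intro nm_cong_AE sq_int_measurable sq_int_diff ap_sq_int)
  qed
  have net: "\<exists>W. finite W \<and> W \<subseteq> sq_int n \<and>
      (\<forall>f\<in>sq_int m. nm m f \<le> 1 \<longrightarrow> (\<exists>v\<in>W. nm n (\<lambda>y. (\<Sum>i\<in>I. \<phi> i f * w i y) - v y) < e))"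
    if "e > 0" for e
    using I that w bound
  proof (induction I arbitrary: e)
    case empty
    then show ?case by (intro exI[of _ "{\<lambda>_. 0}"]) auto
  next
    case (insert i I)
    have e2: "e / 2 > 0" using insert.prems(1) by simp
    have "\<exists>W. finite W \<and> W \<subseteq> sq_int n \<and>
      (\<forall>f\<in>sq_int m. nm m f \<le> 1 \<longrightarrow> (\<exists>v\<in>W. nm n (\<lambda>y. (\<Sum>i\<in>I. \<phi> i f * w i y) - v y) < e / 2))"
      using insert.prems by (intro insert.IH e2) auto
    then obtain W where W: "finite W" "W \<subseteq> sq_int n"
      "\<And>f. f \<in> sq_int m \<Longrightarrow> nm m f \<le> 1 \<Longrightarrow> (\<exists>v\<in>W. nm n (\<lambda>y. (\<Sum>i\<in>I. \<phi> i f * w i y) - v y) < e / 2)"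
      by blast
    have wi: "w i \<in> sq_int n" and wI: "\<And>j. j \<in> I \<Longrightarrow> w j \<in> sq_int n" using insert.prems by auto
    \<comment> \<open>An error \<open>d\<close> in the coefficient of \<open>w i\<close> costs at
      most \<open>e / 2\<close> in norm; the added one avoids division by zero.\<close>
    define d where "d = e / 2 / (nm n (w i) + 1)"
    have n1: "nm n (w i) + 1 > 0" by (simp add: add_nonneg_pos)
    have d: "d > 0" unfolding d_def using e2 n1 by (rule divide_pos_pos)
    have "compact (cball (0::complex) (C i))" by simp
    then have "\<exists>Z. finite Z \<and> cball (0::complex) (C i) \<subseteq> (\<Union>z\<in>Z. ball z d)"
      using d unfolding compact_eq_totally_bounded by simp
    then obtain Z where Z: "finite Z" "cball (0::complex) (C i) \<subseteq> (\<Union>z\<in>Z. ball z d)"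
      by blast
    let ?W = "(\<lambda>(z, v) y. z * w i y + v y) ` (Z \<times> W)"
    have "\<exists>v\<in>?W. nm n (\<lambda>y. (\<Sum>i\<in>insert i I. \<phi> i f * w i y) - v y) < e" if f: "f \<in> sq_int m" "nm m f \<le> 1" for f
    proof -
      obtain v where v: "v \<in> W" "nm n (\<lambda>y. (\<Sum>i\<in>I. \<phi> i f * w i y) - v y) < e / 2" using W(3)[OF f] by blast
      have "\<phi> i f \<in> cball 0 (C i)" using insert.prems(3)[OF _ f, of i] by simp
      then obtain z where z: "z \<in> Z" "dist z (\<phi> i f) < d" using Z(2) by auto
      have vs: "v \<in> sq_int n" using v W by blast
      have "(\<lambda>y. (\<Sum>i\<in>insert i I. \<phi> i f * w i y) - (z * w i y + v y))
          = (\<lambda>y. (\<phi> i f - z) * w i y + ((\<Sum>i\<in>I. \<phi> i f * w i y) - v y))"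
        using insert.hyps by (auto simp: fun_eq_iff algebra_simps)
      then have "nm n (\<lambda>y. (\<Sum>i\<in>insert i I. \<phi> i f * w i y) - (z * w i y + v y))
          \<le> nm n (\<lambda>y. (\<phi> i f - z) * w i y) + nm n (\<lambda>y. (\<Sum>i\<in>I. \<phi> i f * w i y) - v y)"
        using wi wI vs by (simp only:) (intro nm_triangle sq_int_cmult sq_int_diff sq_int_sum)
      moreover have "nm n (\<lambda>y. (\<phi> i f - z) * w i y) \<le> e / 2"
      proof -
        have "nm n (\<lambda>y. (\<phi> i f - z) * w i y) \<le> d * (nm n (w i) + 1)"
          unfolding nm_cmult using z(2) d by (intro mult_mono) (auto simp: dist_norm norm_minus_commute)
        also have "\<dots> = e / 2"
          unfolding d_def using n1 by (metis less_irrefl nonzero_eq_divide_eq)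
        finally show ?thesis .
      qed
      ultimately have "nm n (\<lambda>y. (\<Sum>i\<in>insert i I. \<phi> i f * w i y) - (z * w i y + v y)) < e"
        using v(2) by linarith
      moreover have "(\<lambda>y. z * w i y + v y) \<in> ?W" using z(1) v(1) by force
      ultimately show ?thesis by (rule bexI)
    qed
    moreover have "?W \<subseteq> sq_int n" using W(2) wi by auto
    moreover have "finite ?W" using Z(1) W(1) by simp
    ultimately show ?case by blast
  qed
  show ?thesis
    unfolding compact_ops_iff
  proof (intro conjI allI impI T)
    fix e :: real assume "e > 0"
    from net[OF this] obtain W where W: "finite W" "W \<subseteq> sq_int n"
      "\<And>f. f \<in> sq_int m \<Longrightarrow> nm m f \<le> 1 \<Longrightarrow> (\<exists>v\<in>W. nm n (\<lambda>y. (\<Sum>i\<in>I. \<phi> i f * w i y) - v y) < e)"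
      by blast
    have "\<exists>v\<in>W. nm n (\<lambda>y. ap m T f y - v y) < e" if f: "f \<in> sq_int m" "nm m f \<le> 1" for f
    proof -
      obtain v where v: "v \<in> W" "nm n (\<lambda>y. (\<Sum>i\<in>I. \<phi> i f * w i y) - v y) < e" using W(3)[OF f] by blast
      have "v \<in> sq_int n" using v(1) W(2) by blast
      then show ?thesis using v ap_eq[OF f(1)] by (intro bexI[of _ v]) auto
    qed
    then show "\<exists>W. finite W \<and> W \<subseteq> sq_int n \<and>
      (\<forall>f\<in>sq_int m. nm m f \<le> 1 \<longrightarrow> (\<exists>w\<in>W. nm n (\<lambda>y. ap m T f y - w y) < e))"
      using W(1,2) by blast
  qed
qed

section \<open>Hilbert--Schmidt operators\<close>

lemma orthonormal_basis_rep:
  assumes "l2_orthonormal_basis m E"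
  shows "\<And>u. u \<in> E \<Longrightarrow> u \<in> L2 m" and "orthonormal m rep E"
    and "\<And>f. f \<in> sq_int m \<Longrightarrow> (\<And>u. u \<in> E \<Longrightarrow> ip m f (rep u) = 0) \<Longrightarrow> nm m f = 0"
proof -
  show E: "\<And>u. u \<in> E \<Longrightarrow> u \<in> L2 m" using assms by (auto simp: l2_orthonormal_basis_def)
  have "l2_inner m u v = ip m (rep u) (rep v)" for u v by (simp add: l2_inner_def ip_def)
  then show "orthonormal m rep E"
    using assms E L2_rep(1)[OF E] unfolding l2_orthonormal_basis_def orthonormal_def by simp
  fix f assume f: "f \<in> sq_int m" and 0: "\<And>u. u \<in> E \<Longrightarrow> ip m f (rep u) = 0"
  have "l2_inner m (cls m f) u = 0" if u: "u \<in> E" for u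
    using l2_inner_cls[OF f L2_rep(1)[OF E[OF u]]] L2_rep(2)[OF E[OF u]] 0[OF u] by simp
  then have "cls m f = l2_zero m"
    using assms f unfolding l2_orthonormal_basis_def by blast
  then have "AE x in m. f x = 0"
    unfolding l2_zero_def by (rule cls_eqD) (rule sq_int_measurable[OF f])
  then show "nm m f = 0" by (simp add: nm_eq_0_iff[OF f])
qed

text \<open>
  Projections onto the spans of finite subsets \<open>G k\<close> which almost exhaust the Bessel sum form a
  Cauchy sequence, and \<open>f\<close> minus its limit is orthogonal to \<open>E\<close>.
\<close>

lemma orthonormal_basis_approx:
  assumes E: "l2_orthonormal_basis m E" and f: "f \<in> sq_int m" and d: "d > 0"
  shows "\<exists>G. finite G \<and> G \<subseteq> E \<and> nm m (\<lambda>x. f x - proj m rep G f x) < d"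
proof -
  note on = orthonormal_basis_rep(2)[OF E]
  have onG: "orthonormal m rep G" if "G \<subseteq> E" for G
    using on that unfolding orthonormal_def by blast
  have es: "rep u \<in> sq_int m" if "u \<in> E" for u using orthonormalD[OF on that] .
  have ps: "proj m rep G f \<in> sq_int m" if "G \<subseteq> E" for G using es that by (intro proj_sq_int) blast
  define c where "c u = (cmod (ip m f (rep u)))\<^sup>2" for u
  define \<F> where "\<F> = {G. finite G \<and> G \<subseteq> E}"
  define s where "s = Sup (sum c ` \<F>)"
  have ne: "sum c ` \<F> \<noteq> {}" unfolding \<F>_def by blast
  have bdd: "bdd_above (sum c ` \<F>)"
    unfolding \<F>_def c_def
    by (intro bdd_aboveI2[of _ _ "(nm m f)\<^sup>2"] bessel[OF orthonormal_imp_sub[OF onG] _ f]) auto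
  have le_s: "sum c G \<le> s" if "G \<in> \<F>" for G
    unfolding s_def using that by (intro cSup_upper bdd) auto
  have "\<exists>G\<in>\<F>. s - (inverse (real (Suc k)))\<^sup>2 < sum c G" for k
    using less_cSupD[OF ne, of "s - (inverse (real (Suc k)))\<^sup>2"] unfolding s_def by auto
  then obtain G where G: "\<And>k. G k \<in> \<F>" "\<And>k. s - (inverse (real (Suc k)))\<^sup>2 < sum c (G k)"
    by metis
  have Gf: "finite (G k)" "G k \<subseteq> E" for k using G(1)[of k] by (auto simp: \<F>_def)
  \<comment> \<open>\<open>G k\<close> exhausts the supremum \<open>s\<close> of the Bessel sums up
    to the square of \<open>1 / Suc k\<close>, so nothing disjoint from it can carry more than
    that.\<close>
  have extra: "sum c H < (inverse (real (Suc k)))\<^sup>2" if "finite H" "H \<subseteq> E" "H \<inter> G k = {}" for H k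
  proof -
    have "sum c (G k) + sum c H = sum c (G k \<union> H)"
      using that Gf by (intro sum.union_disjoint[symmetric]) auto
    also have "\<dots> \<le> s" using that Gf by (intro le_s) (auto simp: \<F>_def)
    finally show ?thesis using G(2)[of k] by linarith
  qed
  have half: "nm m (\<lambda>x. proj m rep (G k \<union> H) f x - proj m rep (G k) f x) < inverse (real (Suc k))"
    if H: "finite H" "H \<subseteq> E" for H k
  proof -
    have "proj m rep (G k \<union> H) f x - proj m rep (G k) f x = proj m rep (H - G k) f x" for x
    proof -
      have "proj m rep (G k \<union> (H - G k)) f x = proj m rep (G k) f x + proj m rep (H - G k) f x"
        unfolding proj_def using Gf H by (intro sum.union_disjoint) auto
      then show ?thesis by simp
    qed
    then have "(nm m (\<lambda>x. proj m rep (G k \<union> H) f x - proj m rep (G k) f x))\<^sup>2 = sum c (H - G k)"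
      unfolding c_def using H nm_proj_sq[OF onG, of "H - G k" f] by auto
    also have "\<dots> < (inverse (real (Suc k)))\<^sup>2" using H by (intro extra) auto
    finally show ?thesis by (rule power2_less_imp_less) simp
  qed
  have cau: "nm m (\<lambda>x. proj m rep (G i) f x - proj m rep (G j) f x) < inverse (real (Suc i)) + inverse (real (Suc j))" for i j
  proof -
    have "nm m (\<lambda>x. proj m rep (G i) f x - proj m rep (G j) f x)
        \<le> nm m (\<lambda>x. proj m rep (G i) f x - proj m rep (G i \<union> G j) f x)
        + nm m (\<lambda>x. proj m rep (G i \<union> G j) f x - proj m rep (G j) f x)"
      using Gf by (intro nm_dist_triangle ps) auto
    also have "nm m (\<lambda>x. proj m rep (G i) f x - proj m rep (G i \<union> G j) f x) < inverse (real (Suc i))"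
      using half[OF Gf, of i j] by (simp add: nm_diff_commute)
    also have "nm m (\<lambda>x. proj m rep (G i \<union> G j) f x - proj m rep (G j) f x) < inverse (real (Suc j))"
      using half[OF Gf, of j i] by (simp add: Un_commute)
    finally show ?thesis by simp
  qed
  have inv_small: "\<exists>N. \<forall>i\<ge>N. inverse (real (Suc i)) < e" if "e > 0" for e :: real
    using order_tendstoD(2)[OF LIMSEQ_inverse_real_of_nat that] by (simp add: eventually_sequentially)
  have "\<exists>N. \<forall>i\<ge>N. \<forall>j\<ge>N. nm m (\<lambda>x. proj m rep (G i) f x - proj m rep (G j) f x) < e" if "e > 0" for e
  proof -
    have "e / 2 > 0" using that by simp
    then obtain N where N: "\<forall>i\<ge>N. inverse (real (Suc i)) < e / 2" using inv_small by blast
    have "nm m (\<lambda>x. proj m rep (G i) f x - proj m rep (G j) f x) < e" if "i \<ge> N" "j \<ge> N" for i j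
    proof -
      have "inverse (real (Suc i)) < e / 2" "inverse (real (Suc j)) < e / 2" using N that by blast+
      then show ?thesis using cau[of i j] by linarith
    qed
    then show ?thesis by blast
  qed
  then obtain v where v: "v \<in> sq_int m" "(\<lambda>k. nm m (\<lambda>x. proj m rep (G k) f x - v x)) \<longlonglongrightarrow> 0"
    by (rule sq_int_complete[OF ps[OF Gf(2)]])
  have "ip m (\<lambda>x. f x - v x) (rep u) = 0" if u: "u \<in> E" for u
  proof -
    have "(\<lambda>k. ip m f (rep u) - ip m (proj m rep (G k) f) (rep u)) \<longlonglongrightarrow> ip m f (rep u) - ip m v (rep u)"
      by (intro tendsto_diff tendsto_const tendsto_ip(2) ps Gf v es u)
    moreover have "(\<lambda>k. ip m f (rep u) - ip m (proj m rep (G k) f) (rep u)) \<longlonglongrightarrow> 0"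
    proof (rule Lim_null_comparison[OF _ LIMSEQ_inverse_real_of_nat])
      show "\<forall>\<^sub>F k in sequentially. norm (ip m f (rep u) - ip m (proj m rep (G k) f) (rep u)) \<le> inverse (real (Suc k))"
      proof (intro always_eventually allI)
        fix k
        show "norm (ip m f (rep u) - ip m (proj m rep (G k) f) (rep u)) \<le> inverse (real (Suc k))"
        \<comment> \<open>Inside \<open>G k\<close> the projection reproduces the coefficient of
          \<open>f\<close>. Outside, the projection has coefficient zero and that of
          \<open>f\<close> is itself the extra mass of \<open>{u}\<close>.\<close>
        proof (cases "u \<in> G k")
          case True
          then show ?thesis using ip_proj_left[OF onG[OF Gf(2)] Gf(1) _ f] by simp
        next
          case False
          have "ip m (proj m rep (G k) f) (rep u) = (\<Sum>w\<in>G k. ip m f (rep w) * ip m (rep w) (rep u))"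
            unfolding proj_def using es u Gf(2) by (subst ip_sum_left) auto
          also have "\<dots> = 0"
          proof (rule sum.neutral, rule ballI)
            fix w assume w: "w \<in> G k"
            then have "w \<in> E" "w \<noteq> u" using Gf(2)[of k] False by auto
            then show "ip m f (rep w) * ip m (rep w) (rep u) = 0"
              using on u unfolding orthonormal_def by simp
          qed
          finally have "(norm (ip m f (rep u) - ip m (proj m rep (G k) f) (rep u)))\<^sup>2 = sum c {u}"
            by (simp add: c_def)
          also have "\<dots> < (inverse (real (Suc k)))\<^sup>2" using u False by (intro extra) auto
          finally show ?thesis by (rule less_imp_le[OF power2_less_imp_less]) simp
        qed
      qed
    qed
    ultimately have "ip m f (rep u) - ip m v (rep u) = 0" by (rule LIMSEQ_unique)
    then show ?thesis using f v es[OF u] by (simp add: ip_diff_left)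
  qed
  then have fv: "nm m (\<lambda>x. f x - v x) = 0"
    using f v by (intro orthonormal_basis_rep(3)[OF E]) auto
  obtain k where k: "nm m (\<lambda>x. proj m rep (G k) f x - v x) < d"
    using order_tendstoD(2)[OF v(2) d] by (auto simp: eventually_sequentially)
  have "nm m (\<lambda>x. f x - proj m rep (G k) f x) \<le> nm m (\<lambda>x. f x - v x) + nm m (\<lambda>x. v x - proj m rep (G k) f x)"
    by (intro nm_dist_triangle f v ps Gf)
  then have "nm m (\<lambda>x. f x - proj m rep (G k) f x) < d"
    using k fv by (simp add: nm_diff_commute[of m v])
  then show ?thesis using Gf by blast
qed

text \<open>The definition of a Hilbert--Schmidt operator asks for some basis, and this provides one
  for \<open>kop_hilbert_schmidt\<close>. By Zorn's lemma there is a maximal orthonormal family; a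
  nonzero vector orthogonal to it could be normalized and added.\<close>

lemma orthonormal_basis_exists: "\<exists>E. l2_orthonormal_basis m E"
proof -
  let ?A = "{E. E \<subseteq> L2 m \<and> orthonormal m rep E}"
  have "\<exists>M\<in>?A. \<forall>X\<in>?A. M \<subseteq> X \<longrightarrow> X = M"
  proof (rule subset_Zorn')
    fix C assume C: "subset.chain ?A C"
    have CA: "X \<subseteq> L2 m" "orthonormal m rep X" if "X \<in> C" for X
      using C that unfolding subset_chain_def by auto
    have tot: "X \<subseteq> Y \<or> Y \<subseteq> X" if "X \<in> C" "Y \<in> C" for X Y
      using C that unfolding subset_chain_def by simp
    have "orthonormal m rep (\<Union>C)"
      unfolding orthonormal_def
    proof (intro conjI ballI)
      fix u assume u: "u \<in> \<Union>C"
      then show "rep u \<in> sq_int m" using CA(1) L2_rep(1) by (meson UnionE subsetD)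
      fix v assume v: "v \<in> \<Union>C"
      obtain X where X: "X \<in> C" "u \<in> X" using u by (rule UnionE)
      obtain Y where Y: "Y \<in> C" "v \<in> Y" using v by (rule UnionE)
      obtain Z where Z: "Z \<in> C" "u \<in> Z" "v \<in> Z" using tot[OF X(1) Y(1)] X Y by blast
      show "ip m (rep u) (rep v) = (if u = v then 1 else 0)"
        using CA(2)[OF Z(1)] Z(2,3) unfolding orthonormal_def by simp
    qed
    moreover have "\<Union>C \<subseteq> L2 m" using CA(1) by (rule Union_least)
    ultimately show "\<Union>C \<in> ?A" by simp
  qed
  then obtain E where E: "E \<subseteq> L2 m" "orthonormal m rep E"
    and max: "\<And>X. X \<subseteq> L2 m \<Longrightarrow> orthonormal m rep X \<Longrightarrow> E \<subseteq> X \<Longrightarrow> X = E" by auto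
  have "u = l2_zero m" if u: "u \<in> L2 m" and 0: "\<And>e. e \<in> E \<Longrightarrow> ip m (rep u) (rep e) = 0" for u
  proof (rule ccontr)
    assume nz: "u \<noteq> l2_zero m"
    let ?f = "rep u"
    have f: "?f \<in> sq_int m" "cls m ?f = u" using L2_rep[OF u] by auto
    have nf: "nm m ?f \<noteq> 0"
    proof
      assume "nm m ?f = 0"
      then have "AE x in m. ?f x = 0" using nm_eq_0_iff[OF f(1)] by simp
      then show False using nz f(2) cls_eqI[of ?f "\<lambda>_. 0" m] by (simp add: l2_zero_def)
    qed
    define g where "g = (\<lambda>x. complex_of_real (1 / nm m ?f) * ?f x)"
    have g: "g \<in> sq_int m" unfolding g_def using f(1) by (rule sq_int_cmult)
    have "nm m g = 1" unfolding g_def nm_cmult using nf by (simp add: norm_divide)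
    then have gg: "ip m g g = 1" by (simp only: nm_eq_1_iff)
    have ge: "ip m g (rep e) = 0" if "e \<in> E" for e
      unfolding g_def ip_cmult_left using 0[OF that] by simp
    let ?v = "cls m g"
    have rv: "AE x in m. rep ?v x = g x" "rep ?v \<in> sq_int m"
      using rep_cls(2)[OF sq_int_measurable[OF g]] rep_cls_sq_int[OF g] by auto
    have vv: "ip m (rep ?v) (rep ?v) = 1"
      using ip_cong_AE[OF rv(2) g rv(2) g rv(1) rv(1)] gg by simp
    have Es: "rep e \<in> sq_int m" if "e \<in> E" for e using E(1) L2_rep(1) that by blast
    have ve: "ip m (rep ?v) (rep e) = 0" if "e \<in> E" for e
      using ip_cong_AE[OF rv(2) g Es[OF that] Es[OF that] rv(1)] ge[OF that] by simp
    have ev: "ip m (rep e) (rep ?v) = 0" if "e \<in> E" for e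
      using ve[OF that] cnj_ip[of m "rep ?v" "rep e"] by simp
    have vE: "?v \<notin> E" using vv ve[of ?v] by auto
    have "orthonormal m rep (insert ?v E)"
      using E(2) rv(2) vv ve ev vE unfolding orthonormal_def by auto
    then have "insert ?v E = E" using E(1) g by (intro max) auto
    then show False using vE by blast
  qed
  moreover have "l2_inner m u v = ip m (rep u) (rep v)" for u v by (simp add: l2_inner_def ip_def)
  ultimately have "l2_orthonormal_basis m E"
    using E unfolding l2_orthonormal_basis_def orthonormal_def by auto
  then show ?thesis by blast
qed

section \<open>Hilbert--Schmidt operators are compact\<close>

lemma summable_on_tail:
  fixes c :: "'i \<Rightarrow> real"
  assumes s: "c summable_on E" and e: "e > 0"
  shows "\<exists>F. finite F \<and> F \<subseteq> E \<and> (\<forall>G. finite G \<and> G \<subseteq> E \<and> G \<inter> F = {} \<longrightarrow> sum c G < e)"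
proof -
  obtain S where "(c has_sum S) E" using s by (auto simp: summable_on_def)
  then have "(sum c \<longlongrightarrow> S) (finite_subsets_at_top E)" by (simp add: has_sum_def)
  then have "\<forall>\<^sub>F F in finite_subsets_at_top E. dist (sum c F) S < e / 2"
    by (rule tendstoD) (use e in simp)
  then obtain F where F: "finite F" "F \<subseteq> E"
    and F': "\<forall>G. finite G \<and> F \<subseteq> G \<and> G \<subseteq> E \<longrightarrow> dist (sum c G) S < e / 2"
    unfolding eventually_finite_subsets_at_top by (elim exE conjE)
  have "sum c G < e" if G: "finite G" "G \<subseteq> E" "G \<inter> F = {}" for G
  proof -
    have "sum c (F \<union> G) = sum c F + sum c G"
      using F G by (intro sum.union_disjoint) auto
    moreover have "dist (sum c (F \<union> G)) S < e / 2" "dist (sum c F) S < e / 2"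
      using F G by (intro F'[rule_format]; auto)+
    ultimately show ?thesis unfolding dist_real_def by linarith
  qed
  then show ?thesis using F by (intro exI[of _ F] conjI allI impI) auto
qed

text \<open>Precompose \<open>T\<close> with the projection onto the span of a finite
  \<open>F\<close> outside of which the square sum is small. On the complement, Cauchy--Schwarz
  between Bessel coefficients and the norms \<open>l2_norm n (T u)\<close> makes \<open>T\<close>
  small, so \<open>T\<close> is a norm limit of finite rank operators.\<close>

theorem hilbert_schmidt_compact:
  assumes "T \<in> hilbert_schmidt_ops m n" shows "T \<in> compact_ops m n"
proof -
  obtain E where T: "T \<in> bounded_ops m n" and E: "l2_orthonormal_basis m E"
    and s: "(\<lambda>u. (l2_norm n (T u))\<^sup>2) summable_on E"
    using assms unfolding hilbert_schmidt_ops_def by blast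
  interpret T: bounded_form m n "bform m n T" "op_norm m n T" by (rule bounded_form_bform[OF T])
  note on = orthonormal_basis_rep(2)[OF E]
  have onG: "orthonormal m rep G" if "G \<subseteq> E" for G
    using on that unfolding orthonormal_def by blast
  have es: "rep u \<in> sq_int m" if "u \<in> E" for u using orthonormalD[OF on that] .
  have ps: "proj m rep G f \<in> sq_int m" if "G \<subseteq> E" for G f using es that by (intro proj_sq_int) blast
  have Tu: "l2_norm n (T u) = nm n (ap m T (rep u))" if "u \<in> E" for u
    using L2_rep(2)[OF orthonormal_basis_rep(1)[OF E that]] by (simp add: ap_def l2_norm_eq)
  show ?thesis
  proof (rule compact_ops_limit[OF T])
    fix e :: real assume e: "e > 0"
    have "(e / 2)\<^sup>2 > 0" using e by simp
    from summable_on_tail[OF s this] obtain F where F: "finite F" "F \<subseteq> E"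
      and tail: "\<forall>G. finite G \<and> G \<subseteq> E \<and> G \<inter> F = {} \<longrightarrow> (\<Sum>u\<in>G. (l2_norm n (T u))\<^sup>2) < (e / 2)\<^sup>2"
      by (elim exE conjE)
    \<comment> \<open>The estimate by the tail is available for finite sums only. So
      \<open>f\<close> is first replaced by its projection to a finite \<open>G\<close> containing
      \<open>F\<close>, at the price of an arbitrary \<open>\<delta>\<close>.\<close>
    have close: "cmod (bform m n T (\<lambda>x. f x - proj m rep F f x) g) \<le> e / 2 * nm m f * nm n g"
      if f: "f \<in> sq_int m" and g: "g \<in> sq_int n" for f g
    proof (rule field_le_epsilon)
      fix \<delta> :: real assume \<delta>: "\<delta> > 0"
      \<comment> \<open>Chosen so that an error \<open>d\<close> in the first argument of the form
        costs at most \<open>\<delta>\<close>.\<close>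
      define d where "d = \<delta> / (op_norm m n T * nm n g + 1)"
      have pos: "op_norm m n T * nm n g + 1 > 0" using T.K_nonneg by (simp add: add_nonneg_pos)
      have d: "d > 0" unfolding d_def using \<delta> pos by (rule divide_pos_pos)
      obtain G0 where G0: "finite G0" "G0 \<subseteq> E" "nm m (\<lambda>x. f x - proj m rep G0 f x) < d"
        using orthonormal_basis_approx[OF E f d] by blast
      define G where "G = F \<union> G0"
      have G: "finite G" "G \<subseteq> E" using F G0 by (auto simp: G_def)
      have "(nm m (\<lambda>x. f x - proj m rep G f x))\<^sup>2 \<le> (nm m (\<lambda>x. f x - proj m rep G0 f x))\<^sup>2"
        unfolding nm_diff_proj_sq[OF onG[OF G(2)] G(1) f] nm_diff_proj_sq[OF onG[OF G0(2)] G0(1) f]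
        using G(1) by (intro diff_left_mono sum_mono2) (auto simp: G_def)
      then have nG: "nm m (\<lambda>x. f x - proj m rep G f x) < d"
        using G0(3) by (meson nm_nonneg order_le_less_trans power2_le_imp_le)
      have split: "f x - proj m rep F f x = (f x - proj m rep G f x) + proj m rep (G - F) f x" for x
      proof -
        have "proj m rep (F \<union> (G - F)) f x = proj m rep F f x + proj m rep (G - F) f x"
          unfolding proj_def using F G by (intro sum.union_disjoint) auto
        then show ?thesis by (simp add: G_def)
      qed
      have p2: "proj m rep (G - F) f \<in> sq_int m" using G by (intro ps) auto
      have "cmod (bform m n T (proj m rep (G - F) f) g) \<le> nm n g * (\<Sum>u\<in>G - F. cmod (ip m f (rep u)) * l2_norm n (T u))"
      proof -
        have "bform m n T (proj m rep (G - F) f) g = (\<Sum>u\<in>G - F. ip m f (rep u) * bform m n T (rep u) g)"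
          unfolding proj_def using es G g by (subst T.sum_left) (auto simp: T.cmult_left subset_iff)
        also have "cmod \<dots> \<le> (\<Sum>u\<in>G - F. cmod (ip m f (rep u) * bform m n T (rep u) g))"
          by (rule norm_sum)
        also have "\<dots> \<le> (\<Sum>u\<in>G - F. cmod (ip m f (rep u)) * (l2_norm n (T u) * nm n g))"
        proof (rule sum_mono)
          fix u assume "u \<in> G - F"
          then have u: "u \<in> E" using G by blast
          have "cmod (bform m n T (rep u) g) \<le> l2_norm n (T u) * nm n g"
            unfolding Tu[OF u] bform_eq_ip[OF T es[OF u] g]
            using norm_ip_le[OF ap_sq_int[OF T es[OF u]] sq_int_cnj[OF g]] by simp
          then show "cmod (ip m f (rep u) * bform m n T (rep u) g) \<le> cmod (ip m f (rep u)) * (l2_norm n (T u) * nm n g)"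
            unfolding norm_mult by (intro mult_left_mono) auto
        qed
        finally show ?thesis by (simp add: sum_distrib_left mult_ac)
      qed
      also have "(\<Sum>u\<in>G - F. cmod (ip m f (rep u)) * l2_norm n (T u)) \<le> nm m f * (e / 2)"
      proof (rule power2_le_imp_le)
        have "(\<Sum>u\<in>G - F. cmod (ip m f (rep u)) * l2_norm n (T u))\<^sup>2
            \<le> (\<Sum>u\<in>G - F. (cmod (ip m f (rep u)))\<^sup>2) * (\<Sum>u\<in>G - F. (l2_norm n (T u))\<^sup>2)"
          by (rule Cauchy_Schwarz_ineq_sum)
        also have "\<dots> \<le> (nm m f)\<^sup>2 * (e / 2)\<^sup>2"
        proof (rule mult_mono)
          show "(\<Sum>u\<in>G - F. (cmod (ip m f (rep u)))\<^sup>2) \<le> (nm m f)\<^sup>2"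
            using G by (intro bessel[OF orthonormal_imp_sub[OF onG] _ f]) auto
          show "(\<Sum>u\<in>G - F. (l2_norm n (T u))\<^sup>2) \<le> (e / 2)\<^sup>2"
            using G by (intro less_imp_le tail[rule_format]) auto
        qed (auto intro: sum_nonneg)
        finally show "(\<Sum>u\<in>G - F. cmod (ip m f (rep u)) * l2_norm n (T u))\<^sup>2 \<le> (nm m f * (e / 2))\<^sup>2"
          by (simp only: power_mult_distrib)
        show "0 \<le> nm m f * (e / 2)" using e by simp
      qed
      finally have b2: "cmod (bform m n T (proj m rep (G - F) f) g) \<le> nm n g * (nm m f * (e / 2))"
        by (simp add: mult_left_mono)
      have "cmod (bform m n T (\<lambda>x. f x - proj m rep G f x) g) \<le> op_norm m n T * d * nm n g"
      proof -
        have "cmod (bform m n T (\<lambda>x. f x - proj m rep G f x) g)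
            \<le> op_norm m n T * nm m (\<lambda>x. f x - proj m rep G f x) * nm n g"
          by (intro T.bound sq_int_diff f g ps G)
        also have "\<dots> \<le> op_norm m n T * d * nm n g"
          using nG T.K_nonneg by (intro mult_right_mono mult_left_mono) auto
        finally show ?thesis .
      qed
      also have "\<dots> \<le> d * (op_norm m n T * nm n g + 1)"
        using d by (simp add: algebra_simps)
      also have "\<dots> = \<delta>" unfolding d_def using pos by (metis less_irrefl nonzero_eq_divide_eq)
      finally have b1: "cmod (bform m n T (\<lambda>x. f x - proj m rep G f x) g) \<le> \<delta>" .
      have "bform m n T (\<lambda>x. f x - proj m rep F f x) g
          = bform m n T (\<lambda>x. f x - proj m rep G f x) g + bform m n T (proj m rep (G - F) f) g"
        unfolding split by (intro T.add_left sq_int_diff f g ps G p2)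
      also have "cmod \<dots> \<le> cmod (bform m n T (\<lambda>x. f x - proj m rep G f x) g) + cmod (bform m n T (proj m rep (G - F) f) g)"
        by (rule norm_triangle_ineq)
      also have "\<dots> \<le> e / 2 * nm m f * nm n g + \<delta>"
        using b1 b2 by (simp add: mult_ac)
      finally show "cmod (bform m n T (\<lambda>x. f x - proj m rep F f x) g) \<le> e / 2 * nm m f * nm n g + \<delta>" .
    qed
    have "bounded_form m n (\<lambda>f g. bform m n T (proj m rep F f) g) (op_norm m n T)"
    proof
      fix f g assume f: "f \<in> sq_int m" and g: "g \<in> sq_int n"
      have "(nm m (proj m rep F f))\<^sup>2 \<le> (nm m f)\<^sup>2"
        unfolding nm_proj_sq[OF onG[OF F(2)] F(1)] by (rule bessel[OF orthonormal_imp_sub[OF onG[OF F(2)]] F(1) f])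
      then have "nm m (proj m rep F f) \<le> nm m f" by (rule power2_le_imp_le) simp
      then have "op_norm m n T * nm m (proj m rep F f) * nm n g \<le> op_norm m n T * nm m f * nm n g"
        using T.K_nonneg by (intro mult_right_mono mult_left_mono) auto
      then show "cmod (bform m n T (proj m rep F f) g) \<le> op_norm m n T * nm m f * nm n g"
        using T.bound[OF ps[OF F(2)] g, of f] by linarith
      fix c
      have "proj m rep F (\<lambda>x. c * f x) = (\<lambda>x. c * proj m rep F f x)"
        by (simp add: proj_def sum_distrib_left mult.assoc)
      then show "bform m n T (proj m rep F (\<lambda>x. c * f x)) g = c * bform m n T (proj m rep F f) g"
        using T.cmult_left[OF ps[OF F(2)] g] by simp
      show "bform m n T (proj m rep F f) (\<lambda>y. c * g y) = c * bform m n T (proj m rep F f) g"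
        using T.cmult_right[OF ps[OF F(2)] g] by simp
    next
      fix f f' g assume f: "f \<in> sq_int m" "f' \<in> sq_int m" and g: "g \<in> sq_int n"
      have "proj m rep F (\<lambda>x. f x + f' x) = (\<lambda>x. proj m rep F f x + proj m rep F f' x)"
        unfolding proj_def sum.distrib[symmetric] distrib_right[symmetric]
        using f es F(2) by (intro ext sum.cong refl) (auto simp: ip_add_left subset_iff)
      then show "bform m n T (proj m rep F (\<lambda>x. f x + f' x)) g
          = bform m n T (proj m rep F f) g + bform m n T (proj m rep F f') g"
        using T.add_left[OF ps[OF F(2)] ps[OF F(2)] g] by simp
    qed (auto intro: T.add_right ps[OF F(2)] T.K_nonneg)
    then obtain S where S: "S \<in> bounded_ops m n"
      and S_eq: "\<And>f g. f \<in> sq_int m \<Longrightarrow> g \<in> sq_int n \<Longrightarrow> bform m n S f g = bform m n T (proj m rep F f) g"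
      using op_of_form by blast
    have "S \<in> compact_ops m n"
    proof (rule compact_ops_finite_rank[OF S F(1), where w = "\<lambda>u. ap m T (rep u)" and \<phi> = "\<lambda>u f. ip m f (rep u)" and C = "\<lambda>u. 1"])
      show "ap m T (rep u) \<in> sq_int n" if "u \<in> F" for u using es F(2) that T by (intro ap_sq_int) auto
      show "bform m n S f g = (\<Sum>u\<in>F. ip m f (rep u) * (\<integral>y. ap m T (rep u) y * g y \<partial>n))"
        if f: "f \<in> sq_int m" and g: "g \<in> sq_int n" for f g
      proof -
        have "bform m n S f g = (\<Sum>u\<in>F. ip m f (rep u) * bform m n T (rep u) g)"
          unfolding S_eq[OF f g] unfolding proj_def using es F g
          by (subst T.sum_left) (auto simp: T.cmult_left subset_iff)
        also have "\<dots> = (\<Sum>u\<in>F. ip m f (rep u) * (\<integral>y. ap m T (rep u) y * g y \<partial>n))"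
          using es F(2) g T by (intro sum.cong refl) (auto simp: bform_eq_ip ip_def subset_iff)
        finally show ?thesis .
      qed
      show "cmod (ip m f (rep u)) \<le> 1" if "u \<in> F" "f \<in> sq_int m" "nm m f \<le> 1" for u f
      proof -
        have u: "u \<in> E" using that F(2) by blast
        have "nm m (rep u) = 1" using on u unfolding orthonormal_def nm_eq_1_iff by simp
        then show ?thesis using norm_ip_le[OF that(2) es[OF u]] that(3) by simp
      qed
    qed
    moreover have "op_norm m n (op_lincomb m n 1 T (-1) S) \<le> e / 2"
    proof (rule op_norm_leI[OF op_lincomb_bounded[OF T S]])
      fix f g assume f: "f \<in> sq_int m" and g: "g \<in> sq_int n"
      have "bform m n (op_lincomb m n 1 T (-1) S) f g = bform m n T (\<lambda>x. f x - proj m rep F f x) g"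
        using f g ps[OF F(2)] by (simp add: bform_op_lincomb[OF T S] S_eq T.diff_left)
      then show "cmod (bform m n (op_lincomb m n 1 T (-1) S) f g) \<le> e / 2 * nm m f * nm n g"
        using close[OF f g] by simp
    qed (use e in simp)
    ultimately show "\<exists>S\<in>compact_ops m n. op_norm m n (op_lincomb m n 1 T (-1) S) < e"
      using e by (intro bexI[of _ S]) auto
  qed
qed

section \<open>Kernel operators are Hilbert--Schmidt and norm dense among the compact
  operators\<close>

context two_sigma_finite
begin

text \<open>Let \<open>?S\<close> be a finite partial sum. It is the integral of the kernel against
  the sum of the tensors \<open>?t u\<close>; these are orthogonal, and their sum has squared norm
  \<open>?S\<close> again. Cauchy--Schwarz bounds \<open>?S\<close> by the norm of \<open>k\<close>
  times the root of \<open>?S\<close>, so every \<open>?S\<close> is at most the squared norm of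
  \<open>k\<close>.\<close>

lemma kop_hilbert_schmidt:
  assumes k: "k \<in> sq_int (m \<Otimes>\<^sub>M n)" shows "kop m n k \<in> hilbert_schmidt_ops m n"
proof -
  let ?T = "kop m n k"
  have T: "?T \<in> bounded_ops m n" by (rule kop_bounded[OF k])
  obtain E where E: "l2_orthonormal_basis m E" using orthonormal_basis_exists by blast
  note on = orthonormal_basis_rep(2)[OF E]
  have es: "rep u \<in> sq_int m" if "u \<in> E" for u using orthonormalD[OF on that] .
  have Tu: "l2_norm n (?T u) = nm n (ap m ?T (rep u))" if "u \<in> E" for u
    using L2_rep(2)[OF orthonormal_basis_rep(1)[OF E that]] by (simp add: ap_def l2_norm_eq)
  have "(\<Sum>u\<in>F. (l2_norm n (?T u))\<^sup>2) \<le> (nm (m \<Otimes>\<^sub>M n) k)\<^sup>2" if F: "finite F" "F \<subseteq> E" for F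
  proof -
    let ?S = "\<Sum>u\<in>F. (l2_norm n (?T u))\<^sup>2"
    let ?t = "\<lambda>u. tensor (rep u) (\<lambda>y. cnj (ap m ?T (rep u) y))"
    have Ts: "(\<lambda>y. cnj (ap m ?T (rep u) y)) \<in> sq_int n" if "u \<in> F" for u
      using that F es T by (intro sq_int_cnj ap_sq_int) auto
    have eF: "rep u \<in> sq_int m" if "u \<in> F" for u using that F es by blast
    have ts: "?t u \<in> sq_int (m \<Otimes>\<^sub>M n)" if "u \<in> F" for u
      using that by (intro tensor_sq_int Ts eF)
    have "complex_of_real ?S = (\<Sum>u\<in>F. bform m n ?T (rep u) (\<lambda>y. cnj (ap m ?T (rep u) y)))"
      unfolding of_real_sum using F by (intro sum.cong refl) (auto simp: nm_ap_sq_eq_bform[OF T eF] Tu)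
    also have "\<dots> = (\<Sum>u\<in>F. \<integral>z. k z * ?t u z \<partial>(m \<Otimes>\<^sub>M n))"
      using Ts eF by (intro sum.cong refl) (simp add: bform_kop[OF k] kform_def)
    also have "\<dots> = (\<integral>z. k z * (\<Sum>u\<in>F. ?t u z) \<partial>(m \<Otimes>\<^sub>M n))"
      unfolding sum_distrib_left using k ts
      by (intro Bochner_Integration.integral_sum[symmetric] integrable_sq_mult)
    finally have eq: "complex_of_real ?S = (\<integral>z. k z * (\<Sum>u\<in>F. ?t u z) \<partial>(m \<Otimes>\<^sub>M n))" .
    have "cmod (complex_of_real ?S) \<le> nm (m \<Otimes>\<^sub>M n) k * nm (m \<Otimes>\<^sub>M n) (\<lambda>z. \<Sum>u\<in>F. ?t u z)"
      unfolding eq by (rule norm_integral_mult_le[OF k sq_int_sum[of F ?t, OF ts]])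
    then have absS: "\<bar>?S\<bar> \<le> nm (m \<Otimes>\<^sub>M n) k * nm (m \<Otimes>\<^sub>M n) (\<lambda>z. \<Sum>u\<in>F. ?t u z)"
      by (simp only: norm_of_real)
    have nmS: "(nm (m \<Otimes>\<^sub>M n) (\<lambda>z. \<Sum>u\<in>F. ?t u z))\<^sup>2 = ?S"
    proof -
      have "(nm (m \<Otimes>\<^sub>M n) (\<lambda>z. \<Sum>u\<in>F. ?t u z))\<^sup>2 = (\<Sum>u\<in>F. (nm (m \<Otimes>\<^sub>M n) (?t u))\<^sup>2)"
      proof (rule nm_sum_orthogonal[OF F(1) ts])
        fix u v assume uv: "u \<in> F" "v \<in> F" "u \<noteq> v"
        then have "ip m (rep u) (rep v) = 0" using on F(2) unfolding orthonormal_def by (auto simp: subset_iff)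
        then show "ip (m \<Otimes>\<^sub>M n) (?t u) (?t v) = 0"
          using uv by (simp add: ip_tensor eF Ts)
      qed
      also have "\<dots> = ?S"
      proof (rule sum.cong[OF refl])
        fix u assume u: "u \<in> F"
        then have uE: "u \<in> E" using F by blast
        have "nm m (rep u) = 1" using on uE unfolding orthonormal_def nm_eq_1_iff by simp
        then show "(nm (m \<Otimes>\<^sub>M n) (?t u))\<^sup>2 = (l2_norm n (?T u))\<^sup>2"
          by (simp add: nm_tensor eF[OF u] Ts[OF u] Tu[OF uE])
      qed
      finally show ?thesis .
    qed
    then have le: "(nm (m \<Otimes>\<^sub>M n) (\<lambda>z. \<Sum>u\<in>F. ?t u z))\<^sup>2
        \<le> nm (m \<Otimes>\<^sub>M n) k * nm (m \<Otimes>\<^sub>M n) (\<lambda>z. \<Sum>u\<in>F. ?t u z)"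
      using absS by linarith
    have "nm (m \<Otimes>\<^sub>M n) (\<lambda>z. \<Sum>u\<in>F. ?t u z) \<le> nm (m \<Otimes>\<^sub>M n) k"
    proof (cases "nm (m \<Otimes>\<^sub>M n) (\<lambda>z. \<Sum>u\<in>F. ?t u z) = 0")
      case False
      then have "nm (m \<Otimes>\<^sub>M n) (\<lambda>z. \<Sum>u\<in>F. ?t u z) > 0"
        using nm_nonneg[of "m \<Otimes>\<^sub>M n" "\<lambda>z. \<Sum>u\<in>F. ?t u z"] by linarith
      then show ?thesis using le unfolding power2_eq_square by simp
    qed simp
    then have "(nm (m \<Otimes>\<^sub>M n) (\<lambda>z. \<Sum>u\<in>F. ?t u z))\<^sup>2 \<le> (nm (m \<Otimes>\<^sub>M n) k)\<^sup>2"
      by (rule power_mono) simp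
    then show ?thesis unfolding nmS .
  qed
  then have "(\<lambda>u. (l2_norm n (?T u))\<^sup>2) summable_on E"
    by (intro nonneg_bdd_above_summable_on) (auto intro!: bdd_aboveI2)
  then show ?thesis unfolding hilbert_schmidt_ops_def using T E by blast
qed

lemma kop_compact: "k \<in> sq_int (m \<Otimes>\<^sub>M n) \<Longrightarrow> kop m n k \<in> compact_ops m n"
  by (rule hilbert_schmidt_compact[OF kop_hilbert_schmidt])

text \<open>Let \<open>q\<close> be an orthonormal family spanning an \<open>e\<close>-net of the
  image of the unit ball. Following \<open>T\<close> by the projection onto this span changes it by
  at most \<open>e\<close>, and the product is the kernel operator of a finite sum of tensors, with
  one factor \<open>q j\<close> and the other representing the \<open>q j\<close> coefficient of
  \<open>T\<close>.\<close>

lemma compact_approx_kop: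
  assumes T: "T \<in> compact_ops m n" and e: "e > 0"
  shows "\<exists>k\<in>sq_int (m \<Otimes>\<^sub>M n). op_norm m n (op_lincomb m n 1 T (-1) (kop m n k)) \<le> e"
proof -
  have Tb: "T \<in> bounded_ops m n" by (rule compact_ops_bounded[OF T])
  interpret T: bounded_form m n "bform m n T" "op_norm m n T" by (rule bounded_form_bform[OF Tb])
  obtain W where W: "finite W" "W \<subseteq> sq_int n"
    and net: "\<forall>f\<in>sq_int m. nm m f \<le> 1 \<longrightarrow> (\<exists>w\<in>W. nm n (\<lambda>y. ap m T f y - w y) < e)"
    using conjunct2[OF T[unfolded compact_ops_iff], rule_format, OF e] by (elim exE conjE)
  obtain r :: nat and w where w: "W = w ` {i. i < r}"
    using finite_imp_nat_seg_image_inj_on[OF W(1)] by blast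
  have ws: "w i \<in> sq_int n" if "i < r" for i using W(2) that unfolding w by blast
  obtain N :: nat and q where q: "orthonormal n q {..<N}"
    and null: "\<And>i. i < r \<Longrightarrow> nm n (\<lambda>x. w i x - proj n q {..<N} (w i) x) = 0"
    using gram_schmidt[of r w n, OF ws] by blast
  have qs: "q j \<in> sq_int n" if "j < N" for j using orthonormalD[OF q] that by auto
  have "\<exists>a. a \<in> sq_int m \<and> (\<forall>f\<in>sq_int m. bform m n T f (\<lambda>y. cnj (q j y)) = (\<integral>x. a x * f x \<partial>m))" if j: "j < N" for j
  proof (rule riesz_representation[of m "\<lambda>f. bform m n T f (\<lambda>y. cnj (q j y))" "op_norm m n T * nm n (q j)"])
    have c: "(\<lambda>y. cnj (q j y)) \<in> sq_int n" using qs[OF j] by auto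
    show "bform m n T (\<lambda>x. f x + g x) (\<lambda>y. cnj (q j y)) = bform m n T f (\<lambda>y. cnj (q j y)) + bform m n T g (\<lambda>y. cnj (q j y))"
      if "f \<in> sq_int m" "g \<in> sq_int m" for f g using that c by (intro T.add_left)
    show "bform m n T (\<lambda>x. b * f x) (\<lambda>y. cnj (q j y)) = b * bform m n T f (\<lambda>y. cnj (q j y))"
      if "f \<in> sq_int m" for f b using that c by (intro T.cmult_left)
    show "cmod (bform m n T f (\<lambda>y. cnj (q j y))) \<le> op_norm m n T * nm n (q j) * nm m f" if "f \<in> sq_int m" for f
      using T.bound[OF that c] by (simp add: mult_ac)
    show "0 \<le> op_norm m n T * nm n (q j)" using T.K_nonneg by simp
    fix u assume u: "u \<in> sq_int m" "\<And>f. f \<in> sq_int m \<Longrightarrow> bform m n T f (\<lambda>y. cnj (q j y)) = ip m f u"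
    show ?thesis
      using u(1) by (intro exI[of _ "\<lambda>x. cnj (u x)"]) (auto simp: u(2) ip_def mult.commute)
  qed
  then have "\<forall>j\<in>{..<N}. \<exists>a. a \<in> sq_int m \<and> (\<forall>f\<in>sq_int m. bform m n T f (\<lambda>y. cnj (q j y)) = (\<integral>x. a x * f x \<partial>m))"
    by blast
  from bchoice[OF this] obtain a where
    a: "\<forall>j\<in>{..<N}. a j \<in> sq_int m \<and> (\<forall>f\<in>sq_int m. bform m n T f (\<lambda>y. cnj (q j y)) = (\<integral>x. a j x * f x \<partial>m))"
    by blast
  have as: "a j \<in> sq_int m" if "j < N" for j using a that by blast
  have aeq: "(\<integral>x. a j x * f x \<partial>m) = ip n (ap m T f) (q j)" if "j < N" "f \<in> sq_int m" for j f
  proof -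
    have "(\<integral>x. a j x * f x \<partial>m) = bform m n T f (\<lambda>y. cnj (q j y))" using a that by simp
    also have "\<dots> = ip n (ap m T f) (q j)"
      unfolding bform_eq_ip[OF Tb that(2) sq_int_cnj[OF qs[OF that(1)]]] by simp
    finally show ?thesis .
  qed
  define k where "k = (\<lambda>z. \<Sum>j<N. tensor (a j) (q j) z)"
  have ks: "k \<in> sq_int (m \<Otimes>\<^sub>M n)" unfolding k_def using as qs by auto
  let ?R = "op_lincomb m n 1 T (-1) (kop m n k)"
  have R: "?R \<in> bounded_ops m n" by (intro op_lincomb_bounded Tb kop_bounded ks)
  have kf: "kform m n k f g = ip n (proj n q {..<N} (ap m T f)) (\<lambda>y. cnj (g y))"
    if f: "f \<in> sq_int m" and g: "g \<in> sq_int n" for f g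
  proof -
    have "kform m n k f g = (\<Sum>j<N. kform m n (tensor (a j) (q j)) f g)"
      unfolding k_def by (intro kform_sum integrable_sq_mult tensor_sq_int as qs f g) auto
    also have "\<dots> = (\<Sum>j<N. ip n (ap m T f) (q j) * (\<integral>y. q j y * g y \<partial>n))"
      by (intro sum.cong refl) (simp add: kform_tensor as qs f g aeq)
    also have "\<dots> = ip n (proj n q {..<N} (ap m T f)) (\<lambda>y. cnj (g y))"
      unfolding proj_def using qs g by (subst ip_sum_left) (auto simp: ip_def)
    finally show ?thesis .
  qed
  have bR: "bform m n ?R f g = ip n (\<lambda>y. ap m T f y - proj n q {..<N} (ap m T f) y) (\<lambda>y. cnj (g y))"
    if f: "f \<in> sq_int m" and g: "g \<in> sq_int n" for f g
  proof -
    have "proj n q {..<N} (ap m T f) \<in> sq_int n" using qs by (intro proj_sq_int) auto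
    from ip_diff_left[OF ap_sq_int[OF Tb f] this sq_int_cnj[OF g]] show ?thesis
      by (simp add: bform_op_lincomb[OF Tb kop_bounded[OF ks] f g] bform_kop[OF ks f g] kf[OF f g]
          bform_eq_ip[OF Tb f g])
  qed
  have "op_norm m n ?R \<le> e"
    unfolding op_norm_def
  proof (rule cSUP_least)
    have "l2_zero m \<in> {u \<in> L2 m. l2_norm m u \<le> 1}" by (simp add: l2_zero_def)
    then show "{u \<in> L2 m. l2_norm m u \<le> 1} \<noteq> {}" by blast
    fix u assume "u \<in> {u \<in> L2 m. l2_norm m u \<le> 1}"
    then have f: "rep u \<in> sq_int m" "nm m (rep u) \<le> 1" "cls m (rep u) = u"
      by (auto simp: L2_rep l2_norm_eq)
    let ?t = "ap m T (rep u)"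
    have ts: "?t \<in> sq_int n" using Tb f by auto
    have pq: "proj n q {..<N} h \<in> sq_int n" for h using qs by (intro proj_sq_int) auto
    obtain i where i: "i < r" "nm n (\<lambda>y. ?t y - w i y) < e"
      using net f(1,2) unfolding w by blast
    \<comment> \<open>Apply the complementary projection to \<open>?t = (?t - w i) + w i\<close>: it
      does not increase the norm of the first part, which is less than \<open>e\<close>, and it
      annihilates the net point.\<close>
    have "?t y - proj n q {..<N} ?t y = (?t y - w i y - proj n q {..<N} (\<lambda>y. ?t y - w i y) y)
        + (w i y - proj n q {..<N} (w i) y)" for y
      using ts ws[OF i(1)] qs
      by (simp add: proj_def ip_diff_left left_diff_distrib sum_subtractf)
    then have "nm n (\<lambda>y. ?t y - proj n q {..<N} ?t y)
        \<le> nm n (\<lambda>y. ?t y - w i y - proj n q {..<N} (\<lambda>y. ?t y - w i y) y) + nm n (\<lambda>y. w i y - proj n q {..<N} (w i) y)"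
      by (simp only:) (intro nm_triangle sq_int_diff ts ws i pq)
    also have "\<dots> \<le> nm n (\<lambda>y. ?t y - w i y) + 0"
      using null[OF i(1)] by (intro add_mono nm_diff_proj_le[OF q] sq_int_diff ts ws i) auto
    finally have ne: "nm n (\<lambda>y. ?t y - proj n q {..<N} ?t y) \<le> e" using i(2) by linarith
    have "nm n (ap m ?R (rep u)) \<le> e"
    proof (rule nm_ap_leI[OF R f(1)])
      fix g assume g: "g \<in> sq_int n"
      have "cmod (bform m n ?R (rep u) g) \<le> nm n (\<lambda>y. ?t y - proj n q {..<N} ?t y) * nm n (\<lambda>y. cnj (g y))"
        unfolding bR[OF f(1) g] by (intro norm_ip_le sq_int_diff ts pq sq_int_cnj g)
      also have "\<dots> \<le> e * nm n g" using ne by (simp add: mult_right_mono)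
      finally show "cmod (bform m n ?R (rep u) g) \<le> e * nm n g" .
    qed (use e in simp)
    then show "l2_norm n (?R u) \<le> e" by (simp add: ap_def f(3) l2_norm_eq)
  qed
  with ks show ?thesis by blast
qed

end

section \<open>Singular values and the trace class\<close>

lemma compact_ops_convergent_subseq:
  assumes T: "T \<in> compact_ops m n" and f: "\<And>j. f j \<in> sq_int m" "\<And>j::nat. nm m (f j) \<le> 1"
  obtains r w where "strict_mono (r :: nat \<Rightarrow> nat)" "w \<in> sq_int n"
    "(\<lambda>j. nm n (\<lambda>y. ap m T (f (r j)) y - w y)) \<longlonglongrightarrow> 0"
proof -
  interpret Metric_space "L2 n" "l2_dist n" by (rule Metric_space_L2)
  have Tb: "T \<in> bounded_ops m n" by (rule compact_ops_bounded[OF T])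
  let ?D = "{u \<in> L2 m. l2_norm m u \<le> 1}"
  have "T ` ?D \<subseteq> L2 n" using bounded_ops_L2[OF Tb] by blast
  moreover have "compactin mtopology (mtopology closure_of (T ` ?D))"
    using T unfolding compact_ops_def l2_topology_def by blast
  ultimately have tb: "mtotally_bounded (T ` ?D)"
    by (intro compact_closure_of_imp_mtotally_bounded)
  define \<sigma> where "\<sigma> j = T (cls m (f j))" for j
  have "range \<sigma> \<subseteq> T ` ?D" unfolding \<sigma>_def using f by auto
  then have "\<exists>r :: nat \<Rightarrow> nat. strict_mono r \<and> MCauchy (\<sigma> \<circ> r)"
    by (rule conjunct2[OF tb[unfolded mtotally_bounded_sequentially], rule_format])
  then obtain r :: "nat \<Rightarrow> nat" where r: "strict_mono r" "MCauchy (\<sigma> \<circ> r)"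
    by (elim exE conjE)
  have "\<exists>N. \<forall>i\<ge>N. \<forall>j\<ge>N. nm n (\<lambda>y. ap m T (f (r i)) y - ap m T (f (r j)) y) < e" if "e > 0" for e
    using conjunct2[OF r(2)[unfolded MCauchy_def], rule_format, OF that]
    by (simp add: \<sigma>_def l2_dist_eq ap_def)
  then obtain w where "w \<in> sq_int n" "(\<lambda>j. nm n (\<lambda>y. ap m T (f (r j)) y - w y)) \<longlonglongrightarrow> 0"
    by (rule sq_int_complete[OF ap_sq_int[OF Tb f(1)]])
  with r(1) show ?thesis by (rule that)
qed

text \<open>
  If \<open>f (r j)\<close> is a maximizing sequence whose images converge to \<open>w\<close>, then it converges itself, to the
  multiple \<open>f0\<close> of the image of \<open>w\<close> under the adjoint.
\<close>

lemma compact_norm_attained: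
  assumes T: "T \<in> compact_ops m n" and s: "op_norm m n T > 0"
  shows "\<exists>f g. f \<in> sq_int m \<and> g \<in> sq_int n \<and> nm m f = 1 \<and> nm n g = 1 \<and>
    (\<forall>f'\<in>sq_int m. bform m n T f' g = op_norm m n T * ip m f' f) \<and>
    (\<forall>g'\<in>sq_int n. bform m n T f g' = op_norm m n T * ip n g' g)"
proof -
  let ?s = "op_norm m n T"
  have Tb: "T \<in> bounded_ops m n" by (rule compact_ops_bounded[OF T])
  interpret T: bounded_form m n "bform m n T" ?s by (rule bounded_form_bform[OF Tb])
  have "\<exists>f\<in>sq_int m. nm m f \<le> 1 \<and> ?s - inverse (real (Suc j)) < nm n (ap m T f)" for j
  proof -
    have ne: "(\<lambda>u. l2_norm n (T u)) ` {u \<in> L2 m. l2_norm m u \<le> 1} \<noteq> {}"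
    proof -
      have "l2_zero m \<in> {u \<in> L2 m. l2_norm m u \<le> 1}" by (simp add: l2_zero_def)
      then show ?thesis by blast
    qed
    have "?s - inverse (real (Suc j)) < Sup ((\<lambda>u. l2_norm n (T u)) ` {u \<in> L2 m. l2_norm m u \<le> 1})"
      unfolding op_norm_def by simp
    from less_cSupD[OF ne this] obtain u where u: "u \<in> L2 m" "l2_norm m u \<le> 1"
      "?s - inverse (real (Suc j)) < l2_norm n (T u)" by auto
    then show ?thesis
      using L2_rep[OF u(1)] by (intro bexI[of _ "rep u"]) (auto simp: ap_def l2_norm_eq)
  qed
  then have "\<forall>j. \<exists>f. f \<in> sq_int m \<and> nm m f \<le> 1 \<and> ?s - inverse (real (Suc j)) < nm n (ap m T f)"
    by blast
  from choice[OF this] obtain f where f: "\<And>j. f j \<in> sq_int m" "\<And>j. nm m (f j) \<le> 1"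
    "\<And>j. ?s - inverse (real (Suc j)) < nm n (ap m T (f j))" by blast
  obtain r w where r: "strict_mono (r :: nat \<Rightarrow> nat)" and w: "w \<in> sq_int n"
    and lim: "(\<lambda>j. nm n (\<lambda>y. ap m T (f (r j)) y - w y)) \<longlonglongrightarrow> 0"
    by (rule compact_ops_convergent_subseq[OF T f(1,2)])
  have up: "nm n (ap m T (f j)) \<le> ?s" for j
  proof -
    have "nm n (ap m T (f j)) \<le> ?s * nm m (f j)" by (rule nm_ap_le[OF Tb f(1)])
    also have "\<dots> \<le> ?s * 1" using f(2) T.K_nonneg by (rule mult_left_mono)
    finally show ?thesis by simp
  qed
  have "(\<lambda>j. nm n (ap m T (f (r j)))) \<longlonglongrightarrow> ?s"
  proof (rule tendsto_sandwich[OF _ _ _ tendsto_const])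
    show "(\<lambda>j. ?s - inverse (real (Suc (r j)))) \<longlonglongrightarrow> ?s"
      using tendsto_diff[OF tendsto_const LIMSEQ_subseq_LIMSEQ[OF LIMSEQ_inverse_real_of_nat r], of ?s]
      by (simp add: comp_def)
    show "\<forall>\<^sub>F j in sequentially. ?s - inverse (real (Suc (r j))) \<le> nm n (ap m T (f (r j)))"
      using f(3) by (intro always_eventually allI less_imp_le)
    show "\<forall>\<^sub>F j in sequentially. nm n (ap m T (f (r j))) \<le> ?s"
      using up by (intro always_eventually allI)
  qed
  with tendsto_nm[OF ap_sq_int[OF Tb f(1)] w lim] have nw: "nm n w = ?s"
    by (rule LIMSEQ_unique)
  have wc: "(\<lambda>y. cnj (w y)) \<in> sq_int n" using w by auto
  obtain a where a: "a \<in> sq_int m" "\<And>f'. f' \<in> sq_int m \<Longrightarrow> bform m n T f' (\<lambda>y. cnj (w y)) = ip m f' a"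
    "nm m a \<le> ?s * ?s"
  proof (rule riesz_representation[of m "\<lambda>f'. bform m n T f' (\<lambda>y. cnj (w y))" "?s * ?s"])
    show "cmod (bform m n T f' (\<lambda>y. cnj (w y))) \<le> ?s * ?s * nm m f'" if "f' \<in> sq_int m" for f'
      using T.bound[OF that wc] by (simp add: nw mult_ac)
  qed (use wc in \<open>auto intro: T.add_left T.cmult_left\<close>)
  have ipa: "ip n (ap m T f') w = ip m f' a" if "f' \<in> sq_int m" for f'
    using a(2)[OF that] bform_eq_ip[OF Tb that wc] by simp
  \<comment> \<open>Here \<open>a\<close> is the image of \<open>w\<close> under the adjoint, of
    norm at most \<open>?s * ?s\<close>; dividing by the square of \<open>?s\<close> puts
    \<open>f0\<close> in the unit ball.\<close>
  define f0 where "f0 = (\<lambda>x. complex_of_real (1 / ?s\<^sup>2) * a x)"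
  have f0: "f0 \<in> sq_int m" unfolding f0_def using a(1) by (rule sq_int_cmult)
  have a_f0: "ip m f' a = ?s\<^sup>2 * ip m f' f0" for f'
    unfolding f0_def ip_cmult_right using s by simp
  have nf0: "nm m f0 \<le> 1"
    unfolding f0_def nm_cmult norm_of_real using a(3) s by (simp add: divide_le_eq power2_eq_square)
  have "(\<lambda>j. nm m (\<lambda>x. f (r j) x - f0 x)) \<longlonglongrightarrow> 0"
  proof -
    \<comment> \<open>Both vectors have norm at most one, so their distance is governed by their
      inner product. Moving the adjoint back expresses it through the inner product of
      \<open>ap m T (f (r j))\<close> with \<open>w\<close>, which converges to the square of
      \<open>?s\<close>.\<close>
    have le: "(nm m (\<lambda>x. f (r j) x - f0 x))\<^sup>2 \<le> 2 - 2 * Re (ip n (ap m T (f (r j))) w) / ?s\<^sup>2" for j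
    proof -
      have "Re (ip m (f (r j)) f0) = Re (ip n (ap m T (f (r j))) w) / ?s\<^sup>2"
        unfolding ipa[OF f(1)] a_f0 using s by simp
      moreover have "(nm m (f (r j)))\<^sup>2 \<le> 1" "(nm m f0)\<^sup>2 \<le> 1"
        using f(2) nf0 by (auto intro: power_le_one)
      ultimately show ?thesis unfolding nm_diff_sq[OF f(1) f0] by simp
    qed
    have "(\<lambda>j. 2 - 2 * Re (ip n (ap m T (f (r j))) w) / ?s\<^sup>2) \<longlonglongrightarrow> 2 - 2 * Re (ip n w w) / ?s\<^sup>2"
      using s by (intro tendsto_intros tendsto_ip(2) ap_sq_int[OF Tb f(1)] w lim) auto
    also have "2 - 2 * Re (ip n w w) / ?s\<^sup>2 = 0"
      unfolding ip_self nw using s by simp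
    finally have "(\<lambda>j. (nm m (\<lambda>x. f (r j) x - f0 x))\<^sup>2) \<longlonglongrightarrow> 0"
      by (rule Lim_null_comparison[rotated]) (use le in auto)
    then have "(\<lambda>j. sqrt ((nm m (\<lambda>x. f (r j) x - f0 x))\<^sup>2)) \<longlonglongrightarrow> sqrt 0"
      by (rule tendsto_real_sqrt)
    then show ?thesis by simp
  qed
  then have lim0: "(\<lambda>j. ?s * nm m (\<lambda>x. f (r j) x - f0 x)) \<longlonglongrightarrow> 0"
    using tendsto_mult_right_zero by blast
  have Tf0: "bform m n T f0 g' = ip n w (\<lambda>y. cnj (g' y))" if g': "g' \<in> sq_int n" for g'
  proof (rule LIMSEQ_unique)
    show "(\<lambda>j. bform m n T (f (r j)) g') \<longlonglongrightarrow> ip n w (\<lambda>y. cnj (g' y))"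
      unfolding bform_eq_ip[OF Tb f(1) g']
      by (intro tendsto_ip(2) ap_sq_int[OF Tb f(1)] w lim sq_int_cnj g')
    have "(\<lambda>j. bform m n T (f (r j)) g' - bform m n T f0 g') \<longlonglongrightarrow> 0"
    proof (rule Lim_null_comparison)
      show "\<forall>\<^sub>F j in sequentially. norm (bform m n T (f (r j)) g' - bform m n T f0 g')
          \<le> ?s * nm m (\<lambda>x. f (r j) x - f0 x) * nm n g'"
        using T.bound[OF sq_int_diff[OF f(1) f0] g'] by (simp add: T.diff_left[OF f(1) f0 g'])
      show "(\<lambda>j. ?s * nm m (\<lambda>x. f (r j) x - f0 x) * nm n g') \<longlonglongrightarrow> 0"
        using tendsto_mult_left_zero[OF lim0] .
    qed
    then show "(\<lambda>j. bform m n T (f (r j)) g') \<longlonglongrightarrow> bform m n T f0 g'" by (simp add: LIM_zero_iff)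
  qed
  have "?s\<^sup>2 \<le> ?s * nm m f0 * ?s"
  proof -
    \<comment> \<open>The image of \<open>f0\<close> is \<open>w\<close>, of norm \<open>?s\<close>.
      Pairing it with \<open>w\<close> and using the norm bound of the form forces
      \<open>nm m f0\<close> to be at least one.\<close>
    have "complex_of_real (?s\<^sup>2) = bform m n T f0 (\<lambda>y. cnj (w y))"
      unfolding Tf0[OF wc] using ip_self[of n w] by (simp add: nw)
    then have "cmod (bform m n T f0 (\<lambda>y. cnj (w y))) = ?s\<^sup>2"
      by (metis abs_power2 norm_of_real)
    then show ?thesis using T.bound[OF f0 wc] by (simp add: nw)
  qed
  then have "?s\<^sup>2 * 1 \<le> ?s\<^sup>2 * nm m f0" by (simp add: power2_eq_square mult_ac)
  then have "1 \<le> nm m f0" using s by simp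
  with nf0 have nf1: "nm m f0 = 1" by simp
  \<comment> \<open>The conjugate of the normalized image, since the form is bilinear.\<close>
  define g0 where "g0 = (\<lambda>y. complex_of_real (1 / ?s) * cnj (w y))"
  have g0: "g0 \<in> sq_int n" unfolding g0_def using wc by (rule sq_int_cmult)
  have "nm n g0 = 1" unfolding g0_def nm_cmult using s by (simp add: nw norm_divide)
  moreover have "bform m n T f' g0 = ?s * ip m f' f0" if "f' \<in> sq_int m" for f'
    unfolding g0_def T.cmult_right[OF that wc] a(2)[OF that] a_f0
    using s by (simp add: power2_eq_square)
  moreover have "bform m n T f0 g' = ?s * ip n g' g0" if g': "g' \<in> sq_int n" for g'
  proof -
    have "ip n g' g0 = complex_of_real (1 / ?s) * ip n g' (\<lambda>y. cnj (w y))"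
      unfolding g0_def ip_cmult_right by simp
    also have "ip n g' (\<lambda>y. cnj (w y)) = ip n w (\<lambda>y. cnj (g' y))" by (simp add: ip_def mult.commute)
    finally show ?thesis unfolding Tf0[OF g'] using s by simp
  qed
  ultimately show ?thesis using f0 g0 nf1 by blast
qed

section \<open>Singular value decomposition of kernels\<close>

context two_sigma_finite
begin

text \<open>Singular vectors for the largest singular value. For a zero operator both are set to
  zero, so that the recursion below can run on forever and simply adds zero terms.\<close>

definition singular_pair :: "('x \<times> 'y \<Rightarrow> complex) \<Rightarrow> ('x \<Rightarrow> complex) \<times> ('y \<Rightarrow> complex) \<Rightarrow> bool" where
  "singular_pair A p \<longleftrightarrow> fst p \<in> sq_int m \<and> snd p \<in> sq_int n \<and>
     nm m (fst p) \<le> 1 \<and> nm n (snd p) \<le> 1 \<and>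
     (\<forall>f\<in>sq_int m. kform m n A f (snd p) = op_norm m n (kop m n A) * ip m f (fst p)) \<and>
     (\<forall>g\<in>sq_int n. kform m n A (fst p) g = op_norm m n (kop m n A) * ip n g (snd p)) \<and>
     (op_norm m n (kop m n A) \<noteq> 0 \<longrightarrow> nm m (fst p) = 1 \<and> nm n (snd p) = 1) \<and>
     (op_norm m n (kop m n A) = 0 \<longrightarrow> fst p = (\<lambda>_. 0) \<and> snd p = (\<lambda>_. 0))"

lemma kform_le_op_norm:
  "A \<in> sq_int (m \<Otimes>\<^sub>M n) \<Longrightarrow> f \<in> sq_int m \<Longrightarrow> g \<in> sq_int n \<Longrightarrow>
    cmod (kform m n A f g) \<le> op_norm m n (kop m n A) * nm m f * nm n g"
  using bform_bound[OF kop_bounded] by (metis bform_kop)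

lemma singular_pair_exists:
  assumes A: "A \<in> sq_int (m \<Otimes>\<^sub>M n)" shows "\<exists>p. singular_pair A p"
proof (cases "op_norm m n (kop m n A) = 0")
  case True
  interpret bounded_form m n "kform m n A" "nm (m \<Otimes>\<^sub>M n) A" by (rule bounded_form_kform[OF A])
  show ?thesis
    using True by (intro exI[of _ "(\<lambda>_. 0, \<lambda>_. 0)"]) (simp add: singular_pair_def)
next
  case False
  then have "op_norm m n (kop m n A) > 0" using op_norm_nonneg[OF kop_bounded[OF A]] by linarith
  from compact_norm_attained[OF kop_compact[OF A] this] obtain f g where fg: "f \<in> sq_int m" "g \<in> sq_int n"
    "nm m f = 1" "nm n g = 1"
    "\<forall>f'\<in>sq_int m. bform m n (kop m n A) f' g = op_norm m n (kop m n A) * ip m f' f"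
    "\<forall>g'\<in>sq_int n. bform m n (kop m n A) f g' = op_norm m n (kop m n A) * ip n g' g"
    by blast
  show ?thesis
    using fg False by (intro exI[of _ "(f, g)"]) (simp add: singular_pair_def bform_kop[OF A])
qed

text \<open>Bessel's inequality in both variables, joined by Cauchy--Schwarz. For orthonormal
  families the operator is a partial isometry; these are the test operators by which the trace norm
  is computed.\<close>

lemma op_norm_partial_isometry:
  assumes f: "sub_orthonormal m f {..<N::nat}" and g: "sub_orthonormal n g {..<N}"
  shows "op_norm m n (kop m n (\<lambda>z. \<Sum>i<N. tensor (f i) (g i) z)) \<le> 1"
proof -
  have fs: "f i \<in> sq_int m" and gs: "g i \<in> sq_int n" if "i < N" for i
    using f g that by (auto simp: sub_orthonormal_def)
  have ks: "(\<lambda>z. \<Sum>i<N. tensor (f i) (g i) z) \<in> sq_int (m \<Otimes>\<^sub>M n)" using fs gs by auto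
  show ?thesis
  proof (rule op_norm_leI[OF kop_bounded[OF ks]])
    fix u v assume u: "u \<in> sq_int m" and v: "v \<in> sq_int n"
    have uc: "(\<lambda>x. cnj (u x)) \<in> sq_int m" and vc: "(\<lambda>y. cnj (v y)) \<in> sq_int n" using u v by auto
    let ?a = "\<lambda>i. cmod (ip m (\<lambda>x. cnj (u x)) (f i))" and ?b = "\<lambda>i. cmod (ip n (\<lambda>y. cnj (v y)) (g i))"
    have "kform m n (\<lambda>z. \<Sum>i<N. tensor (f i) (g i) z) u v = (\<Sum>i<N. kform m n (tensor (f i) (g i)) u v)"
      by (intro kform_sum integrable_sq_mult tensor_sq_int fs gs u v) auto
    also have "\<dots> = (\<Sum>i<N. cnj (ip m (\<lambda>x. cnj (u x)) (f i)) * cnj (ip n (\<lambda>y. cnj (v y)) (g i)))"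
      by (intro sum.cong refl) (simp add: kform_tensor fs gs u v cnj_ip, simp add: ip_def)
    also have "cmod \<dots> \<le> (\<Sum>i<N. ?a i * ?b i)"
      by (rule order_trans[OF norm_sum]) (simp add: norm_mult)
    also have "\<dots> \<le> nm m u * nm n v"
    proof (rule power2_le_imp_le)
      have "(\<Sum>i<N. ?a i * ?b i)\<^sup>2 \<le> (\<Sum>i<N. (?a i)\<^sup>2) * (\<Sum>i<N. (?b i)\<^sup>2)" by (rule Cauchy_Schwarz_ineq_sum)
      also have "\<dots> \<le> (nm m (\<lambda>x. cnj (u x)))\<^sup>2 * (nm n (\<lambda>y. cnj (v y)))\<^sup>2"
        by (intro mult_mono bessel f g uc vc sum_nonneg) auto
      finally show "(\<Sum>i<N. ?a i * ?b i)\<^sup>2 \<le> (nm m u * nm n v)\<^sup>2" by (simp add: power_mult_distrib)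
    qed simp
    finally show "cmod (bform m n (kop m n (\<lambda>z. \<Sum>i<N. tensor (f i) (g i) z)) u v) \<le> 1 * nm m u * nm n v"
      by (simp add: bform_kop[OF ks u v])
  qed simp
qed

text \<open>
  A kernel which is bounded as a functional on the kernel operators lies in the predual: its
  singular value decomposition is obtained by successively splitting off singular pairs.
\<close>

theorem trace_class_criterion:
  assumes A: "A \<in> sq_int (m \<Otimes>\<^sub>M n)" and C: "C \<ge> 0"
    and bound: "\<And>K. K \<in> sq_int (m \<Otimes>\<^sub>M n) \<Longrightarrow>
      cmod (\<integral>z. K z * A z \<partial>(m \<Otimes>\<^sub>M n)) \<le> C * op_norm m n (kop m n K)"
  shows "\<exists>F G. gexp m n F G \<and> (\<Sum>i. (nm m (F i))\<^sup>2) \<le> C \<and> (\<Sum>i. (nm n (G i))\<^sup>2) \<le> C \<and>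
    (AE z in m \<Otimes>\<^sub>M n. A z = gsum F G z)"
proof -
  have "\<forall>A\<in>sq_int (m \<Otimes>\<^sub>M n). \<exists>p. singular_pair A p" using singular_pair_exists by blast
  from bchoice[OF this] obtain p where p: "\<And>A. A \<in> sq_int (m \<Otimes>\<^sub>M n) \<Longrightarrow> singular_pair A (p A)" by blast
  \<comment> \<open>Subtracts the rank one part of the largest singular value. The conjugates make
    the form of the subtracted tensor at \<open>u\<close>, \<open>v\<close> equal to
    \<open>ip m u f * ip n v g\<close>.\<close>
  define step where "step A = (\<lambda>z. A z - complex_of_real (op_norm m n (kop m n A)) *
    tensor (\<lambda>x. cnj (fst (p A) x)) (\<lambda>y. cnj (snd (p A) y)) z)" for A
  define R where "R k = (step ^^ k) A" for k
  define f where "f k = fst (p (R k))" for k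
  define g where "g k = snd (p (R k))" for k
  define s where "s k = op_norm m n (kop m n (R k))" for k
  have RS: "R (Suc k) = (\<lambda>z. R k z - complex_of_real (s k) * tensor (\<lambda>x. cnj (f k x)) (\<lambda>y. cnj (g k y)) z)" for k
    by (simp add: R_def step_def f_def g_def s_def)
  have R: "R k \<in> sq_int (m \<Otimes>\<^sub>M n)" for k
  proof (induction k)
    case 0
    then show ?case using A by (simp add: R_def)
  next
    case (Suc k)
    then have "f k \<in> sq_int m" "g k \<in> sq_int n"
      using p[OF Suc] by (auto simp: singular_pair_def f_def g_def)
    then show ?case unfolding RS using Suc by auto
  qed
  have sp: "singular_pair (R k) (p (R k))" for k by (rule p[OF R])
  have fs: "f k \<in> sq_int m" and gs: "g k \<in> sq_int n" and f1: "nm m (f k) \<le> 1" and g1: "nm n (g k) \<le> 1"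
    and left: "\<And>u. u \<in> sq_int m \<Longrightarrow> kform m n (R k) u (g k) = s k * ip m u (f k)"
    and right: "\<And>v. v \<in> sq_int n \<Longrightarrow> kform m n (R k) (f k) v = s k * ip n v (g k)"
    and unit: "s k \<noteq> 0 \<Longrightarrow> nm m (f k) = 1 \<and> nm n (g k) = 1"
    and null: "s k = 0 \<Longrightarrow> f k = (\<lambda>_. 0) \<and> g k = (\<lambda>_. 0)" for k
    using sp[of k] unfolding singular_pair_def f_def g_def s_def by auto
  have s0: "s k \<ge> 0" for k unfolding s_def by (rule op_norm_nonneg[OF kop_bounded[OF R]])
  \<comment> \<open>Stated with the factor \<open>s k\<close> so as to hold in both cases: the
    vectors are unit vectors if \<open>s k\<close> is nonzero and vanish otherwise.\<close>
  have sf: "s k * ip m (f k) (f k) = s k" and sg: "s k * ip n (g k) (g k) = s k" for k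
    using unit[of k] by (cases "s k = 0"; simp add: ip_self)+
  have kRS: "kform m n (R (Suc k)) u v = kform m n (R k) u v - s k * (ip m u (f k) * ip n v (g k))"
    if u: "u \<in> sq_int m" and v: "v \<in> sq_int n" for k u v
  proof -
    let ?t = "tensor (\<lambda>x. cnj (f k x)) (\<lambda>y. cnj (g k y))"
    have ts: "?t \<in> sq_int (m \<Otimes>\<^sub>M n)" using fs gs by auto
    have "kform m n (R (Suc k)) u v = kform m n (R k) u v - kform m n (\<lambda>z. complex_of_real (s k) * ?t z) u v"
      unfolding RS by (intro kform_diff R sq_int_cmult ts u v)
    also have "kform m n (\<lambda>z. complex_of_real (s k) * ?t z) u v = s k * kform m n ?t u v"
      by (simp add: kform_def mult.assoc)
    also have "kform m n ?t u v = ip m u (f k) * ip n v (g k)"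
      using fs gs u v by (simp add: kform_tensor, simp add: ip_def mult.commute)
    finally show ?thesis .
  qed
  have vanish: "(\<forall>v\<in>sq_int n. kform m n (R k) (f j) v = 0) \<and> (\<forall>u\<in>sq_int m. kform m n (R k) u (g j) = 0)"
    if "j < k" for j k
    using that
  proof (induction k)
    case (Suc k)
    show ?case
    proof (cases "j = k")
      case True
      have "kform m n (R (Suc k)) (f k) v = 0" if "v \<in> sq_int n" for v
        unfolding kRS[OF fs that] right[OF that] using sf[of k] by (simp add: mult.assoc[symmetric])
      moreover have "kform m n (R (Suc k)) u (g k) = 0" if "u \<in> sq_int m" for u
      proof -
        have "s k * (ip m u (f k) * ip n (g k) (g k)) = (s k * ip n (g k) (g k)) * ip m u (f k)"
          by (simp add: mult_ac)
        then show ?thesis unfolding kRS[OF that gs] left[OF that] sg by simp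
      qed
      ultimately show ?thesis using True by simp
    next
      case False
      then have IH: "\<forall>v\<in>sq_int n. kform m n (R k) (f j) v = 0" "\<forall>u\<in>sq_int m. kform m n (R k) u (g j) = 0"
        using Suc by auto
      have "s k * ip m (f j) (f k) = 0" "s k * ip n (g j) (g k) = 0"
        using IH left[OF fs, of k j] right[OF gs, of k j] fs gs by auto
      then show ?thesis using IH fs gs by (auto simp: kRS)
    qed
  qed simp
  have orth: "ip m (f j) (f k) = 0 \<and> ip n (g j) (g k) = 0" if "j < k" for j k
  proof (cases "s k = 0")
    case True
    then show ?thesis using null by simp
  next
    case False
    have "s k * ip m (f j) (f k) = 0" "s k * ip n (g j) (g k) = 0"
      using vanish[OF that] left[OF fs, of k j] right[OF gs, of k j] fs gs by auto
    then show ?thesis using False by simp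
  qed
  have orth': "ip m (f j) (f k) = 0 \<and> ip n (g j) (g k) = 0" if "j \<noteq> k" for j k
  proof (cases "j < k")
    case False
    then have "k < j" using that by simp
    from orth[OF this] show ?thesis
      using cnj_ip[of m "f k" "f j"] cnj_ip[of n "g k" "g j"] by simp
  qed (rule orth)
  have onf: "sub_orthonormal m f {..<N}" and ong: "sub_orthonormal n g {..<N}" for N
    using fs gs f1 g1 orth' by (auto simp: sub_orthonormal_def)
  have expand: "kform m n A u v = kform m n (R N) u v + (\<Sum>k<N. s k * (ip m u (f k) * ip n v (g k)))"
    if "u \<in> sq_int m" "v \<in> sq_int n" for N u v
  proof (induction N)
    case 0
    show ?case by (simp add: R_def)
  next
    case (Suc N)
    then show ?case by (simp add: kRS[OF that])
  qed
  have diag: "kform m n A (f i) (g i) = s i" for i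
  proof -
    have "(\<Sum>k<i. s k * (ip m (f i) (f k) * ip n (g i) (g k))) = 0"
      using orth' by (intro sum.neutral) auto
    then show ?thesis
      unfolding expand[OF fs gs, of i i i] right[OF gs] sg by simp
  qed
  \<comment> \<open>The test kernel \<open>?K\<close> has operator norm at most one and pairs with
    \<open>A\<close> to the sum of the first \<open>N\<close> singular values. Here boundedness of
    the functional becomes summability.\<close>
  have partial: "(\<Sum>i<N. s i) \<le> C" for N
  proof -
    let ?K = "\<lambda>z. \<Sum>i<N. tensor (f i) (g i) z"
    have Ks: "?K \<in> sq_int (m \<Otimes>\<^sub>M n)" using fs gs by auto
    have "(\<integral>z. ?K z * A z \<partial>(m \<Otimes>\<^sub>M n)) = (\<Sum>i<N. \<integral>z. tensor (f i) (g i) z * A z \<partial>(m \<Otimes>\<^sub>M n))"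
      unfolding sum_distrib_right using fs gs A by (intro Bochner_Integration.integral_sum) auto
    also have "\<dots> = (\<Sum>i<N. kform m n A (f i) (g i))"
      by (simp add: kform_def mult.commute)
    also have "\<dots> = complex_of_real (\<Sum>i<N. s i)" by (simp add: diag)
    finally have "\<bar>\<Sum>i<N. s i\<bar> = cmod (\<integral>z. ?K z * A z \<partial>(m \<Otimes>\<^sub>M n))" by (simp only: norm_of_real)
    also have "\<dots> \<le> C * op_norm m n (kop m n ?K)" by (rule bound[OF Ks])
    also have "\<dots> \<le> C * 1" by (intro mult_left_mono op_norm_partial_isometry onf ong C)
    finally show ?thesis by simp
  qed
  have ss: "summable s"
    by (rule bounded_imp_summable[OF s0]) (use partial in \<open>simp only: lessThan_Suc_atMost[symmetric]\<close>)
  have sC: "suminf s \<le> C" by (rule suminf_le_const[OF ss partial])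
  have s_lim: "s \<longlonglongrightarrow> 0" by (rule summable_LIMSEQ_zero[OF ss])
  \<comment> \<open>The singular value is shared between the factors, so that both families have
    squared norms at most \<open>s k\<close>.\<close>
  define F where "F k = (\<lambda>x. complex_of_real (sqrt (s k)) * cnj (f k x))" for k
  define G where "G k = (\<lambda>y. complex_of_real (sqrt (s k)) * cnj (g k y))" for k
  have Fs: "F k \<in> sq_int m" and Gs: "G k \<in> sq_int n" for k
    unfolding F_def G_def using fs gs by auto
  have nF: "(nm m (F k))\<^sup>2 \<le> s k" and nG: "(nm n (G k))\<^sup>2 \<le> s k" for k
  proof -
    have "(nm m (f k))\<^sup>2 \<le> 1" "(nm n (g k))\<^sup>2 \<le> 1" using f1 g1 by (auto intro: power_le_one)
    then show "(nm m (F k))\<^sup>2 \<le> s k" "(nm n (G k))\<^sup>2 \<le> s k"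
      unfolding F_def G_def nm_cmult power_mult_distrib using s0[of k]
      by (auto simp: mult_left_le)
  qed
  have sF: "summable (\<lambda>k. (nm m (F k))\<^sup>2)" and sG: "summable (\<lambda>k. (nm n (G k))\<^sup>2)"
    by (rule summable_comparison_test[OF _ ss], use nF nG in auto)+
  have FG: "gexp m n F G" using Fs Gs sF sG by (simp add: gexp_def)
  have "AE z in m \<Otimes>\<^sub>M n. A z - gsum F G z = 0"
  proof (rule tensors_separate)
    show "(\<lambda>z. A z - gsum F G z) \<in> sq_int (m \<Otimes>\<^sub>M n)" by (intro sq_int_diff A gsum_sq_int FG)
    fix u v assume u: "u \<in> sq_int m" and v: "v \<in> sq_int n"
    have term_eq: "kform m n (tensor u v) (F k) (G k) = s k * (ip m u (f k) * ip n v (g k))" for k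
    proof -
      have "kform m n (tensor u v) (F k) (G k) = (\<integral>x. u x * F k x \<partial>m) * (\<integral>y. v y * G k y \<partial>n)"
        by (rule kform_tensor[OF u v Fs Gs])
      also have "(\<lambda>x. u x * F k x) = (\<lambda>x. complex_of_real (sqrt (s k)) * (u x * cnj (f k x)))"
        by (simp add: F_def mult_ac)
      also have "(\<integral>x. \<dots> x \<partial>m) = sqrt (s k) * ip m u (f k)"
        by (simp only: ip_def integral_mult_right_zero)
      also have "(\<lambda>y. v y * G k y) = (\<lambda>y. complex_of_real (sqrt (s k)) * (v y * cnj (g k y)))"
        by (simp add: G_def mult_ac)
      also have "(\<integral>y. \<dots> y \<partial>n) = sqrt (s k) * ip n v (g k)"
        by (simp only: ip_def integral_mult_right_zero)
      also have "complex_of_real (sqrt (s k)) * ip m u (f k) * (complex_of_real (sqrt (s k)) * ip n v (g k))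
          = complex_of_real (sqrt (s k) * sqrt (s k)) * (ip m u (f k) * ip n v (g k))"
        by (simp only: of_real_mult mult_ac)
      finally show ?thesis using s0[of k] by simp
    qed
    \<comment> \<open>The remainder has operator norm \<open>s N\<close>, which tends to zero.
      Convergence of the forms is all that is needed, because tensors separate kernels.\<close>
    have "(\<lambda>N. kform m n (R N) u v) \<longlonglongrightarrow> 0"
    proof (rule Lim_null_comparison)
      show "\<forall>\<^sub>F N in sequentially. norm (kform m n (R N) u v) \<le> s N * (nm m u * nm n v)"
        using kform_le_op_norm[OF R u v] by (simp add: s_def mult.assoc)
      show "(\<lambda>N. s N * (nm m u * nm n v)) \<longlonglongrightarrow> 0" by (rule tendsto_mult_left_zero[OF s_lim])
    qed
    from tendsto_diff[OF tendsto_const this, of "kform m n A u v"]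
    have "(\<lambda>N. kform m n A u v - kform m n (R N) u v) \<longlonglongrightarrow> kform m n A u v" by simp
    moreover have "kform m n A u v - kform m n (R N) u v = (\<Sum>k<N. s k * (ip m u (f k) * ip n v (g k)))" for N
      using expand[OF u v, of N] by simp
    ultimately have "(\<lambda>k. kform m n (tensor u v) (F k) (G k)) sums kform m n A u v"
      unfolding sums_def term_eq by (simp only:)
    moreover have "(\<lambda>k. kform m n (tensor u v) (F k) (G k)) sums kform m n (gsum F G) u v"
      using kform_sums[OF FG tensor_sq_int[OF u v]] by (simp add: kform_def mult.commute)
    ultimately have "kform m n A u v = kform m n (gsum F G) u v" by (rule sums_unique2)
    then show "kform m n (\<lambda>z. A z - gsum F G z) u v = 0"
      using kform_diff[OF A gsum_sq_int[OF FG] u v] by simp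
  qed
  then have "AE z in m \<Otimes>\<^sub>M n. A z = gsum F G z" by eventually_elim simp
  moreover have "(\<Sum>i. (nm m (F i))\<^sup>2) \<le> C"
    using suminf_le[OF nF sF ss] sC by linarith
  moreover have "(\<Sum>i. (nm n (G i))\<^sup>2) \<le> C"
    using suminf_le[OF nG sG ss] sC by linarith
  ultimately show ?thesis using FG by blast
qed

end

section \<open>Idempotent Schur maps\<close>

lemma op_norm_lincomb_le:
  assumes T: "T \<in> bounded_ops m n" and S: "S \<in> bounded_ops m n"
  shows "op_norm m n (op_lincomb m n 1 T (-1) S) \<le> op_norm m n T + op_norm m n S"
proof (rule op_norm_leI[OF op_lincomb_bounded[OF T S]])
  show "0 \<le> op_norm m n T + op_norm m n S" using op_norm_nonneg[OF T] op_norm_nonneg[OF S] by simp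
  fix f g assume fg: "f \<in> sq_int m" "g \<in> sq_int n"
  have "cmod (bform m n T f g - bform m n S f g) \<le> cmod (bform m n T f g) + cmod (bform m n S f g)"
    by (rule norm_triangle_ineq4)
  also have "\<dots> \<le> (op_norm m n T + op_norm m n S) * nm m f * nm n g"
    using bform_bound[OF T fg] bform_bound[OF S fg] by (simp add: distrib_right)
  finally show "cmod (bform m n (op_lincomb m n 1 T (-1) S) f g) \<le> (op_norm m n T + op_norm m n S) * nm m f * nm n g"
    by (simp add: bform_op_lincomb[OF T S fg])
qed

context two_sigma_finite
begin

text \<open>A single kernel from which a multiplier can be recovered almost everywhere by division;
  it is the root of a strictly positive integrable function.\<close>

lemma nonvanishing_sq_int: "\<exists>k\<in>sq_int (m \<Otimes>\<^sub>M n). \<forall>z\<in>space (m \<Otimes>\<^sub>M n). k z \<noteq> 0"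
proof -
  obtain h where h: "h \<in> borel_measurable (m \<Otimes>\<^sub>M n)" "integral\<^sup>N (m \<Otimes>\<^sub>M n) h \<noteq> \<infinity>"
    "\<And>z. z \<in> space (m \<Otimes>\<^sub>M n) \<Longrightarrow> 0 < h z \<and> h z < \<infinity>"
    using P.Ex_finite_integrable_function by blast
  define k where "k z = complex_of_real (sqrt (enn2real (h z)))" for z
  have [measurable]: "h \<in> borel_measurable (m \<Otimes>\<^sub>M n)" by (rule h(1))
  have km: "k \<in> borel_measurable (m \<Otimes>\<^sub>M n)" unfolding k_def by measurable
  have ck: "(cmod (k z))\<^sup>2 = enn2real (h z)" for z by (simp add: k_def)
  have "(\<integral>\<^sup>+z. ennreal (norm (enn2real (h z))) \<partial>(m \<Otimes>\<^sub>M n)) = integral\<^sup>N (m \<Otimes>\<^sub>M n) h"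
    using h(3) by (intro nn_integral_cong) (simp add: ennreal_enn2real)
  also have "\<dots> < \<infinity>" using h(2) by (simp add: less_top)
  finally have "integrable (m \<Otimes>\<^sub>M n) (\<lambda>z. enn2real (h z))"
    by (intro integrableI_bounded) measurable
  then have "k \<in> sq_int (m \<Otimes>\<^sub>M n)" using km by (simp add: sq_int_def ck)
  moreover have "k z \<noteq> 0" if "z \<in> space (m \<Otimes>\<^sub>M n)" for z
    using h(3)[OF that] by (auto simp: k_def enn2real_eq_0_iff)
  ultimately show ?thesis by blast
qed

definition schur_pair :: "('x \<times> 'y \<Rightarrow> complex) \<Rightarrow> (('x, 'y) l2_op \<Rightarrow> ('x, 'y) l2_op) \<Rightarrow> bool" where
  "schur_pair \<phi> \<Phi> \<longleftrightarrow> schur_multiplier m n \<phi> \<and> is_schur_map m n \<phi> \<Phi>"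

lemma schur_bounded: "schur_pair \<phi> \<Phi> \<Longrightarrow> T \<in> bounded_ops m n \<Longrightarrow> \<Phi> T \<in> bounded_ops m n"
  unfolding schur_pair_def is_schur_map_def by blast

lemma schur_multiplier_ess: "schur_pair \<phi> \<Phi> \<Longrightarrow> \<phi> \<in> ess_bounded (m \<Otimes>\<^sub>M n)"
  by (simp add: schur_pair_def schur_multiplier_def)

lemma schur_mult_ex:
  assumes "schur_pair \<phi> \<Phi>" "h \<in> Gamma m n"
  obtains h' where "h' \<in> Gamma m n" "AE z in m \<Otimes>\<^sub>M n. h' z = \<phi> z * h z"
  using assms unfolding schur_pair_def schur_multiplier_def by blast

lemma pairing_schur:
  "schur_pair \<phi> \<Phi> \<Longrightarrow> T \<in> bounded_ops m n \<Longrightarrow> h \<in> Gamma m n \<Longrightarrow> h' \<in> Gamma m n \<Longrightarrow>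
    AE z in m \<Otimes>\<^sub>M n. h' z = \<phi> z * h z \<Longrightarrow> pairing m n (\<Phi> T) h = pairing m n T h'"
  unfolding schur_pair_def is_schur_map_def by blast

lemma schur_mult_sq_int:
  "schur_pair \<phi> \<Phi> \<Longrightarrow> k \<in> sq_int (m \<Otimes>\<^sub>M n) \<Longrightarrow> (\<lambda>z. \<phi> z * k z) \<in> sq_int (m \<Otimes>\<^sub>M n)"
  by (intro sq_int_ess_mult schur_multiplier_ess)

text \<open>The pairing with a kernel operator is an integral of \<open>k * h\<close>, and the
  multiplier may be attached to either factor.\<close>

lemma schur_kop:
  assumes S: "schur_pair \<phi> \<Phi>" and k: "k \<in> sq_int (m \<Otimes>\<^sub>M n)"
  shows "\<Phi> (kop m n k) = kop m n (\<lambda>z. \<phi> z * k z)"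
proof (rule pairing_eqI)
  have pk: "(\<lambda>z. \<phi> z * k z) \<in> sq_int (m \<Otimes>\<^sub>M n)" by (rule schur_mult_sq_int[OF S k])
  show "\<Phi> (kop m n k) \<in> bounded_ops m n" by (intro schur_bounded[OF S] kop_bounded k)
  show "kop m n (\<lambda>z. \<phi> z * k z) \<in> bounded_ops m n" by (intro kop_bounded pk)
  fix h assume h: "h \<in> Gamma m n"
  obtain h' where h': "h' \<in> Gamma m n" "AE z in m \<Otimes>\<^sub>M n. h' z = \<phi> z * h z" using schur_mult_ex[OF S h] .
  obtain u where u: "u \<in> sq_int (m \<Otimes>\<^sub>M n)" "AE z in m \<Otimes>\<^sub>M n. h z = u z"
    "\<And>k. k \<in> sq_int (m \<Otimes>\<^sub>M n) \<Longrightarrow> pairing m n (kop m n k) h = (\<integral>z. k z * u z \<partial>(m \<Otimes>\<^sub>M n))"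
    using Gamma_AE_sq_int[OF h] by blast
  obtain v where v: "v \<in> sq_int (m \<Otimes>\<^sub>M n)" "AE z in m \<Otimes>\<^sub>M n. h' z = v z"
    "\<And>k. k \<in> sq_int (m \<Otimes>\<^sub>M n) \<Longrightarrow> pairing m n (kop m n k) h' = (\<integral>z. k z * v z \<partial>(m \<Otimes>\<^sub>M n))"
    using Gamma_AE_sq_int[OF h'(1)] by blast
  have "AE z in m \<Otimes>\<^sub>M n. k z * v z = \<phi> z * k z * u z"
    using h'(2) u(2) v(2) by eventually_elim simp
  then have "(\<integral>z. k z * v z \<partial>(m \<Otimes>\<^sub>M n)) = (\<integral>z. \<phi> z * k z * u z \<partial>(m \<Otimes>\<^sub>M n))"
    by (intro integral_cong_AE borel_measurable_integrable integrable_sq_mult k v(1) pk u(1))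
  then show "pairing m n (\<Phi> (kop m n k)) h = pairing m n (kop m n (\<lambda>z. \<phi> z * k z)) h"
    unfolding pairing_schur[OF S kop_bounded[OF k] h h'] v(3)[OF k] u(3)[OF pk] .
qed

lemma schur_lincomb:
  assumes S: "schur_pair \<phi> \<Phi>" and T: "T \<in> bounded_ops m n" "R \<in> bounded_ops m n"
  shows "\<Phi> (op_lincomb m n a T b R) = op_lincomb m n a (\<Phi> T) b (\<Phi> R)"
proof (rule pairing_eqI)
  note TR = op_lincomb_bounded[OF T] and P = schur_bounded[OF S]
  show "\<Phi> (op_lincomb m n a T b R) \<in> bounded_ops m n" by (intro P TR)
  show "op_lincomb m n a (\<Phi> T) b (\<Phi> R) \<in> bounded_ops m n" by (intro op_lincomb_bounded P T)
  fix h assume h: "h \<in> Gamma m n"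
  obtain h' where h': "h' \<in> Gamma m n" "AE z in m \<Otimes>\<^sub>M n. h' z = \<phi> z * h z" using schur_mult_ex[OF S h] .
  show "pairing m n (\<Phi> (op_lincomb m n a T b R)) h = pairing m n (op_lincomb m n a (\<Phi> T) b (\<Phi> R)) h"
    unfolding pairing_schur[OF S TR h h'] pairing_op_lincomb[OF T h'(1)]
      pairing_op_lincomb[OF P[OF T(1)] P[OF T(2)] h]
      pairing_schur[OF S T(1) h h'] pairing_schur[OF S T(2) h h'] ..
qed

lemma schur_zero:
  assumes S: "schur_pair \<phi> \<Phi>" shows "\<Phi> (op_zero m n) = op_zero m n"
proof (rule pairing_eqI)
  show "\<Phi> (op_zero m n) \<in> bounded_ops m n" by (intro schur_bounded[OF S] op_zero_bounded)
  show "op_zero m n \<in> bounded_ops m n" by (rule op_zero_bounded)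
  fix h assume h: "h \<in> Gamma m n"
  obtain h' where h': "h' \<in> Gamma m n" "AE z in m \<Otimes>\<^sub>M n. h' z = \<phi> z * h z" using schur_mult_ex[OF S h] .
  show "pairing m n (\<Phi> (op_zero m n)) h = pairing m n (op_zero m n) h"
    unfolding pairing_schur[OF S op_zero_bounded h h'] by (simp add: pairing_op_zero h h'(1))
qed

lemma schur_sandwich:
  assumes S: "schur_pair \<phi> \<Phi>" and T: "T \<in> bounded_ops m n"
    and a: "a \<in> ess_bounded m" and b: "b \<in> ess_bounded n"
  shows "\<Phi> (sandwich m n b T a) = sandwich m n b (\<Phi> T) a"
proof (rule pairing_eqI)
  note sT = sandwich_bounded[OF T a b] and PT = schur_bounded[OF S T]
  show "\<Phi> (sandwich m n b T a) \<in> bounded_ops m n" by (rule schur_bounded[OF S sT])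
  show "sandwich m n b (\<Phi> T) a \<in> bounded_ops m n" by (rule sandwich_bounded[OF PT a b])
  fix h assume h: "h \<in> Gamma m n"
  obtain h' where h': "h' \<in> Gamma m n" "AE z in m \<Otimes>\<^sub>M n. h' z = \<phi> z * h z" using schur_mult_ex[OF S h] .
  obtain F G where FG: "gamma_expansion m n h F G" using h by (rule Gamma_E)
  obtain F' G' where FG': "gamma_expansion m n h' F' G'" using h'(1) by (rule Gamma_E)
  note 1 = Gamma_mult_tensor[OF FG a b] and 2 = Gamma_mult_tensor[OF FG' a b]
  have "AE z in m \<Otimes>\<^sub>M n. tensor a b z * h' z = \<phi> z * (tensor a b z * h z)"
    using h'(2) by eventually_elim (simp add: mult.left_commute)
  from pairing_schur[OF S T Gamma_I[OF 1(1)] Gamma_I[OF 2(1)] this]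
  show "pairing m n (\<Phi> (sandwich m n b T a)) h = pairing m n (sandwich m n b (\<Phi> T) a) h"
    unfolding pairing_schur[OF S sT h h'] 2(2)[OF T] 1(2)[OF PT] by (rule sym)
qed

text \<open>Reduces identities between Schur maps to identities almost everywhere between
  multipliers, as soon as the product is known to have a Schur map \<open>\<Theta>\<close> of its
  own.\<close>

lemma schur_comp:
  assumes S: "schur_pair \<phi> \<Phi>" and R: "schur_pair \<psi> \<Psi>" and Q: "schur_pair \<theta> \<Theta>"
    and eq: "AE z in m \<Otimes>\<^sub>M n. \<theta> z = \<phi> z * \<psi> z" and T: "T \<in> bounded_ops m n"
  shows "\<Phi> (\<Psi> T) = \<Theta> T"
proof (rule pairing_eqI)
  note RT = schur_bounded[OF R T]
  show "\<Phi> (\<Psi> T) \<in> bounded_ops m n" by (rule schur_bounded[OF S RT])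
  show "\<Theta> T \<in> bounded_ops m n" by (rule schur_bounded[OF Q T])
  fix h assume h: "h \<in> Gamma m n"
  obtain h' where h': "h' \<in> Gamma m n" "AE z in m \<Otimes>\<^sub>M n. h' z = \<phi> z * h z" using schur_mult_ex[OF S h] .
  obtain h'' where h'': "h'' \<in> Gamma m n" "AE z in m \<Otimes>\<^sub>M n. h'' z = \<psi> z * h' z"
    using schur_mult_ex[OF R h'(1)] .
  have "AE z in m \<Otimes>\<^sub>M n. h'' z = \<theta> z * h z"
    using h''(2) h'(2) eq by eventually_elim (simp add: mult_ac)
  then show "pairing m n (\<Phi> (\<Psi> T)) h = pairing m n (\<Theta> T) h"
    using pairing_schur[OF S RT h h'] pairing_schur[OF R T h'(1) h''] pairing_schur[OF Q T h h''(1)] by simp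
qed

text \<open>The converse passage, from maps to multipliers: apply both sides to the kernel operator
  of a nowhere vanishing kernel and compare the kernels.\<close>

lemma schur_mult_AE_eqI:
  assumes S: "schur_pair \<phi> \<Phi>" and R: "schur_pair \<psi> \<Psi>"
    and eq: "\<And>T. T \<in> bounded_ops m n \<Longrightarrow> \<Phi> (\<Psi> T) = \<Psi> T"
  shows "AE z in m \<Otimes>\<^sub>M n. \<phi> z * \<psi> z = \<psi> z"
proof -
  obtain k where k: "k \<in> sq_int (m \<Otimes>\<^sub>M n)" "\<And>z. z \<in> space (m \<Otimes>\<^sub>M n) \<Longrightarrow> k z \<noteq> 0"
    using nonvanishing_sq_int by blast
  note pk = schur_mult_sq_int[OF R k(1)]
  have "kop m n (\<lambda>z. \<phi> z * (\<psi> z * k z)) = kop m n (\<lambda>z. \<psi> z * k z)"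
    using eq[OF kop_bounded[OF k(1)]] unfolding schur_kop[OF R k(1)] schur_kop[OF S pk] .
  then have "AE z in m \<Otimes>\<^sub>M n. \<phi> z * (\<psi> z * k z) = \<psi> z * k z"
    by (rule kop_eqD[OF schur_mult_sq_int[OF S pk] pk])
  then show ?thesis using AE_space
  proof eventually_elim
    case (elim z)
    then have "(\<phi> z * \<psi> z) * k z = \<psi> z * k z" by (simp add: mult.assoc)
    then show ?case using k(2)[OF elim(2)] by simp
  qed
qed

section \<open>Ranges and fixed points of idempotent Schur maps\<close>

lemma idempotent_schur_mapsE:
  assumes "\<Phi> \<in> idempotent_schur_maps m n"
  obtains \<phi> where "schur_pair \<phi> \<Phi>"
  using assms unfolding idempotent_schur_maps_def schur_pair_def by blast

lemma idempotent_schur_mapsD: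
  "\<Phi> \<in> idempotent_schur_maps m n \<Longrightarrow> T \<in> bounded_ops m n \<Longrightarrow> \<Phi> (\<Phi> T) = \<Phi> T"
  unfolding idempotent_schur_maps_def by blast

lemma idempotent_range_iff:
  assumes "\<Phi> \<in> idempotent_schur_maps m n"
  shows "T \<in> \<Phi> ` bounded_ops m n \<longleftrightarrow> T \<in> bounded_ops m n \<and> \<Phi> T = T"
proof -
  obtain \<phi> where S: "schur_pair \<phi> \<Phi>" using assms by (rule idempotent_schur_mapsE)
  note idem = idempotent_schur_mapsD[OF assms]
  show ?thesis
  proof
    assume "T \<in> \<Phi> ` bounded_ops m n"
    then obtain R where R: "R \<in> bounded_ops m n" "T = \<Phi> R" by blast
    then show "T \<in> bounded_ops m n \<and> \<Phi> T = T" using idem[OF R(1)] schur_bounded[OF S R(1)] by simp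
  next
    assume T: "T \<in> bounded_ops m n \<and> \<Phi> T = T"
    then have "\<Phi> T \<in> \<Phi> ` bounded_ops m n" by blast
    then show "T \<in> \<Phi> ` bounded_ops m n" using T by simp
  qed
qed

text \<open>Formulated for equalizers of families; with the identity as second map it gives fixed
  point spaces and hence intersections of ranges of idempotents.\<close>

lemma masa_bimodule_fixed_points:
  assumes S: "\<And>i. i \<in> I \<Longrightarrow> schur_pair (\<phi> i) (\<Phi> i)" and R: "\<And>i. i \<in> I \<Longrightarrow> schur_pair (\<psi> i) (\<Psi> i)"
  shows "masa_bimodule m n {T \<in> bounded_ops m n. \<forall>i\<in>I. \<Phi> i T = \<Psi> i T}"
  unfolding masa_bimodule_def op_subspace_def
proof (intro conjI ballI allI)
  show "op_zero m n \<in> {T \<in> bounded_ops m n. \<forall>i\<in>I. \<Phi> i T = \<Psi> i T}"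
    using schur_zero[OF S] schur_zero[OF R] by (simp add: op_zero_bounded)
  fix T assume T: "T \<in> {T \<in> bounded_ops m n. \<forall>i\<in>I. \<Phi> i T = \<Psi> i T}"
  fix T' a b assume T': "T' \<in> {T \<in> bounded_ops m n. \<forall>i\<in>I. \<Phi> i T = \<Psi> i T}"
  show "op_lincomb m n a T b T' \<in> {T \<in> bounded_ops m n. \<forall>i\<in>I. \<Phi> i T = \<Psi> i T}"
    using T T' schur_lincomb[OF S] schur_lincomb[OF R] by (simp add: op_lincomb_bounded)
next
  fix T a b assume T: "T \<in> {T \<in> bounded_ops m n. \<forall>i\<in>I. \<Phi> i T = \<Psi> i T}"
    and ab: "a \<in> ess_bounded m" "b \<in> ess_bounded n"
  show "sandwich m n b T a \<in> {T \<in> bounded_ops m n. \<forall>i\<in>I. \<Phi> i T = \<Psi> i T}"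
    using T ab schur_sandwich[OF S] schur_sandwich[OF R] by (simp add: sandwich_bounded)
qed auto

text \<open>Fixed points survive weak* closure: the function \<open>h' - h\<close> with
  \<open>h'\<close> the product of \<open>\<phi>\<close> and \<open>h\<close> annihilates all fixed
  points in \<open>U\<close>, hence \<open>T\<close>, and its pairing with \<open>T\<close> is the
  pairing of \<open>\<Phi> T - T\<close> with \<open>h\<close>.\<close>

lemma pairing_diff_schur_closed:
  assumes S: "schur_pair \<phi> \<Phi>" and T: "T \<in> bounded_ops m n"
    and ann: "\<And>h. h \<in> Gamma m n \<Longrightarrow> (\<And>R. R \<in> U \<Longrightarrow> pairing m n R h = 0) \<Longrightarrow> pairing m n T h = 0"
    and U: "\<And>R. R \<in> U \<Longrightarrow> R \<in> bounded_ops m n \<and> \<Phi> R = R"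
  shows "\<Phi> T = T"
proof (rule pairing_eqI[OF schur_bounded[OF S T] T])
  fix h assume h: "h \<in> Gamma m n"
  obtain h' where h': "h' \<in> Gamma m n" "AE z in m \<Otimes>\<^sub>M n. h' z = \<phi> z * h z" using schur_mult_ex[OF S h] .
  have "pairing m n R (\<lambda>z. h' z - h z) = 0" if R: "R \<in> U" for R
    using pairing_schur[OF S _ h h', of R] U[OF R] Gamma_diff(2)[OF h'(1) h, of R] by simp
  then have "pairing m n T (\<lambda>z. h' z - h z) = 0"
    by (intro ann Gamma_diff(1) h' h)
  then show "pairing m n (\<Phi> T) h = pairing m n T h"
    using pairing_schur[OF S T h h'] Gamma_diff(2)[OF h'(1) h T] by simp
qed

end

section \<open>The limit of a decreasing sequence of idempotent Schur maps\<close>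

text \<open>An approximating sequence together with multipliers for its maps. Inclusion of the
  ranges is expressed by the earlier idempotent fixing the range of the later one.\<close>

locale schur_chain = two_sigma_finite m n
  for m :: "'x measure" and n :: "'y measure" +
  fixes \<phi> :: "nat \<Rightarrow> 'x \<times> 'y \<Rightarrow> complex" and \<Phi> :: "nat \<Rightarrow> ('x, 'y) l2_op \<Rightarrow> ('x, 'y) l2_op" and C :: real
  assumes C_pos: "C > 0"
    and pair: "\<And>k. schur_pair (\<phi> k) (\<Phi> k)"
    and idem: "\<And>k T. T \<in> bounded_ops m n \<Longrightarrow> \<Phi> k (\<Phi> k T) = \<Phi> k T"
    and norm_le: "\<And>k T. T \<in> bounded_ops m n \<Longrightarrow> op_norm m n (\<Phi> k T) \<le> C * op_norm m n T"
    and decreasing: "\<And>k T. T \<in> bounded_ops m n \<Longrightarrow> \<Phi> k (\<Phi> (Suc k) T) = \<Phi> (Suc k) T"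
begin

text \<open>Given by a case distinction and not as a limit, so that it takes the values zero and one
  everywhere; its idempotency then holds at every point.\<close>

definition limit_mult :: "'x \<times> 'y \<Rightarrow> complex" where
  "limit_mult z = (if \<forall>k. \<phi> k z = 1 then 1 else 0)"

lemma mult_measurable [measurable]: "\<phi> k \<in> borel_measurable (m \<Otimes>\<^sub>M n)"
  using schur_multiplier_ess[OF pair[of k]] by (simp add: ess_bounded_def)

lemma limit_mult_measurable [measurable]: "limit_mult \<in> borel_measurable (m \<Otimes>\<^sub>M n)"
  unfolding limit_mult_def by measurable

lemma limit_mult_ess: "limit_mult \<in> ess_bounded (m \<Otimes>\<^sub>M n)"
  unfolding ess_bounded_def using limit_mult_measurable
  by (auto simp: limit_mult_def intro!: exI[of _ 1])

lemma mult_values: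
  "AE z in m \<Otimes>\<^sub>M n. (\<forall>k. \<phi> k z = 0 \<or> \<phi> k z = 1) \<and> (\<forall>k. \<phi> k z * \<phi> (Suc k) z = \<phi> (Suc k) z)"
proof -
  have "AE z in m \<Otimes>\<^sub>M n. \<forall>k. \<phi> k z * \<phi> k z = \<phi> k z"
    unfolding AE_all_countable by (intro allI schur_mult_AE_eqI[OF pair pair] idem)
  moreover have "AE z in m \<Otimes>\<^sub>M n. \<forall>k. \<phi> k z * \<phi> (Suc k) z = \<phi> (Suc k) z"
    unfolding AE_all_countable by (intro allI schur_mult_AE_eqI[OF pair pair] decreasing)
  ultimately show ?thesis
  proof eventually_elim
    case (elim z)
    have "\<phi> k z = 0 \<or> \<phi> k z = 1" for k
    proof -
      have "\<phi> k z * (\<phi> k z - 1) = 0" using elim(1)[rule_format, of k] by (simp add: algebra_simps)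
      then show ?thesis by simp
    qed
    with elim(2) show ?case by blast
  qed
qed

lemma limit_mult_AE:
  "AE z in m \<Otimes>\<^sub>M n. (\<lambda>k. \<phi> k z) \<longlonglongrightarrow> limit_mult z \<and>
    (\<forall>k. cmod (\<phi> k z - limit_mult z) \<le> 1) \<and> (\<forall>k. \<phi> k z * limit_mult z = limit_mult z)"
  using mult_values
proof eventually_elim
  case (elim z)
  have "(\<lambda>k. \<phi> k z) \<longlonglongrightarrow> limit_mult z"
  proof (cases "\<forall>k. \<phi> k z = 1")
    case False
    then obtain k0 where "\<phi> k0 z = 0" using elim by blast
    \<comment> \<open>A zero persists, because each multiplier absorbs its predecessor.\<close>
    have "\<phi> k z = 0" if "k \<ge> k0" for k
      using that
    proof (induction k rule: dec_induct)
      case (step k)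
      have "\<phi> k z * \<phi> (Suc k) z = \<phi> (Suc k) z" using elim by blast
      then show ?case using step by simp
    qed fact
    then have "\<forall>\<^sub>F k in sequentially. \<phi> k z = limit_mult z"
      using False by (auto simp: eventually_sequentially limit_mult_def)
    then show ?thesis by (rule tendsto_eventually)
  qed (simp add: limit_mult_def)
  moreover have "cmod (\<phi> k z - limit_mult z) \<le> 1" for k
  proof -
    have "\<phi> k z = 0 \<or> \<phi> k z = 1" using elim by blast
    then show ?thesis by (auto simp: limit_mult_def)
  qed
  moreover have "\<phi> k z * limit_mult z = limit_mult z" for k by (simp add: limit_mult_def)
  ultimately show ?case by blast
qed

section \<open>The limit multiplier acts on the predual\<close>

lemma limit_mult_sq_int: "k \<in> sq_int (m \<Otimes>\<^sub>M n) \<Longrightarrow> (\<lambda>z. limit_mult z * k z) \<in> sq_int (m \<Otimes>\<^sub>M n)"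
  by (rule sq_int_ess_mult[OF _ limit_mult_ess])

lemma mult_sq_int: "k \<in> sq_int (m \<Otimes>\<^sub>M n) \<Longrightarrow> (\<lambda>z. \<phi> j z * k z) \<in> sq_int (m \<Otimes>\<^sub>M n)"
  by (rule schur_mult_sq_int[OF pair])

lemma kernel_limit:
  assumes k: "k \<in> sq_int (m \<Otimes>\<^sub>M n)"
  shows "(\<lambda>j. nm (m \<Otimes>\<^sub>M n) (\<lambda>z. \<phi> j z * k z - limit_mult z * k z)) \<longlonglongrightarrow> 0"
proof -
  have [measurable]: "k \<in> borel_measurable (m \<Otimes>\<^sub>M n)" using k by (rule sq_int_measurable)
  have "(\<lambda>j. \<integral>z. (cmod (\<phi> j z * k z - limit_mult z * k z))\<^sup>2 \<partial>(m \<Otimes>\<^sub>M n)) \<longlonglongrightarrow> (\<integral>z. 0 \<partial>(m \<Otimes>\<^sub>M n))"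
  proof (rule integral_dominated_convergence)
    show "integrable (m \<Otimes>\<^sub>M n) (\<lambda>z. (cmod (k z))\<^sup>2)" by (rule sq_int_integrable[OF k])
    show "AE z in m \<Otimes>\<^sub>M n. (\<lambda>j. (cmod (\<phi> j z * k z - limit_mult z * k z))\<^sup>2) \<longlonglongrightarrow> 0"
      using limit_mult_AE
    proof eventually_elim
      case (elim z)
      then have "(\<lambda>j. (cmod (\<phi> j z * k z - limit_mult z * k z))\<^sup>2)
          \<longlonglongrightarrow> (cmod (limit_mult z * k z - limit_mult z * k z))\<^sup>2"
        by (intro tendsto_intros) blast
      then show ?case by simp
    qed
    fix j
    show "AE z in m \<Otimes>\<^sub>M n. norm ((cmod (\<phi> j z * k z - limit_mult z * k z))\<^sup>2) \<le> (cmod (k z))\<^sup>2"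
      using limit_mult_AE
    proof eventually_elim
      case (elim z)
      then have "cmod (\<phi> j z - limit_mult z) * cmod (k z) \<le> 1 * cmod (k z)"
        by (intro mult_right_mono) auto
      then have "cmod (\<phi> j z * k z - limit_mult z * k z) \<le> cmod (k z)"
        by (simp add: norm_mult[symmetric] left_diff_distrib)
      then show ?case by (simp add: power_mono)
    qed
  qed measurable
  then have "(\<lambda>j. sqrt (\<integral>z. (cmod (\<phi> j z * k z - limit_mult z * k z))\<^sup>2 \<partial>(m \<Otimes>\<^sub>M n))) \<longlonglongrightarrow> sqrt 0"
    by (intro tendsto_real_sqrt) simp
  then show ?thesis by (simp add: nm_def)
qed

text \<open>The quantitative form: a bound \<open>c\<close> for \<open>h\<close> becomes
  \<open>C * c\<close> for the product. The explicit constant later gives both the norm bound and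
  the weak* continuity of the limit map.\<close>

lemma limit_mult_Gamma:
  assumes h: "h \<in> Gamma m n" and c: "c \<ge> 0" "\<And>T. T \<in> bounded_ops m n \<Longrightarrow> cmod (pairing m n T h) \<le> op_norm m n T * c"
  shows "\<exists>h'\<in>Gamma m n. (AE z in m \<Otimes>\<^sub>M n. h' z = limit_mult z * h z) \<and>
    (\<forall>T\<in>bounded_ops m n. cmod (pairing m n T h') \<le> op_norm m n T * (C * c))"
proof -
  obtain u where u: "u \<in> sq_int (m \<Otimes>\<^sub>M n)" "AE z in m \<Otimes>\<^sub>M n. h z = u z"
    "\<And>k. k \<in> sq_int (m \<Otimes>\<^sub>M n) \<Longrightarrow> pairing m n (kop m n k) h = (\<integral>z. k z * u z \<partial>(m \<Otimes>\<^sub>M n))"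
    using Gamma_AE_sq_int[OF h] by blast
  let ?A = "\<lambda>z. limit_mult z * u z"
  have A: "?A \<in> sq_int (m \<Otimes>\<^sub>M n)" by (rule limit_mult_sq_int[OF u(1)])
  have Cc: "C * c \<ge> 0" using C_pos c by simp
  have "cmod (\<integral>z. K z * ?A z \<partial>(m \<Otimes>\<^sub>M n)) \<le> C * c * op_norm m n (kop m n K)"
    if K: "K \<in> sq_int (m \<Otimes>\<^sub>M n)" for K
  proof (rule LIMSEQ_le_const2)
    have uc: "(\<lambda>z. cnj (u z)) \<in> sq_int (m \<Otimes>\<^sub>M n)" using u(1) by auto
    \<comment> \<open>For each \<open>j\<close> the integral is the pairing of
      \<open>\<Phi> j (kop m n K)\<close> with \<open>h\<close>, so it obeys a bound independent of
      \<open>j\<close>. Square mean convergence of the kernels carries the bound to the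
      limit.\<close>
    have "(\<lambda>j. ip (m \<Otimes>\<^sub>M n) (\<lambda>z. \<phi> j z * K z) (\<lambda>z. cnj (u z)))
        \<longlonglongrightarrow> ip (m \<Otimes>\<^sub>M n) (\<lambda>z. limit_mult z * K z) (\<lambda>z. cnj (u z))"
      by (rule tendsto_ip(2)[OF mult_sq_int[OF K] limit_mult_sq_int[OF K] uc kernel_limit[OF K]])
    then have "(\<lambda>j. \<integral>z. \<phi> j z * K z * u z \<partial>(m \<Otimes>\<^sub>M n)) \<longlonglongrightarrow> (\<integral>z. K z * ?A z \<partial>(m \<Otimes>\<^sub>M n))"
      by (simp add: ip_def mult_ac)
    then show "(\<lambda>j. cmod (\<integral>z. \<phi> j z * K z * u z \<partial>(m \<Otimes>\<^sub>M n))) \<longlonglongrightarrow> cmod (\<integral>z. K z * ?A z \<partial>(m \<Otimes>\<^sub>M n))"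
      by (rule tendsto_norm)
    have "cmod (\<integral>z. \<phi> j z * K z * u z \<partial>(m \<Otimes>\<^sub>M n)) \<le> C * c * op_norm m n (kop m n K)" for j
    proof -
      have Kb: "kop m n K \<in> bounded_ops m n" by (rule kop_bounded[OF K])
      have "(\<integral>z. \<phi> j z * K z * u z \<partial>(m \<Otimes>\<^sub>M n)) = pairing m n (\<Phi> j (kop m n K)) h"
        unfolding schur_kop[OF pair K] u(3)[OF mult_sq_int[OF K]] ..
      also have "cmod \<dots> \<le> op_norm m n (\<Phi> j (kop m n K)) * c"
        by (intro c(2) schur_bounded[OF pair] Kb)
      also have "\<dots> \<le> C * op_norm m n (kop m n K) * c"
        by (intro mult_right_mono norm_le Kb c(1))
      finally show ?thesis by (simp add: mult_ac)
    qed
    then show "\<exists>N. \<forall>j\<ge>N. cmod (\<integral>z. \<phi> j z * K z * u z \<partial>(m \<Otimes>\<^sub>M n)) \<le> C * c * op_norm m n (kop m n K)"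
      by blast
  qed
  from trace_class_criterion[OF A Cc this] obtain F G where FG: "gexp m n F G"
    "(\<Sum>i. (nm m (F i))\<^sup>2) \<le> C * c" "(\<Sum>i. (nm n (G i))\<^sup>2) \<le> C * c" "AE z in m \<Otimes>\<^sub>M n. ?A z = gsum F G z"
    by blast
  have ge: "gamma_expansion m n (gsum F G) F G" by (rule gamma_expansion_gsum[OF FG(1)])
  have "AE z in m \<Otimes>\<^sub>M n. gsum F G z = limit_mult z * h z"
    using FG(4) u(2) by eventually_elim simp
  moreover have "cmod (pairing m n T (gsum F G)) \<le> op_norm m n T * (C * c)" if T: "T \<in> bounded_ops m n" for T
  proof -
    have "cmod (pairing m n T (gsum F G)) \<le> op_norm m n T * (((\<Sum>i. (nm m (F i))\<^sup>2) + (\<Sum>i. (nm n (G i))\<^sup>2)) / 2)"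
      unfolding pairing_eq[OF T ge] by (rule summable_bform(2)[OF T FG(1)])
    also have "\<dots> \<le> op_norm m n T * (C * c)"
      using FG(2,3) by (intro mult_left_mono op_norm_nonneg[OF T]) simp
    finally show ?thesis .
  qed
  ultimately show ?thesis using Gamma_I[OF ge] by blast
qed

lemma limit_mult_schur_multiplier: "schur_multiplier m n limit_mult"
  unfolding schur_multiplier_def
proof (intro conjI limit_mult_ess ballI)
  fix h assume h: "h \<in> Gamma m n"
  obtain c where c: "c \<ge> 0" "\<forall>T\<in>bounded_ops m n. cmod (pairing m n T h) \<le> op_norm m n T * c"
    using pairing_bound[OF h] by blast
  show "\<exists>h'\<in>Gamma m n. AE z in m \<Otimes>\<^sub>M n. h' z = limit_mult z * h z"
    using limit_mult_Gamma[OF h c(1)] c(2) by blast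
qed

text \<open>A choice determined only up to null sets, so \<open>mul\<close> is not linear. Its
  pairings with operators are, by \<open>pairing_mul_cong\<close>.\<close>

definition mul :: "('x \<times> 'y \<Rightarrow> complex) \<Rightarrow> 'x \<times> 'y \<Rightarrow> complex" where
  "mul h = (SOME h'. h' \<in> Gamma m n \<and> (AE z in m \<Otimes>\<^sub>M n. h' z = limit_mult z * h z))"

lemma mul:
  assumes "h \<in> Gamma m n"
  shows "mul h \<in> Gamma m n" "AE z in m \<Otimes>\<^sub>M n. mul h z = limit_mult z * h z"
proof -
  have "\<exists>h'. h' \<in> Gamma m n \<and> (AE z in m \<Otimes>\<^sub>M n. h' z = limit_mult z * h z)"
    using limit_mult_schur_multiplier assms unfolding schur_multiplier_def by blast
  from someI_ex[OF this] show "mul h \<in> Gamma m n" "AE z in m \<Otimes>\<^sub>M n. mul h z = limit_mult z * h z"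
    unfolding mul_def by blast+
qed

lemma pairing_mul_cong:
  assumes T: "T \<in> bounded_ops m n" and h: "h \<in> Gamma m n" "h' \<in> Gamma m n"
    and eq: "AE z in m \<Otimes>\<^sub>M n. h' z = limit_mult z * h z"
  shows "pairing m n T h' = pairing m n T (mul h)"
proof (rule pairing_cong_AE[OF T h(2) mul(1)[OF h(1)]])
  show "AE z in m \<Otimes>\<^sub>M n. h' z = mul h z" using eq mul(2)[OF h(1)] by eventually_elim simp
qed

lemma pairing_mul_add:
  assumes T: "T \<in> bounded_ops m n" and h: "h \<in> Gamma m n" "h' \<in> Gamma m n" "h'' \<in> Gamma m n"
    and eq: "AE z in m \<Otimes>\<^sub>M n. h'' z = h z + h' z"
  shows "pairing m n T (mul h'') = pairing m n T (mul h) + pairing m n T (mul h')"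
proof -
  have "AE z in m \<Otimes>\<^sub>M n. mul h z + mul h' z = limit_mult z * h'' z"
    using mul(2)[OF h(1)] mul(2)[OF h(2)] eq by eventually_elim (simp add: distrib_left)
  from pairing_mul_cong[OF T h(3) Gamma_add(1)[OF mul(1)[OF h(1)] mul(1)[OF h(2)]] this]
  show ?thesis using Gamma_add(2)[OF mul(1)[OF h(1)] mul(1)[OF h(2)] T] by simp
qed

lemma pairing_mul_bound:
  assumes h: "h \<in> Gamma m n" and c: "c \<ge> 0" "\<And>T. T \<in> bounded_ops m n \<Longrightarrow> cmod (pairing m n T h) \<le> op_norm m n T * c"
    and T: "T \<in> bounded_ops m n"
  shows "cmod (pairing m n T (mul h)) \<le> op_norm m n T * (C * c)"
proof -
  obtain h' where h': "h' \<in> Gamma m n" "AE z in m \<Otimes>\<^sub>M n. h' z = limit_mult z * h z"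
    "\<forall>T\<in>bounded_ops m n. cmod (pairing m n T h') \<le> op_norm m n T * (C * c)"
    using limit_mult_Gamma[OF h c] by blast
  show ?thesis using h'(3) T unfolding pairing_mul_cong[OF T h h'(1,2), symmetric] by blast
qed

section \<open>The limit Schur map\<close>

lemma bounded_form_mul:
  assumes T: "T \<in> bounded_ops m n"
  shows "bounded_form m n (\<lambda>f g. pairing m n T (mul (tensor f g))) (C * op_norm m n T)"
proof
  show "0 \<le> C * op_norm m n T" using C_pos op_norm_nonneg[OF T] by simp
next
  fix f f' g assume "f \<in> sq_int m" "f' \<in> sq_int m" "g \<in> sq_int n"
  then show "pairing m n T (mul (tensor (\<lambda>x. f x + f' x) g)) = pairing m n T (mul (tensor f g)) + pairing m n T (mul (tensor f' g))"
    by (intro pairing_mul_add T tensor_in_Gamma sq_int_add AE_I2) (simp_all add: tensor_def distrib_right)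
next
  fix f g g' assume "f \<in> sq_int m" "g \<in> sq_int n" "g' \<in> sq_int n"
  then show "pairing m n T (mul (tensor f (\<lambda>y. g y + g' y))) = pairing m n T (mul (tensor f g)) + pairing m n T (mul (tensor f g'))"
    by (intro pairing_mul_add T tensor_in_Gamma sq_int_add AE_I2) (simp_all add: tensor_def distrib_left)
next
  fix f g c assume fg: "f \<in> sq_int m" "g \<in> sq_int n"
  note t = tensor_in_Gamma[OF fg]
  have "AE z in m \<Otimes>\<^sub>M n. c * mul (tensor f g) z = limit_mult z * tensor (\<lambda>x. c * f x) g z"
    using mul(2)[OF t] by eventually_elim (simp add: tensor_def mult_ac)
  from pairing_mul_cong[OF T tensor_in_Gamma[OF sq_int_cmult[OF fg(1)] fg(2)] Gamma_cmult(1)[OF mul(1)[OF t]] this]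
  show 1: "pairing m n T (mul (tensor (\<lambda>x. c * f x) g)) = c * pairing m n T (mul (tensor f g))"
    by (simp add: Gamma_cmult(2)[OF mul(1)[OF t] T])
  have "tensor f (\<lambda>y. c * g y) = tensor (\<lambda>x. c * f x) g" by (simp add: tensor_def mult_ac)
  with 1 show "pairing m n T (mul (tensor f (\<lambda>y. c * g y))) = c * pairing m n T (mul (tensor f g))" by simp
next
  fix f g assume fg: "f \<in> sq_int m" "g \<in> sq_int n"
  have "cmod (pairing m n T (mul (tensor f g))) \<le> op_norm m n T * (C * (nm m f * nm n g))"
    using bform_bound[OF _ fg]
    by (intro pairing_mul_bound T tensor_in_Gamma fg) (simp_all add: pairing_tensor fg mult.assoc)
  then show "cmod (pairing m n T (mul (tensor f g))) \<le> C * op_norm m n T * nm m f * nm n g"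
    by (simp add: mult_ac)
qed

text \<open>Defined on elementary tensors only, as the dual of multiplication by
  \<open>limit_mult\<close>. That it is the dual on the whole predual is
  \<open>pairing_limit_map\<close>. The restriction makes it extensional, as
  \<open>is_schur_map\<close> demands.\<close>

definition limit_map :: "('x, 'y) l2_op \<Rightarrow> ('x, 'y) l2_op" where
  "limit_map = (\<lambda>T\<in>bounded_ops m n. SOME R. R \<in> bounded_ops m n \<and>
     (\<forall>f\<in>sq_int m. \<forall>g\<in>sq_int n. bform m n R f g = pairing m n T (mul (tensor f g))))"

lemma limit_map:
  assumes T: "T \<in> bounded_ops m n"
  shows limit_map_bounded: "limit_map T \<in> bounded_ops m n"
    and bform_limit_map: "\<And>f g. f \<in> sq_int m \<Longrightarrow> g \<in> sq_int n \<Longrightarrow>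
      bform m n (limit_map T) f g = pairing m n T (mul (tensor f g))"
proof -
  have "\<exists>R. R \<in> bounded_ops m n \<and>
     (\<forall>f\<in>sq_int m. \<forall>g\<in>sq_int n. bform m n R f g = pairing m n T (mul (tensor f g)))"
    using op_of_form[OF bounded_form_mul[OF T]] by blast
  from someI_ex[OF this] show "limit_map T \<in> bounded_ops m n"
    "\<And>f g. f \<in> sq_int m \<Longrightarrow> g \<in> sq_int n \<Longrightarrow>
      bform m n (limit_map T) f g = pairing m n T (mul (tensor f g))"
    using T unfolding limit_map_def by auto
qed

lemma limit_map_norm_le:
  assumes T: "T \<in> bounded_ops m n" shows "op_norm m n (limit_map T) \<le> C * op_norm m n T"
  using bounded_form.bound[OF bounded_form_mul[OF T]] bounded_form.K_nonneg[OF bounded_form_mul[OF T]]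
  by (intro op_norm_leI limit_map_bounded T) (simp_all add: bform_limit_map[OF T])

text \<open>
  Weak* continuity: the pairing with the tails of an expansion is controlled by
  the bound on \<open>mul\<close>.
\<close>

lemma pairing_limit_map:
  assumes T: "T \<in> bounded_ops m n" and h: "h \<in> Gamma m n"
  shows "pairing m n (limit_map T) h = pairing m n T (mul h)"
proof -
  obtain F G where ge: "gamma_expansion m n h F G" and FG: "gexp m n F G" using h by (rule Gamma_E)
  let ?tail = "\<lambda>N. gsum (\<lambda>i. F (i + N)) (\<lambda>i. G (i + N))"
  let ?t = "\<lambda>i. tensor (F i) (G i)"
  have sh: "gexp m n (\<lambda>i. F (i + N)) (\<lambda>i. G (i + N))" for N by (rule gexp_shift[OF FG])
  have tail: "?tail N \<in> Gamma m n" for N by (rule Gamma_I[OF gamma_expansion_gsum[OF sh]])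
  have tG: "?t i \<in> Gamma m n" for i by (intro tensor_in_Gamma gexpD[OF FG])
  \<comment> \<open>Additivity under the pairing is known for two summands at a time, so the
    infinite sum is approached by splitting off one head after the other.\<close>
  have rest: "pairing m n T (mul h) - (\<Sum>i<N. pairing m n T (mul (?t i))) = pairing m n T (mul (?tail N))" for N
  proof (induction N)
    case 0
    have "AE z in m \<Otimes>\<^sub>M n. mul h z = limit_mult z * gsum F G z"
      using mul(2)[OF h] gamma_expansion_AE[OF ge] by eventually_elim simp
    from pairing_mul_cong[OF T tail[of 0, simplified] mul(1)[OF h] this] show ?case by simp
  next
    case (Suc N)
    have "AE z in m \<Otimes>\<^sub>M n. ?tail N z = ?t N z + ?tail (Suc N) z"
      using gexp_AE_bound[OF sh[of N]]
    proof eventually_elim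
      case (elim z)
      then have "summable (\<lambda>i. ?t (i + N) z)" by blast
      from suminf_split_head[OF this] show ?case by (simp add: gsum_def)
    qed
    from pairing_mul_add[OF T tG tail tail this] show ?case
      unfolding sum.lessThan_Suc diff_diff_add[symmetric] Suc.IH by simp
  qed
  define c where "c N = ((\<Sum>i. (nm m (F (i + N)))\<^sup>2) + (\<Sum>i. (nm n (G (i + N)))\<^sup>2)) / 2" for N
  have c0: "c N \<ge> 0" for N unfolding c_def using gexpD(3,4)[OF sh[of N]] by (simp add: suminf_nonneg)
  have cb: "cmod (pairing m n R (?tail N)) \<le> op_norm m n R * c N" if "R \<in> bounded_ops m n" for R N
    unfolding pairing_eq[OF that gamma_expansion_gsum[OF sh]] c_def by (rule summable_bform(2)[OF that sh])
  have bound: "cmod (pairing m n T (mul (?tail N))) \<le> op_norm m n T * (C * c N)" for N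
    by (rule pairing_mul_bound[OF tail c0 cb T])
  have "c \<longlonglongrightarrow> (0 + 0) / 2"
    unfolding c_def by (intro tendsto_divide tendsto_add tendsto_const suminf_exist_split2 gexpD[OF FG]) simp
  then have "(\<lambda>N. op_norm m n T * (C * c N)) \<longlonglongrightarrow> op_norm m n T * (C * 0)"
    by (intro tendsto_mult tendsto_const) simp
  then have "(\<lambda>N. op_norm m n T * (C * c N)) \<longlonglongrightarrow> 0" by simp
  then have "(\<lambda>N. pairing m n T (mul (?tail N))) \<longlonglongrightarrow> 0"
    by (rule Lim_null_comparison[OF always_eventually[OF allI[OF bound]]])
  from tendsto_diff[OF tendsto_const this, of "pairing m n T (mul h)"]
  have "(\<lambda>N. pairing m n T (mul h) - pairing m n T (mul (?tail N))) \<longlonglongrightarrow> pairing m n T (mul h)" by simp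
  moreover have "pairing m n T (mul h) - pairing m n T (mul (?tail N)) = (\<Sum>i<N. bform m n (limit_map T) (F i) (G i))" for N
    unfolding rest[symmetric] bform_limit_map[OF T gexpD(1,2)[OF FG]] by simp
  ultimately have "(\<lambda>i. bform m n (limit_map T) (F i) (G i)) sums pairing m n T (mul h)"
    unfolding sums_def by (simp only:)
  then show ?thesis using pairing_sums[OF limit_map_bounded[OF T] ge] by (rule sums_unique2[symmetric])
qed

lemma limit_pair: "schur_pair limit_mult limit_map"
  unfolding schur_pair_def is_schur_map_def
proof (intro conjI ballI impI limit_mult_schur_multiplier)
  show "limit_map \<in> bounded_ops m n \<rightarrow>\<^sub>E bounded_ops m n"
    using limit_map_bounded by (auto simp: limit_map_def)
  fix T h h' assume "T \<in> bounded_ops m n" "h \<in> Gamma m n" "h' \<in> Gamma m n"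
    "AE z in m \<Otimes>\<^sub>M n. h' z = limit_mult z * h z"
  then show "pairing m n (limit_map T) h = pairing m n T h'"
    by (simp add: pairing_limit_map pairing_mul_cong)
qed

end

section \<open>Annihilators and supports\<close>

lemma masa_bimoduleD:
  assumes "masa_bimodule m n U"
  shows "op_subspace m n U"
    "T \<in> U \<Longrightarrow> a \<in> ess_bounded m \<Longrightarrow> b \<in> ess_bounded n \<Longrightarrow> sandwich m n b T a \<in> U"
  using assms by (auto simp: masa_bimodule_def)

text \<open>The vectors \<open>S f\<close> with \<open>S\<close> in \<open>U\<close> all lie in the
  closed hyperplane orthogonal to the conjugate of \<open>g\<close>, and \<open>T f\<close> is a
  limit of such vectors.\<close>

lemma Ref_bform_zero:
  assumes U: "U \<subseteq> bounded_ops m n" and T: "T \<in> Ref m n U" and f: "f \<in> sq_int m" and g: "g \<in> sq_int n"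
    and zero: "\<And>S. S \<in> U \<Longrightarrow> bform m n S f g = 0"
  shows "bform m n T f g = 0"
proof -
  have Tb: "T \<in> bounded_ops m n" using T by (simp add: Ref_def)
  have cl: "T (cls m f) \<in> l2_topology n closure_of ((\<lambda>S. S (cls m f)) ` U)"
    using T f by (simp add: Ref_def)
  have sub: "(\<lambda>S. S (cls m f)) ` U \<subseteq> L2 n" using U f bounded_ops_L2 by blast
  have "cmod (bform m n T f g) \<le> e * nm n g" if e: "e > 0" for e
  proof -
    have "\<exists>v\<in>(\<lambda>S. S (cls m f)) ` U. l2_dist n (T (cls m f)) v < e"
      using cl e in_l2_closure_iff[OF sub bounded_ops_L2[OF Tb cls_in_L2[OF f]]] by blast
    then obtain S where S: "S \<in> U" "l2_dist n (T (cls m f)) (S (cls m f)) < e" by blast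
    have Sb: "S \<in> bounded_ops m n" using S U by blast
    have "bform m n T f g = ip n (\<lambda>y. ap m T f y - ap m S f y) (\<lambda>y. cnj (g y))"
      using zero[OF S(1)] f g Tb Sb by (simp add: bform_eq_ip ip_diff_left)
    also have "cmod \<dots> \<le> nm n (\<lambda>y. ap m T f y - ap m S f y) * nm n (\<lambda>y. cnj (g y))"
      by (intro norm_ip_le sq_int_diff ap_sq_int[OF Tb f] ap_sq_int[OF Sb f] sq_int_cnj g)
    also have "\<dots> \<le> e * nm n g"
      using S(2) unfolding l2_dist_eq ap_def[symmetric] by (simp add: mult_right_mono)
    finally show ?thesis .
  qed
  then have "cmod (bform m n T f g) \<le> inverse (real (Suc k)) * nm n g" for k by simp
  then have "cmod (bform m n T f g) \<le> 0"
    by (intro LIMSEQ_le_const[OF tendsto_mult_left_zero[OF LIMSEQ_inverse_real_of_nat, of "nm n g"]]) blast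
  then show ?thesis by simp
qed

section \<open>Bounded test functions and rows of multipliers\<close>

definition truncate :: "nat \<Rightarrow> ('a \<Rightarrow> complex) \<Rightarrow> 'a \<Rightarrow> complex" where
  "truncate N f x = (if cmod (f x) \<le> real N then f x else 0)"

lemma truncate:
  assumes f: "f \<in> sq_int m"
  shows truncate_sq_int: "truncate N f \<in> sq_int m" and truncate_ess: "truncate N f \<in> ess_bounded m"
    and nm_truncate_le: "nm m (truncate N f) \<le> nm m f"
    and truncate_tendsto: "(\<lambda>N. nm m (\<lambda>x. truncate N f x - f x)) \<longlonglongrightarrow> 0"
proof -
  have [measurable]: "f \<in> borel_measurable m" using f by (rule sq_int_measurable)
  have m: "truncate N f \<in> borel_measurable m" for N unfolding truncate_def by measurable
  note m [measurable]
  show s: "truncate N f \<in> sq_int m" for N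
    by (rule sq_intI[OF m sq_int_integrable[OF f]]) (simp add: truncate_def)
  show "truncate N f \<in> ess_bounded m"
    unfolding ess_bounded_def using m by (auto simp: truncate_def intro!: exI[of _ "real N"] AE_I2)
  have "(nm m (truncate N f))\<^sup>2 \<le> (nm m f)\<^sup>2"
    unfolding nm_sq using sq_int_integrable[OF s] sq_int_integrable[OF f]
    by (intro integral_mono) (simp_all add: truncate_def)
  then show "nm m (truncate N f) \<le> nm m f" by (rule power2_le_imp_le) simp
  have "(\<lambda>N. \<integral>x. (cmod (truncate N f x - f x))\<^sup>2 \<partial>m) \<longlonglongrightarrow> (\<integral>x. 0 \<partial>m)"
  proof (rule integral_dominated_convergence[OF _ _ sq_int_integrable[OF f]])
    show "AE x in m. (\<lambda>N. (cmod (truncate N f x - f x))\<^sup>2) \<longlonglongrightarrow> 0"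
    proof (rule AE_I2)
      fix x
      obtain N0 :: nat where "cmod (f x) \<le> real N0" using real_arch_simple by blast
      then have "(cmod (truncate N f x - f x))\<^sup>2 = 0" if "N \<ge> N0" for N
        using that by (simp add: truncate_def)
      then show "(\<lambda>N. (cmod (truncate N f x - f x))\<^sup>2) \<longlonglongrightarrow> 0"
        by (intro tendsto_eventually eventually_sequentiallyI)
    qed
    show "AE x in m. norm ((cmod (truncate N f x - f x))\<^sup>2) \<le> (cmod (f x))\<^sup>2" for N
      by (rule AE_I2) (simp add: truncate_def)
  qed measurable
  then have "(\<lambda>N. sqrt (\<integral>x. (cmod (truncate N f x - f x))\<^sup>2 \<partial>m)) \<longlonglongrightarrow> sqrt 0"
    by (intro tendsto_real_sqrt) simp
  then show "(\<lambda>N. nm m (\<lambda>x. truncate N f x - f x)) \<longlonglongrightarrow> 0" by (simp add: nm_def)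
qed

text \<open>By density of truncations. In the perturbation argument the test functions also serve as
  multipliers of a sandwich, so they must be essentially bounded.\<close>

lemma op_norm_leI_bounded:
  assumes T: "T \<in> bounded_ops m n" and C: "0 \<le> C"
    and le: "\<And>f g. f \<in> sq_int m \<Longrightarrow> f \<in> ess_bounded m \<Longrightarrow> g \<in> sq_int n \<Longrightarrow> g \<in> ess_bounded n \<Longrightarrow>
      cmod (bform m n T f g) \<le> C * nm m f * nm n g"
  shows "op_norm m n T \<le> C"
proof (rule op_norm_leI[OF T C])
  interpret T: bounded_form m n "bform m n T" "op_norm m n T" by (rule bounded_form_bform[OF T])
  fix f g assume f: "f \<in> sq_int m" and g: "g \<in> sq_int n"
  let ?f = "\<lambda>N. truncate N f" and ?g = "\<lambda>N. truncate N g"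
  have "(\<lambda>N. bform m n T (?f N) (?g N) - bform m n T f g) \<longlonglongrightarrow> 0"
  proof (rule Lim_null_comparison)
    let ?b = "\<lambda>N. op_norm m n T * nm m (\<lambda>x. ?f N x - f x) * nm n g + op_norm m n T * nm m f * nm n (\<lambda>y. ?g N y - g y)"
    show "\<forall>\<^sub>F N in sequentially. norm (bform m n T (?f N) (?g N) - bform m n T f g) \<le> ?b N"
    proof (intro always_eventually allI)
      fix N
      note fN = truncate_sq_int[OF f, of N] and gN = truncate_sq_int[OF g, of N]
      have "bform m n T (?f N) (?g N) - bform m n T f g
          = bform m n T (\<lambda>x. ?f N x - f x) (?g N) + bform m n T f (\<lambda>y. ?g N y - g y)"
        by (simp add: T.diff_left[OF fN f gN] T.diff_right[OF f gN g])
      also have "norm \<dots> \<le> norm (bform m n T (\<lambda>x. ?f N x - f x) (?g N)) + norm (bform m n T f (\<lambda>y. ?g N y - g y))"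
        by (rule norm_triangle_ineq)
      also have "\<dots> \<le> op_norm m n T * nm m (\<lambda>x. ?f N x - f x) * nm n (?g N) + op_norm m n T * nm m f * nm n (\<lambda>y. ?g N y - g y)"
        by (intro add_mono T.bound sq_int_diff fN gN f g)
      also have "\<dots> \<le> ?b N"
        using nm_truncate_le[OF g, of N] T.K_nonneg by (intro add_right_mono mult_left_mono mult_nonneg_nonneg) auto
      finally show "norm (bform m n T (?f N) (?g N) - bform m n T f g) \<le> ?b N" .
    qed
    have "?b \<longlonglongrightarrow> op_norm m n T * 0 * nm n g + op_norm m n T * nm m f * 0"
      by (intro tendsto_intros truncate_tendsto f g)
    then show "?b \<longlonglongrightarrow> 0" by simp
  qed
  then have "(\<lambda>N. bform m n T (?f N) (?g N)) \<longlonglongrightarrow> bform m n T f g" by (simp add: LIM_zero_iff)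
  then have "(\<lambda>N. cmod (bform m n T (?f N) (?g N))) \<longlonglongrightarrow> cmod (bform m n T f g)" by (rule tendsto_norm)
  moreover have "cmod (bform m n T (?f N) (?g N)) \<le> C * nm m f * nm n g" for N
  proof -
    have "cmod (bform m n T (?f N) (?g N)) \<le> C * nm m (?f N) * nm n (?g N)"
      by (intro le truncate_sq_int truncate_ess f g)
    also have "\<dots> \<le> C * nm m f * nm n g"
      by (intro mult_mono nm_truncate_le f g mult_left_mono C mult_nonneg_nonneg) auto
    finally show ?thesis .
  qed
  ultimately show "cmod (bform m n T f g) \<le> C * nm m f * nm n g"
    by (intro LIMSEQ_le_const2) auto
qed

text \<open>A sequence of functions with square sums at most the square of \<open>a\<close> is a row
  operator of norm at most \<open>a\<close>: integrate the pointwise bound.\<close>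

lemma row_mult:
  assumes f: "f \<in> sq_int m" and A: "\<And>i::nat. A i \<in> borel_measurable m"
    and bound: "\<And>x N. (\<Sum>i<N. (cmod (A i x))\<^sup>2) \<le> a\<^sup>2"
  shows "(\<lambda>x. f x * A i x) \<in> sq_int m" "summable (\<lambda>i. (nm m (\<lambda>x. f x * A i x))\<^sup>2)"
    "(\<Sum>i. (nm m (\<lambda>x. f x * A i x))\<^sup>2) \<le> (a * nm m f)\<^sup>2"
proof -
  have [measurable]: "f \<in> borel_measurable m" using f by (rule sq_int_measurable)
  note A [measurable]
  have Ai: "(cmod (A i x))\<^sup>2 \<le> a\<^sup>2" for i x
  proof -
    have "(cmod (A i x))\<^sup>2 \<le> (\<Sum>j<Suc i. (cmod (A j x))\<^sup>2)" by (simp add: sum_nonneg)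
    then show ?thesis using bound[where N = "Suc i" and x = x] by linarith
  qed
  have ia: "integrable m (\<lambda>x. a\<^sup>2 * (cmod (f x))\<^sup>2)" using sq_int_integrable[OF f] by simp
  show s: "(\<lambda>x. f x * A i x) \<in> sq_int m" for i
  proof (rule sq_intI[OF _ ia])
    fix x
    have "(cmod (f x))\<^sup>2 * (cmod (A i x))\<^sup>2 \<le> (cmod (f x))\<^sup>2 * a\<^sup>2" by (intro mult_left_mono Ai) simp
    then show "(cmod (f x * A i x))\<^sup>2 \<le> a\<^sup>2 * (cmod (f x))\<^sup>2"
      by (simp add: norm_mult power_mult_distrib mult.commute)
  qed measurable
  have partial: "(\<Sum>i<N. (nm m (\<lambda>x. f x * A i x))\<^sup>2) \<le> (a * nm m f)\<^sup>2" for N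
  proof -
    have "(\<Sum>i<N. (nm m (\<lambda>x. f x * A i x))\<^sup>2) = (\<integral>x. (\<Sum>i<N. (cmod (f x * A i x))\<^sup>2) \<partial>m)"
      unfolding nm_sq by (intro Bochner_Integration.integral_sum[symmetric] sq_int_integrable s)
    also have "\<dots> \<le> (\<integral>x. a\<^sup>2 * (cmod (f x))\<^sup>2 \<partial>m)"
    proof (rule integral_mono[OF _ ia])
      show "integrable m (\<lambda>x. \<Sum>i<N. (cmod (f x * A i x))\<^sup>2)"
        by (intro Bochner_Integration.integrable_sum sq_int_integrable s)
      fix x
      have "(cmod (f x))\<^sup>2 * (\<Sum>i<N. (cmod (A i x))\<^sup>2) \<le> (cmod (f x))\<^sup>2 * a\<^sup>2"
        by (intro mult_left_mono bound) auto
      then show "(\<Sum>i<N. (cmod (f x * A i x))\<^sup>2) \<le> a\<^sup>2 * (cmod (f x))\<^sup>2"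
        by (simp add: norm_mult power_mult_distrib sum_distrib_left mult.commute)
    qed
    also have "\<dots> = (a * nm m f)\<^sup>2" by (simp add: power_mult_distrib nm_sq)
    finally show ?thesis .
  qed
  show sm: "summable (\<lambda>i. (nm m (\<lambda>x. f x * A i x))\<^sup>2)"
    by (rule bounded_imp_summable) (use partial in \<open>simp_all only: lessThan_Suc_atMost[symmetric] zero_le_power2\<close>)
  show "(\<Sum>i. (nm m (\<lambda>x. f x * A i x))\<^sup>2) \<le> (a * nm m f)\<^sup>2"
    by (rule suminf_le_const[OF sm partial])
qed

text \<open>The function of \<open>x\<close> and \<open>y\<close> given by the sum of
  \<open>A i x * B i y\<close> is a Schur multiplier of norm at most \<open>a * b\<close>, and the
  series is the form of its Schur map applied to \<open>S\<close>. This is the easy half of the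
  characterization of Schur multipliers.\<close>

lemma suminf_bform_rows_le:
  assumes S: "S \<in> bounded_ops m n" and f: "f \<in> sq_int m" and g: "g \<in> sq_int n"
    and A: "\<And>i::nat. A i \<in> borel_measurable m" "\<And>x N. (\<Sum>i<N. (cmod (A i x))\<^sup>2) \<le> a\<^sup>2" "a \<ge> 0"
    and B: "\<And>i::nat. B i \<in> borel_measurable n" "\<And>y N. (\<Sum>i<N. (cmod (B i y))\<^sup>2) \<le> b\<^sup>2" "b \<ge> 0"
  shows "summable (\<lambda>i. bform m n S (\<lambda>x. f x * A i x) (\<lambda>y. g y * B i y))"
    and "cmod (\<Sum>i. bform m n S (\<lambda>x. f x * A i x) (\<lambda>y. g y * B i y)) \<le> op_norm m n S * (a * b) * nm m f * nm n g"
proof -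
  note fA = row_mult[OF f A(1,2)] and gB = row_mult[OF g B(1,2)]
  let ?s = "\<lambda>i. nm m (\<lambda>x. f x * A i x)" and ?t = "\<lambda>i. nm n (\<lambda>y. g y * B i y)"
  note cs = summable_sq_imp_prod[OF fA(2) gB(2) nm_nonneg nm_nonneg]
  have "(\<Sum>i. ?s i * ?t i)\<^sup>2 \<le> (a * nm m f)\<^sup>2 * (b * nm n g)\<^sup>2"
    using cs(3) by (rule order_trans) (intro mult_mono fA gB suminf_nonneg; simp)
  then have "(\<Sum>i. ?s i * ?t i)\<^sup>2 \<le> ((a * nm m f) * (b * nm n g))\<^sup>2" by (simp only: power_mult_distrib)
  then have st: "(\<Sum>i. ?s i * ?t i) \<le> (a * nm m f) * (b * nm n g)"
    by (rule power2_le_imp_le) (use A B in simp)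
  have le: "cmod (bform m n S (\<lambda>x. f x * A i x) (\<lambda>y. g y * B i y)) \<le> op_norm m n S * (?s i * ?t i)" for i
    using bform_bound[OF S fA(1) gB(1)] by (simp add: mult.assoc)
  have n: "summable (\<lambda>i. cmod (bform m n S (\<lambda>x. f x * A i x) (\<lambda>y. g y * B i y)))"
    by (rule summable_comparison_test[OF _ summable_mult[OF cs(1)]]) (use le in auto)
  then show "summable (\<lambda>i. bform m n S (\<lambda>x. f x * A i x) (\<lambda>y. g y * B i y))" by (rule summable_norm_cancel)
  have "cmod (\<Sum>i. bform m n S (\<lambda>x. f x * A i x) (\<lambda>y. g y * B i y))
      \<le> (\<Sum>i. cmod (bform m n S (\<lambda>x. f x * A i x) (\<lambda>y. g y * B i y)))" by (rule summable_norm[OF n])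
  also have "\<dots> \<le> (\<Sum>i. op_norm m n S * (?s i * ?t i))" by (rule suminf_le[OF le n summable_mult[OF cs(1)]])
  also have "\<dots> = op_norm m n S * (\<Sum>i. ?s i * ?t i)" by (rule suminf_mult[OF cs(1)])
  also have "\<dots> \<le> op_norm m n S * ((a * nm m f) * (b * nm n g))" by (intro mult_left_mono st op_norm_nonneg S)
  finally show "cmod (\<Sum>i. bform m n S (\<lambda>x. f x * A i x) (\<lambda>y. g y * B i y)) \<le> op_norm m n S * (a * b) * nm m f * nm n g"
    by (simp add: mult_ac)
qed

text \<open>Lists encode finitely supported sequences; with entries from a countable dense set there
  are only countably many of them.\<close>

definition pad :: "complex list \<Rightarrow> nat \<Rightarrow> complex" where
  "pad l i = (if i < length l then l ! i else 0)"

definition lnorm :: "complex list \<Rightarrow> real" where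
  "lnorm l = L2_set (\<lambda>i. cmod (pad l i)) {..<length l}"

text \<open>The points whose sequence lies in the ball of radius \<open>d\<close> around
  \<open>l\<close> in the space of square summable sequences. Bounding all partial sums includes
  summability of the difference.\<close>

definition near :: "'a measure \<Rightarrow> (nat \<Rightarrow> 'a \<Rightarrow> complex) \<Rightarrow> complex list \<Rightarrow> real \<Rightarrow> 'a set" where
  "near m F l d = {x \<in> space m. \<forall>N. (\<Sum>i<N. (cmod (F i x - pad l i))\<^sup>2) \<le> d\<^sup>2}"

definition lprod :: "complex list \<Rightarrow> complex list \<Rightarrow> complex" where
  "lprod l l' = (\<Sum>i<length l. pad l i * pad l' i)"

lemma near_sets:
  assumes [measurable]: "\<And>i. F i \<in> borel_measurable m" shows "near m F l d \<in> sets m"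
proof -
  have [measurable]: "(\<lambda>x. (cmod (F i x - c))\<^sup>2) \<in> borel_measurable m" for i c by measurable
  show ?thesis unfolding near_def by measurable
qed

lemma sum_pad_le: "(\<Sum>i<N. (cmod (pad l i))\<^sup>2) \<le> (lnorm l)\<^sup>2"
proof -
  have "(\<Sum>i<N. (cmod (pad l i))\<^sup>2) = (\<Sum>i\<in>{..<N} \<inter> {..<length l}. (cmod (pad l i))\<^sup>2)"
    by (rule sum.mono_neutral_right) (auto simp: pad_def)
  also have "\<dots> \<le> (\<Sum>i<length l. (cmod (pad l i))\<^sup>2)" by (rule sum_mono2) auto
  finally show ?thesis by (simp add: lnorm_def L2_set_def sum_nonneg)
qed

lemma lnorm_nonneg [simp]: "0 \<le> lnorm l" by (simp add: lnorm_def)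

lemma lprod_eq: "length l \<le> N \<Longrightarrow> (\<Sum>i<N. pad l i * pad l' i) = lprod l l'"
  unfolding lprod_def by (rule sum.mono_neutral_right) (auto simp: pad_def)

text \<open>
  On a rectangle where \<open>F\<close> and \<open>G\<close> are close to constants \<open>l\<close> and \<open>l'\<close>, an annihilating function
  \<open>h = \<Sum> F i * G i\<close> is a small perturbation of the nonzero constant \<open>c = lprod l l'\<close>; the annihilation then
  bounds the norm of the compression \<open>S'\<close> of an operator to the rectangle by a multiple less than one of
  itself.
\<close>

lemma (in two_sigma_finite) annihilator_rectangle:
  assumes U: "masa_bimodule m n U" and h: "gamma_expansion m n h F G"
    and ann: "\<And>S. S \<in> U \<Longrightarrow> pairing m n S h = 0"
    and small: "d * lnorm l' + lnorm l * d + d * d < cmod (lprod l l')" and d: "d \<ge> 0"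
    and S: "S \<in> U" and f: "f \<in> sq_int m" and g: "g \<in> sq_int n"
  shows "bform m n S (\<lambda>x. indicator (near m F l d) x * f x) (\<lambda>y. indicator (near n G l' d) y * g y) = 0"
proof -
  let ?\<alpha> = "near m F l d" and ?\<beta> = "near n G l' d" and ?c = "lprod l l'"
  let ?e = "d * lnorm l' + lnorm l * d + d * d"
  have FG: "gexp m n F G" by (rule gamma_expansionD[OF h])
  note Fs = gexpD(1)[OF FG] and Gs = gexpD(2)[OF FG]
  have Fm [measurable]: "F i \<in> borel_measurable m" and Gm [measurable]: "G i \<in> borel_measurable n" for i
    using Fs Gs by (auto intro: sq_int_measurable)
  have \<alpha> [measurable]: "?\<alpha> \<in> sets m" and \<beta> [measurable]: "?\<beta> \<in> sets n" by (intro near_sets Fm Gm)+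
  have ia: "(indicator ?\<alpha> :: 'x \<Rightarrow> complex) \<in> ess_bounded m" and ib: "(indicator ?\<beta> :: 'y \<Rightarrow> complex) \<in> ess_bounded n"
    by (intro ess_bounded_indicator \<alpha> \<beta>)+
  define S' where "S' = sandwich m n (indicator ?\<beta>) S (indicator ?\<alpha>)"
  have S'U: "S' \<in> U" unfolding S'_def by (rule masa_bimoduleD(2)[OF U S ia ib])
  have Ub: "U \<subseteq> bounded_ops m n" by (rule op_subspaceD(1)[OF masa_bimoduleD(1)[OF U]])
  have Sb: "S \<in> bounded_ops m n" and S'b: "S' \<in> bounded_ops m n" using S S'U Ub by auto
  interpret S': bounded_form m n "bform m n S'" "op_norm m n S'" by (rule bounded_form_bform[OF S'b])
  have S'_eq: "bform m n S' u v = bform m n S (\<lambda>x. indicator ?\<alpha> x * u x) (\<lambda>y. indicator ?\<beta> y * v y)"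
    if "u \<in> sq_int m" "v \<in> sq_int n" for u v
    unfolding S'_def by (rule bform_sandwich[OF Sb ia ib that])
  have loc: "bform m n S' u v = bform m n S' (\<lambda>x. indicator ?\<alpha> x * u x) (\<lambda>y. indicator ?\<beta> y * v y)"
    if u: "u \<in> sq_int m" and v: "v \<in> sq_int n" for u v
  proof -
    have "(\<lambda>x. indicator ?\<alpha> x * (indicator ?\<alpha> x * u x)) = (\<lambda>x. indicator ?\<alpha> x * u x)"
      "(\<lambda>y. indicator ?\<beta> y * (indicator ?\<beta> y * v y)) = (\<lambda>y. indicator ?\<beta> y * v y)"
      by (auto simp: fun_eq_iff split: split_indicator)
    then show ?thesis
      using S'_eq[OF u v] S'_eq[OF sq_int_ess_mult[OF u ia] sq_int_ess_mult[OF v ib]] by (simp only:)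
  qed
  \<comment> \<open>On the rectangle \<open>F i\<close> is the constant \<open>P i\<close> plus the
    deviation \<open>A i\<close>, and \<open>G i\<close> is \<open>Q i\<close> plus
    \<open>B i\<close>. As rows, \<open>P\<close> and \<open>Q\<close> have norms
    \<open>lnorm l\<close> and \<open>lnorm l'\<close>, and both deviations have norm
    \<open>d\<close>. The three mixed products therefore contribute the three terms of
    \<open>?e\<close>.\<close>
  define A where "A i x = indicator ?\<alpha> x * (F i x - pad l i)" for i x
  define B where "B i y = indicator ?\<beta> y * (G i y - pad l' i)" for i y
  define P where "P i x = indicator ?\<alpha> x * pad l i" for i and x :: 'x
  define Q where "Q i y = indicator ?\<beta> y * pad l' i" for i and y :: 'y
  have Am: "A i \<in> borel_measurable m" and Pm: "P i \<in> borel_measurable m"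
    and Bm: "B i \<in> borel_measurable n" and Qm: "Q i \<in> borel_measurable n" for i
    unfolding A_def B_def P_def Q_def by measurable
  have Ab: "(\<Sum>i<N. (cmod (A i x))\<^sup>2) \<le> d\<^sup>2" for x N
    by (cases "x \<in> ?\<alpha>") (auto simp: A_def near_def)
  have Bb: "(\<Sum>i<N. (cmod (B i y))\<^sup>2) \<le> d\<^sup>2" for y N
    by (cases "y \<in> ?\<beta>") (auto simp: B_def near_def)
  have Pb: "(\<Sum>i<N. (cmod (P i x))\<^sup>2) \<le> (lnorm l)\<^sup>2" for x N
    using sum_pad_le[of l N] by (cases "x \<in> ?\<alpha>") (auto simp: P_def)
  have Qb: "(\<Sum>i<N. (cmod (Q i y))\<^sup>2) \<le> (lnorm l')\<^sup>2" for y N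
    using sum_pad_le[of l' N] by (cases "y \<in> ?\<beta>") (auto simp: Q_def)
  \<comment> \<open>An estimate of the norm by a proper fraction of itself, so the norm is
    zero.\<close>
  have "op_norm m n S' \<le> ?e / cmod ?c * op_norm m n S'"
  proof (rule op_norm_leI_bounded[OF S'b])
    show "0 \<le> ?e / cmod ?c * op_norm m n S'" using d S'.K_nonneg by simp
    fix u v assume u: "u \<in> sq_int m" "u \<in> ess_bounded m" and v: "v \<in> sq_int n" "v \<in> ess_bounded n"
    note AQ = suminf_bform_rows_le[OF S'b u(1) v(1) Am Ab d Qm Qb lnorm_nonneg]
      and PB = suminf_bform_rows_le[OF S'b u(1) v(1) Pm Pb lnorm_nonneg Bm Bb d]
      and AB = suminf_bform_rows_le[OF S'b u(1) v(1) Am Ab d Bm Bb d]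
      and PQ = suminf_bform_rows_le[OF S'b u(1) v(1) Pm Pb lnorm_nonneg Qm Qb lnorm_nonneg]
    note As = row_mult(1)[OF u(1) Am Ab] and Ps = row_mult(1)[OF u(1) Pm Pb]
      and Bs = row_mult(1)[OF v(1) Bm Bb] and Qs = row_mult(1)[OF v(1) Qm Qb]
    \<comment> \<open>The test functions act as multipliers: the sandwich stays in \<open>U\<close>,
      is annihilated by \<open>h\<close>, and its pairing with \<open>h\<close> is the sum of the
      forms of \<open>S'\<close> at \<open>u * F i\<close>, \<open>v * G i\<close>.\<close>
    have "pairing m n (sandwich m n v S' u) h = 0" by (rule ann[OF masa_bimoduleD(2)[OF U S'U u(2) v(2)]])
    then have zero: "(\<lambda>i. bform m n S' (\<lambda>x. u x * F i x) (\<lambda>y. v y * G i y)) sums 0"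
      using pairing_sums[OF sandwich_bounded[OF S'b u(2) v(2)] h]
      by (simp add: bform_sandwich[OF S'b u(2) v(2) Fs Gs])
    \<comment> \<open>Only the constant part \<open>P\<close>, \<open>Q\<close> sums to a multiple
      of the form at \<open>u\<close>, \<open>v\<close>; the other three series are errors.\<close>
    have split: "bform m n S' (\<lambda>x. u x * F i x) (\<lambda>y. v y * G i y)
        = bform m n S' (\<lambda>x. u x * P i x) (\<lambda>y. v y * Q i y) + bform m n S' (\<lambda>x. u x * A i x) (\<lambda>y. v y * Q i y)
        + bform m n S' (\<lambda>x. u x * P i x) (\<lambda>y. v y * B i y) + bform m n S' (\<lambda>x. u x * A i x) (\<lambda>y. v y * B i y)" for i
    proof -
      have uF: "(\<lambda>x. u x * F i x) \<in> sq_int m" and vG: "(\<lambda>y. v y * G i y) \<in> sq_int n"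
        using Fs Gs u v by auto
      have "(\<lambda>x. indicator ?\<alpha> x * (u x * F i x)) = (\<lambda>x. u x * P i x + u x * A i x)"
        "(\<lambda>y. indicator ?\<beta> y * (v y * G i y)) = (\<lambda>y. v y * Q i y + v y * B i y)"
        by (auto simp: fun_eq_iff P_def A_def Q_def B_def algebra_simps)
      then show ?thesis
        unfolding loc[OF uF vG] by (simp add: S'.add_left S'.add_right As Ps Bs Qs)
    qed
    have PQ_term: "bform m n S' (\<lambda>x. u x * P i x) (\<lambda>y. v y * Q i y) = pad l i * pad l' i * bform m n S' u v" for i
    proof -
      have "(\<lambda>x. u x * P i x) = (\<lambda>x. pad l i * (indicator ?\<alpha> x * u x))"
        "(\<lambda>y. v y * Q i y) = (\<lambda>y. pad l' i * (indicator ?\<beta> y * v y))"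
        by (auto simp: fun_eq_iff P_def Q_def mult_ac)
      then show ?thesis
        using u v ia ib by (simp add: S'.cmult_left S'.cmult_right loc[OF u(1) v(1), symmetric])
    qed
    have "(\<Sum>i. bform m n S' (\<lambda>x. u x * P i x) (\<lambda>y. v y * Q i y)) = ?c * bform m n S' u v"
    proof -
      have "(\<lambda>i. bform m n S' (\<lambda>x. u x * P i x) (\<lambda>y. v y * Q i y))
          sums (\<Sum>i<length l. bform m n S' (\<lambda>x. u x * P i x) (\<lambda>y. v y * Q i y))"
        by (rule sums_finite) (auto simp: PQ_term pad_def)
      also have "(\<Sum>i<length l. bform m n S' (\<lambda>x. u x * P i x) (\<lambda>y. v y * Q i y)) = ?c * bform m n S' u v"
        by (simp add: PQ_term lprod_def sum_distrib_right)
      finally show ?thesis by (simp add: sums_iff)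
    qed
    moreover have "(\<Sum>i. bform m n S' (\<lambda>x. u x * P i x) (\<lambda>y. v y * Q i y))
        + (\<Sum>i. bform m n S' (\<lambda>x. u x * A i x) (\<lambda>y. v y * Q i y))
        + (\<Sum>i. bform m n S' (\<lambda>x. u x * P i x) (\<lambda>y. v y * B i y))
        + (\<Sum>i. bform m n S' (\<lambda>x. u x * A i x) (\<lambda>y. v y * B i y)) = 0"
    proof (rule sums_unique2[OF _ zero])
      show "(\<lambda>i. bform m n S' (\<lambda>x. u x * F i x) (\<lambda>y. v y * G i y)) sums
        ((\<Sum>i. bform m n S' (\<lambda>x. u x * P i x) (\<lambda>y. v y * Q i y))
        + (\<Sum>i. bform m n S' (\<lambda>x. u x * A i x) (\<lambda>y. v y * Q i y))
        + (\<Sum>i. bform m n S' (\<lambda>x. u x * P i x) (\<lambda>y. v y * B i y))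
        + (\<Sum>i. bform m n S' (\<lambda>x. u x * A i x) (\<lambda>y. v y * B i y)))"
        unfolding split by (intro sums_add summable_sums PQ(1) AQ(1) PB(1) AB(1))
    qed
    ultimately have "?c * bform m n S' u v + ((\<Sum>i. bform m n S' (\<lambda>x. u x * A i x) (\<lambda>y. v y * Q i y))
        + (\<Sum>i. bform m n S' (\<lambda>x. u x * P i x) (\<lambda>y. v y * B i y))
        + (\<Sum>i. bform m n S' (\<lambda>x. u x * A i x) (\<lambda>y. v y * B i y))) = 0"
      by (simp only: add.assoc)
    then have "?c * bform m n S' u v = - ((\<Sum>i. bform m n S' (\<lambda>x. u x * A i x) (\<lambda>y. v y * Q i y))
        + (\<Sum>i. bform m n S' (\<lambda>x. u x * P i x) (\<lambda>y. v y * B i y))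
        + (\<Sum>i. bform m n S' (\<lambda>x. u x * A i x) (\<lambda>y. v y * B i y)))"
      by (simp only: eq_neg_iff_add_eq_0)
    then have "cmod (?c * bform m n S' u v) \<le> cmod (\<Sum>i. bform m n S' (\<lambda>x. u x * A i x) (\<lambda>y. v y * Q i y))
        + cmod (\<Sum>i. bform m n S' (\<lambda>x. u x * P i x) (\<lambda>y. v y * B i y))
        + cmod (\<Sum>i. bform m n S' (\<lambda>x. u x * A i x) (\<lambda>y. v y * B i y))"
      by (simp only: norm_minus_cancel) (intro order_trans[OF norm_triangle_ineq] add_right_mono norm_triangle_ineq)
    also have "\<dots> \<le> op_norm m n S' * (d * lnorm l') * nm m u * nm n v + op_norm m n S' * (lnorm l * d) * nm m u * nm n v
        + op_norm m n S' * (d * d) * nm m u * nm n v"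
      by (intro add_mono AQ(2) PB(2) AB(2))
    also have "\<dots> = ?e * op_norm m n S' * nm m u * nm n v" by (simp add: algebra_simps)
    finally have "cmod ?c * cmod (bform m n S' u v) \<le> ?e * op_norm m n S' * nm m u * nm n v"
      by (simp only: norm_mult)
    moreover have "cmod ?c > 0"
    proof -
      have "0 \<le> ?e" using d by simp
      then show ?thesis using small by linarith
    qed
    ultimately show "cmod (bform m n S' u v) \<le> ?e / cmod ?c * op_norm m n S' * nm m u * nm n v"
      by (simp add: pos_le_divide_eq mult.commute)
  qed
  moreover have "?e / cmod ?c < 1"
  proof -
    have "0 \<le> ?e" using d by simp
    then have "cmod ?c > 0" using small by linarith
    then show ?thesis using small by simp
  qed
  ultimately have "op_norm m n S' = 0"
    using S'.K_nonneg mult_strict_right_mono[of "?e / cmod ?c" 1 "op_norm m n S'"] by fastforce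
  then have "bform m n S' f g = 0" using S'.bound[OF f g] by simp
  then show ?thesis using S'_eq[OF f g] by simp
qed

text \<open>Cut off the tails and approximate the remaining entries from \<open>D\<close>. As the
  radius shrinks, the error expression tends to zero while \<open>lprod\<close> tends to the nonzero
  sum, so the inequality required in \<open>annihilator_rectangle\<close> holds eventually.\<close>

lemma near_exists:
  fixes a b :: "nat \<Rightarrow> complex" and D :: "complex set"
  assumes a: "summable (\<lambda>i. (cmod (a i))\<^sup>2)" and b: "summable (\<lambda>i. (cmod (b i))\<^sup>2)"
    and D: "\<And>X. open X \<Longrightarrow> X \<noteq> {} \<Longrightarrow> \<exists>d\<in>D. d \<in> X" and nz: "(\<Sum>i. a i * b i) \<noteq> 0"
  shows "\<exists>l\<in>lists D. \<exists>l'\<in>lists D. \<exists>k::nat. let d = inverse (real (Suc k)) in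
    (\<forall>N. (\<Sum>i<N. (cmod (a i - pad l i))\<^sup>2) \<le> d\<^sup>2) \<and> (\<forall>N. (\<Sum>i<N. (cmod (b i - pad l' i))\<^sup>2) \<le> d\<^sup>2) \<and>
    d * lnorm l' + lnorm l * d + d * d < cmod (lprod l l')"
proof -
  have app: "\<exists>l\<in>lists D. \<forall>N. (\<Sum>i<N. (cmod (c i - pad l i))\<^sup>2) \<le> d\<^sup>2"
    if c: "summable (\<lambda>i. (cmod (c i))\<^sup>2)" and d: "d > 0" for c :: "nat \<Rightarrow> complex" and d :: real
  proof -
    have "\<forall>\<^sub>F N in sequentially. (\<Sum>i. (cmod (c (i + N)))\<^sup>2) < d\<^sup>2 / 2"
      using order_tendstoD(2)[OF suminf_exist_split2[OF c], of "d\<^sup>2 / 2"] d by simp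
    then obtain N0 where N0: "(\<Sum>i. (cmod (c (i + N0)))\<^sup>2) < d\<^sup>2 / 2" by (auto simp: eventually_sequentially)
    \<comment> \<open>The \<open>N0\<close> approximated entries use up at most half of the squared
      radius and the tail the other half; the added one covers \<open>N0 = 0\<close>.\<close>
    define r where "r = sqrt (d\<^sup>2 / 2 / (real N0 + 1))"
    have r: "r > 0" unfolding r_def using d by simp
    have r2: "real N0 * r\<^sup>2 \<le> d\<^sup>2 / 2"
    proof -
      have "real N0 * r\<^sup>2 = d\<^sup>2 / 2 * (real N0 / (real N0 + 1))" unfolding r_def by simp
      also have "\<dots> \<le> d\<^sup>2 / 2 * 1" by (intro mult_left_mono) auto
      finally show ?thesis by simp
    qed
    have "\<forall>i. \<exists>p. p \<in> D \<and> p \<in> ball (c i) r" using D[of "ball (c _) r"] r by auto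
    from choice[OF this] obtain p where p: "\<And>i. p i \<in> D" "\<And>i. p i \<in> ball (c i) r" by blast
    let ?l = "map p [0..<N0]"
    have pl: "pad ?l i = (if i < N0 then p i else 0)" for i by (simp add: pad_def)
    have "(\<Sum>i<N. (cmod (c i - pad ?l i))\<^sup>2) \<le> d\<^sup>2" for N
    proof -
      have "(\<Sum>i<N. (cmod (c i - pad ?l i))\<^sup>2) \<le> (\<Sum>i<N0 + N. (cmod (c i - pad ?l i))\<^sup>2)"
        by (rule sum_mono2) auto
      also have "\<dots> = (\<Sum>i<N0. (cmod (c i - pad ?l i))\<^sup>2) + (\<Sum>i<N. (cmod (c (i + N0) - pad ?l (i + N0)))\<^sup>2)"
        by (induction N) (simp_all add: add.commute)
      also have "(\<Sum>i<N0. (cmod (c i - pad ?l i))\<^sup>2) \<le> (\<Sum>i<N0. r\<^sup>2)"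
        using p(2) by (intro sum_mono power_mono) (auto simp: pl dist_norm intro: less_imp_le)
      also have "(\<Sum>i<N0. r\<^sup>2) \<le> d\<^sup>2 / 2" using r2 by simp
      also have "(\<Sum>i<N. (cmod (c (i + N0) - pad ?l (i + N0)))\<^sup>2) \<le> (\<Sum>i. (cmod (c (i + N0)))\<^sup>2)"
        unfolding pl using summable_ignore_initial_segment[OF c, of N0] by (simp add: sum_le_suminf)
      finally show ?thesis using N0 by simp
    qed
    moreover have "?l \<in> lists D" using p(1) by auto
    ultimately show ?thesis by blast
  qed
  define X where "X = sqrt (\<Sum>i. (cmod (a i))\<^sup>2)"
  define Y where "Y = sqrt (\<Sum>i. (cmod (b i))\<^sup>2)"
  have lnorm_le: "lnorm l \<le> sqrt (\<Sum>i. (cmod (c i))\<^sup>2) + d"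
    if c: "summable (\<lambda>i. (cmod (c i))\<^sup>2)" and d: "d > 0" and l: "\<forall>N. (\<Sum>i<N. (cmod (c i - pad l i))\<^sup>2) \<le> d\<^sup>2"
    for c :: "nat \<Rightarrow> complex" and d l
  proof -
    let ?I = "{..<length l}"
    have "lnorm l \<le> L2_set (\<lambda>i. cmod (c i) + cmod (c i - pad l i)) ?I"
      unfolding lnorm_def
    proof (rule L2_set_mono)
      fix i show "cmod (pad l i) \<le> cmod (c i) + cmod (c i - pad l i)"
        using norm_triangle_ineq4[of "c i" "c i - pad l i"] by simp
    qed simp
    also have "\<dots> \<le> L2_set (\<lambda>i. cmod (c i)) ?I + L2_set (\<lambda>i. cmod (c i - pad l i)) ?I"
      by (rule L2_set_triangle_ineq)
    also have "L2_set (\<lambda>i. cmod (c i)) ?I \<le> sqrt (\<Sum>i. (cmod (c i))\<^sup>2)"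
      unfolding L2_set_def by (intro real_sqrt_le_mono sum_le_suminf c) auto
    also have "L2_set (\<lambda>i. cmod (c i - pad l i)) ?I \<le> d"
      unfolding L2_set_def using l d by (intro real_le_lsqrt) (auto intro: sum_nonneg)
    finally show ?thesis by simp
  qed
  let ?c0 = "\<Sum>i. a i * b i"
  \<comment> \<open>\<open>X + d\<close> and \<open>Y + d\<close> bound the norms of the
    approximating lists, so half of this expression bounds \<open>?e\<close>. The factor two is
    needed because \<open>?c0\<close> differs from \<open>lprod l l'\<close> by at most
    \<open>?e\<close>: twice \<open>?e\<close> below the modulus of \<open>?c0\<close> leaves more
    than \<open>?e\<close> for \<open>lprod\<close>.\<close>
  have "(\<lambda>k. 2 * (inverse (real (Suc k)) * (Y + inverse (real (Suc k))) + (X + inverse (real (Suc k))) * inverse (real (Suc k))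
      + inverse (real (Suc k)) * inverse (real (Suc k)))) \<longlonglongrightarrow> 2 * (0 * (Y + 0) + (X + 0) * 0 + 0 * 0)"
    by (intro tendsto_intros LIMSEQ_inverse_real_of_nat)
  then have "\<forall>\<^sub>F k in sequentially. 2 * (inverse (real (Suc k)) * (Y + inverse (real (Suc k))) + (X + inverse (real (Suc k))) * inverse (real (Suc k))
      + inverse (real (Suc k)) * inverse (real (Suc k))) < cmod ?c0"
    using nz by (intro order_tendstoD(2)) auto
  then obtain k where k: "2 * (inverse (real (Suc k)) * (Y + inverse (real (Suc k))) + (X + inverse (real (Suc k))) * inverse (real (Suc k))
      + inverse (real (Suc k)) * inverse (real (Suc k))) < cmod ?c0"
    by (auto simp only: eventually_sequentially)
  define d where "d = inverse (real (Suc k))"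
  have d: "d > 0" by (simp add: d_def)
  obtain l where l: "l \<in> lists D" "\<forall>N. (\<Sum>i<N. (cmod (a i - pad l i))\<^sup>2) \<le> d\<^sup>2" using app[OF a d] by blast
  obtain l' where l': "l' \<in> lists D" "\<forall>N. (\<Sum>i<N. (cmod (b i - pad l' i))\<^sup>2) \<le> d\<^sup>2" using app[OF b d] by blast
  let ?e = "d * lnorm l' + lnorm l * d + d * d"
  have le: "?e \<le> d * (Y + d) + (X + d) * d + d * d"
    using lnorm_le[OF a d l(2)] lnorm_le[OF b d l'(2)] d unfolding X_def Y_def
    by (intro add_mono mult_left_mono mult_right_mono order_refl) auto
  have e: "2 * ?e < cmod ?c0"
    by (rule order_le_less_trans[OF mult_left_mono[OF le] k[folded d_def]]) simp
  have cs: "cmod (\<Sum>i<N. u i * v i) \<le> p * q"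
    if "(\<Sum>i<N. (cmod (u i))\<^sup>2) \<le> p\<^sup>2" "(\<Sum>i<N. (cmod (v i))\<^sup>2) \<le> q\<^sup>2" "p \<ge> 0" "q \<ge> 0"
    for u v :: "nat \<Rightarrow> complex" and p q N
  proof -
    have "cmod (\<Sum>i<N. u i * v i) \<le> (\<Sum>i<N. cmod (u i) * cmod (v i))"
      using norm_sum[of "\<lambda>i. u i * v i" "{..<N}"] by (simp add: norm_mult)
    also have "\<dots> \<le> p * q"
    proof (rule power2_le_imp_le)
      have "(\<Sum>i<N. cmod (u i) * cmod (v i))\<^sup>2 \<le> (\<Sum>i<N. (cmod (u i))\<^sup>2) * (\<Sum>i<N. (cmod (v i))\<^sup>2)"
        by (rule Cauchy_Schwarz_ineq_sum)
      also have "\<dots> \<le> p\<^sup>2 * q\<^sup>2" using that by (intro mult_mono) (auto intro: sum_nonneg)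
      finally show "(\<Sum>i<N. cmod (u i) * cmod (v i))\<^sup>2 \<le> (p * q)\<^sup>2" by (simp add: power_mult_distrib)
    qed (use that in simp)
    finally show ?thesis .
  qed
  have gt: "E < z" if "x \<le> E" "y \<le> x + z" "2 * E < y" for E x y z :: real
    using that by linarith
  have diff: "cmod ((\<Sum>i<N. a i * b i) - lprod l l') \<le> ?e" if N: "N \<ge> length l" for N
  proof -
    have "(\<Sum>i<N. a i * b i) - lprod l l' = (\<Sum>i<N. (a i - pad l i) * pad l' i) + (\<Sum>i<N. pad l i * (b i - pad l' i))
        + (\<Sum>i<N. (a i - pad l i) * (b i - pad l' i))"
      unfolding lprod_eq[OF N, symmetric] sum_subtractf[symmetric] sum.distrib[symmetric]
      by (intro sum.cong refl) (simp add: algebra_simps)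
    then have "cmod ((\<Sum>i<N. a i * b i) - lprod l l') \<le> cmod (\<Sum>i<N. (a i - pad l i) * pad l' i)
        + cmod (\<Sum>i<N. pad l i * (b i - pad l' i)) + cmod (\<Sum>i<N. (a i - pad l i) * (b i - pad l' i))"
      by (simp only:) (intro order_trans[OF norm_triangle_ineq] add_right_mono norm_triangle_ineq)
    also have "\<dots> \<le> ?e"
      using d l(2) l'(2) by (intro add_mono cs sum_pad_le lnorm_nonneg) auto
    finally show ?thesis .
  qed
  have "summable (\<lambda>i. cmod (a i * b i))"
    unfolding norm_mult by (rule summable_sq_imp_prod(1)[OF a b]) auto
  then have "(\<lambda>N. \<Sum>i<N. a i * b i) \<longlonglongrightarrow> ?c0" by (intro summable_LIMSEQ) (rule summable_norm_cancel)
  then have "(\<lambda>N. cmod ((\<Sum>i<N. a i * b i) - lprod l l')) \<longlonglongrightarrow> cmod (?c0 - lprod l l')"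
    by (intro tendsto_norm tendsto_diff tendsto_const)
  then have "cmod (?c0 - lprod l l') \<le> ?e" by (rule LIMSEQ_le_const2) (use diff in blast)
  moreover have "cmod ?c0 \<le> cmod (?c0 - lprod l l') + cmod (lprod l l')"
    using norm_triangle_ineq[of "?c0 - lprod l l'" "lprod l l'"] by simp
  ultimately have "?e < cmod (lprod l l')"
    using e gt[of "cmod (?c0 - lprod l l')" ?e "cmod ?c0" "cmod (lprod l l')"] by blast
  then show ?thesis
    using l l' unfolding d_def Let_def by blast
qed

text \<open>For a kernel operator, vanishing on a rectangle means that the kernel vanishes there
  almost everywhere, and such statements can be combined over countably many rectangles. The
  integrand \<open>k * h\<close> is then zero almost everywhere.\<close>

theorem (in two_sigma_finite) annihilator_kop_Ref:
  assumes U: "masa_bimodule m n U" and h: "h \<in> Gamma m n"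
    and ann: "\<And>S. S \<in> U \<Longrightarrow> pairing m n S h = 0"
    and k: "k \<in> sq_int (m \<Otimes>\<^sub>M n)" and ref: "kop m n k \<in> Ref m n U"
  shows "pairing m n (kop m n k) h = 0"
proof -
  obtain F G where ge: "gamma_expansion m n h F G" and FG: "gexp m n F G" using h by (rule Gamma_E)
  have Fm: "F i \<in> borel_measurable m" and Gm: "G i \<in> borel_measurable n" for i
    using gexpD(1,2)[OF FG] by (auto intro: sq_int_measurable)
  have Ub: "U \<subseteq> bounded_ops m n" by (rule op_subspaceD(1)[OF masa_bimoduleD(1)[OF U]])
  obtain D :: "complex set" where D: "countable D" "\<And>X. open X \<Longrightarrow> X \<noteq> {} \<Longrightarrow> \<exists>d\<in>D. d \<in> X"
    using countable_dense_exists by blast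
  \<comment> \<open>Centres have entries in the countable set \<open>D\<close> and radii are
    reciprocals of integers, so that the exceptional null sets can be united.\<close>
  define J where "J = {(l, l', j). l \<in> lists D \<and> l' \<in> lists D \<and>
    inverse (real (Suc j)) * lnorm l' + lnorm l * inverse (real (Suc j)) + inverse (real (Suc j)) * inverse (real (Suc j)) < cmod (lprod l l')}"
  have "countable J"
    by (rule countable_subset[of _ "lists D \<times> lists D \<times> (UNIV :: nat set)"])
       (auto simp: J_def intro!: countable_SIGMA countable_lists D(1))
  have rect: "AE z in m \<Otimes>\<^sub>M n. indicator (near m F l (inverse (real (Suc j)))) (fst z) *
      indicator (near n G l' (inverse (real (Suc j)))) (snd z) * k z = 0" if lj: "(l, l', j) \<in> J" for l l' j
  proof (rule tensors_separate)
    let ?a = "indicator (near m F l (inverse (real (Suc j)))) :: 'x \<Rightarrow> complex"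
      and ?b = "indicator (near n G l' (inverse (real (Suc j)))) :: 'y \<Rightarrow> complex"
    have a: "?a \<in> ess_bounded m" and b: "?b \<in> ess_bounded n"
      by (intro ess_bounded_indicator near_sets Fm Gm)+
    have ab: "?a \<in> borel_measurable m" "?b \<in> borel_measurable n"
      using a b by (auto simp: ess_bounded_def)
    have "(\<lambda>z. tensor ?a ?b z * k z) \<in> sq_int (m \<Otimes>\<^sub>M n)"
      by (rule sq_int_bounded_mult[OF k tensor_measurable[OF ab], where C = 1], rule AE_I2)
         (simp add: tensor_def split: split_indicator)
    then show "(\<lambda>z. ?a (fst z) * ?b (snd z) * k z) \<in> sq_int (m \<Otimes>\<^sub>M n)" by (simp add: tensor_def)
    fix f g assume f: "f \<in> sq_int m" and g: "g \<in> sq_int n"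
    have "kform m n (\<lambda>z. ?a (fst z) * ?b (snd z) * k z) f g = kform m n k (\<lambda>x. ?a x * f x) (\<lambda>y. ?b y * g y)"
      by (simp add: kform_def tensor_def mult_ac)
    also have "\<dots> = bform m n (kop m n k) (\<lambda>x. ?a x * f x) (\<lambda>y. ?b y * g y)"
      using f g a b by (simp add: bform_kop[OF k])
    also have "\<dots> = 0"
    proof (rule Ref_bform_zero[OF Ub ref])
      fix S assume S: "S \<in> U"
      show "bform m n S (\<lambda>x. ?a x * f x) (\<lambda>y. ?b y * g y) = 0"
        using lj by (intro annihilator_rectangle[OF U ge ann _ _ S f g]) (auto simp: J_def)
    qed (use f g a b in auto)
    finally show "kform m n (\<lambda>z. ?a (fst z) * ?b (snd z) * k z) f g = 0" .
  qed
  have "AE z in m \<Otimes>\<^sub>M n. \<forall>(l, l', j)\<in>J. indicator (near m F l (inverse (real (Suc j)))) (fst z) *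
      indicator (near n G l' (inverse (real (Suc j)))) (snd z) * k z = 0"
    unfolding AE_ball_countable[OF \<open>countable J\<close>] split_beta using rect by auto
  then have "AE z in m \<Otimes>\<^sub>M n. k z * gsum F G z = 0"
    using AE_fst[OF AE_summable_sq[OF gexpD(1,3)[OF FG]]] AE_snd[OF AE_summable_sq[OF gexpD(2,4)[OF FG]]] AE_space
  proof eventually_elim
    case (elim z)
    show ?case
    proof (cases "gsum F G z = 0")
      case False
      then have "(\<Sum>i. F i (fst z) * G i (snd z)) \<noteq> 0" by (simp add: gsum_def tensor_def)
      from near_exists[OF elim(2,3) D(2) this] obtain l l' j where
        lj: "(l, l', j) \<in> J" "\<forall>N. (\<Sum>i<N. (cmod (F i (fst z) - pad l i))\<^sup>2) \<le> (inverse (real (Suc j)))\<^sup>2"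
        "\<forall>N. (\<Sum>i<N. (cmod (G i (snd z) - pad l' i))\<^sup>2) \<le> (inverse (real (Suc j)))\<^sup>2"
        unfolding Let_def J_def by blast
      have "fst z \<in> near m F l (inverse (real (Suc j)))" "snd z \<in> near n G l' (inverse (real (Suc j)))"
        using elim(4) lj(2,3) by (auto simp: near_def space_pair_measure)
      then have "k z = 0" using bspec[OF elim(1) lj(1)] by simp
      then show ?thesis by simp
    qed simp
  qed
  then have "(\<integral>z. k z * gsum F G z \<partial>(m \<Otimes>\<^sub>M n)) = 0"
    by (rule integral_eq_zero_AE)
  then show ?thesis by (simp add: pairing_kop[OF k ge])
qed

section \<open>The decomposition\<close>

context two_sigma_finite
begin

text \<open>Allows fixed point sets to be treated as equalizers of two Schur maps.\<close>

lemma schur_pair_id: "schur_pair (\<lambda>_. 1) (\<lambda>T\<in>bounded_ops m n. T)"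
  unfolding schur_pair_def schur_multiplier_def is_schur_map_def
proof (intro conjI ballI impI)
  show "(\<lambda>_. 1) \<in> ess_bounded (m \<Otimes>\<^sub>M n)" by (auto simp: ess_bounded_def intro!: exI[of _ 1])
  show "(\<lambda>T\<in>bounded_ops m n. T) \<in> bounded_ops m n \<rightarrow>\<^sub>E bounded_ops m n" by auto
next
  fix h assume "h \<in> Gamma m n"
  then show "\<exists>h'\<in>Gamma m n. AE z in m \<Otimes>\<^sub>M n. h' z = 1 * h z" by (intro bexI[of _ h]) auto
next
  fix T h h' assume T: "T \<in> bounded_ops m n" and h: "h \<in> Gamma m n" "h' \<in> Gamma m n"
    and eq: "AE z in m \<Otimes>\<^sub>M n. h' z = 1 * h z"
  have "AE z in m \<Otimes>\<^sub>M n. h z = h' z" using eq by eventually_elim simp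
  then show "pairing m n ((\<lambda>T\<in>bounded_ops m n. T) T) h = pairing m n T h'"
    using T by (simp add: pairing_cong_AE[OF T h])
qed

lemma schur_pair_diff:
  assumes S: "schur_pair \<phi> \<Phi>" and R: "schur_pair \<psi> \<Psi>"
  shows "schur_pair (\<lambda>z. \<phi> z - \<psi> z) (\<lambda>T\<in>bounded_ops m n. op_lincomb m n 1 (\<Phi> T) (-1) (\<Psi> T))"
  unfolding schur_pair_def schur_multiplier_def is_schur_map_def
proof (intro conjI ballI impI)
  obtain A where A: "AE z in m \<Otimes>\<^sub>M n. cmod (\<phi> z) \<le> A" "\<phi> \<in> borel_measurable (m \<Otimes>\<^sub>M n)"
    using schur_multiplier_ess[OF S] by (rule ess_boundedE)
  obtain B where B: "AE z in m \<Otimes>\<^sub>M n. cmod (\<psi> z) \<le> B" "\<psi> \<in> borel_measurable (m \<Otimes>\<^sub>M n)"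
    using schur_multiplier_ess[OF R] by (rule ess_boundedE)
  have "AE z in m \<Otimes>\<^sub>M n. cmod (\<phi> z - \<psi> z) \<le> A + B"
    using A(1) B(1) by eventually_elim (rule norm_triangle_le_diff, simp)
  then show "(\<lambda>z. \<phi> z - \<psi> z) \<in> ess_bounded (m \<Otimes>\<^sub>M n)"
    using A(2) B(2) by (auto simp: ess_bounded_def)
  show "(\<lambda>T\<in>bounded_ops m n. op_lincomb m n 1 (\<Phi> T) (-1) (\<Psi> T)) \<in> bounded_ops m n \<rightarrow>\<^sub>E bounded_ops m n"
    using schur_bounded[OF S] schur_bounded[OF R] by (auto intro!: op_lincomb_bounded)
next
  fix h assume h: "h \<in> Gamma m n"
  obtain u where u: "u \<in> Gamma m n" "AE z in m \<Otimes>\<^sub>M n. u z = \<phi> z * h z" using schur_mult_ex[OF S h] .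
  obtain v where v: "v \<in> Gamma m n" "AE z in m \<Otimes>\<^sub>M n. v z = \<psi> z * h z" using schur_mult_ex[OF R h] .
  have uv: "AE z in m \<Otimes>\<^sub>M n. u z - v z = (\<phi> z - \<psi> z) * h z"
    using u(2) v(2) by eventually_elim (simp add: left_diff_distrib)
  show "\<exists>h'\<in>Gamma m n. AE z in m \<Otimes>\<^sub>M n. h' z = (\<phi> z - \<psi> z) * h z"
    using uv by (intro bexI[of _ "\<lambda>z. u z - v z"] Gamma_diff(1)[OF u(1) v(1)])
  fix T h' assume T: "T \<in> bounded_ops m n" and h': "h' \<in> Gamma m n" "AE z in m \<Otimes>\<^sub>M n. h' z = (\<phi> z - \<psi> z) * h z"
  have "AE z in m \<Otimes>\<^sub>M n. h' z = u z - v z" using uv h'(2) by eventually_elim simp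
  from pairing_cong_AE[OF T h'(1) Gamma_diff(1)[OF u(1) v(1)] this]
  have "pairing m n T h' = pairing m n T u - pairing m n T v" using Gamma_diff(2)[OF u(1) v(1) T] by simp
  also have "\<dots> = pairing m n (op_lincomb m n 1 (\<Phi> T) (-1) (\<Psi> T)) h"
    using pairing_op_lincomb[OF schur_bounded[OF S T] schur_bounded[OF R T] h, of 1 "-1"]
      pairing_schur[OF S T h u] pairing_schur[OF R T h v] by simp
  finally show "pairing m n ((\<lambda>T\<in>bounded_ops m n. op_lincomb m n 1 (\<Phi> T) (-1) (\<Psi> T)) T) h = pairing m n T h'"
    using T by simp
qed

text \<open>If \<open>R\<close> is fixed then \<open>\<Phi> T - T\<close> equals
  \<open>\<Phi> (T - R) - (T - R)\<close>, so it has norm at most \<open>C + 1\<close> times that of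
  \<open>T - R\<close>: fixed points are norm closed.\<close>

lemma schur_fixed_by_approx:
  assumes S: "schur_pair \<phi> \<Phi>" and C: "\<And>T. T \<in> bounded_ops m n \<Longrightarrow> op_norm m n (\<Phi> T) \<le> C * op_norm m n T" "C \<ge> 0"
    and T: "T \<in> bounded_ops m n"
    and approx: "\<And>e. e > 0 \<Longrightarrow> \<exists>R\<in>bounded_ops m n. \<Phi> R = R \<and> op_norm m n (op_lincomb m n 1 T (-1) R) \<le> e"
  shows "\<Phi> T = T"
proof (rule bform_eqI[OF schur_bounded[OF S T] T])
  fix f g assume fg: "f \<in> sq_int m" "g \<in> sq_int n"
  let ?d = "cmod (bform m n (\<Phi> T) f g - bform m n T f g)"
  have le: "?d \<le> inverse (real (Suc k)) * ((C + 1) * nm m f * nm n g)" for k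
  proof -
    obtain R where R: "R \<in> bounded_ops m n" "\<Phi> R = R"
      and e: "op_norm m n (op_lincomb m n 1 T (-1) R) \<le> inverse (real (Suc k))"
      using approx[of "inverse (real (Suc k))"] by auto
    let ?D = "op_lincomb m n 1 T (-1) R"
    have D: "?D \<in> bounded_ops m n" by (rule op_lincomb_bounded[OF T R(1)])
    have "\<Phi> ?D = op_lincomb m n 1 (\<Phi> T) (-1) R" using schur_lincomb[OF S T R(1)] R(2) by simp
    then have "bform m n (\<Phi> T) f g - bform m n T f g = bform m n (\<Phi> ?D) f g - bform m n ?D f g"
      using bform_op_lincomb[OF schur_bounded[OF S T] R(1) fg, of 1 "-1"] bform_op_lincomb[OF T R(1) fg, of 1 "-1"]
      by simp
    also have "cmod \<dots> \<le> cmod (bform m n (\<Phi> ?D) f g) + cmod (bform m n ?D f g)" by (rule norm_triangle_ineq4)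
    also have "\<dots> \<le> op_norm m n (\<Phi> ?D) * nm m f * nm n g + op_norm m n ?D * nm m f * nm n g"
      by (intro add_mono bform_bound schur_bounded[OF S] D fg)
    also have "\<dots> = (op_norm m n (\<Phi> ?D) + op_norm m n ?D) * (nm m f * nm n g)" by (simp add: algebra_simps)
    also have "\<dots> \<le> ((C + 1) * inverse (real (Suc k))) * (nm m f * nm n g)"
    proof (rule mult_right_mono)
      have "op_norm m n (\<Phi> ?D) \<le> C * op_norm m n ?D" by (rule C(1)[OF D])
      also have "\<dots> \<le> C * inverse (real (Suc k))" using e C(2) by (rule mult_left_mono)
      finally show "op_norm m n (\<Phi> ?D) + op_norm m n ?D \<le> (C + 1) * inverse (real (Suc k))"
        using e by (simp only: distrib_right mult_1)
    qed simp
    finally show ?thesis by (simp only: mult_ac)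
  qed
  have "?d \<le> 0"
    by (rule LIMSEQ_le_const[OF tendsto_mult_left_zero[OF LIMSEQ_inverse_real_of_nat]]) (use le in blast)
  then show "bform m n (\<Phi> T) f g = bform m n T f g" by simp
qed

end

section \<open>The masa-bimodule of the chain and its compact operators\<close>

context schur_chain
begin

definition M :: "('x, 'y) l2_op set" where
  "M = (\<Inter>k. \<Phi> k ` bounded_ops m n)"

lemma idempotent: "\<Phi> k \<in> idempotent_schur_maps m n"
  using pair[of k] idem[of _ k] unfolding idempotent_schur_maps_def schur_pair_def by blast

lemma M_iff: "T \<in> M \<longleftrightarrow> T \<in> bounded_ops m n \<and> (\<forall>k. \<Phi> k T = T)"
  unfolding M_def using idempotent_range_iff[OF idempotent] by auto

lemma M_subspace: "masa_bimodule m n M"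
proof -
  have "M = {T \<in> bounded_ops m n. \<forall>k\<in>UNIV. \<Phi> k T = (\<lambda>T\<in>bounded_ops m n. T) T}"
    by (auto simp: M_iff)
  then show ?thesis using masa_bimodule_fixed_points[OF pair schur_pair_id, of UNIV] by (simp only:)
qed

lemma M_closed: "closedin (weak_star m n) M"
proof (rule weak_star_closedI[OF masa_bimoduleD(1)[OF M_subspace]])
  fix T assume T: "T \<in> bounded_ops m n"
    and ann: "\<And>h. h \<in> Gamma m n \<Longrightarrow> \<forall>S\<in>M. pairing m n S h = 0 \<Longrightarrow> pairing m n T h = 0"
  have "\<Phi> k T = T" for k
    by (rule pairing_diff_schur_closed[OF pair T, where U = M]) (auto simp: M_iff intro: ann)
  then show "T \<in> M" using T by (simp add: M_iff)
qed

lemma limit_mult_idem: "limit_mult z * limit_mult z = limit_mult z"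
  by (simp add: limit_mult_def)

lemma chain_limit_map: "T \<in> bounded_ops m n \<Longrightarrow> \<Phi> k (limit_map T) = limit_map T"
proof (rule schur_comp[OF pair limit_pair limit_pair])
  show "AE z in m \<Otimes>\<^sub>M n. limit_mult z = \<phi> k z * limit_mult z"
    using limit_mult_AE by eventually_elim auto
qed

lemma limit_map_idem: "T \<in> bounded_ops m n \<Longrightarrow> limit_map (limit_map T) = limit_map T"
  by (rule schur_comp[OF limit_pair limit_pair limit_pair]) (simp add: limit_mult_idem)

lemma limit_idempotent: "limit_map \<in> idempotent_schur_maps m n"
  using limit_pair limit_map_idem unfolding idempotent_schur_maps_def schur_pair_def by blast

lemma limit_map_M: "T \<in> bounded_ops m n \<Longrightarrow> limit_map T \<in> M"
  by (simp add: M_iff limit_map_bounded chain_limit_map)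

lemma kop_limit:
  assumes k: "k \<in> sq_int (m \<Otimes>\<^sub>M n)"
  shows "kop m n (\<lambda>z. limit_mult z * k z) = limit_map (kop m n k)"
    "kop m n (\<lambda>z. limit_mult z * k z) \<in> M"
  using limit_map_M[OF kop_bounded[OF k]] schur_kop[OF limit_pair k] by simp_all

text \<open>
  A compact operator in \<open>M\<close> is fixed by all \<open>\<Phi> j\<close>, which on kernel operators converge to \<open>limit_map\<close>.
\<close>

lemma compact_approx:
  assumes T: "T \<in> M" "T \<in> compact_ops m n" and e: "e > 0"
  shows "\<exists>k\<in>sq_int (m \<Otimes>\<^sub>M n). op_norm m n (op_lincomb m n 1 T (-1) (kop m n (\<lambda>z. limit_mult z * k z))) \<le> e"
proof -
  have Tb: "T \<in> bounded_ops m n" by (rule compact_ops_bounded[OF T(2)])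
  \<comment> \<open>Compensates for the factor \<open>C\<close> lost when \<open>\<Phi> j\<close> is
    applied to the error.\<close>
  have "e / C > 0" using e C_pos by simp
  from compact_approx_kop[OF T(2) this] obtain k where k: "k \<in> sq_int (m \<Otimes>\<^sub>M n)"
    and le: "op_norm m n (op_lincomb m n 1 T (-1) (kop m n k)) \<le> e / C" by blast
  let ?D = "op_lincomb m n 1 T (-1) (kop m n k)" and ?l = "\<lambda>z. limit_mult z * k z"
  have kb: "kop m n k \<in> bounded_ops m n" by (rule kop_bounded[OF k])
  have D: "?D \<in> bounded_ops m n" by (rule op_lincomb_bounded[OF Tb kb])
  have ls: "?l \<in> sq_int (m \<Otimes>\<^sub>M n)" by (rule limit_mult_sq_int[OF k])
  have lb: "kop m n ?l \<in> bounded_ops m n" by (rule kop_bounded[OF ls])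
  have "op_norm m n (op_lincomb m n 1 T (-1) (kop m n ?l)) \<le> e"
  proof (rule op_norm_leI[OF op_lincomb_bounded[OF Tb lb]])
    fix f g assume fg: "f \<in> sq_int m" "g \<in> sq_int n"
    have "(\<lambda>j. kform m n (\<lambda>z. \<phi> j z * k z) f g - kform m n ?l f g) \<longlonglongrightarrow> 0"
    proof (rule Lim_null_comparison)
      show "\<forall>\<^sub>F j in sequentially. norm (kform m n (\<lambda>z. \<phi> j z * k z) f g - kform m n ?l f g)
          \<le> nm (m \<Otimes>\<^sub>M n) (\<lambda>z. \<phi> j z * k z - ?l z) * (nm m f * nm n g)"
        using kform_bound[OF sq_int_diff[OF mult_sq_int[OF k] ls] fg]
        by (simp add: kform_diff[OF mult_sq_int[OF k] ls fg] mult.assoc)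
      show "(\<lambda>j. nm (m \<Otimes>\<^sub>M n) (\<lambda>z. \<phi> j z * k z - ?l z) * (nm m f * nm n g)) \<longlonglongrightarrow> 0"
        by (rule tendsto_mult_left_zero[OF kernel_limit[OF k]])
    qed
    then have "(\<lambda>j. kform m n (\<lambda>z. \<phi> j z * k z) f g) \<longlonglongrightarrow> kform m n ?l f g" by (simp add: LIM_zero_iff)
    then have "(\<lambda>j. cmod (bform m n T f g - kform m n (\<lambda>z. \<phi> j z * k z) f g)) \<longlonglongrightarrow> cmod (bform m n T f g - kform m n ?l f g)"
      by (intro tendsto_norm tendsto_diff tendsto_const)
    moreover have "cmod (bform m n T f g - kform m n (\<lambda>z. \<phi> j z * k z) f g) \<le> e * nm m f * nm n g" for j
    proof -
      \<comment> \<open>As \<open>T\<close> is fixed, \<open>\<Phi> j\<close> changes only the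
        kernel part of the error. The resulting bound does not depend on \<open>j\<close> and
        survives the limit.\<close>
      have "\<Phi> j ?D = op_lincomb m n 1 T (-1) (kop m n (\<lambda>z. \<phi> j z * k z))"
        using schur_lincomb[OF pair Tb kb] T(1) by (simp add: M_iff schur_kop[OF pair k])
      then have "bform m n T f g - kform m n (\<lambda>z. \<phi> j z * k z) f g = bform m n (\<Phi> j ?D) f g"
        using bform_op_lincomb[OF Tb kop_bounded[OF mult_sq_int[OF k]] fg, of 1 "-1" j]
        by (simp add: bform_kop[OF mult_sq_int[OF k] fg])
      also have "cmod \<dots> \<le> op_norm m n (\<Phi> j ?D) * nm m f * nm n g"
        by (intro bform_bound schur_bounded[OF pair] D fg)
      also have "\<dots> \<le> e * nm m f * nm n g"
      proof (intro mult_right_mono)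
        have "op_norm m n (\<Phi> j ?D) \<le> C * op_norm m n ?D" by (rule norm_le[OF D])
        also have "\<dots> \<le> C * (e / C)" using le C_pos by (intro mult_left_mono) auto
        finally show "op_norm m n (\<Phi> j ?D) \<le> e" using C_pos by simp
      qed simp_all
      finally show ?thesis .
    qed
    ultimately have "cmod (bform m n T f g - kform m n ?l f g) \<le> e * nm m f * nm n g"
      by (intro LIMSEQ_le_const2) auto
    then show "cmod (bform m n (op_lincomb m n 1 T (-1) (kop m n ?l)) f g) \<le> e * nm m f * nm n g"
      by (simp add: bform_op_lincomb[OF Tb lb fg] bform_kop[OF ls fg])
  qed (use e in simp)
  with k show ?thesis by blast
qed

lemma compact_fixed:
  assumes T: "T \<in> M" "T \<in> compact_ops m n" shows "limit_map T = T"
proof (rule schur_fixed_by_approx[OF limit_pair limit_map_norm_le])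
  show "0 \<le> C" using C_pos by simp
  show "T \<in> bounded_ops m n" by (rule compact_ops_bounded[OF T(2)])
  fix e :: real assume "e > 0"
  from compact_approx[OF T this] obtain k where k: "k \<in> sq_int (m \<Otimes>\<^sub>M n)"
    "op_norm m n (op_lincomb m n 1 T (-1) (kop m n (\<lambda>z. limit_mult z * k z))) \<le> e" by blast
  have "limit_map (kop m n (\<lambda>z. limit_mult z * k z)) = kop m n (\<lambda>z. limit_mult z * k z)"
    unfolding kop_limit(1)[OF k(1)] by (rule limit_map_idem[OF kop_bounded[OF k(1)]])
  then show "\<exists>R\<in>bounded_ops m n. limit_map R = R \<and> op_norm m n (op_lincomb m n 1 T (-1) R) \<le> e"
    using k kop_bounded[OF limit_mult_sq_int[OF k(1)]] by blast
qed

section \<open>The two summands\<close>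

definition M_inj :: "('x, 'y) l2_op set" where
  "M_inj = limit_map ` bounded_ops m n"

definition residual :: "nat \<Rightarrow> ('x, 'y) l2_op \<Rightarrow> ('x, 'y) l2_op" where
  "residual k = (\<lambda>T\<in>bounded_ops m n. op_lincomb m n 1 (\<Phi> k T) (-1) (limit_map T))"

text \<open>Introduced as the kernel of \<open>limit_map\<close> in \<open>M\<close>, which makes
  the direct sum immediate; \<open>M_pai_eq\<close> identifies it with the intersection of the
  ranges of the residual idempotents.\<close>

definition M_pai :: "('x, 'y) l2_op set" where
  "M_pai = {T \<in> M. limit_map T = op_zero m n}"

lemma M_inj_iff: "T \<in> M_inj \<longleftrightarrow> T \<in> bounded_ops m n \<and> limit_map T = T"
  unfolding M_inj_def by (rule idempotent_range_iff[OF limit_idempotent])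

lemma M_inj_bimodule: "masa_bimodule m n M_inj"
proof -
  have "M_inj = {T \<in> bounded_ops m n. \<forall>k\<in>(UNIV::nat set). limit_map T = (\<lambda>T\<in>bounded_ops m n. T) T}"
    by (auto simp: M_inj_iff)
  then show ?thesis using masa_bimodule_fixed_points[OF limit_pair schur_pair_id, of "UNIV::nat set"] by simp
qed

lemma M_inj_injective: "schur_injective m n M_inj"
  unfolding schur_injective_def M_inj_def using limit_idempotent by blast

lemma M_inj_subset: "M_inj \<subseteq> M"
  unfolding M_inj_def using limit_map_M by blast

lemma residual_pair: "schur_pair (\<lambda>z. \<phi> k z - limit_mult z) (residual k)"
  unfolding residual_def by (rule schur_pair_diff[OF pair limit_pair])

text \<open>Almost everywhere \<open>\<phi> k\<close> and \<open>limit_mult\<close> are indicators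
  of sets, the second contained in the first, so the differences are indicators of decreasing
  sets.\<close>

lemma residual_mult_AE:
  "AE z in m \<Otimes>\<^sub>M n. \<phi> (Suc k) z - limit_mult z = (\<phi> k z - limit_mult z) * (\<phi> (Suc k) z - limit_mult z)"
  "AE z in m \<Otimes>\<^sub>M n. \<phi> k z - limit_mult z = (\<phi> k z - limit_mult z) * (\<phi> k z - limit_mult z)"
proof -
  have "AE z in m \<Otimes>\<^sub>M n. (\<forall>j. \<phi> j z * limit_mult z = limit_mult z) \<and> \<phi> k z * \<phi> (Suc k) z = \<phi> (Suc k) z \<and> \<phi> k z * \<phi> k z = \<phi> k z"
    using limit_mult_AE mult_values
  proof eventually_elim
    case (elim z)
    have "\<phi> k z = 0 \<or> \<phi> k z = 1" using elim(2) by blast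
    then have "\<phi> k z * \<phi> k z = \<phi> k z" by auto
    with elim show ?case by blast
  qed
  then have *: "AE z in m \<Otimes>\<^sub>M n.
    \<phi> (Suc k) z - limit_mult z = (\<phi> k z - limit_mult z) * (\<phi> (Suc k) z - limit_mult z) \<and>
    \<phi> k z - limit_mult z = (\<phi> k z - limit_mult z) * (\<phi> k z - limit_mult z)"
  proof eventually_elim
    case (elim z)
    then have h: "\<phi> k z * limit_mult z = limit_mult z" "\<phi> (Suc k) z * limit_mult z = limit_mult z"
      "\<phi> k z * \<phi> (Suc k) z = \<phi> (Suc k) z" "\<phi> k z * \<phi> k z = \<phi> k z"
      by blast+
    have h': "limit_mult z * \<phi> k z = limit_mult z" "limit_mult z * \<phi> (Suc k) z = limit_mult z"
      using h(1,2) by (simp_all only: mult.commute)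
    show ?case
      by (simp only: left_diff_distrib right_diff_distrib h h' limit_mult_idem diff_self diff_zero simp_thms)
  qed
  show "AE z in m \<Otimes>\<^sub>M n. \<phi> (Suc k) z - limit_mult z = (\<phi> k z - limit_mult z) * (\<phi> (Suc k) z - limit_mult z)"
    using * by eventually_elim blast
  show "AE z in m \<Otimes>\<^sub>M n. \<phi> k z - limit_mult z = (\<phi> k z - limit_mult z) * (\<phi> k z - limit_mult z)"
    using * by eventually_elim blast
qed

lemma residual_idempotent: "residual k \<in> idempotent_schur_maps m n"
  using schur_comp[OF residual_pair residual_pair residual_pair residual_mult_AE(2)] residual_pair
  unfolding idempotent_schur_maps_def schur_pair_def by blast

lemma residual_norm_le:
  assumes T: "T \<in> bounded_ops m n" shows "op_norm m n (residual k T) \<le> (2 * C) * op_norm m n T"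
  using op_norm_lincomb_le[OF schur_bounded[OF pair T, of k] limit_map_bounded[OF T]] norm_le[OF T, of k] limit_map_norm_le[OF T] T
  by (simp add: residual_def)

lemma bform_zero_imp:
  assumes "T \<in> bounded_ops m n" "S \<in> bounded_ops m n"
  shows "op_lincomb m n 1 T (-1) S = T \<longleftrightarrow> S = op_zero m n"
proof
  assume eq: "op_lincomb m n 1 T (-1) S = T"
  show "S = op_zero m n"
  proof (rule bform_eqI[OF assms(2) op_zero_bounded])
    fix f g assume "f \<in> sq_int m" "g \<in> sq_int n"
    then show "bform m n S f g = bform m n (op_zero m n) f g"
      using bform_op_lincomb[OF assms, of f g 1 "-1"] eq by (simp add: bform_op_zero)
  qed
next
  assume S: "S = op_zero m n"
  show "op_lincomb m n 1 T (-1) S = T"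
    by (rule bform_eqI[OF op_lincomb_bounded[OF assms] assms(1)])
       (simp add: bform_op_lincomb[OF assms], simp add: S bform_op_zero)
qed

text \<open>The residual maps into the range of \<open>\<Phi> k\<close>, so a fixed point
  \<open>T\<close> is fixed by \<open>\<Phi> k\<close>. Then \<open>residual k T\<close> is
  \<open>T\<close> minus \<open>limit_map T\<close>, and equality with \<open>T\<close> forces the
  second term to vanish.\<close>

lemma residual_fixed_iff:
  assumes T: "T \<in> bounded_ops m n"
  shows "residual k T = T \<longleftrightarrow> \<Phi> k T = T \<and> limit_map T = op_zero m n"
proof
  assume eq: "residual k T = T"
  have r: "residual k T = op_lincomb m n 1 (\<Phi> k T) (-1) (limit_map T)" using T by (simp add: residual_def)
  note PT = schur_bounded[OF pair T, of k] and LT = limit_map_bounded[OF T]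
  have "\<Phi> k (residual k T) = residual k T"
    unfolding r schur_lincomb[OF pair PT LT] chain_limit_map[OF T] idem[OF T] ..
  then have 1: "\<Phi> k T = T" using eq by simp
  then have "limit_map T = op_zero m n" using bform_zero_imp[OF T LT] eq r by simp
  with 1 show "\<Phi> k T = T \<and> limit_map T = op_zero m n" by simp
next
  assume "\<Phi> k T = T \<and> limit_map T = op_zero m n"
  then show "residual k T = T"
    using T bform_zero_imp[OF T op_zero_bounded] by (simp add: residual_def)
qed

lemma M_pai_eq: "M_pai = (\<Inter>k. residual k ` bounded_ops m n)"
  unfolding M_pai_def using idempotent_range_iff[OF residual_idempotent] residual_fixed_iff
  by (auto simp: M_iff)

lemma M_pai_bimodule: "masa_bimodule m n M_pai"
proof -
  have "M_pai = {T \<in> bounded_ops m n. \<forall>k\<in>UNIV. residual k T = (\<lambda>T\<in>bounded_ops m n. T) T}"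
    unfolding M_pai_def using residual_fixed_iff by (auto simp: M_iff)
  then show ?thesis using masa_bimodule_fixed_points[OF residual_pair schur_pair_id, of UNIV] by (simp only:)
qed

lemma M_pai_approx: "approx_schur_injective m n M_pai"
  unfolding approx_schur_injective_def
proof (intro exI conjI allI ballI)
  show "2 * C > 0" using C_pos by simp
  show "residual k \<in> idempotent_schur_maps m n" for k by (rule residual_idempotent)
  show "op_norm m n (residual k T) \<le> 2 * C * op_norm m n T" if "T \<in> bounded_ops m n" for k T
    by (rule residual_norm_le[OF that])
  show "residual (Suc k) ` bounded_ops m n \<subseteq> residual k ` bounded_ops m n" for k
  proof (rule image_subsetI)
    fix T assume T: "T \<in> bounded_ops m n"
    have "residual k (residual (Suc k) T) = residual (Suc k) T"
      by (rule schur_comp[OF residual_pair residual_pair residual_pair residual_mult_AE(1) T])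
    then show "residual (Suc k) T \<in> residual k ` bounded_ops m n"
      using schur_bounded[OF residual_pair T, of "Suc k"] unfolding idempotent_range_iff[OF residual_idempotent] by blast
  qed
  show "M_pai = (\<Inter>k. residual k ` bounded_ops m n)" by (rule M_pai_eq)
qed

lemma M_decomposition: "M = {op_lincomb m n 1 T 1 S | T S. T \<in> M_inj \<and> S \<in> M_pai}"
proof (intro equalityI subsetI)
  fix T assume T: "T \<in> M"
  then have Tb: "T \<in> bounded_ops m n" by (simp add: M_iff)
  note LT = limit_map_bounded[OF Tb]
  let ?S = "op_lincomb m n 1 T (-1) (limit_map T)"
  have Sb: "?S \<in> bounded_ops m n" by (rule op_lincomb_bounded[OF Tb LT])
  have SM: "?S \<in> M"
    by (rule op_subspaceD(3)[OF masa_bimoduleD(1)[OF M_subspace] T limit_map_M[OF Tb]])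
  have "limit_map ?S = op_zero m n"
  proof (rule bform_eqI[OF limit_map_bounded[OF Sb] op_zero_bounded])
    fix f g assume fg: "f \<in> sq_int m" "g \<in> sq_int n"
    show "bform m n (limit_map ?S) f g = bform m n (op_zero m n) f g"
      unfolding schur_lincomb[OF limit_pair Tb LT] limit_map_idem[OF Tb] bform_op_lincomb[OF LT LT fg]
      by (simp add: bform_op_zero[OF fg])
  qed
  with SM have "?S \<in> M_pai" by (simp add: M_pai_def)
  moreover have "limit_map T \<in> M_inj" unfolding M_inj_def using Tb by blast
  moreover have "T = op_lincomb m n 1 (limit_map T) 1 ?S"
    by (rule bform_eqI[OF Tb op_lincomb_bounded[OF LT Sb]])
       (simp add: bform_op_lincomb[OF LT Sb] bform_op_lincomb[OF Tb LT])
  ultimately show "T \<in> {op_lincomb m n 1 T 1 S | T S. T \<in> M_inj \<and> S \<in> M_pai}" by blast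
next
  fix R assume "R \<in> {op_lincomb m n 1 T 1 S | T S. T \<in> M_inj \<and> S \<in> M_pai}"
  then obtain T S where R: "R = op_lincomb m n 1 T 1 S" and TS: "T \<in> M_inj" "S \<in> M_pai" by blast
  show "R \<in> M"
    unfolding R using TS M_inj_subset
    by (intro op_subspaceD(3)[OF masa_bimoduleD(1)[OF M_subspace]]) (auto simp: M_pai_def)
qed

lemma M_inj_M_pai: "M_inj \<inter> M_pai = {op_zero m n}"
  using op_subspaceD(2)[OF masa_bimoduleD(1)[OF M_inj_bimodule]] op_subspaceD(2)[OF masa_bimoduleD(1)[OF M_pai_bimodule]]
  by (auto simp: M_inj_iff M_pai_def)

lemma M_pai_compact: "T \<in> M_pai \<Longrightarrow> T \<in> compact_ops m n \<Longrightarrow> T = op_zero m n"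
  using compact_fixed[of T] by (simp add: M_pai_def)

section \<open>The injective summand as weak* closure of the compact operators\<close>

lemma M_inj_closed: "closedin (weak_star m n) M_inj"
proof (rule weak_star_closedI[OF masa_bimoduleD(1)[OF M_inj_bimodule]])
  fix T assume T: "T \<in> bounded_ops m n"
    and ann: "\<And>h. h \<in> Gamma m n \<Longrightarrow> \<forall>S\<in>M_inj. pairing m n S h = 0 \<Longrightarrow> pairing m n T h = 0"
  have "limit_map T = T"
    by (rule pairing_diff_schur_closed[OF limit_pair T, where U = M_inj]) (auto simp: M_inj_iff intro: ann)
  then show "T \<in> M_inj" using T by (simp add: M_inj_iff)
qed

text \<open>The images of all kernel operators under \<open>limit_map\<close>: compact operators in
  \<open>M\<close> forming a subspace whose annihilator can be computed explicitly.\<close>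

definition kernel_part :: "('x, 'y) l2_op set" where
  "kernel_part = {kop m n (\<lambda>z. limit_mult z * k z) | k. k \<in> sq_int (m \<Otimes>\<^sub>M n)}"

lemma kernel_part_subspace: "op_subspace m n kernel_part"
  unfolding op_subspace_def
proof (intro conjI allI ballI)
  show "kernel_part \<subseteq> bounded_ops m n"
    unfolding kernel_part_def using kop_bounded[OF limit_mult_sq_int] by blast
  have "kop m n (\<lambda>z. limit_mult z * 0) = op_zero m n"
    by (rule bform_eqI[OF kop_bounded op_zero_bounded]) (simp_all add: bform_kop kform_def bform_op_zero)
  then show "op_zero m n \<in> kernel_part"
    unfolding kernel_part_def by (intro CollectI exI[of _ "\<lambda>_. 0"]) simp
  fix a b T S assume "T \<in> kernel_part" "S \<in> kernel_part"
  then obtain k l where k: "k \<in> sq_int (m \<Otimes>\<^sub>M n)" "T = kop m n (\<lambda>z. limit_mult z * k z)"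
    and l: "l \<in> sq_int (m \<Otimes>\<^sub>M n)" "S = kop m n (\<lambda>z. limit_mult z * l z)"
    unfolding kernel_part_def by blast
  have kl: "(\<lambda>z. a * k z + b * l z) \<in> sq_int (m \<Otimes>\<^sub>M n)" using k l by auto
  have "op_lincomb m n a (kop m n k) b (kop m n l) = kop m n (\<lambda>z. a * k z + b * l z)"
  proof (rule bform_eqI[OF op_lincomb_bounded[OF kop_bounded[OF k(1)] kop_bounded[OF l(1)]] kop_bounded[OF kl]])
    fix f g assume fg: "f \<in> sq_int m" "g \<in> sq_int n"
    have "kform m n (\<lambda>z. a * k z + b * l z) f g = a * kform m n k f g + b * kform m n l f g"
      using integrable_sq_mult[OF k(1) tensor_sq_int[OF fg]] integrable_sq_mult[OF l(1) tensor_sq_int[OF fg]]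
      by (simp add: kform_def distrib_right mult.assoc)
    then show "bform m n (op_lincomb m n a (kop m n k) b (kop m n l)) f g = bform m n (kop m n (\<lambda>z. a * k z + b * l z)) f g"
      by (simp add: bform_op_lincomb[OF kop_bounded[OF k(1)] kop_bounded[OF l(1)] fg] bform_kop k l kl fg)
  qed
  then have "op_lincomb m n a T b S = kop m n (\<lambda>z. limit_mult z * (a * k z + b * l z))"
    using schur_lincomb[OF limit_pair kop_bounded[OF k(1)] kop_bounded[OF l(1)], of a b]
    by (simp only: k(2) l(2) kop_limit(1)[OF k(1)] kop_limit(1)[OF l(1)] kop_limit(1)[OF kl])
  then show "op_lincomb m n a T b S \<in> kernel_part"
    unfolding kernel_part_def using kl by (intro CollectI exI[of _ "\<lambda>z. a * k z + b * l z"] conjI)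
qed

text \<open>An \<open>h\<close> annihilating all these operators satisfies
  \<open>limit_mult * h = 0\<close> almost everywhere, because tensors separate kernels. An operator
  fixed by \<open>limit_map\<close> pairs with \<open>h\<close> as it does with this product, hence
  to zero.\<close>

lemma M_inj_subset_closure: "M_inj \<subseteq> weak_star m n closure_of kernel_part"
proof
  fix T assume T: "T \<in> M_inj"
  then have Tb: "T \<in> bounded_ops m n" and LT: "limit_map T = T" by (auto simp: M_inj_iff)
  show "T \<in> weak_star m n closure_of kernel_part"
    unfolding weak_star_closure_iff[OF kernel_part_subspace]
  proof (intro conjI Tb ballI impI)
    fix h assume h: "h \<in> Gamma m n" and ann: "\<forall>S\<in>kernel_part. pairing m n S h = 0"
    obtain u where u: "u \<in> sq_int (m \<Otimes>\<^sub>M n)" "AE z in m \<Otimes>\<^sub>M n. h z = u z"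
      "\<And>k. k \<in> sq_int (m \<Otimes>\<^sub>M n) \<Longrightarrow> pairing m n (kop m n k) h = (\<integral>z. k z * u z \<partial>(m \<Otimes>\<^sub>M n))"
      using Gamma_AE_sq_int[OF h] by blast
    have "AE z in m \<Otimes>\<^sub>M n. limit_mult z * u z = 0"
    proof (rule tensors_separate[OF limit_mult_sq_int[OF u(1)]])
      fix f g assume fg: "f \<in> sq_int m" "g \<in> sq_int n"
      have t: "tensor f g \<in> sq_int (m \<Otimes>\<^sub>M n)" using fg by (rule tensor_sq_int)
      have "kform m n (\<lambda>z. limit_mult z * u z) f g = pairing m n (kop m n (\<lambda>z. limit_mult z * tensor f g z)) h"
        unfolding u(3)[OF limit_mult_sq_int[OF t]] kform_def by (simp add: mult_ac)
      also have "\<dots> = 0" using ann t unfolding kernel_part_def by blast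
      finally show "kform m n (\<lambda>z. limit_mult z * u z) f g = 0" .
    qed
    then have "AE z in m \<Otimes>\<^sub>M n. 0 = limit_mult z * h z" using u(2) by eventually_elim simp
    from pairing_schur[OF limit_pair Tb h zero_in_Gamma this] show "pairing m n T h = 0"
      by (simp add: LT Tb)
  qed
qed

lemma kernel_part_subset: "kernel_part \<subseteq> M \<inter> compact_ops m n"
  unfolding kernel_part_def using kop_limit(2) kop_compact[OF limit_mult_sq_int] by blast

lemma M_inj_closure: "M_inj = weak_star m n closure_of (M \<inter> compact_ops m n)"
proof
  show "M_inj \<subseteq> weak_star m n closure_of (M \<inter> compact_ops m n)"
    using M_inj_subset_closure closure_of_mono[OF kernel_part_subset] by blast
  have "M \<inter> compact_ops m n \<subseteq> M_inj"
    using compact_fixed by (auto simp: M_inj_iff M_iff)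
  then show "weak_star m n closure_of (M \<inter> compact_ops m n) \<subseteq> M_inj"
    using M_inj_closed by (rule closure_of_minimal)
qed

text \<open>The multiplier of an idempotent with range in \<open>M\<close> is absorbed by every
  \<open>\<phi> k\<close>. It can be nonzero only where all of these equal one, and there
  \<open>limit_mult\<close> is one.\<close>

lemma M_inj_maximal:
  assumes N: "schur_injective m n N" "N \<subseteq> M" shows "N \<subseteq> M_inj"
proof -
  obtain \<Psi> where \<Psi>: "\<Psi> \<in> idempotent_schur_maps m n" "N = \<Psi> ` bounded_ops m n"
    using N(1) unfolding schur_injective_def by blast
  obtain \<psi> where R: "schur_pair \<psi> \<Psi>" using \<Psi>(1) by (rule idempotent_schur_mapsE)
  have "\<Phi> k (\<Psi> T) = \<Psi> T" if "T \<in> bounded_ops m n" for k T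
    using N(2) that unfolding \<Psi>(2) by (auto simp: M_iff)
  then have "AE z in m \<Otimes>\<^sub>M n. \<forall>k. \<phi> k z * \<psi> z = \<psi> z"
    unfolding AE_all_countable by (intro allI schur_mult_AE_eqI[OF pair R])
  then have "AE z in m \<Otimes>\<^sub>M n. \<psi> z = limit_mult z * \<psi> z"
  proof eventually_elim
    case (elim z)
    then show ?case by (cases "\<psi> z = 0") (auto simp: limit_mult_def)
  qed
  from schur_comp[OF limit_pair R R this] show ?thesis
    unfolding \<Psi>(2) using schur_bounded[OF R] by (auto simp: M_inj_iff)
qed

section \<open>Norm closure, reflexivity and the minimal masa-bimodule\<close>

lemma compact_norm_closure:
  "M \<inter> compact_ops m n = op_norm_closure m n (M \<inter> hilbert_schmidt_ops m n)"
proof (intro equalityI subsetI)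
  fix T assume T: "T \<in> M \<inter> compact_ops m n"
  show "T \<in> op_norm_closure m n (M \<inter> hilbert_schmidt_ops m n)"
    unfolding op_norm_closure_def
  proof (intro CollectI conjI allI impI)
    show "T \<in> bounded_ops m n" using T by (simp add: M_iff)
    fix e :: real assume e: "e > 0"
    then have "e / 2 > 0" by simp
    with T obtain k where k: "k \<in> sq_int (m \<Otimes>\<^sub>M n)"
      "op_norm m n (op_lincomb m n 1 T (-1) (kop m n (\<lambda>z. limit_mult z * k z))) \<le> e / 2"
      using compact_approx[of T "e / 2"] by blast
    have "kop m n (\<lambda>z. limit_mult z * k z) \<in> M \<inter> hilbert_schmidt_ops m n"
      using kop_limit(2)[OF k(1)] kop_hilbert_schmidt[OF limit_mult_sq_int[OF k(1)]] by blast
    moreover have "op_norm m n (op_lincomb m n 1 T (-1) (kop m n (\<lambda>z. limit_mult z * k z))) < e"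
      using k(2) e by linarith
    ultimately show "\<exists>S\<in>M \<inter> hilbert_schmidt_ops m n. op_norm m n (op_lincomb m n 1 T (-1) S) < e" by blast
  qed
next
  fix T assume "T \<in> op_norm_closure m n (M \<inter> hilbert_schmidt_ops m n)"
  then have Tb: "T \<in> bounded_ops m n"
    and approx: "\<And>e. e > 0 \<Longrightarrow> \<exists>S\<in>M \<inter> hilbert_schmidt_ops m n. op_norm m n (op_lincomb m n 1 T (-1) S) < e"
    by (auto simp: op_norm_closure_def)
  have "T \<in> compact_ops m n"
  proof (rule compact_ops_limit[OF Tb])
    fix e :: real assume "e > 0"
    from approx[OF this] show "\<exists>S\<in>compact_ops m n. op_norm m n (op_lincomb m n 1 T (-1) S) < e"
      using hilbert_schmidt_compact by blast
  qed
  moreover have "\<Phi> k T = T" for k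
  proof (rule schur_fixed_by_approx[OF pair norm_le _ Tb])
    show "0 \<le> C" using C_pos by simp
    fix e :: real assume "e > 0"
    from approx[OF this] obtain S where S: "S \<in> M" "op_norm m n (op_lincomb m n 1 T (-1) S) < e" by blast
    then show "\<exists>R\<in>bounded_ops m n. \<Phi> k R = R \<and> op_norm m n (op_lincomb m n 1 T (-1) R) \<le> e"
      by (intro bexI[of _ S]) (auto simp: M_iff)
  qed
  ultimately show "T \<in> M \<inter> compact_ops m n" using Tb by (simp add: M_iff)
qed

text \<open>A compact \<open>T\<close> in \<open>M\<close> is a norm limit of kernel operators in
  \<open>M\<close>, hence in \<open>Ref m n U\<close>. These are killed by every annihilator of
  \<open>U\<close>, so \<open>T\<close> is too, and a weak* closed \<open>U\<close> is determined by
  its annihilator.\<close>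

lemma compact_subset_of_Ref:
  assumes U: "masa_bimodule m n U" "closedin (weak_star m n) U" and ref: "M \<subseteq> Ref m n U"
  shows "M \<inter> compact_ops m n \<subseteq> U"
proof
  fix T assume T: "T \<in> M \<inter> compact_ops m n"
  then have Tb: "T \<in> bounded_ops m n" by (simp add: M_iff)
  show "T \<in> U"
  proof (rule weak_star_closedD[OF U(2) masa_bimoduleD(1)[OF U(1)] Tb])
    fix h assume h: "h \<in> Gamma m n" and ann: "\<forall>S\<in>U. pairing m n S h = 0"
    obtain c where c: "c \<ge> 0" "\<forall>T\<in>bounded_ops m n. cmod (pairing m n T h) \<le> op_norm m n T * c"
      using pairing_bound[OF h] by blast
    have "cmod (pairing m n T h) \<le> inverse (real (Suc j)) * c" for j
    proof -
      have "inverse (real (Suc j)) > 0" by simp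
      with T obtain k where k: "k \<in> sq_int (m \<Otimes>\<^sub>M n)"
        "op_norm m n (op_lincomb m n 1 T (-1) (kop m n (\<lambda>z. limit_mult z * k z))) \<le> inverse (real (Suc j))"
        using compact_approx[of T "inverse (real (Suc j))"] by blast
      let ?S = "kop m n (\<lambda>z. limit_mult z * k z)"
      have ls: "(\<lambda>z. limit_mult z * k z) \<in> sq_int (m \<Otimes>\<^sub>M n)" by (rule limit_mult_sq_int[OF k(1)])
      have Sb: "?S \<in> bounded_ops m n" by (rule kop_bounded[OF ls])
      have "?S \<in> Ref m n U" using ref kop_limit(2)[OF k(1)] by blast
      then have "pairing m n ?S h = 0"
        using ann by (intro annihilator_kop_Ref[OF U(1) h _ ls]) auto
      then have "pairing m n T h = pairing m n (op_lincomb m n 1 T (-1) ?S) h"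
        by (simp add: pairing_op_lincomb[OF Tb Sb h])
      also have "cmod \<dots> \<le> op_norm m n (op_lincomb m n 1 T (-1) ?S) * c"
        using c(2) op_lincomb_bounded[OF Tb Sb] by blast
      also have "\<dots> \<le> inverse (real (Suc j)) * c" using k(2) c(1) by (rule mult_right_mono)
      finally show ?thesis .
    qed
    then have "cmod (pairing m n T h) \<le> 0"
      by (intro LIMSEQ_le_const[OF tendsto_mult_left_zero[OF LIMSEQ_inverse_real_of_nat, of c]]) blast
    then show "pairing m n T h = 0" by simp
  qed
qed

text \<open>Membership in \<open>M_max\<close> is a family of conditions that single matrix
  coefficients vanish, and \<open>Ref\<close> preserves each of them.\<close>

lemma M_max_reflexive:
  assumes "M = M_max m n \<kappa>" shows "Ref m n M = M"
proof (intro equalityI subsetI)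
  fix T assume T: "T \<in> Ref m n M"
  then have Tb: "T \<in> bounded_ops m n" by (simp add: Ref_def)
  have Mb: "M \<subseteq> bounded_ops m n" by (auto simp: M_iff)
  have "T \<in> M_max m n \<kappa>"
    unfolding M_max_def
  proof (intro CollectI conjI Tb ballI impI)
    fix \<alpha> \<beta> assume ab: "\<alpha> \<in> sets m" "\<beta> \<in> sets n" and null: "marginally_null m n (\<alpha> \<times> \<beta> \<inter> \<kappa>)"
    note a = ess_bounded_indicator[OF ab(1)] and b = ess_bounded_indicator[OF ab(2)]
    show "sandwich m n (indicator \<beta>) T (indicator \<alpha>) = op_zero m n"
    proof (rule bform_eqI[OF sandwich_bounded[OF Tb a b] op_zero_bounded])
      fix f g assume f: "f \<in> sq_int m" and g: "g \<in> sq_int n"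
      have "bform m n T (\<lambda>x. indicator \<alpha> x * f x) (\<lambda>y. indicator \<beta> y * g y) = 0"
      proof (rule Ref_bform_zero[OF Mb T sq_int_ess_mult[OF f a] sq_int_ess_mult[OF g b]])
        fix S assume S: "S \<in> M"
        then have "sandwich m n (indicator \<beta>) S (indicator \<alpha>) = op_zero m n"
          using ab null unfolding assms M_max_def by blast
        then show "bform m n S (\<lambda>x. indicator \<alpha> x * f x) (\<lambda>y. indicator \<beta> y * g y) = 0"
          using bform_sandwich[OF _ a b f g, of S] S Mb by (auto simp: bform_op_zero f g)
      qed
      then show "bform m n (sandwich m n (indicator \<beta>) T (indicator \<alpha>)) f g = bform m n (op_zero m n) f g"
        by (simp add: bform_sandwich[OF Tb a b f g] bform_op_zero f g)
    qed
  qed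
  then show "T \<in> M" using assms by simp
next
  fix T assume T: "T \<in> M"
  then have Tb: "T \<in> bounded_ops m n" by (simp add: M_iff)
  have "T u \<in> l2_topology n closure_of ((\<lambda>S. S u) ` M)" if u: "u \<in> L2 m" for u
  proof -
    interpret L: Metric_space "L2 n" "l2_dist n" by (rule Metric_space_L2)
    have sub: "(\<lambda>S. S u) ` M \<subseteq> L2 n" using bounded_ops_L2[OF _ u] by (auto simp: M_iff)
    have "T u \<in> (\<lambda>S. S u) ` M" using T by blast
    moreover have "l2_dist n (T u) (T u) = 0" by (simp add: l2_dist_eq)
    ultimately show ?thesis
      unfolding in_l2_closure_iff[OF sub bounded_ops_L2[OF Tb u]] by force
  qed
  then show "T \<in> Ref m n M" using Tb by (simp add: Ref_def)
qed

text \<open>By reflexivity \<open>M\<close> itself is one of the masa-bimodules intersected in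
  \<open>M_min\<close>. For the other inclusion, every competitor \<open>U\<close> has
  \<open>Ref m n U = M\<close> and so contains the compact operators of \<open>M\<close>.\<close>

lemma M_min_compact:
  assumes "omega_closed m n \<kappa>" "M = M_max m n \<kappa>"
  shows "M_min m n \<kappa> \<inter> compact_ops m n = M \<inter> compact_ops m n"
proof
  have "M_min m n \<kappa> \<subseteq> M"
    unfolding M_min_def has_support_def
    using M_subspace M_closed assms M_max_reflexive[OF assms(2)] by blast
  then show "M_min m n \<kappa> \<inter> compact_ops m n \<subseteq> M \<inter> compact_ops m n" by blast
  have "M \<inter> compact_ops m n \<subseteq> U"
    if "masa_bimodule m n U" "closedin (weak_star m n) U" "has_support m n U \<kappa>" for U
    using that assms(2) by (intro compact_subset_of_Ref) (auto simp: has_support_def)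
  then show "M \<inter> compact_ops m n \<subseteq> M_min m n \<kappa> \<inter> compact_ops m n"
    unfolding M_min_def by blast
qed

end

theorem theorem5p2:
  fixes m :: "'x measure" and n :: "'y measure"
    and M :: "('x, 'y) l2_op set" and \<kappa> :: "('x \<times> 'y) set"
  assumes "standard_measure m" and "standard_measure n"
    and "masa_bimodule m n M" and "approx_schur_injective m n M"
    and "omega_closed m n \<kappa>" and "M = M_max m n \<kappa>"
  shows "(\<exists>M_inj M_pai.
            masa_bimodule m n M_inj \<and> schur_injective m n M_inj \<and>
            masa_bimodule m n M_pai \<and> approx_schur_injective m n M_pai \<and>
            M_max m n \<kappa> = {op_lincomb m n 1 T 1 S | T S. T \<in> M_inj \<and> S \<in> M_pai} \<and>
            M_inj \<inter> M_pai = {op_zero m n} \<and>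
            M_inj = weak_star m n closure_of (M \<inter> compact_ops m n) \<and>
            (\<forall>T\<in>M_pai. T \<in> compact_ops m n \<longrightarrow> T = op_zero m n) \<and>
            M_inj \<subseteq> M \<and>
            (\<forall>N. masa_bimodule m n N \<and> schur_injective m n N \<and> N \<subseteq> M \<longrightarrow> N \<subseteq> M_inj)) \<and>
         M_min m n \<kappa> \<inter> compact_ops m n = M_max m n \<kappa> \<inter> compact_ops m n \<and>
         M_max m n \<kappa> \<inter> compact_ops m n =
           op_norm_closure m n (M_max m n \<kappa> \<inter> hilbert_schmidt_ops m n)"
proof -
  interpret two_sigma_finite m n
    using assms(1,2) unfolding standard_measure_def two_sigma_finite_def by blast
  obtain \<Phi> :: "nat \<Rightarrow> ('x, 'y) l2_op \<Rightarrow> ('x, 'y) l2_op" and C :: real where C: "C > 0"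
    and idem: "\<forall>k. \<Phi> k \<in> idempotent_schur_maps m n"
    and bound: "\<forall>k. \<forall>T\<in>bounded_ops m n. op_norm m n (\<Phi> k T) \<le> C * op_norm m n T"
    and decr: "\<forall>k. \<Phi> (Suc k) ` bounded_ops m n \<subseteq> \<Phi> k ` bounded_ops m n"
    and M: "M = (\<Inter>k. \<Phi> k ` bounded_ops m n)"
    using assms(4) unfolding approx_schur_injective_def by (elim exE conjE)
  have "\<forall>k. \<exists>\<phi>. schur_pair \<phi> (\<Phi> k)"
    using idem by (auto elim: idempotent_schur_mapsE)
  then obtain \<phi> where pair: "\<forall>k. schur_pair (\<phi> k) (\<Phi> k)" by (rule choice[THEN exE])
  interpret c: schur_chain m n \<phi> \<Phi> C
  proof
    fix k T assume T: "T \<in> bounded_ops m n"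
    show "\<Phi> k (\<Phi> k T) = \<Phi> k T" using idem T by (simp add: idempotent_schur_mapsD)
    show "op_norm m n (\<Phi> k T) \<le> C * op_norm m n T" using bound T by simp
    have "\<Phi> (Suc k) T \<in> \<Phi> k ` bounded_ops m n" using decr T by blast
    then show "\<Phi> k (\<Phi> (Suc k) T) = \<Phi> (Suc k) T"
      using idempotent_range_iff[OF idem[rule_format]] by blast
  qed (use C pair in auto)
  have M_eq: "M = c.M" unfolding M c.M_def ..
  have max: "M_max m n \<kappa> = c.M" using assms(6) M_eq by simp
  show ?thesis
    unfolding max unfolding M_eq
    by (intro conjI exI[of _ c.M_inj] exI[of _ c.M_pai] c.M_inj_bimodule c.M_inj_injective c.M_pai_bimodule
        c.M_pai_approx c.M_decomposition c.M_inj_M_pai c.M_inj_closure c.M_inj_subset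
        c.M_min_compact[OF assms(5) max[symmetric]] c.compact_norm_closure)
      (auto intro: c.M_pai_compact dest: c.M_inj_maximal)
qed

end
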